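(* In the setting described in the context (Cauchy problem (E1) with (A1) and $\xi\le\min(\sigma_3',\varsigma_3')$, admissible data, good covering), there exist constants $I,\delta>0$ (independent of $\epsilon$) such that if, for all $0\le h\le S-1$, all $\epsilon\in\dot D(0,\epsilon_0)$, all $k\in\llbracket -n,n\rrbracket$ and all $0\le p\le\iota-1$, $$\sum_{j=0}^{S-1-h}\|w_{j+h}(\tau,\epsilon)\|_{(0,\underline{\sigma}',H_k,\epsilon)}\frac{\delta^j}{j!}\le I,\quad \sum_{j=0}^{S-1-h}\|w_{j+h}(\tau,\epsilon)\|_{(0,\underline{\varsigma}',J_k,\epsilon)}\frac{\delta^j}{j!}\le I,\quad \sum_{j=0}^{S-1-h}\|w_{j+h}(\tau,\epsilon)\|_{(0,\sigma_1',S_{d_p}\cup D(0,r),\epsilon)}\frac{\delta^j}{j!}\le I,$$ then, for some $0<\delta_1<1$ and some radius $r_{\mathcal T}>0$ taken small enough ($\epsilon_0$ being also small enough), the following hold. 1) For each $k\in\llbracket -n,n\rrbracket$, the Cauchy problem (E1) with initial data $(\partial_z^ju)(t,0,\epsilon)=\varphi_{j,\mathcal E_{HJ_n}^k}(t,\epsilon)$, $0\le j\le S-1$, has a bounded holomorphic solution $u_{\mathcal E_{HJ_n}^k}(t,z,\epsilon)$ on $(\mathcal T\cap D(0,r_{\mathcal T}))\times D(0,\delta\delta_1)\times\mathcal E_{HJ_n}^k$. It can be written as $$u_{\mathcal E_{HJ_n}^k}(t,z,\epsilon)=\int_{P_k}w_{HJ_n}(u,z,\epsilon)\exp\left(-\frac{u}{\epsilon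 t}\right)\frac{du}{u},$$ where $w_{HJ_n}(\tau,z,\epsilon)$ is holomorphic on $\mathring{HJ}_n\times D(0,\delta\delta_1)\times\dot D(0,\epsilon_0)$, continuous on $HJ_n\times D(0,\delta\delta_1)\times\dot D(0,\epsilon_0)$, and such that for any tuples $\underline\sigma=(\sigma_1,\sigma_2,\sigma_3)$, $\underline\varsigma=(\sigma_1,\varsigma_2,\varsigma_3)$ with $\sigma_1>\sigma_1'$, $0<\sigma_2<\sigma_2'$, $\sigma_3=\sigma_3'$, $\varsigma_2>\varsigma_2'$, $\varsigma_3=\varsigma_3'$, there are constants $C_{H_k},C_{J_k}>0$ (independent of $\epsilon$) with $$|w_{HJ_n}(\tau,z,\epsilon)|\le C_{H_k}|\tau|\exp\left(\frac{\sigma_1}{|\epsilon|}\zeta(b)|\tau|-\sigma_2(M-\zeta(b))\exp(\sigma_3|\tau|)\right)\quad(\tau\in H_k),$$ $$|w_{HJ_n}(\tau,z,\epsilon)|\le C_{J_k}|\tau|\exp\left(\frac{\sigma_1}{|\epsilon|}\zeta(b)|\tau|+\varsigma_2\zeta(b)\exp(\varsigma_3|\tau|)\right)\quad(\tau\in J_k),$$ for all $z\in D(0,\delta\delta_1)$, $\epsilon\in\dot D(0,\epsilon_0)$, $k\in\llbracket -n,n\rrbracket$. Moreover, for $-n\le k\le n-1$ there are constants $M_{k,1},M_{k,2}>0$, $M_{k,3}>1$ independent of $\epsilon$ with $$|u_{\mathcal E_{HJ_n}^{k+1}}(t,z,\epsilon)-u_{\mathcal E_{HJ_n}^k}(t,z,\epsilon)|\le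 M_{k,1}\exp\left(-\frac{M_{k,2}}{|\epsilon|}\mathrm{Log}\frac{M_{k,3}}{|\epsilon|}\right)$$ for all $t\in\mathcal T\cap D(0,r_{\mathcal T})$, $\epsilon\in\mathcal E_{HJ_n}^k\cap\mathcal E_{HJ_n}^{k+1}$, $z\in D(0,\delta\delta_1)$. 2) For each $0\le p\le\iota-1$, the Cauchy problem (E1) with initial data $(\partial_z^ju)(t,0,\epsilon)=\varphi_{j,\mathcal E_{S_{d_p}}}(t,\epsilon)$, $0\le j\le S-1$, has a bounded holomorphic solution $u_{\mathcal E_{S_{d_p}}}(t,z,\epsilon)$ on $(\mathcal T\cap D(0,r_{\mathcal T}))\times D(0,\delta\delta_1)\times\mathcal E_{S_{d_p}}$. It can be written as $$u_{\mathcal E_{S_{d_p}}}(t,z,\epsilon)=\int_{L_{\gamma_{d_p}}}w_{S_{d_p}}(u,z,\epsilon)\exp\left(-\frac{u}{\epsilon t}\right)\frac{du}{u},$$ where $w_{S_{d_p}}$ is holomorphic on $(S_{d_p}\cup D(0,r))\times D(0,\delta\delta_1)\times\dot D(0,\epsilon_0)$, continuous on $(\bar S_{d_p}\cup\bar D(0,r))\times D(0,\delta\delta_1)\times\dot D(0,\epsilon_0)$, and for any $\sigma_1>\sigma_1'$ there is $C_{S_{d_p}}>0$ (independent of $\epsilon$) with $|w_{S_{d_p}}(\tau,z,\epsilon)|\le C_{S_{d_p}}|\tau|\exp(\frac{\sigma_1}{|\epsilon|}\zeta(b)|\tau|)$ for all $\tau\in S_{d_p}\cup D(0,r)$, $z\in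 D(0,\delta\delta_1)$, $\epsilon\in\dot D(0,\epsilon_0)$. Moreover, for $0\le p\le\iota-2$ there are $M_{p,1},M_{p,2}>0$ (independent of $\epsilon$) with $$|u_{\mathcal E_{S_{d_{p+1}}}}(t,z,\epsilon)-u_{\mathcal E_{S_{d_p}}}(t,z,\epsilon)|\le M_{p,1}\exp\left(-\frac{M_{p,2}}{|\epsilon|}\right)$$ for all $t\in\mathcal T\cap D(0,r_{\mathcal T})$, $\epsilon\in\mathcal E_{S_{d_{p+1}}}\cap\mathcal E_{S_{d_p}}$, $z\in D(0,\delta\delta_1)$. 3) Provided that $r_{\mathcal T}>0$ is close to $0$, there exist $M_{n,1},M_{n,2}>0$ (independent of $\epsilon$) with $$|u_{\mathcal E_{HJ_n}^{-n}}(t,z,\epsilon)-u_{\mathcal E_{S_{d_0}}}(t,z,\epsilon)|\le M_{n,1}\exp\left(-\frac{M_{n,2}}{|\epsilon|}\right)\quad\text{for }\epsilon\in\mathcal E_{HJ_n}^{-n}\cap\mathcal E_{S_{d_0}},$$ $$|u_{\mathcal E_{HJ_n}^{n}}(t,z,\epsilon)-u_{\mathcal E_{S_{d_{\iota-1}}}}(t,z,\epsilon)|\le M_{n,1}\exp\left(-\frac{M_{n,2}}{|\epsilon|}\right)\quad\text{for }\epsilon\in\mathcal E_{HJ_n}^{n}\cap\mathcal E_{S_{d_{\iota-1}}},$$ whenever $t\in\mathcal T\cap D(0,r_{\mathcal T})$ and $z\in D(0,\delta\delta_1)$.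
   Context: Notation: $D(0,r)$, $\bar D(0,r)$ are the open and closed discs in $\mathbb C$; $\dot D(0,\epsilon_0)=D(0,\epsilon_0)\setminus\{0\}$; $\mathbb C_+=\{z\in\mathbb C:\mathrm{Re}(z)>0\}$; $\llbracket -n,n\rrbracket$ is the set of integers $m$ with $-n\le m\le n$; $\mathring X$ is the interior of $X$. Cauchy problem (E1). $\mathcal A\subset\mathbb N^3$ is finite; for $\underline k=(k_0,k_1,k_2)\in\mathcal A$, $c_{\underline k}(z,\epsilon)$ is bounded holomorphic on $D(0,\rho)\times D(0,\epsilon_0)$ ($\rho,\epsilon_0>0$); $S\ge1$ is an integer; $P$ is a complex polynomial, not identically $0$, with all roots in $\mathbb C_+$. The equation is $$(E1)\quad P(\epsilon t^2\partial_t)\partial_z^Su(t,z,\epsilon)=\sum_{\underline k\in\mathcal A}c_{\underline k}(z,\epsilon)\left((t^2\partial_t)^{k_0}\partial_z^{k_1}u\right)\left(\frac{t}{1+k_2\epsilon t},z,\epsilon\right).$$ (A1): there are $\xi>0$, $b>1$ with $S\ge k_1+bk_0+\frac{bk_2}{\xi}$ and $S>k_1$ for all $\underline k\in\mathcal A$. Put $\zeta(b)=\sum_{m\ge0}(m+1)^{-b}$ and fix $M>\zeta(b)$. Strips. $n\ge1$ is an integer and, for $k\in\llbracket -n,n\rrbracket$, $H_k=\{a_k\le\mathrm{Im}(z)\le b_k,\ \mathrm{Re}(z)\le0\}$, $J_k=\{c_k\le\mathrm{Im}(z)\le d_k,\ \mathrm{Re}(z)\le0\}$, where: $0\in(c_0,d_0)$;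 $c_k<a_k<d_k$ and $c_{k+1}<b_k<d_{k+1}$ for $-n\le k\le n-1$, $c_n<a_n<d_n$, $b_n>d_n$; $a_{k+1}>b_k$ and $c_{k+1}>d_k$ for $-n\le k\le n-1$. Put $HJ_n=\{c_{-n}\le\mathrm{Im}(z)\le b_n,\ \mathrm{Re}(z)\le0\}=\bigcup_k(H_k\cup J_k)$. Norms. $\underline\sigma'=(\sigma_1',\sigma_2',\sigma_3')$, $\underline\varsigma'=(\sigma_1',\varsigma_2',\varsigma_3')$ have positive entries, with $\xi\le\min(\sigma_3',\varsigma_3')$. For $\epsilon\in\dot D(0,\epsilon_0)$ (quotients taken at $\tau\ne0$): $\|v\|_{(0,\underline\sigma',H_k,\epsilon)}=\sup_{\tau\in H_k}\frac{|v(\tau)|}{|\tau|}\exp(-\frac{\sigma_1'}{|\epsilon|}|\tau|+\sigma_2'(M-1)e^{\sigma_3'|\tau|})$; $\|v\|_{(0,\underline\varsigma',J_k,\epsilon)}=\sup_{\tau\in J_k}\frac{|v(\tau)|}{|\tau|}\exp(-\frac{\sigma_1'}{|\epsilon|}|\tau|-\varsigma_2'e^{\varsigma_3'|\tau|})$; $\|v\|_{(0,\sigma_1',S_d\cup D(0,r),\epsilon)}=\sup_{\tau\in\bar S_d\cup\bar D(0,r)}\frac{|v(\tau)|}{|\tau|}\exp(-\frac{\sigma_1'}{|\epsilon|}|\tau|)$. Data. $\iota\ge2$ is an integer; $S_{d_p}\subset\mathbb C_+$, $0\le p\le\iota-1$, are unbounded open sectors centered at $0$ with bisecting directions $d_p\in\mathbb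 R$, $d_p<d_{p+1}$, $S_{d_p}\cap S_{d_{p+1}}=\emptyset$ for $0\le p\le\iota-2$; $r>0$ is such that no root of $P$ lies in $\bar S_{d_p}\cup\bar D(0,r)$ and $D(0,r)\cap\{\mathrm{Re}(z)\le0\}\subset J_0$. For $0\le j\le S-1$, $w_j(\tau,\epsilon)$ is holomorphic on $\mathring{HJ}_n\times\dot D(0,\epsilon_0)$ and continuous on $HJ_n\times\dot D(0,\epsilon_0)$, holomorphic on $(S_{d_p}\cup D(0,r))\times\dot D(0,\epsilon_0)$ and continuous on $(\bar S_{d_p}\cup\bar D(0,r))\times\dot D(0,\epsilon_0)$ for all $p$; its restrictions to $\mathring{HJ}_n$ and to each $S_{d_p}$ are analytic continuations in $\tau$ of a common holomorphic function on $D(0,r)$; and the norms $\|w_j\|_{(0,\underline\sigma',H_k,\epsilon)}$, $\|w_j\|_{(0,\underline\varsigma',J_k,\epsilon)}$, $\|w_j\|_{(0,\sigma_1',S_{d_p}\cup D(0,r),\epsilon)}$ are bounded by a constant independent of $\epsilon\in\dot D(0,\epsilon_0)$, for all $k$, $p$. Sectors. $\mathcal T$ is a bounded open sector centered at $0$ with bisecting direction $0$. $\mathcal E_{HJ_n}^k$ ($k\in\llbracket -n,n\rrbracket$) and $\mathcal E_{S_{d_p}}$ ($0\le p\le\iota-1$) are open sectors centered at $0$ inside $D(0,\epsilon_0)$, such that: each $\mathcal E_{HJ_n}^k$ has aperture strictly less than $\pi$ and, for some small $\delta_{HJ_n}>0$, $\pi-\arg(t)-\arg(\epsilon)\in(-\frac\pi2+\delta_{HJ_n},\frac\pi2-\delta_{HJ_n})$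 for all $\epsilon\in\mathcal E_{HJ_n}^k$, $t\in\mathcal T$; for all $t\in\mathcal T$, $\epsilon\in\mathcal E_{S_{d_p}}$ there is a direction $\gamma_{d_p}$ (depending on $t,\epsilon$) with $e^{\sqrt{-1}\gamma_{d_p}}\in S_{d_p}$ and $\gamma_{d_p}-\arg(t)-\arg(\epsilon)\in(-\frac\pi2+\eta,\frac\pi2-\eta)$, for some $\eta>0$ close to $0$. Good covering: $\mathcal E_{HJ_n}^k\cap\mathcal E_{HJ_n}^{k+1}\ne\emptyset$ ($-n\le k\le n-1$), $\mathcal E_{S_{d_{p+1}}}\cap\mathcal E_{S_{d_p}}\ne\emptyset$ ($0\le p\le\iota-2$), $\mathcal E_{HJ_n}^{-n}\cap\mathcal E_{S_{d_0}}\ne\emptyset$, $\mathcal E_{HJ_n}^n\cap\mathcal E_{S_{d_{\iota-1}}}\ne\emptyset$; the union of all these sectors is $\mathcal U\setminus\{0\}$ for a neighborhood $\mathcal U$ of $0$; any three of the sectors have empty intersection. Paths and initial data. $P_k$ is the union of the segment $P_{k,1}$ from $0$ to a point $A_k\in H_k$ and of the half-line $P_{k,2}=\{A_k-s:s\ge0\}$, where $|\mathrm{Re}(A_k)|$ is taken so large that $\arg(A_k)-\arg(\epsilon)-\arg(t)\in(-\frac\pi2+\eta_k,\frac\pi2-\eta_k)$ for some $\eta_k>0$ close to $0$, for all $\epsilon\in\mathcal E_{HJ_n}^k$, $t\in\mathcal T$. $L_{\gamma_{d_p}}=\mathbb R_+e^{\sqrt{-1}\gamma_{d_p}}$. Put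 $$\varphi_{j,\mathcal E_{HJ_n}^k}(t,\epsilon)=\int_{P_k}w_j(u,\epsilon)e^{-u/(\epsilon t)}\frac{du}u,\qquad \varphi_{j,\mathcal E_{S_{d_p}}}(t,\epsilon)=\int_{L_{\gamma_{d_p}}}w_j(u,\epsilon)e^{-u/(\epsilon t)}\frac{du}u .$$ *)

theory Defs
  imports "HOL-Complex_Analysis.Complex_Analysis"
begin

section \<open>Holomorphic functions of two and three complex variables\<close>

text \<open>Complex differentiability on an open set: the real derivative exists and is
  complex-linear.\<close>

definition holomorphic2_on :: "(complex \<Rightarrow> complex \<Rightarrow> complex) \<Rightarrow> (complex \<times> complex) set \<Rightarrow> bool" where
  "holomorphic2_on f X \<longleftrightarrow> open X \<and>
     (\<forall>p\<in>X. \<exists>a b. ((\<lambda>(x, y). f x y) has_derivative (\<lambda>(h, k). a * h + b * k)) (at p))"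

definition holomorphic3_on ::
  "(complex \<Rightarrow> complex \<Rightarrow> complex \<Rightarrow> complex) \<Rightarrow> (complex \<times> complex \<times> complex) set \<Rightarrow> bool" where
  "holomorphic3_on f X \<longleftrightarrow> open X \<and>
     (\<forall>p\<in>X. \<exists>a b c. ((\<lambda>(x, y, z). f x y z) has_derivative
                        (\<lambda>(h, k, l). a * h + b * k + c * l)) (at p))"

section \<open>Sectors and arguments\<close>

text \<open>The parameter \<open>\<theta>\<close> is half of the aperture.\<close>

definition sector :: "real \<Rightarrow> real \<Rightarrow> complex set" where
  "sector d \<theta> = {z. z \<noteq> 0 \<and> (\<exists>\<phi>. is_Arg z \<phi> \<and> \<bar>\<phi> - d\<bar> < \<theta>)}"

definition unbounded_sector :: "real \<Rightarrow> complex set \<Rightarrow> bool" where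
  "unbounded_sector d X \<longleftrightarrow> (\<exists>\<theta>. 0 < \<theta> \<and> \<theta> \<le> pi \<and> X = sector d \<theta>)"

definition bounded_sector :: "real \<Rightarrow> real \<Rightarrow> complex set \<Rightarrow> bool" where
  "bounded_sector d \<theta> X \<longleftrightarrow> 0 < \<theta> \<and> \<theta> \<le> pi \<and> (\<exists>R>0. X = sector d \<theta> \<inter> ball 0 R)"

text \<open>\<open>\<theta> - arg t - arg \<epsilon>\<close> lies in \<open>(- \<pi>/2 + \<eta>, \<pi>/2 - \<eta>)\<close>. Arguments are understood modulo
  \<open>2\<pi>\<close>: principal values would be wrong here, since the sectors in \<open>\<epsilon>\<close> may cross the
  negative real axis.\<close>

definition arg_cond :: "real \<Rightarrow> real \<Rightarrow> complex \<Rightarrow> complex \<Rightarrow> bool" where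
  "arg_cond \<eta> \<theta> t \<epsilon> \<longleftrightarrow>
     (\<exists>\<alpha> \<beta>. is_Arg t \<alpha> \<and> is_Arg \<epsilon> \<beta> \<and> \<theta> - \<alpha> - \<beta> \<in> {- pi/2 + \<eta> <..< pi/2 - \<eta>})"

section \<open>The Cauchy problem\<close>

definition zeta_sum :: "real \<Rightarrow> real" where
  "zeta_sum b = (\<Sum>m. (real m + 1) powr (- b))"

definition t2d :: "(complex \<Rightarrow> complex) \<Rightarrow> complex \<Rightarrow> complex" where
  "t2d f t = t\<^sup>2 * deriv f t"

text \<open>The equation at the point \<open>(t, z, \<epsilon>)\<close>; the operator \<open>\<epsilon> t\<^sup>2 \<partial>\<^sub>t\<close> acts with \<open>\<epsilon>\<close> as a
  parameter, so that its \<open>i\<close>-th power is \<open>\<epsilon> ^ i\<close> times the \<open>i\<close>-th power of \<open>t\<^sup>2 \<partial>\<^sub>t\<close>.\<close>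

definition satisfies_eq ::
  "complex poly \<Rightarrow> nat \<Rightarrow> (nat \<times> nat \<times> nat) set \<Rightarrow>
   (nat \<times> nat \<times> nat \<Rightarrow> complex \<Rightarrow> complex \<Rightarrow> complex) \<Rightarrow>
   (complex \<Rightarrow> complex \<Rightarrow> complex \<Rightarrow> complex) \<Rightarrow> complex \<Rightarrow> complex \<Rightarrow> complex \<Rightarrow> bool" where
  "satisfies_eq P S A c u t z \<epsilon> \<longleftrightarrow>
     (\<forall>(k0, k1, k2)\<in>A. 1 + of_nat k2 * \<epsilon> * t \<noteq> 0) \<and>
     (\<Sum>i\<le>degree P. coeff P i * \<epsilon> ^ i * (t2d ^^ i) (\<lambda>s. (deriv ^^ S) (\<lambda>y. u s y \<epsilon>) z) t) =
     (\<Sum>(k0, k1, k2)\<in>A. c (k0, k1, k2) z \<epsilon> *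
        (t2d ^^ k0) (\<lambda>s. (deriv ^^ k1) (\<lambda>y. u s y \<epsilon>) z) (t / (1 + of_nat k2 * \<epsilon> * t)))"

text \<open>The points \<open>t / (1 + k\<^sub>2 \<epsilon> t)\<close> need not lie in the sectorial domain \<open>Tr\<close> of \<open>t\<close>, so the
  equation refers to values of the analytic continuation of \<open>u\<close> to them. The following set
  contains \<open>Tr \<times> D \<times> E\<close> (take \<open>s = 0\<close>) and all these points, and every point of a slice with
  \<open>z\<close> and \<open>\<epsilon>\<close> fixed is joined to \<open>Tr\<close> inside the slice (let \<open>s\<close> decrease to 0).\<close>

definition continuation_domain ::
  "(nat \<times> nat \<times> nat) set \<Rightarrow> complex set \<Rightarrow> complex set \<Rightarrow> complex set \<Rightarrow>
   (complex \<times> complex \<times> complex) set" where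
  "continuation_domain A Tr D E =
     {(t / (1 + of_real s * \<epsilon> * t), z, \<epsilon>) | t z \<epsilon> s.
        t \<in> Tr \<and> z \<in> D \<and> \<epsilon> \<in> E \<and> 0 \<le> s \<and> (s = 0 \<or> (\<exists>(k0, k1, k2)\<in>A. s \<le> real k2))}"

definition bounded_holomorphic_solution ::
  "complex poly \<Rightarrow> nat \<Rightarrow> (nat \<times> nat \<times> nat) set \<Rightarrow>
   (nat \<times> nat \<times> nat \<Rightarrow> complex \<Rightarrow> complex \<Rightarrow> complex) \<Rightarrow> (nat \<Rightarrow> complex \<Rightarrow> complex \<Rightarrow> complex) \<Rightarrow>
   complex set \<Rightarrow> complex set \<Rightarrow> complex set \<Rightarrow>
   (complex \<Rightarrow> complex \<Rightarrow> complex \<Rightarrow> complex) \<Rightarrow> bool" where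
  "bounded_holomorphic_solution P S A c \<phi> Tr D E u \<longleftrightarrow>
     holomorphic3_on u (continuation_domain A Tr D E) \<and>
     bounded ((\<lambda>(t, z, \<epsilon>). u t z \<epsilon>) ` (Tr \<times> D \<times> E)) \<and>
     (\<forall>t\<in>Tr. \<forall>z\<in>D. \<forall>\<epsilon>\<in>E. satisfies_eq P S A c u t z \<epsilon>) \<and>
     (\<forall>j<S. \<forall>t\<in>Tr. \<forall>\<epsilon>\<in>E. (deriv ^^ j) (\<lambda>z. u t z \<epsilon>) 0 = \<phi> j t \<epsilon>)"

section \<open>Strips and norms\<close>

definition strip :: "real \<Rightarrow> real \<Rightarrow> complex set" where
  "strip a b = {z. a \<le> Im z \<and> Im z \<le> b \<and> Re z \<le> 0}"

definition strip_bounds ::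
  "int \<Rightarrow> (int \<Rightarrow> real) \<Rightarrow> (int \<Rightarrow> real) \<Rightarrow> (int \<Rightarrow> real) \<Rightarrow> (int \<Rightarrow> real) \<Rightarrow> bool" where
  "strip_bounds n a b c d \<longleftrightarrow>
     c 0 < 0 \<and> 0 < d 0 \<and>
     (\<forall>k\<in>{-n..n-1}. c k < a k \<and> a k < d k \<and> c (k+1) < b k \<and> b k < d (k+1)) \<and>
     c n < a n \<and> a n < d n \<and> d n < b n \<and>
     (\<forall>k\<in>{-n..n-1}. b k < a (k+1) \<and> d k < c (k+1))"

text \<open>Suprema are taken in \<open>[0, \<infinity>]\<close>, so that no boundedness is implicitly assumed.\<close>

definition norm_H :: "real \<Rightarrow> real \<Rightarrow> real \<Rightarrow> real \<Rightarrow> complex set \<Rightarrow> complex \<Rightarrow> (complex \<Rightarrow> complex) \<Rightarrow> ennreal" where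
  "norm_H M \<sigma>1 \<sigma>2 \<sigma>3 X \<epsilon> v =
     (SUP \<tau>\<in>X - {0}. ennreal (cmod (v \<tau>) / cmod \<tau> *
        exp (- (\<sigma>1 / cmod \<epsilon>) * cmod \<tau> + \<sigma>2 * (M - 1) * exp (\<sigma>3 * cmod \<tau>))))"

definition norm_J :: "real \<Rightarrow> real \<Rightarrow> real \<Rightarrow> complex set \<Rightarrow> complex \<Rightarrow> (complex \<Rightarrow> complex) \<Rightarrow> ennreal" where
  "norm_J \<sigma>1 \<sigma>2 \<sigma>3 X \<epsilon> v =
     (SUP \<tau>\<in>X - {0}. ennreal (cmod (v \<tau>) / cmod \<tau> *
        exp (- (\<sigma>1 / cmod \<epsilon>) * cmod \<tau> - \<sigma>2 * exp (\<sigma>3 * cmod \<tau>))))"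

definition norm_S :: "real \<Rightarrow> complex set \<Rightarrow> complex \<Rightarrow> (complex \<Rightarrow> complex) \<Rightarrow> ennreal" where
  "norm_S \<sigma>1 X \<epsilon> v =
     (SUP \<tau>\<in>X - {0}. ennreal (cmod (v \<tau>) / cmod \<tau> * exp (- (\<sigma>1 / cmod \<epsilon>) * cmod \<tau>)))"

section \<open>Laplace integrals\<close>

text \<open>For a function \<open>v\<close> and \<open>x = \<epsilon> t\<close>, the integrand \<open>v(u) exp(- u / (\<epsilon> t)) / u\<close>.\<close>

definition laplace_kernel :: "(complex \<Rightarrow> complex) \<Rightarrow> complex \<Rightarrow> complex \<Rightarrow> complex" where
  "laplace_kernel v x u = v u * exp (- (u / x)) / u"

text \<open>Integration along the half-line \<open>{a + s * e | s \<ge> 0}\<close>.\<close>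

definition ray_integrable :: "complex \<Rightarrow> complex \<Rightarrow> (complex \<Rightarrow> complex) \<Rightarrow> bool" where
  "ray_integrable a e f \<longleftrightarrow> (\<lambda>s. f (a + of_real s * e) * e) absolutely_integrable_on {0..}"

definition ray_integral :: "complex \<Rightarrow> complex \<Rightarrow> (complex \<Rightarrow> complex) \<Rightarrow> complex" where
  "ray_integral a e f = integral {0..} (\<lambda>s. f (a + of_real s * e) * e)"

text \<open>Integration along the segment from \<open>0\<close> to \<open>A\<close> followed by the half-line
  \<open>{A - s | s \<ge> 0}\<close>.\<close>

definition bent_path_integrable :: "complex \<Rightarrow> (complex \<Rightarrow> complex) \<Rightarrow> bool" where
  "bent_path_integrable A f \<longleftrightarrow> f contour_integrable_on (linepath 0 A) \<and> ray_integrable A (- 1) f"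

definition bent_path_integral :: "complex \<Rightarrow> (complex \<Rightarrow> complex) \<Rightarrow> complex" where
  "bent_path_integral A f = contour_integral (linepath 0 A) f + ray_integral A (- 1) f"

section \<open>Data and good coverings\<close>

text \<open>Each \<open>w j\<close> is a single function of \<open>(\<tau>, \<epsilon>)\<close>, so the restrictions to the strip \<open>HJ\<close> and to
  the sectors automatically continue its restriction to the disc \<open>ball 0 r\<close>.\<close>

definition admissible_data ::
  "nat \<Rightarrow> real \<Rightarrow> complex set \<Rightarrow> int \<Rightarrow> (int \<Rightarrow> complex set) \<Rightarrow> (int \<Rightarrow> complex set) \<Rightarrow>
   nat \<Rightarrow> (nat \<Rightarrow> complex set) \<Rightarrow> real \<Rightarrow> real \<Rightarrow>
   real \<times> real \<times> real \<Rightarrow> real \<times> real \<Rightarrow> (nat \<Rightarrow> complex \<Rightarrow> complex \<Rightarrow> complex) \<Rightarrow> bool" where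
  "admissible_data S \<epsilon>0 HJ n H J \<iota> Sd r M = (\<lambda>(\<sigma>1, \<sigma>2, \<sigma>3) (s2, s3) w.
     (\<forall>j<S.
        holomorphic2_on (w j) (interior HJ \<times> (ball 0 \<epsilon>0 - {0})) \<and>
        continuous_on (HJ \<times> (ball 0 \<epsilon>0 - {0})) (\<lambda>(\<tau>, \<epsilon>). w j \<tau> \<epsilon>) \<and>
        (\<forall>p<\<iota>.
           holomorphic2_on (w j) ((Sd p \<union> ball 0 r) \<times> (ball 0 \<epsilon>0 - {0})) \<and>
           continuous_on ((closure (Sd p) \<union> cball 0 r) \<times> (ball 0 \<epsilon>0 - {0})) (\<lambda>(\<tau>, \<epsilon>). w j \<tau> \<epsilon>)) \<and>
        (\<exists>K::real. \<forall>\<epsilon>\<in>ball 0 \<epsilon>0 - {0}.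
           (\<forall>k\<in>{-n..n}.
              norm_H M \<sigma>1 \<sigma>2 \<sigma>3 (H k) \<epsilon> (\<lambda>\<tau>. w j \<tau> \<epsilon>) \<le> ennreal K \<and>
              norm_J \<sigma>1 s2 s3 (J k) \<epsilon> (\<lambda>\<tau>. w j \<tau> \<epsilon>) \<le> ennreal K) \<and>
           (\<forall>p<\<iota>. norm_S \<sigma>1 (closure (Sd p) \<union> cball 0 r) \<epsilon> (\<lambda>\<tau>. w j \<tau> \<epsilon>) \<le> ennreal K))))"

definition small_data ::
  "nat \<Rightarrow> real \<Rightarrow> int \<Rightarrow> (int \<Rightarrow> complex set) \<Rightarrow> (int \<Rightarrow> complex set) \<Rightarrow>
   nat \<Rightarrow> (nat \<Rightarrow> complex set) \<Rightarrow> real \<Rightarrow> real \<Rightarrow>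
   real \<times> real \<times> real \<Rightarrow> real \<times> real \<Rightarrow> real \<Rightarrow> real \<Rightarrow>
   (nat \<Rightarrow> complex \<Rightarrow> complex \<Rightarrow> complex) \<Rightarrow> bool" where
  "small_data S \<epsilon>0 n H J \<iota> Sd r M = (\<lambda>(\<sigma>1, \<sigma>2, \<sigma>3) (s2, s3) I \<delta> w.
     (\<forall>h<S. \<forall>\<epsilon>\<in>ball 0 \<epsilon>0 - {0}.
        (\<forall>k\<in>{-n..n}.
           (\<Sum>j=0..S-1-h. norm_H M \<sigma>1 \<sigma>2 \<sigma>3 (H k) \<epsilon> (\<lambda>\<tau>. w (j+h) \<tau> \<epsilon>) * ennreal (\<delta> ^ j / fact j))
             \<le> ennreal I \<and>
           (\<Sum>j=0..S-1-h. norm_J \<sigma>1 s2 s3 (J k) \<epsilon> (\<lambda>\<tau>. w (j+h) \<tau> \<epsilon>) * ennreal (\<delta> ^ j / fact j))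
             \<le> ennreal I) \<and>
        (\<forall>p<\<iota>.
           (\<Sum>j=0..S-1-h. norm_S \<sigma>1 (closure (Sd p) \<union> cball 0 r) \<epsilon> (\<lambda>\<tau>. w (j+h) \<tau> \<epsilon>)
                            * ennreal (\<delta> ^ j / fact j))
             \<le> ennreal I)))"

definition good_covering :: "int \<Rightarrow> nat \<Rightarrow> (int \<Rightarrow> complex set) \<Rightarrow> (nat \<Rightarrow> complex set) \<Rightarrow> bool" where
  "good_covering n \<iota> EH ES \<longleftrightarrow>
     (\<forall>k\<in>{-n..n-1}. EH k \<inter> EH (k+1) \<noteq> {}) \<and>
     (\<forall>p. p + 1 < \<iota> \<longrightarrow> ES (p+1) \<inter> ES p \<noteq> {}) \<and>
     EH (-n) \<inter> ES 0 \<noteq> {} \<and>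
     EH n \<inter> ES (\<iota>-1) \<noteq> {} \<and>
     (\<exists>U. 0 \<in> interior U \<and> (\<Union>k\<in>{-n..n}. EH k) \<union> (\<Union>p<\<iota>. ES p) = U - {0}) \<and>
     (let F = case_sum EH ES; Idx = Inl ` {-n..n} \<union> Inr ` {..<\<iota>} in
        \<forall>x\<in>Idx. \<forall>y\<in>Idx. \<forall>z\<in>Idx. x \<noteq> y \<longrightarrow> y \<noteq> z \<longrightarrow> x \<noteq> z \<longrightarrow> F x \<inter> F y \<inter> F z = {})"

text \<open>The sectors \<open>T\<close>, \<open>EH k\<close>, \<open>ES p\<close> together with the directions \<open>\<gamma> p t \<epsilon>\<close> and the corners
  \<open>A k\<close> of the paths used for the Laplace integrals.\<close>

definition admissible_sectors ::
  "real \<Rightarrow> int \<Rightarrow> (int \<Rightarrow> complex set) \<Rightarrow> nat \<Rightarrow> (nat \<Rightarrow> complex set) \<Rightarrow>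
   complex set \<Rightarrow> (int \<Rightarrow> complex set) \<Rightarrow> (nat \<Rightarrow> complex set) \<Rightarrow>
   (nat \<Rightarrow> complex \<Rightarrow> complex \<Rightarrow> real) \<Rightarrow> (int \<Rightarrow> complex) \<Rightarrow> bool" where
  "admissible_sectors \<epsilon>0 n H \<iota> Sd T EH ES \<gamma> A \<longleftrightarrow>
     (\<exists>\<theta>. bounded_sector 0 \<theta> T) \<and>
     (\<forall>k\<in>{-n..n}. EH k \<subseteq> ball 0 \<epsilon>0 \<and> (\<exists>d \<theta>. 2 * \<theta> < pi \<and> bounded_sector d \<theta> (EH k))) \<and>
     (\<forall>p<\<iota>. ES p \<subseteq> ball 0 \<epsilon>0 \<and> (\<exists>d \<theta>. bounded_sector d \<theta> (ES p))) \<and>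
     (\<exists>\<eta>>0. \<forall>k\<in>{-n..n}. \<forall>t\<in>T. \<forall>\<epsilon>\<in>EH k. arg_cond \<eta> pi t \<epsilon>) \<and>
     (\<forall>p<\<iota>. \<exists>\<eta>>0. \<forall>t\<in>T. \<forall>\<epsilon>\<in>ES p. cis (\<gamma> p t \<epsilon>) \<in> Sd p \<and> arg_cond \<eta> (\<gamma> p t \<epsilon>) t \<epsilon>) \<and>
     good_covering n \<iota> EH ES \<and>
     (\<forall>k\<in>{-n..n}. A k \<in> H k \<and> A k \<noteq> 0 \<and>
        (\<exists>\<eta>>0. \<forall>t\<in>T. \<forall>\<epsilon>\<in>EH k. arg_cond \<eta> (Arg (A k)) t \<epsilon>))"

end

theory Submission
  imports Defs
begin

text \<open>The Borel transform turns the equation into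
  \<open>P(\<tau>) \<partial>\<^sub>z\<^sup>S W = \<Sum>\<^sub>k c\<^sub>k(z, \<epsilon>) (\<tau>/\<epsilon>)\<^bsup>k0\<^esup> exp(- k2 \<tau>) \<partial>\<^sub>z\<^bsup>k1\<^esup> W\<close>, because \<open>t \<mapsto> t/(1 + k2 \<epsilon> t)\<close> multiplies
  \<open>exp(- \<tau>/(\<epsilon> t))\<close> by \<open>exp(- k2 \<tau>)\<close>. For fixed \<open>\<tau>\<close> and \<open>\<epsilon>\<close> it is solved by a power series in \<open>z\<close> whose
  coefficients are given by a linear recursion. Hence one function \<open>W\<close> serves the strip and all sectors.
  The coefficient of index \<open>\<beta>\<close> is estimated with weights in which \<open>\<sigma>1\<close> and the factor of the double
  exponential are multiplied by the partial sum of order \<open>\<beta>\<close> of the series of \<open>\<zeta>(b)\<close>: the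
  increment of the partial sum between the indices \<open>\<beta> - S + k1\<close> and \<open>\<beta>\<close> absorbs \<open>(\<tau>/\<epsilon>)\<^bsup>k0\<^esup> exp(- k2 \<tau>)\<close> at
  the price of a power of \<open>\<beta>\<close>, which the hypothesis on the exponents allows.

  The solutions are the Laplace integrals of \<open>W\<close>. The directions in which \<open>exp(- \<tau>/(\<epsilon> t))\<close> decays
  at a given rate form a convex cone, so paths are deformed along straight segments. Two paths in the
  strip differ by a vertical segment pushed to real part \<open>- X\<close> up to a constant, whose contribution is at
  most \<open>exp(C exp(s3 X) - X/|\<epsilon>|)\<close> up to a constant; \<open>X = ln(1/|\<epsilon>|)/s3\<close> balances
  the double exponential against \<open>1/|\<epsilon>|\<close>. When a path in a sector is involved, the segment stays within \<open>D(0, r)\<close>.\<close>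

section \<open>Holomorphic parameter integrals\<close>

text \<open>The transform may grow like \<open>exp(kp |\<tau>|/|\<epsilon>|)\<close>,
  \<open>kp = \<zeta>(b) * \<sigma>1\<close>, at the same scale 1/|\<epsilon>| as the kernel.
  Therefore t is restricted to |t| < \<open>rT = s0/ka\<close> with \<open>ka = kp + 1\<close>: the
  kernel then decays at rate \<open>ka/|\<epsilon>|\<close> along the paths, and the margin
  \<open>ka - kp = 1\<close> leaves \<open>exp(- |\<tau>|/|\<epsilon>|)\<close>, the source of every
  exponential estimate. The equation evaluates u at t/(1 + k2 \<epsilon> t), which may leave the
  sector of t. In the strips the superexponential decay on \<open>H k\<close> makes the integral
  converge for every nonzero t. In the sectors 1/(\<epsilon> t) changes by k2, and directions in the
  right half-plane stay admissible. The weights of the recursion can only grow with the index, so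
  they cannot carry the decay on \<open>H k\<close>. It is hidden in the size of the data, pointwise
  in \<tau>, and \<open>M > \<zeta>(b)\<close> is what lets a part of it survive. The double
  exponential costs \<open>B/|\<epsilon>|\<close> at the chosen X, with B independent of \<epsilon>;
  for small \<epsilon> one has \<open>X \<ge> 2 * B\<close>, and half of X is left for the
  logarithmic estimate.\<close>

lemma continuous_on_local:
  fixes f :: "'a::topological_space \<Rightarrow> 'b::topological_space"
  assumes "\<And>x. x \<in> X \<Longrightarrow> \<exists>V. open V \<and> x \<in> V \<and> continuous_on (X \<inter> V) f"
  shows "continuous_on X f"
  unfolding continuous_on_def
proof
  fix x assume x: "x \<in> X"
  obtain V where V: "open V" "x \<in> V" "continuous_on (X \<inter> V) f" using assms[OF x] by blast
  have "(f \<longlongrightarrow> f x) (at x within X \<inter> V)" using V x unfolding continuous_on_def by auto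
  thus "(f \<longlongrightarrow> f x) (at x within X)" using at_within_nhd[OF V(2,1), of "X \<inter> V" X] by auto
qed

text \<open>Cauchy's formula for the derivative over one circle that stays fixed while the point and
  the parameter vary nearby: continuity passes through the integral. The parameter space is any
  topological space, so that it can be a pair of further variables.\<close>

lemma continuous_on_deriv_param:
  fixes f :: "complex \<Rightarrow> 'p::topological_space \<Rightarrow> complex"
  assumes U: "open U" and c: "continuous_on (U \<times> T) (\<lambda>(x, p). f x p)"
    and h: "\<And>p. p \<in> T \<Longrightarrow> (\<lambda>x. f x p) holomorphic_on U"
  shows "continuous_on (U \<times> T) (\<lambda>(x, p). deriv (\<lambda>x. f x p) x)"
proof -
  have loc: "\<exists>V. open V \<and> q \<in> V \<and> continuous_on ((U \<times> T) \<inter> V) (\<lambda>(x, p). deriv (\<lambda>x. f x p) x)"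
    if q: "q \<in> U \<times> T" for q
  proof -
    obtain x0 p0 where q0: "q = (x0, p0)" "x0 \<in> U" "p0 \<in> T" using q by auto
    obtain r where r: "r > 0" "cball x0 r \<subseteq> U" using U q0 open_contains_cball by blast
    let ?g = "circlepath x0 r"
    let ?F = "\<lambda>(y::complex \<times> 'p) t::real. f (?g t) (snd y) / (?g t - fst y)\<^sup>2 * (2 * pi * \<i> * r * exp (2 * of_real pi * \<i> * t))"
    have gU: "?g t \<in> U" for t
      using r by (auto simp: circlepath dist_norm norm_mult intro!: subsetD[OF r(2)])
    have contg: "continuous_on X ?g" for X
      unfolding circlepath by (intro continuous_intros)
    have ne: "?g t - x \<noteq> 0" if "x \<in> ball x0 r" for t x
    proof
      assume "?g t - x = 0"
      hence "x = ?g t" by simp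
      moreover have "dist x0 (?g t) = r" using r by (simp add: circlepath dist_norm norm_mult)
      ultimately show False using that by simp
    qed
    have "continuous_on ((ball x0 r \<times> T) \<times> {0..1}) (\<lambda>(y, t). ?F y t)"
    proof -
      have "continuous_on ((ball x0 r \<times> T) \<times> {0..1}) (\<lambda>y. (\<lambda>(x, p). f x p) (?g (snd y), snd (fst y)))"
        by (rule continuous_on_compose2[OF c])
          (auto intro!: continuous_intros continuous_on_compose2[OF contg] simp: gU)
      thus ?thesis unfolding split_def
        by (intro continuous_intros continuous_on_compose2[OF contg[of UNIV]]) (auto dest: ne)
    qed
    hence ci: "continuous_on (ball x0 r \<times> T) (\<lambda>y. integral {0..1} (?F y))"
      using integral_continuous_on_param[of "ball x0 r \<times> T" 0 "1::real" ?F] by simp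
    have eq: "deriv (\<lambda>x. f x (snd y)) (fst y) = integral {0..1} (?F y) / (2 * of_real pi * \<i>)"
      if "y \<in> ball x0 r \<times> T" for y
    proof -
      have hh: "(\<lambda>x. f x (snd y)) holomorphic_on U" using that h by auto
      have w: "fst y \<in> ball x0 r" using that by auto
      note C = Cauchy_derivative_integral_circlepath[OF holomorphic_on_imp_continuous_on[OF holomorphic_on_subset[OF hh r(2)]]
          holomorphic_on_subset[OF hh subset_trans[OF ball_subset_cball r(2)]] w]
      have "contour_integral ?g (\<lambda>u. f u (snd y) / (u - fst y)^2) = (2 * of_real pi * \<i>) * deriv (\<lambda>x. f x (snd y)) (fst y)"
        using DERIV_imp_deriv[OF C(2)] by simp
      hence "((\<lambda>u. f u (snd y) / (u - fst y)^2) has_contour_integral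
           (2 * of_real pi * \<i>) * deriv (\<lambda>x. f x (snd y)) (fst y)) ?g"
        using has_contour_integral_integral[OF C(1)] by simp
      hence "integral {0..1} (\<lambda>t. f (?g t) (snd y) / (?g t - fst y)^2 * vector_derivative ?g (at t)) 
           = (2 * of_real pi * \<i>) * deriv (\<lambda>x. f x (snd y)) (fst y)"
        unfolding has_contour_integral by (simp add: integral_unique)
      thus ?thesis by (simp add: vector_derivative_circlepath field_simps)
    qed
    have "continuous_on (ball x0 r \<times> T) (\<lambda>y. integral {0..1} (?F y) / (2 * of_real pi * \<i>))"
      by (intro continuous_intros ci) auto
    hence "continuous_on (ball x0 r \<times> T) (\<lambda>(x, p). deriv (\<lambda>x. f x p) x)"
      by (rule continuous_on_eq) (simp add: eq split_def)
    hence "continuous_on ((U \<times> T) \<inter> (ball x0 r \<times> UNIV)) (\<lambda>(x, p). deriv (\<lambda>x. f x p) x)"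
      by (rule continuous_on_subset) auto
    moreover have "open (ball x0 r \<times> (UNIV::'p set))" by (intro open_Times) auto
    ultimately show ?thesis using r q0 by (intro exI[of _ "ball x0 r \<times> UNIV"]) auto
  qed
  show ?thesis by (rule continuous_on_local[OF loc])
qed

text \<open>Continuity and Cauchy's formula make the partial derivatives in \<open>y\<close> and
  \<open>z\<close> jointly continuous, and continuous partial derivatives give a total one.
  Holomorphy in three variables is thereby reduced to continuity and to one variable at a
  time.\<close>

lemma holomorphic3_onI:
  assumes X: "open X" and c: "continuous_on X (\<lambda>(x, y, z). f x y z)"
    and d1: "\<And>x y z. (x, y, z) \<in> X \<Longrightarrow> (\<lambda>x. f x y z) field_differentiable at x"
    and d2: "\<And>x y z. (x, y, z) \<in> X \<Longrightarrow> (\<lambda>y. f x y z) field_differentiable at y"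
    and d3: "\<And>x y z. (x, y, z) \<in> X \<Longrightarrow> (\<lambda>z. f x y z) field_differentiable at z"
  shows "holomorphic3_on f X"
  unfolding holomorphic3_on_def
proof (intro conjI X ballI)
  fix p assume p: "p \<in> X"
  obtain x0 y0 z0 where p0: "p = (x0, y0, z0)" by (cases p) auto
  obtain A Q where AQ: "open A" "open Q" "p \<in> A \<times> Q" "A \<times> Q \<subseteq> X"
    using open_prod_elim[OF X p] by (metis mem_Times_iff)
  obtain B C where BC: "open B" "open C" "(y0, z0) \<in> B \<times> C" "B \<times> C \<subseteq> Q"
    using open_prod_elim[OF AQ(2), of "(y0, z0)"] AQ(3) p0 by (metis mem_Sigma_iff)
  obtain r1 r2 r3 where r: "r1 > 0" "r2 > 0" "r3 > 0" "ball x0 r1 \<subseteq> A" "ball y0 r2 \<subseteq> B" "ball z0 r3 \<subseteq> C"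
    using AQ BC p0 by (metis mem_Sigma_iff open_contains_ball)
  let ?A = "ball x0 r1" let ?B = "ball y0 r2" let ?C = "ball z0 r3"
  have sub: "?A \<times> ?B \<times> ?C \<subseteq> X" using r AQ BC by blast
  have mem: "(x, y, z) \<in> X" if "x \<in> ?A" "y \<in> ?B" "z \<in> ?C" for x y z using sub that by blast
  define fy where "fy = (\<lambda>x y z. deriv (\<lambda>y. f x y z) y)"
  define fz where "fz = (\<lambda>x y z. deriv (\<lambda>z. f x y z) z)"
  have cb: "continuous_on (?A \<times> ?B \<times> ?C) (\<lambda>(x, y, z). f x y z)" using c sub continuous_on_subset by blast
  have cy: "continuous_on (?A \<times> ?B \<times> ?C) (\<lambda>(x, y, z). fy x y z)"
  proof -
    have "continuous_on (?B \<times> (?A \<times> ?C)) (\<lambda>(y, q). deriv (\<lambda>y. f (fst q) y (snd q)) y)"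
    proof (rule continuous_on_deriv_param)
      have "continuous_on (?B \<times> (?A \<times> ?C)) (\<lambda>u. (\<lambda>(x, y, z). f x y z) (fst (snd u), fst u, snd (snd u)))"
        by (rule continuous_on_compose2[OF cb]) (auto intro!: continuous_intros)
      thus "continuous_on (?B \<times> ?A \<times> ?C) (\<lambda>(y, q). f (fst q) y (snd q))"
        by (simp add: split_def)
    qed (auto simp: holomorphic_on_open intro: mem intro!: d2[unfolded field_differentiable_def])
    hence "continuous_on (?A \<times> ?B \<times> ?C) (\<lambda>u. (\<lambda>(y, q). deriv (\<lambda>y. f (fst q) y (snd q)) y) (fst (snd u), fst u, snd (snd u)))"
      by (rule continuous_on_compose2) (auto intro!: continuous_intros)
    thus ?thesis by (simp add: fy_def split_def)
  qed
  have cz: "continuous_on (?A \<times> ?B \<times> ?C) (\<lambda>(x, y, z). fz x y z)"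
  proof -
    have "continuous_on (?C \<times> (?A \<times> ?B)) (\<lambda>(z, q). deriv (\<lambda>z. f (fst q) (snd q) z) z)"
    proof (rule continuous_on_deriv_param)
      have "continuous_on (?C \<times> (?A \<times> ?B)) (\<lambda>u. (\<lambda>(x, y, z). f x y z) (fst (snd u), snd (snd u), fst u))"
        by (rule continuous_on_compose2[OF cb]) (auto intro!: continuous_intros)
      thus "continuous_on (?C \<times> ?A \<times> ?B) (\<lambda>(z, q). f (fst q) (snd q) z)"
        by (simp add: split_def)
    qed (auto simp: holomorphic_on_open intro: mem intro!: d3[unfolded field_differentiable_def])
    hence "continuous_on (?A \<times> ?B \<times> ?C) (\<lambda>u. (\<lambda>(z, q). deriv (\<lambda>z. f (fst q) (snd q) z) z) (snd (snd u), fst u, fst (snd u)))"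
      by (rule continuous_on_compose2) (auto intro!: continuous_intros)
    thus ?thesis by (simp add: fz_def split_def)
  qed
  \<comment> \<open>The derivative in \<open>(y, z)\<close> as one bounded linear map:
    \<open>has_derivative_partialsI\<close> handles two arguments, so it is applied to
    \<open>y\<close> and \<open>z\<close> first, then to \<open>x\<close> and the pair, and the
    second use needs continuity of \<open>Q'\<close> in the operator norm.\<close>
  define Q' where "Q' = (\<lambda>x (q::complex \<times> complex). 
     (blinfun_mult_right (fy x (fst q) (snd q)) o\<^sub>L fst_blinfun) + (blinfun_mult_right (fz x (fst q) (snd q)) o\<^sub>L snd_blinfun))"
  have Q'app: "blinfun_apply (Q' x q) = (\<lambda>u. fy x (fst q) (snd q) * fst u + fz x (fst q) (snd q) * snd u)" for x q
    by (auto simp: Q'_def blinfun.add_left fun_eq_iff)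
  have inner: "((\<lambda>q. f x (fst q) (snd q)) has_derivative blinfun_apply (Q' x q)) (at q within ?B \<times> ?C)"
    if "x \<in> ?A" "q \<in> ?B \<times> ?C" for x q
  proof -
    have 1: "((\<lambda>y. f x y (snd q)) has_derivative (*) (fy x (fst q) (snd q))) (at (fst q) within ?B)"
      using field_differentiable_derivI[OF d2[OF mem, of x "fst q" "snd q"]] that unfolding fy_def 
      by (auto simp: has_field_derivative_def[symmetric] intro: has_field_derivative_at_within)
    have 2: "((\<lambda>z. f x y z) has_derivative blinfun_apply (blinfun_mult_right (fz x y z))) (at z within ?C)"
      if "y \<in> ?B" "z \<in> ?C" for y z
    proof -
      have "((\<lambda>z. f x y z) has_field_derivative fz x y z) (at z)"
        using field_differentiable_derivI[OF d3[OF mem, of x y z]] that \<open>x \<in> ?A\<close> unfolding fz_def by auto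
      hence "((\<lambda>z. f x y z) has_field_derivative fz x y z) (at z within ?C)"
        by (rule has_field_derivative_at_within)
      thus ?thesis by (simp add: has_field_derivative_def)
    qed
    have "continuous_on (?B \<times> ?C) (\<lambda>q. (\<lambda>(x, y, z). fz x y z) (x, fst q, snd q))"
      by (rule continuous_on_compose2[OF cz]) (use that in \<open>auto intro!: continuous_intros\<close>)
    hence 3: "continuous_on (?B \<times> ?C) (\<lambda>(y, z). blinfun_mult_right (fz x y z))"
      by (auto simp: split_def intro!: bounded_linear.continuous_on[OF bounded_linear_blinfun_mult_right])
    have "((\<lambda>(y, z). f x y z) has_derivative (\<lambda>(h, k). fy x (fst q) (snd q) * h + blinfun_mult_right (fz x (fst q) (snd q)) k)) 
        (at (fst q, snd q) within ?B \<times> ?C)"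
      by (rule has_derivative_partialsI[OF 1 2]) (use that 3 in \<open>auto simp: continuous_on_eq_continuous_within\<close>)
    thus ?thesis by (simp add: Q'app split_def)
  qed
  have "((\<lambda>(x, q). f x (fst q) (snd q)) has_derivative (\<lambda>(h, u). deriv (\<lambda>x. f x y0 z0) x0 * h + blinfun_apply (Q' x0 (y0, z0)) u)) 
        (at (x0, (y0, z0)) within ?A \<times> (?B \<times> ?C))"
  proof (rule has_derivative_partialsI[where fx = "(*) (deriv (\<lambda>x. f x y0 z0) x0)" and fy = Q'])
    have "((\<lambda>x. f x y0 z0) has_field_derivative deriv (\<lambda>x. f x y0 z0) x0) (at x0 within ?A)"
      using d1[of x0 y0 z0] p p0 by (auto simp: field_differentiable_derivI intro: has_field_derivative_at_within)
    thus "((\<lambda>x. f x (fst (y0, z0)) (snd (y0, z0))) has_derivative (*) (deriv (\<lambda>x. f x y0 z0) x0)) (at x0 within ?A)"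
      by (simp add: has_field_derivative_def)
    have "continuous_on (?A \<times> ?B \<times> ?C) (\<lambda>(x, q). Q' x q)"
      using cy cz unfolding Q'_def split_def
      by (auto intro!: continuous_intros bounded_linear.continuous_on[OF bounded_linear_blinfun_mult_right] 
           bounded_bilinear.continuous_on[OF bounded_bilinear_blinfun_compose])
    moreover have "(x0, (y0, z0)) \<in> ?A \<times> ?B \<times> ?C" using r by simp
    ultimately show "continuous (at (x0, (y0, z0)) within ?A \<times> ?B \<times> ?C) (\<lambda>(x, q). Q' x q)"
      by (simp only: continuous_on_eq_continuous_within)
    show "convex (?B \<times> ?C)" by (intro convex_Times) auto
  qed (use inner r in auto)
  moreover have "at (x0, (y0, z0)) within ?A \<times> (?B \<times> ?C) = at (x0, (y0, z0))"
    by (rule at_within_open) (use r in \<open>auto intro!: open_Times\<close>)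
  ultimately have "((\<lambda>(x, y, z). f x y z) has_derivative (\<lambda>(h, k, l). deriv (\<lambda>x. f x y0 z0) x0 * h + fy x0 y0 z0 * k + fz x0 y0 z0 * l)) (at p)"
    unfolding p0 by (simp add: Q'app split_def algebra_simps)
  thus "\<exists>a b c. ((\<lambda>(x, y, z). f x y z) has_derivative (\<lambda>(h, k, l). a * h + b * k + c * l)) (at p)"
    by blast
qed

text \<open>A majorant near each point is enough: a convergent sequence lies in the neighbourhood
  from some index \<open>N\<close> on, and dominated convergence applies to the shifted sequence.
  The measure is left free, so that the counting measure covers series.\<close>

lemma continuous_on_integral_dominated:
  fixes f :: "'p::{first_countable_topology, t2_space} \<Rightarrow> 's \<Rightarrow> complex"
  assumes meas: "\<And>p. p \<in> X \<Longrightarrow> f p \<in> borel_measurable M"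
    and cont: "\<And>s. s \<in> space M \<Longrightarrow> continuous_on X (\<lambda>p. f p s)"
    and dom: "\<And>p. p \<in> X \<Longrightarrow> \<exists>V h. open V \<and> p \<in> V \<and> integrable M h \<and> (\<forall>q\<in>X \<inter> V. \<forall>s\<in>space M. cmod (f q s) \<le> h s)"
  shows "continuous_on X (\<lambda>p. LINT s|M. f p s)"
proof (rule continuous_on_sequentiallyI)
  fix u p assume u: "\<forall>n. u n \<in> X" "p \<in> X" "u \<longlonglongrightarrow> p"
  obtain V h where V: "open V" "p \<in> V" "integrable M h" "\<And>q s. q \<in> X \<inter> V \<Longrightarrow> s \<in> space M \<Longrightarrow> cmod (f q s) \<le> h s"
    using dom[OF u(2)] by metis
  obtain N where N: "\<And>n. n \<ge> N \<Longrightarrow> u n \<in> V"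
    using topological_tendstoD[OF u(3) V(1,2)] by (auto simp: eventually_sequentially)
  have "(\<lambda>n. LINT s|M. f (u (n + N)) s) \<longlonglongrightarrow> (LINT s|M. f p s)"
  proof (rule integral_dominated_convergence)
    show "AE s in M. (\<lambda>n. f (u (n + N)) s) \<longlonglongrightarrow> f p s"
    proof (rule AE_I2)
      fix s assume s: "s \<in> space M"
      have "(\<lambda>n. u (n + N)) \<longlonglongrightarrow> p" using u(3) by (rule LIMSEQ_ignore_initial_segment)
      thus "(\<lambda>n. f (u (n + N)) s) \<longlonglongrightarrow> f p s"
        by (rule continuous_on_tendsto_compose[OF cont[OF s] _ u(2)]) (use u in auto)
    qed
  qed (use V N u meas in auto)
  thus "(\<lambda>n. LINT s|M. f (u n) s) \<longlonglongrightarrow> (LINT s|M. f p s)"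
    by (rule LIMSEQ_offset)
qed

text \<open>The setting for differentiating under the integral sign. Asking for majorants only
  locally makes the notion stable under differentiation, by Cauchy's inequality, and so under
  iteration. Three measures occur: counting measure for the series in \<open>z\<close>, Lebesgue
  measure on the unit interval for Taylor coefficients, and on \<open>{-1..}\<close> for Laplace
  integrals.\<close>

definition dominated_family :: "'s measure \<Rightarrow> complex set \<Rightarrow> (complex \<Rightarrow> 's \<Rightarrow> complex) \<Rightarrow> bool" where
  "dominated_family M U f \<longleftrightarrow> open U \<and> (\<forall>s\<in>space M. (\<lambda>x. f x s) holomorphic_on U) \<and>
     (\<forall>x\<in>U. f x \<in> borel_measurable M) \<and>
     (\<forall>x\<in>U. \<exists>r>0. \<exists>h. integrable M h \<and> (\<forall>y\<in>ball x r \<inter> U. \<forall>s\<in>space M. cmod (f y s) \<le> h s))"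

lemma dominated_family_boundE:
  assumes "dominated_family M U f" "x \<in> U"
  obtains r h where "r > 0" "integrable M h" "\<And>y s. y \<in> ball x r \<inter> U \<Longrightarrow> s \<in> space M \<Longrightarrow> cmod (f y s) \<le> h s"
  using assms unfolding dominated_family_def by meson

lemma dominated_family_integrable:
  assumes "dominated_family M U f" "x \<in> U"
  shows "integrable M (f x)"
proof -
  obtain r h where r: "r > 0" "integrable M h" "\<forall>y\<in>ball x r \<inter> U. \<forall>s\<in>space M. cmod (f y s) \<le> h s"
    using assms unfolding dominated_family_def by blast
  show ?thesis
    by (rule Bochner_Integration.integrable_bound[OF r(2)])
      (use assms r in \<open>auto simp: dominated_family_def intro!: AE_I2 order_trans[OF _ abs_ge_self]\<close>)
qed

lemma dominated_family_mult:
  assumes "dominated_family M U f" "a holomorphic_on U"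
  shows "dominated_family M U (\<lambda>x s. a x * f x s)"
proof -
  have "\<exists>r>0. \<exists>h. integrable M h \<and> (\<forall>y\<in>ball x r \<inter> U. \<forall>s\<in>space M. cmod (a y * f y s) \<le> h s)" if "x \<in> U" for x
  proof -
    obtain r h where r: "r > 0" "integrable M h" "\<And>y s. y \<in> ball x r \<inter> U \<Longrightarrow> s \<in> space M \<Longrightarrow> cmod (f y s) \<le> h s"
      using dominated_family_boundE[OF assms(1) \<open>x \<in> U\<close>] by blast
    have "isCont a x" using continuous_on_eq_continuous_at[of U a] holomorphic_on_imp_continuous_on[OF assms(2)] assms(1) that
      by (auto simp: dominated_family_def)
    then obtain d where d: "d > 0" "\<And>y. dist y x < d \<Longrightarrow> dist (a y) (a x) < 1"
      unfolding continuous_at_eps_delta by (metis zero_less_one)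
    have "cmod (a y * f y s) \<le> (cmod (a x) + 1) * h s" if "y \<in> ball x (min r d) \<inter> U" "s \<in> space M" for y s
    proof -
      have "cmod (a y) \<le> cmod (a x) + 1" using d(2)[of y] that norm_triangle_ineq2[of "a y" "a x"]
        by (auto simp: dist_norm dist_commute norm_minus_commute)
      thus ?thesis unfolding norm_mult using r that by (intro mult_mono) auto
    qed
    moreover have "integrable M (\<lambda>s. (cmod (a x) + 1) * h s)" using r(2) by simp
    moreover have "min r d > 0" using r d by simp
    ultimately show ?thesis by blast
  qed
  thus ?thesis using assms unfolding dominated_family_def by (auto intro!: holomorphic_intros)
qed

text \<open>Cauchy's inequality on small discs turns a majorant of the functions into one of their
  derivatives. By the mean value inequality it also bounds the difference quotients, so dominated
  convergence applies to them; the same limit shows that the derivative is measurable.\<close>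

lemma dominated_family_deriv:
  assumes f: "dominated_family M U f"
  shows "dominated_family M U (\<lambda>x s. deriv (\<lambda>x. f x s) x)" (is ?A)
    and "\<And>x. x \<in> U \<Longrightarrow> ((\<lambda>x. LINT s|M. f x s) has_field_derivative (LINT s|M. deriv (\<lambda>x. f x s) x)) (at x)"
proof -
  have U: "open U" and hol: "\<And>s. s \<in> space M \<Longrightarrow> (\<lambda>x. f x s) holomorphic_on U"
    and meas: "\<And>x. x \<in> U \<Longrightarrow> f x \<in> borel_measurable M"
    using f by (auto simp: dominated_family_def)
  have loc: "\<exists>r>0. \<exists>h. ball x r \<subseteq> U \<and> integrable M h \<and> (\<forall>y\<in>ball x r. \<forall>s\<in>space M. cmod (deriv (\<lambda>x. f x s) y) \<le> h s)"
    if x: "x \<in> U" for x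
  proof -
    obtain r h where r: "r > 0" "integrable M h" "\<And>y s. y \<in> ball x r \<inter> U \<Longrightarrow> s \<in> space M \<Longrightarrow> cmod (f y s) \<le> h s"
      using dominated_family_boundE[OF assms(1) x] by blast
    obtain r' where r': "r' > 0" "ball x r' \<subseteq> U" using U x open_contains_ball by blast
    \<comment> \<open>Discs of radius \<open>q / 2\<close> about points of \<open>ball x q\<close>
      stay within \<open>3 * q / 2 < min r r'\<close> of \<open>x\<close>, hence inside both the
      region of the majorant and \<open>U\<close>.\<close>
    define q where "q = min r r' / 2"
    have q: "q > 0" using r r' by (auto simp: q_def)
    have sub: "cball y (q / 2) \<subseteq> ball x r \<inter> U" if "y \<in> ball x q" for y
    proof
      fix z assume "z \<in> cball y (q / 2)"
      hence "dist x z < min r r'" using that dist_triangle[of x z y] q unfolding q_def by (auto simp: dist_commute)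
      thus "z \<in> ball x r \<inter> U" using r'(2) by auto
    qed
    have "cmod (deriv (\<lambda>x. f x s) y) \<le> h s / (q / 2)" if y: "y \<in> ball x q" and s: "s \<in> space M" for y s
    proof -
      have "cmod ((deriv ^^ 1) (\<lambda>x. f x s) y) \<le> fact 1 * h s / (q / 2) ^ 1"
      proof (rule Cauchy_inequality)
        show "(\<lambda>x. f x s) holomorphic_on ball y (q / 2)" 
          using sub[OF y] by (intro holomorphic_on_subset[OF hol[OF s]]) auto
        show "continuous_on (cball y (q / 2)) (\<lambda>x. f x s)"
          using sub[OF y] by (intro holomorphic_on_imp_continuous_on holomorphic_on_subset[OF hol[OF s]]) auto
        show "cmod (f z s) \<le> h s" if "cmod (y - z) = q / 2" for z
          using sub[OF y] r(3) s that by (auto simp: subset_eq dist_norm)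
      qed (use q in auto)
      thus ?thesis by simp
    qed
    moreover have "ball x q \<subseteq> U" using r' q by (auto simp: q_def)
    ultimately show ?thesis using q r by (intro exI[of _ q] conjI exI[of _ "\<lambda>s. h s / (q / 2)"]) auto
  qed
  have hasd: "((\<lambda>x. f x s) has_field_derivative deriv (\<lambda>x. f x s) x) (at x)" if "x \<in> U" "s \<in> space M" for x s
    using hol[OF that(2)] U that(1) holomorphic_derivI by blast
  have seqlim: "(\<lambda>n. LINT s|M. (f (u n) s - f x s) / (u n - x)) \<longlonglongrightarrow> (LINT s|M. deriv (\<lambda>x. f x s) x)
       \<and> (\<lambda>s. deriv (\<lambda>x. f x s) x) \<in> borel_measurable M"
    if x: "x \<in> U" and u: "\<And>n. u n \<in> U" "\<And>n. u n \<noteq> x" "u \<longlonglongrightarrow> x" for x u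
  proof -
    obtain r h where r: "r > 0" "ball x r \<subseteq> U" "integrable M h" 
        "\<And>y s. y\<in>ball x r \<Longrightarrow> s \<in> space M \<Longrightarrow> cmod (deriv (\<lambda>x. f x s) y) \<le> h s"
      using loc[OF x] by metis
    obtain N where N: "\<And>n. n \<ge> N \<Longrightarrow> u n \<in> ball x r"
      using topological_tendstoD[OF u(3), of "ball x r"] r(1) by (auto simp: eventually_sequentially)
    have lim: "(\<lambda>n. (f (u n) s - f x s) / (u n - x)) \<longlonglongrightarrow> deriv (\<lambda>x. f x s) x" if "s \<in> space M" for s
      using hasd[OF x that, unfolded has_field_derivative_iff tendsto_at_iff_sequentially] u
      by (auto simp: o_def)
    have m: "(\<lambda>s. (f (u n) s - f x s) / (u n - x)) \<in> borel_measurable M" for n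
      using meas[OF u(1)] meas[OF x] by measurable
    have m2: "(\<lambda>s. deriv (\<lambda>x. f x s) x) \<in> borel_measurable M"
      by (rule borel_measurable_LIMSEQ_metric[OF m lim])
    have "(\<lambda>n. LINT s|M. (f (u (n + N)) s - f x s) / (u (n + N) - x)) \<longlonglongrightarrow> (LINT s|M. deriv (\<lambda>x. f x s) x)"
    proof (rule integral_dominated_convergence[OF m2 m r(3)])
      show "AE s in M. (\<lambda>n. (f (u (n + N)) s - f x s) / (u (n + N) - x)) \<longlonglongrightarrow> deriv (\<lambda>x. f x s) x"
        using LIMSEQ_ignore_initial_segment[OF lim] by auto
      show "AE s in M. cmod ((f (u (n + N)) s - f x s) / (u (n + N) - x)) \<le> h s" for n
      proof (rule AE_I2)
        fix s assume s: "s \<in> space M"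
        have "cmod (f (u (n + N)) s - f x s) \<le> h s * cmod (u (n + N) - x)"
          by (rule field_differentiable_bound[of "ball x r" _ "\<lambda>y. deriv (\<lambda>x. f x s) y"])
            (use N r s hasd[OF _ s, THEN has_field_derivative_at_within] in auto)
        thus "cmod ((f (u (n + N)) s - f x s) / (u (n + N) - x)) \<le> h s"
          using u(2)[of "n + N"] by (simp add: norm_divide divide_simps)
      qed
    qed
    hence "(\<lambda>n. LINT s|M. (f (u n) s - f x s) / (u n - x)) \<longlonglongrightarrow> (LINT s|M. deriv (\<lambda>x. f x s) x)"
      by (rule LIMSEQ_offset)
    thus ?thesis using m2 by blast
  qed
  have measd: "(\<lambda>s. deriv (\<lambda>x. f x s) x) \<in> borel_measurable M" if x: "x \<in> U" for x
  proof -
    obtain r where r: "r > 0" "ball x r \<subseteq> U" using U x open_contains_ball by blast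
    \<comment> \<open>\<open>seqlim\<close> yields measurability only along a sequence in
      \<open>U\<close> that tends to \<open>x\<close> and avoids it, so one is exhibited.\<close>
    have "(\<lambda>n. x + of_real (r / 2 / real (Suc n))) \<longlonglongrightarrow> x + of_real 0"
      by (intro tendsto_add tendsto_const tendsto_of_real) (use lim_const_over_n[of "r/2"] LIMSEQ_Suc in blast)
    moreover have "x + of_real (r / 2 / real (Suc n)) \<in> U" for n
    proof (rule subsetD[OF r(2)])
      have "r / 2 / real (Suc n) \<le> r / 2 / 1" using r by (intro divide_left_mono) auto
      hence "r / 2 / real (Suc n) < r" using r by linarith
      thus "x + complex_of_real (r / 2 / real (Suc n)) \<in> ball x r" using r by (simp add: dist_norm norm_divide norm_mult del: of_nat_Suc)
    qed
    moreover have "x + of_real (r / 2 / real (Suc n)) \<noteq> x" for n using r by (simp del: of_nat_Suc)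
    ultimately show ?thesis using seqlim[OF x, of "\<lambda>n. x + of_real (r / 2 / real (Suc n))"]
      unfolding of_real_0 add_0_right by blast
  qed
  show ?A unfolding dominated_family_def
  proof (intro conjI ballI U)
    show "(\<lambda>x. deriv (\<lambda>x. f x s) x) holomorphic_on U" if "s \<in> space M" for s
      using holomorphic_deriv[OF hol[OF that] U] .
    show "\<exists>r>0. \<exists>h. integrable M h \<and> (\<forall>y\<in>ball x r \<inter> U. \<forall>s\<in>space M. cmod (deriv (\<lambda>x. f x s) y) \<le> h s)"
      if "x \<in> U" for x using loc[OF that] by (meson IntD1)
  qed (use measd in auto)
  fix x assume x: "x \<in> U"
  show "((\<lambda>x. LINT s|M. f x s) has_field_derivative (LINT s|M. deriv (\<lambda>x. f x s) x)) (at x)"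
  proof -
    have "((\<lambda>y. ((LINT s|M. f y s) - (LINT s|M. f x s)) / (y - x)) \<longlongrightarrow> (LINT s|M. deriv (\<lambda>x. f x s) x)) (at x within U)"
      unfolding tendsto_at_iff_sequentially
    proof (intro allI impI)
      fix u :: "nat \<Rightarrow> complex" assume u: "\<forall>i. u i \<in> U - {x}" "u \<longlonglongrightarrow> x"
      have "((LINT s|M. f (u n) s) - (LINT s|M. f x s)) / (u n - x) = (LINT s|M. (f (u n) s - f x s) / (u n - x))" for n
        using u x dominated_family_integrable[OF f] by (subst Bochner_Integration.integral_diff[symmetric]) auto
      thus "((\<lambda>y. ((LINT s|M. f y s) - (LINT s|M. f x s)) / (y - x)) \<circ> u) \<longlonglongrightarrow> (LINT s|M. deriv (\<lambda>x. f x s) x)"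
        using seqlim[OF x, of u] u by (auto simp: o_def)
    qed
    thus ?thesis unfolding has_field_derivative_iff using at_within_open[OF x U] by simp
  qed
qed

text \<open>\<open>L\<close> is a first order operator with coefficient \<open>a\<close>, so that
  \<open>deriv\<close> and \<open>t2d\<close> are treated together. Its powers are local: they see
  only the values on a neighbourhood of the point.\<close>

lemma funpow_deriv_mult_cong:
  fixes L :: "(complex \<Rightarrow> complex) \<Rightarrow> complex \<Rightarrow> complex"
  assumes L: "\<And>f x. L f x = a x * deriv f x" and U: "open U" and eq: "\<And>x. x \<in> U \<Longrightarrow> f x = g x" and x: "x \<in> U"
  shows "(L ^^ i) f x = (L ^^ i) g x"
  using x
proof (induction i arbitrary: x)
  case (Suc i)
  have "deriv ((L ^^ i) f) x = deriv ((L ^^ i) g) x"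
    by (rule deriv_cong_ev) (use Suc U in \<open>auto simp: eventually_nhds intro!: exI[of _ U]\<close>)
  thus ?case using L[of "(L ^^ i) f" x] L[of "(L ^^ i) g" x] by simp
qed (simp add: eq)

text \<open>To exchange the next derivative with the integral, the current iterate has to be
  dominated; therefore both claims run in one induction.\<close>

lemma funpow_deriv_integral:
  fixes L :: "(complex \<Rightarrow> complex) \<Rightarrow> complex \<Rightarrow> complex"
  assumes L: "\<And>f x. L f x = a x * deriv f x" and a: "a holomorphic_on U" and f: "dominated_family M U f"
  shows "dominated_family M U (\<lambda>x s. (L ^^ i) (\<lambda>x. f x s) x)"
    and "\<And>x. x \<in> U \<Longrightarrow> (L ^^ i) (\<lambda>x. LINT s|M. f x s) x = (LINT s|M. (L ^^ i) (\<lambda>x. f x s) x)"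
proof (induction i)
  case 0
  { case 1 show ?case using f by simp }
  { case 2 show ?case by simp }
next
  case (Suc i)
  note D = dominated_family_deriv[OF Suc(1)]
  have U: "open U" using f by (simp add: dominated_family_def)
  { case 1 show ?case using dominated_family_mult[OF D(1) a] unfolding funpow.simps comp_apply L[of "(L ^^ i) _"] . }
  { case 2
    have "deriv ((L ^^ i) (\<lambda>x. LINT s|M. f x s)) x = deriv (\<lambda>x. LINT s|M. (L ^^ i) (\<lambda>x. f x s) x) x"
      by (rule deriv_cong_ev) (use Suc(2) 2 U in \<open>auto simp: eventually_nhds intro!: exI[of _ U]\<close>)
    also have "\<dots> = (LINT s|M. deriv ((L ^^ i) (\<lambda>x. f x s)) x)"
      using D(2)[OF 2] by (rule DERIV_imp_deriv)
    finally show ?case using L[of "(L ^^ i) (\<lambda>x. LINT s|M. f x s)" x] L[of "(L ^^ i) (\<lambda>x. f x s)" x for s] by simp }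
qed

section \<open>Coefficients of the Borel transform\<close>

definition rsum :: "real \<Rightarrow> nat \<Rightarrow> real" where
  "rsum b n = (\<Sum>m\<le>n. (real m + 1) powr (- b))"

lemma rsum_ge_1: "rsum b n \<ge> 1"
proof -
  have "(\<Sum>m\<in>{0}. (real m + 1) powr (- b)) \<le> rsum b n"
    unfolding rsum_def by (rule sum_mono2) auto
  thus ?thesis by simp
qed

text \<open>Only the last term of the increment is kept. It does not depend on how far apart the
  indices are, so every shift of the recursion can be paid with the same
  \<open>y powr (- b)\<close>, \<open>y = n + 1\<close>.\<close>

lemma rsum_gap:
  assumes "m < n" shows "rsum b m + (real n + 1) powr (- b) \<le> rsum b n"
proof -
  have "(\<Sum>i\<in>insert n {..m}. (real i + 1) powr (- b)) \<le> rsum b n"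
    unfolding rsum_def by (rule sum_mono2) (use assms in auto)
  thus ?thesis using assms by (simp add: rsum_def)
qed

lemma rsum_le_zeta: assumes "b > 1" shows "rsum b n \<le> zeta_sum b"
proof -
  have "summable (\<lambda>n. real n powr (- b))" using assms by (simp add: summable_real_powr_iff)
  hence "summable (\<lambda>n. real (Suc n) powr (- b))" by (subst summable_Suc_iff)
  thus ?thesis unfolding rsum_def zeta_sum_def
    by (intro sum_le_suminf) (auto simp: add.commute)
qed

lemma zeta_sum_ge_1: assumes "b > 1" shows "zeta_sum b \<ge> 1"
  using rsum_le_zeta[OF assms, of 0] rsum_ge_1[of b 0] by simp

text \<open>The guard \<open>j + k1 < \<beta>\<close> only serves termination: it holds whenever \<open>k1 < S\<close>.\<close>

function borel_coeff :: "complex poly \<Rightarrow> nat \<Rightarrow> (nat \<times> nat \<times> nat) set \<Rightarrow>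
   (nat \<times> nat \<times> nat \<Rightarrow> nat \<Rightarrow> complex \<Rightarrow> complex) \<Rightarrow> (nat \<Rightarrow> complex \<Rightarrow> complex \<Rightarrow> complex) \<Rightarrow>
   nat \<Rightarrow> complex \<Rightarrow> complex \<Rightarrow> complex" where
  "borel_coeff P S A g w \<beta> \<tau> \<epsilon> = (if \<beta> < S then w \<beta> \<tau> \<epsilon> / fact \<beta> else
     fact (\<beta> - S) / fact \<beta> / poly P \<tau> *
     (\<Sum>k\<in>A. (\<tau> / \<epsilon>) ^ fst k * exp (- (of_nat (snd (snd k)) * \<tau>)) *
        (\<Sum>j\<le>\<beta> - S. g k (\<beta> - S - j) \<epsilon> * (fact (j + fst (snd k)) / fact j) *
           (if j + fst (snd k) < \<beta> then borel_coeff P S A g w (j + fst (snd k)) \<tau> \<epsilon> else 0))))"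
  by pat_completeness auto
termination by (relation "Wellfounded.measure (\<lambda>(P, S, A, g, w, \<beta>, \<tau>, \<epsilon>). \<beta>)") auto
declare borel_coeff.simps [simp del]

section \<open>Factorial quotients and growth of the coefficients\<close>

lemma fact_ge_power: "fact n * (real n + 1) ^ m \<le> fact (n + m)"
proof (induction m)
  case (Suc m)
  have "fact n * (real n + 1) ^ Suc m = (fact n * (real n + 1) ^ m) * (real n + 1)" by simp
  also have "\<dots> \<le> fact (n + m) * (real (n + m) + 1)" using Suc by (intro mult_mono) auto
  also have "\<dots> = fact (n + Suc m)" by (simp add: algebra_simps)
  finally show ?case .
qed simp

text \<open>Integrating \<open>S\<close> times and differentiating \<open>k1\<close> times gains
  \<open>S - k1\<close> powers of the index, which pays for the power of
  \<open>y = n + S + 1\<close> that the weights cost. The constant comes from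
  \<open>n + S + 1 \<le> (S + 1) * (n + k1 + 1)\<close>.\<close>

lemma fact_ratio_bound:
  assumes "k1 < S"
  shows "fact (n + k1) * (real (n + S) + 1) ^ (S - k1) \<le> (real S + 1) ^ S * fact (n + S)"
proof -
  have "real (n + S) + 1 \<le> (real S + 1) * (real (n + k1) + 1)"
    by (simp add: algebra_simps)
  hence "(real (n + S) + 1) ^ (S - k1) \<le> ((real S + 1) * (real (n + k1) + 1)) ^ (S - k1)"
    by (intro power_mono) auto
  also have "\<dots> = (real S + 1) ^ (S - k1) * (real (n + k1) + 1) ^ (S - k1)" by (rule power_mult_distrib)
  also have "\<dots> \<le> (real S + 1) ^ S * (real (n + k1) + 1) ^ (S - k1)"
    by (intro mult_right_mono power_increasing) auto
  finally have "fact (n + k1) * (real (n + S) + 1) ^ (S - k1) \<le>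
      fact (n + k1) * ((real S + 1) ^ S * (real (n + k1) + 1) ^ (S - k1))"
    by (intro mult_left_mono) auto
  also have "\<dots> = (real S + 1) ^ S * (fact (n + k1) * (real (n + k1) + 1) ^ (S - k1))" by simp
  also have "\<dots> \<le> (real S + 1) ^ S * fact (n + k1 + (S - k1))"
    by (intro mult_left_mono fact_ge_power) auto
  finally show ?thesis using assms by simp
qed

lemma fact_shift_quotient_mono:
  assumes "j \<le> n" shows "fact (j + k) / fact j \<le> (fact (n + k) / fact n :: real)"
  using assms
proof (induction n rule: dec_induct)
  case (step n)
  have "(fact (n + k) / fact n) * 1 \<le> (fact (n + k) / fact n :: real) * ((real (n + k) + 1) / (real n + 1))"
    by (intro mult_left_mono) auto
  also have "\<dots> = fact (Suc n + k) / fact (Suc n)" by (simp add: algebra_simps)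
  finally show ?case using step by linarith
qed simp

text \<open>Everything is pointwise in \<open>\<tau>\<close> and \<open>\<epsilon>\<close>:
  \<open>L\<close> is the exponent of the weight there, \<open>Kt\<close> the size of the data, and
  \<open>key\<close> trades the coefficients of the equation against the increment of the weight.
  One step of the recursion multiplies the bound by
  \<open>2 * card A * Cg * C1 * (S + 1) ^ S * R / Pm\<close>, which the choice of \<open>R\<close>
  makes at most 1. \<open>Kt\<close> enters linearly and puts no restriction on
  \<open>R\<close>.\<close>

lemma borel_coeff_bound:
  fixes \<tau> \<epsilon> :: complex
  assumes fin: "finite A" and k1: "\<And>k. k \<in> A \<Longrightarrow> fst (snd k) < S"
    and Pm: "Pm > 0" "cmod (poly P \<tau>) \<ge> Pm"
    and g: "\<And>k n. k \<in> A \<Longrightarrow> cmod (g k n \<epsilon>) \<le> Cg * B ^ n" and B: "B > 0" and Cg: "Cg \<ge> 0"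
    and L: "L \<ge> 0" and Kt: "Kt \<ge> 0" and C1: "C1 \<ge> 0"
    and key: "\<And>k y. k \<in> A \<Longrightarrow> y \<ge> 1 \<Longrightarrow> cmod (\<tau> / \<epsilon>) ^ fst k * cmod (exp (- (of_nat (snd (snd k)) * \<tau>))) *
        exp (- (y powr (- b) * L)) \<le> C1 * y ^ (S - fst (snd k))"
    and w: "\<And>j. j < S \<Longrightarrow> cmod (w j \<tau> \<epsilon>) \<le> Kt * exp (rsum b j * L)"
    and R: "0 < R" "R \<le> 1" "R * B \<le> 1 / 2" "2 * real (card A) * Cg * C1 * (real S + 1) ^ S * R \<le> Pm"
  shows "cmod (borel_coeff P S A g w \<beta> \<tau> \<epsilon>) \<le> Kt * exp (rsum b \<beta> * L) / R ^ \<beta>"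
proof (induction \<beta> rule: less_induct)
  case (less \<beta>)
  show ?case
  proof (cases "\<beta> < S")
    case True
    have "cmod (borel_coeff P S A g w \<beta> \<tau> \<epsilon>) = cmod (w \<beta> \<tau> \<epsilon>) / fact \<beta>"
      using True by (simp add: borel_coeff.simps norm_divide)
    also have "\<dots> \<le> cmod (w \<beta> \<tau> \<epsilon>) / 1" by (intro divide_left_mono) auto
    also have "\<dots> \<le> Kt * exp (rsum b \<beta> * L) / 1" using w[OF True] by simp
    also have "\<dots> \<le> Kt * exp (rsum b \<beta> * L) / R ^ \<beta>"
      using R Kt by (intro divide_left_mono) (auto simp: power_le_one)
    finally show ?thesis .
  next
    case False
    define n where "n = \<beta> - S"
    have Pp: "cmod (poly P \<tau>) > 0" using Pm by linarith
    define y where "y = real \<beta> + 1"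
    have \<beta>: "\<beta> = n + S" using False by (simp add: n_def)
    have y: "y \<ge> 1" by (simp add: y_def)
    let ?v = "\<lambda>m. borel_coeff P S A g w m \<tau> \<epsilon>"
    let ?E = "exp (rsum b \<beta> * L)"
    let ?y = "exp (- (y powr (- b) * L))"
    \<comment> \<open>The exponent \<open>rsum b (j + k1)\<close> is replaced by
      \<open>rsum b \<beta>\<close> minus its last term, which produces \<open>?y\<close>; the
      convolution with the Taylor coefficients is a geometric sum of ratio
      \<open>R * B \<le> 1/2\<close>, which produces the 2.\<close>
    have inner: "cmod (\<Sum>j\<le>n. g k (n - j) \<epsilon> * (fact (j + k1) / fact j) * (if j + k1 < \<beta> then ?v (j + k1) else 0))
        \<le> Cg * (fact (n + k1) / fact n) * Kt * ?E * ?y * (2 * R / R ^ \<beta>)"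
      if k: "k \<in> A" and k1: "k1 = fst (snd k)" for k k1
    proof -
      have lt: "k1 < S" using assms(2)[OF k] k1 by simp
      have "cmod (g k (n - j) \<epsilon> * (fact (j + k1) / fact j) * (if j + k1 < \<beta> then ?v (j + k1) else 0))
           \<le> (Cg * (fact (n + k1) / fact n) * Kt * ?E * ?y / R ^ (n + k1)) * (R * B) ^ (n - j)" if j: "j \<le> n" for j
      proof -
        have lt2: "j + k1 < \<beta>" using lt j \<beta> by simp
        have "cmod (?v (j + k1)) \<le> Kt * exp (rsum b (j + k1) * L) / R ^ (j + k1)" using less[OF lt2] .
        also have "exp (rsum b (j + k1) * L) \<le> exp ((rsum b \<beta> - y powr (- b)) * L)"
          using rsum_gap[OF lt2, of b] L by (intro exp_le_cancel_iff[THEN iffD2] mult_right_mono) (auto simp: y_def)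
        also have "\<dots> = ?E * ?y" by (simp add: exp_add[symmetric] algebra_simps)
        finally have v: "cmod (?v (j + k1)) \<le> Kt * (?E * ?y) / R ^ (j + k1)"
          using R Kt by (simp add: divide_right_mono mult_left_mono)
        have "cmod (g k (n - j) \<epsilon> * (fact (j + k1) / fact j) * ?v (j + k1)) \<le>
            (Cg * B ^ (n - j)) * (fact (n + k1) / fact n) * (Kt * (?E * ?y) / R ^ (j + k1))"
          unfolding norm_mult norm_divide norm_fact
          by (intro mult_mono g k v fact_shift_quotient_mono j) (use Cg B Kt R in auto)
        also have "\<dots> = (Cg * (fact (n + k1) / fact n) * Kt * ?E * ?y / R ^ (n + k1)) * (R * B) ^ (n - j)"
        proof -
          have "R ^ (n + k1) = R ^ (j + k1) * R ^ (n - j)" using j by (simp add: add.commute flip: power_add)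
          thus ?thesis using R by (simp add: power_mult_distrib field_simps)
        qed
        finally show ?thesis using lt2 by simp
      qed
      hence "cmod (\<Sum>j\<le>n. g k (n - j) \<epsilon> * (fact (j + k1) / fact j) * (if j + k1 < \<beta> then ?v (j + k1) else 0))
        \<le> (\<Sum>j\<le>n. (Cg * (fact (n + k1) / fact n) * Kt * ?E * ?y / R ^ (n + k1)) * (R * B) ^ (n - j))"
        by (intro order_trans[OF norm_sum] sum_mono) auto
      also have "\<dots> = (Cg * (fact (n + k1) / fact n) * Kt * ?E * ?y / R ^ (n + k1)) * (\<Sum>j\<le>n. (R * B) ^ (n - j))"
        by (simp add: sum_distrib_left)
      also have "(\<Sum>j\<le>n. (R * B) ^ (n - j)) = (\<Sum>j\<le>n. (R * B) ^ j)"
        by (rule sum.reindex_bij_witness[of _ "\<lambda>j. n - j" "\<lambda>j. n - j"]) auto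
      also have "(Cg * (fact (n + k1) / fact n) * Kt * ?E * ?y / R ^ (n + k1)) * (\<Sum>j\<le>n. (R * B) ^ j)
         \<le> (Cg * (fact (n + k1) / fact n) * Kt * ?E * ?y / R ^ (n + k1)) * 2"
      proof (rule mult_left_mono)
        have "(\<Sum>j\<le>n. (R * B) ^ j) \<le> (\<Sum>j\<le>n. (1 / 2) ^ j)"
          using R B by (intro sum_mono power_mono) auto
        also have "(\<Sum>j\<le>n. (1 / 2 :: real) ^ j) = 2 - (1 / 2) ^ n" by (induction n) auto
        also have "\<dots> \<le> 2" by simp
        finally show "(\<Sum>j\<le>n. (R * B) ^ j) \<le> 2" .
      qed (use R Kt Cg in auto)
      finally have *: "cmod (\<Sum>j\<le>n. g k (n - j) \<epsilon> * (fact (j + k1) / fact j) * (if j + k1 < \<beta> then ?v (j + k1) else 0))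
        \<le> (Cg * (fact (n + k1) / fact n) * Kt * ?E * ?y / R ^ (n + k1)) * 2" .
      \<comment> \<open>Because \<open>k1 < S\<close>, at least one factor \<open>R\<close> is left
        over; this is the smallness that closes the induction.\<close>
      have "R ^ \<beta> \<le> R ^ Suc (n + k1)" using R lt \<beta> by (intro power_decreasing) auto
      hence "1 / R ^ (n + k1) \<le> R / R ^ \<beta>" using R by (simp add: field_simps)
      hence "(Cg * (fact (n + k1) / fact n) * Kt * ?E * ?y * 2) * (1 / R ^ (n + k1)) \<le>
             (Cg * (fact (n + k1) / fact n) * Kt * ?E * ?y * 2) * (R / R ^ \<beta>)"
        using Cg Kt by (intro mult_left_mono) auto
      thus ?thesis using * by (simp add: mult_ac)
    qed
    have "cmod (?v \<beta>) = fact n / fact \<beta> / cmod (poly P \<tau>) *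
       cmod (\<Sum>k\<in>A. (\<tau> / \<epsilon>) ^ fst k * exp (- (of_nat (snd (snd k)) * \<tau>)) *
        (\<Sum>j\<le>n. g k (n - j) \<epsilon> * (fact (j + fst (snd k)) / fact j) *
           (if j + fst (snd k) < \<beta> then ?v (j + fst (snd k)) else 0)))"
      using False by (subst borel_coeff.simps) (simp add: n_def norm_mult norm_divide)
    also have "\<dots> \<le> fact n / fact \<beta> / Pm *
       (\<Sum>k\<in>A. Cg * C1 * (real S + 1) ^ S * (fact \<beta> / fact n) * Kt * ?E * (2 * R / R ^ \<beta>))"
    proof (intro mult_mono order_trans[OF norm_sum] sum_mono divide_left_mono)
      fix k assume k: "k \<in> A"
      define k1 where "k1 = fst (snd k)"
      have lt: "k1 < S" using assms(2)[OF k] k1_def by simp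
      let ?a = "cmod (\<tau> / \<epsilon>) ^ fst k * cmod (exp (- (of_nat (snd (snd k)) * \<tau>)))"
      have "cmod ((\<tau> / \<epsilon>) ^ fst k * exp (- (of_nat (snd (snd k)) * \<tau>)) *
        (\<Sum>j\<le>n. g k (n - j) \<epsilon> * (fact (j + k1) / fact j) * (if j + k1 < \<beta> then ?v (j + k1) else 0)))
         \<le> ?a * (Cg * (fact (n + k1) / fact n) * Kt * ?E * ?y * (2 * R / R ^ \<beta>))"
        unfolding norm_mult norm_power by (intro mult_left_mono inner k k1_def) auto
      also have "\<dots> = (?a * ?y) * (Cg * (fact (n + k1) / fact n) * Kt * ?E * (2 * R / R ^ \<beta>))" by simp
      \<comment> \<open>Here \<open>?y\<close> is spent on the factors with \<open>\<tau>\<close>.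
        What remains is a power of \<open>y\<close>, to be cancelled by the factorials.\<close>
      also have "\<dots> \<le> (C1 * y ^ (S - k1)) * (Cg * (fact (n + k1) / fact n) * Kt * ?E * (2 * R / R ^ \<beta>))"
        using key[OF k y] R Cg Kt unfolding k1_def by (intro mult_right_mono) auto
      also have "\<dots> = (C1 * Cg * Kt * ?E * (2 * R / R ^ \<beta>) / fact n) * (fact (n + k1) * y ^ (S - k1))" by (simp add: mult_ac)
      also have "\<dots> \<le> (C1 * Cg * Kt * ?E * (2 * R / R ^ \<beta>) / fact n) * ((real S + 1) ^ S * fact \<beta>)"
        using fact_ratio_bound[OF lt, of n] C1 Cg Kt R unfolding y_def \<beta> by (intro mult_left_mono) auto
      also have "\<dots> = Cg * C1 * (real S + 1) ^ S * (fact \<beta> / fact n) * Kt * ?E * (2 * R / R ^ \<beta>)"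
        by (simp add: mult_ac)
      finally show "cmod ((\<tau> / \<epsilon>) ^ fst k * exp (- (of_nat (snd (snd k)) * \<tau>)) *
        (\<Sum>j\<le>n. g k (n - j) \<epsilon> * (fact (j + fst (snd k)) / fact j) * (if j + fst (snd k) < \<beta> then ?v (j + fst (snd k)) else 0)))
         \<le> Cg * C1 * (real S + 1) ^ S * (fact \<beta> / fact n) * Kt * ?E * (2 * R / R ^ \<beta>)"
        unfolding k1_def .
    qed (use Pm Pp in \<open>auto intro!: mult_pos_pos\<close>)
    also have "\<dots> = (2 * real (card A) * Cg * C1 * (real S + 1) ^ S * R) / Pm * (Kt * ?E / R ^ \<beta>)"
      using Pm R by (simp add: field_simps)
    also have "\<dots> \<le> 1 * (Kt * ?E / R ^ \<beta>)"
      using R Pm Kt by (intro mult_right_mono) (auto simp: field_simps)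
    finally show ?thesis by simp
  qed
qed

section \<open>Powers and exponentials absorbed by the weights\<close>

lemma powr_exp_bound:
  assumes "a \<ge> 0" shows "\<exists>C>0. \<forall>u\<ge>0. u powr a * exp (- u) \<le> (C :: real)"
proof -
  define n where "n = Suc (nat \<lceil>a\<rceil>)"
  have n: "real n \<ge> a" "n > 0" unfolding n_def using assms by linarith+
  have "u powr a * exp (- u) \<le> 1 + real n ^ n" if u: "u \<ge> 0" for u
  proof (cases "u \<le> 1")
    case True
    have "u powr a * exp (- u) \<le> 1 * 1" using True u assms by (intro mult_mono) (auto simp: powr_le1)
    thus ?thesis by (simp add: add_increasing2)
  next
    case False
    have "u powr a \<le> u powr real n" using False n by (intro powr_mono) auto
    also have "\<dots> = real n ^ n * (u / real n) ^ n" using False n by (simp add: powr_realpow power_divide)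
    also have "\<dots> \<le> real n ^ n * (1 + u / real n) ^ n" using u by (intro mult_left_mono power_mono) auto
    also have "\<dots> \<le> real n ^ n * exp u"
      using exp_ge_one_plus_x_over_n_power_n[of n u] u n by (intro mult_left_mono) auto
    finally have "u powr a * exp (- u) \<le> (real n ^ n * exp u) * exp (- u)" by (intro mult_right_mono) auto
    thus ?thesis by (simp add: mult.assoc flip: exp_add)
  qed
  moreover have "1 + real n ^ n > 0" by (simp add: add_pos_nonneg)
  ultimately show ?thesis by blast
qed

lemma finite_uniform_bound:
  assumes "finite A" and "\<And>k. k \<in> A \<Longrightarrow> \<exists>C::real. Q k C"
    and mono: "\<And>k C C'. k \<in> A \<Longrightarrow> Q k C \<Longrightarrow> C \<le> C' \<Longrightarrow> Q k C'"
  shows "\<exists>C>0. \<forall>k\<in>A. Q k C"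
  using assms
proof (induction A rule: finite_induct)
  case empty
  show ?case by (auto intro: exI[of _ 1])
next
  case (insert k A)
  have "\<exists>C>0. \<forall>k\<in>A. Q k C"
    by (rule insert.IH) (use insert.prems in blast)+
  then obtain C where C: "C > 0" "\<forall>k\<in>A. Q k C" by blast
  obtain C' where C': "Q k C'" using insert.prems(1)[of k] by blast
  have "Q k (max C C')" using insert.prems(2)[of k C' "max C C'"] C' by simp
  moreover have "Q j (max C C')" if "j \<in> A" for j using insert.prems(2)[of j C "max C C'"] C that by simp
  moreover have "max C C' > 0" using C by (simp add: less_max_iff_disj)
  ultimately show ?case by (intro exI[of _ "max C C'"]) simp
qed

text \<open>The shift of the index by at least one in the weights compensates for the factors
  \<open>(\<tau>/\<epsilon>)\<^bsup>k0\<^esup>\<close> and \<open>exp(- k2 \<tau>)\<close>, at the price of a power of the index that the factorials absorb.\<close>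

lemma weight_shift_bound:
  fixes G :: "complex \<Rightarrow> real"
  assumes fin: "finite A" and b: "b > 1" and \<xi>: "\<xi> > 0" and \<sigma>: "\<sigma>1 > 0"
    and A: "\<And>k0 k1 k2. (k0, k1, k2) \<in> A \<Longrightarrow> real S \<ge> real k1 + b * real k0 + b * real k2 / \<xi> \<and> S > k1"
    and G: "\<And>k2. \<exists>C. \<forall>\<tau>\<in>X. \<forall>y\<ge>1. cmod (exp (- (of_nat k2 * \<tau>))) * exp (- (y powr (- b) * G \<tau>)) \<le> C * y powr (b * real k2 / \<xi>)"
  shows "\<exists>C>0. \<forall>k\<in>A. \<forall>\<tau>\<in>X. \<forall>\<epsilon>. \<epsilon> \<noteq> 0 \<longrightarrow> (\<forall>y\<ge>1. 
     cmod (\<tau> / \<epsilon>) ^ fst k * cmod (exp (- (of_nat (snd (snd k)) * \<tau>))) *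
        exp (- (y powr (- b) * (\<sigma>1 * cmod \<tau> / cmod \<epsilon> + G \<tau>))) \<le> C * y ^ (S - fst (snd k)))"
proof (rule finite_uniform_bound[OF fin])
  fix k assume k: "k \<in> A"
  obtain k0 k1 k2 where kk: "k = (k0, k1, k2)" by (cases k) auto
  have S: "real S \<ge> real k1 + b * real k0 + b * real k2 / \<xi>" "S > k1" using A k kk by auto
  obtain C where C: "\<And>\<tau> y. \<tau> \<in> X \<Longrightarrow> y \<ge> 1 \<Longrightarrow> cmod (exp (- (of_nat k2 * \<tau>))) * exp (- (y powr (- b) * G \<tau>)) \<le> C * y powr (b * real k2 / \<xi>)"
    using G by blast
  obtain D where D: "D > 0" "\<And>u. u \<ge> 0 \<Longrightarrow> u powr real k0 * exp (- u) \<le> D" using powr_exp_bound[of "real k0"] by auto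
  \<comment> \<open>The maximum with 1 covers \<open>u = 0\<close> and \<open>k0 = 0\<close>, where
    \<open>u ^ k0\<close> is 1 but \<open>u powr 0\<close> is 0.\<close>
  define D' where "D' = max 1 D"
  have D': "u ^ k0 * exp (- u) \<le> D'" if "u \<ge> 0" for u
    using D(2)[OF that] that by (cases "u = 0"; cases "k0 = 0") (auto simp: powr_realpow D'_def zero_power)
  define C' where "C' = max C 0"
  have C': "C' \<ge> 0" "C \<le> C'" by (auto simp: C'_def)
  have "cmod (\<tau> / \<epsilon>) ^ k0 * cmod (exp (- (of_nat k2 * \<tau>))) * exp (- (y powr (- b) * (\<sigma>1 * cmod \<tau> / cmod \<epsilon> + G \<tau>))) 
       \<le> D' / \<sigma>1 ^ k0 * C' * y ^ (S - k1)" if t: "\<tau> \<in> X" "\<epsilon> \<noteq> 0" "y \<ge> 1" for \<tau> \<epsilon> y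
  proof -
    define x where "x = cmod (\<tau> / \<epsilon>)"
    \<comment> \<open>\<open>u\<close> is the share of the exponent that belongs to
      \<open>\<sigma>1\<close>. Since \<open>x = u * y powr b / \<sigma>1\<close>, the power
      \<open>x ^ k0\<close> costs \<open>y powr (b * k0)\<close>; the other factor costs
      \<open>y powr (b * k2 / \<xi>)\<close>, and by the hypothesis on \<open>A\<close> the two
      exponents add up to at most \<open>S - k1\<close>.\<close>
    define u where "u = y powr (- b) * (\<sigma>1 * x)"
    have u: "u \<ge> 0" using \<sigma> by (simp add: u_def x_def)
    have "x = u * (y powr b / \<sigma>1)" using \<sigma> t by (simp add: u_def powr_minus field_simps)
    hence "x ^ k0 = u ^ k0 * (y powr b / \<sigma>1) ^ k0" by (simp only: power_mult_distrib)
    hence "x ^ k0 * exp (- u) = (u ^ k0 * exp (- u)) * (y powr b / \<sigma>1) ^ k0" by (simp only: mult_ac)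
    also have "\<dots> \<le> D' * (y powr b / \<sigma>1) ^ k0" using D'[OF u] \<sigma> by (intro mult_right_mono) auto
    also have "(y powr b / \<sigma>1) ^ k0 = y powr (b * real k0) / \<sigma>1 ^ k0" 
      using t by (simp add: power_divide powr_powr flip: powr_realpow)
    finally have 1: "x ^ k0 * exp (- u) \<le> D' * (y powr (b * real k0) / \<sigma>1 ^ k0)" .
    have "C * y powr (b * real k2 / \<xi>) \<le> C' * y powr (b * real k2 / \<xi>)" using C' by (intro mult_right_mono) auto
    hence 2: "cmod (exp (- (of_nat k2 * \<tau>))) * exp (- (y powr (- b) * G \<tau>)) \<le> C' * y powr (b * real k2 / \<xi>)"
      using C[OF t(1,3)] by linarith
    have "cmod (\<tau> / \<epsilon>) ^ k0 * cmod (exp (- (of_nat k2 * \<tau>))) * exp (- (y powr (- b) * (\<sigma>1 * cmod \<tau> / cmod \<epsilon> + G \<tau>))) 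
      = (x ^ k0 * exp (- u)) * (cmod (exp (- (of_nat k2 * \<tau>))) * exp (- (y powr (- b) * G \<tau>)))"
      by (simp add: x_def u_def norm_divide algebra_simps flip: exp_add)
    also have "\<dots> \<le> (D' * (y powr (b * real k0) / \<sigma>1 ^ k0)) * (C' * y powr (b * real k2 / \<xi>))"
      by (intro mult_mono 1 2) (use \<sigma> in \<open>auto simp: D'_def\<close>)
    also have "\<dots> = D' / \<sigma>1 ^ k0 * C' * y powr (b * real k0 + b * real k2 / \<xi>)" by (simp add: powr_add mult_ac)
    also have "\<dots> \<le> D' / \<sigma>1 ^ k0 * C' * y powr (real (S - k1))"
      using S t C' \<sigma> by (intro mult_left_mono powr_mono) (auto simp: D'_def of_nat_diff)
    also have "y powr (real (S - k1)) = y ^ (S - k1)" using t by (simp add: powr_realpow)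
    finally show ?thesis .
  qed
  thus "\<exists>C. \<forall>\<tau>\<in>X. \<forall>\<epsilon>. \<epsilon> \<noteq> 0 \<longrightarrow> (\<forall>y\<ge>1. 
     cmod (\<tau> / \<epsilon>) ^ fst k * cmod (exp (- (of_nat (snd (snd k)) * \<tau>))) *
        exp (- (y powr (- b) * (\<sigma>1 * cmod \<tau> / cmod \<epsilon> + G \<tau>))) \<le> C * y ^ (S - fst (snd k)))"
    unfolding kk fst_conv snd_conv by blast
next
  fix k :: "nat \<times> nat \<times> nat" and C C' :: real
  assume *: "\<forall>\<tau>\<in>X. \<forall>\<epsilon>. \<epsilon> \<noteq> 0 \<longrightarrow> (\<forall>y\<ge>1. 
     cmod (\<tau> / \<epsilon>) ^ fst k * cmod (exp (- (of_nat (snd (snd k)) * \<tau>))) *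
        exp (- (y powr (- b) * (\<sigma>1 * cmod \<tau> / cmod \<epsilon> + G \<tau>))) \<le> C * y ^ (S - fst (snd k)))" and "C \<le> C'"
  have "C * y ^ (S - fst (snd k)) \<le> C' * y ^ (S - fst (snd k))" if "y \<ge> 1" for y :: real
    using that \<open>C \<le> C'\<close> by (intro mult_right_mono) auto
  thus "\<forall>\<tau>\<in>X. \<forall>\<epsilon>. \<epsilon> \<noteq> 0 \<longrightarrow> (\<forall>y\<ge>1. 
     cmod (\<tau> / \<epsilon>) ^ fst k * cmod (exp (- (of_nat (snd (snd k)) * \<tau>))) *
        exp (- (y powr (- b) * (\<sigma>1 * cmod \<tau> / cmod \<epsilon> + G \<tau>))) \<le> C' * y ^ (S - fst (snd k)))"
    using * by (meson order_trans)
qed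

text \<open>The modulus of \<open>exp(- k2 \<tau>)\<close> is at most
  \<open>exp(s3 |\<tau>|)\<close> to the power \<open>k2 / s3\<close>, and
  \<open>exp(s3 |\<tau>|)\<close> is \<open>y powr b / s\<close> times the exponent \<open>u\<close>
  of the weight, whose powers are controlled by \<open>exp(- u)\<close>. The price is
  \<open>y powr (b * k2 / s3)\<close>, and \<open>\<xi> \<le> s3\<close> allows \<open>\<xi>\<close>
  in place of \<open>s3\<close>.\<close>

lemma superexp_weight_bound:
  assumes b: "b > 1" and \<xi>: "\<xi> > 0" "\<xi> \<le> s3" and s: "s > 0"
  shows "\<exists>C. \<forall>\<tau>\<in>X. \<forall>y\<ge>1. cmod (exp (- (of_nat k2 * \<tau>))) * exp (- (y powr (- b) * (s * exp (s3 * cmod \<tau>)))) 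
       \<le> C * y powr (b * real k2 / \<xi>)"
proof -
  define a where "a = real k2 / s3"
  have a: "a \<ge> 0" using \<xi> by (simp add: a_def)
  obtain D where D: "D > 0" "\<And>u. u \<ge> 0 \<Longrightarrow> u powr a * exp (- u) \<le> D" using powr_exp_bound[OF a] by auto
  have "cmod (exp (- (of_nat k2 * \<tau>))) * exp (- (y powr (- b) * (s * exp (s3 * cmod \<tau>)))) \<le> (D / s powr a) * y powr (b * real k2 / \<xi>)"
    if y: "y \<ge> 1" for \<tau> y
  proof -
    define u where "u = y powr (- b) * (s * exp (s3 * cmod \<tau>))"
    have u: "u > 0" using s y by (simp add: u_def)
    have "- (real k2 * Re \<tau>) \<le> real k2 * cmod \<tau>"
      using abs_Re_le_cmod[of \<tau>] mult_left_mono[of "- Re \<tau>" "cmod \<tau>" "real k2"] by auto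
    hence "cmod (exp (- (of_nat k2 * \<tau>))) \<le> exp (real k2 * cmod \<tau>)" by simp
    also have "\<dots> = exp (s3 * cmod \<tau>) powr a" using \<xi> by (simp add: powr_def a_def)
    also have "exp (s3 * cmod \<tau>) = u * (y powr b / s)" using s y by (simp add: u_def powr_minus field_simps)
    also have "(u * (y powr b / s)) powr a = u powr a * (y powr (b * a) / s powr a)"
      using u y s by (simp add: powr_mult powr_divide powr_powr)
    finally have "cmod (exp (- (of_nat k2 * \<tau>))) * exp (- u) \<le> u powr a * (y powr (b * a) / s powr a) * exp (- u)"
      by (intro mult_right_mono) auto
    also have "\<dots> = (u powr a * exp (- u)) * (y powr (b * a) / s powr a)" by simp
    also have "\<dots> \<le> D * (y powr (b * a) / s powr a)" using D(2)[of u] u s by (intro mult_right_mono) auto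
    also have "\<dots> \<le> D * (y powr (b * real k2 / \<xi>) / s powr a)"
      using D y s b \<xi> by (intro mult_left_mono divide_right_mono powr_mono) (auto simp: a_def intro!: divide_left_mono)
    finally show ?thesis by (simp add: u_def)
  qed
  thus ?thesis by blast
qed

text \<open>A nonconstant polynomial tends to infinity, so only a compact part of \<open>X\<close>
  matters, and there the minimum of the modulus is attained.\<close>

lemma poly_bounded_below:
  fixes P :: "complex poly"
  assumes P: "P \<noteq> 0" and X: "closed X" "\<And>x. x \<in> X \<Longrightarrow> poly P x \<noteq> 0"
  shows "\<exists>m>0. \<forall>x\<in>X. cmod (poly P x) \<ge> m"
proof (cases "degree P = 0")
  case True
  then obtain a where "P = [:a:]" using degree_eq_zeroE by blast
  thus ?thesis using P by (intro exI[of _ "cmod a"]) auto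
next
  case False
  have "filterlim (poly P) at_infinity at_infinity" using False by (intro filterlim_poly_at_infinity) auto
  hence "eventually (\<lambda>x. cmod (poly P x) \<ge> 1) at_infinity"
    unfolding filterlim_at_infinity[OF order_refl] by auto
  then obtain B where B: "\<And>x. cmod x \<ge> B \<Longrightarrow> cmod (poly P x) \<ge> 1" unfolding eventually_at_infinity by auto
  show ?thesis
  proof (cases "X \<inter> cball 0 B = {}")
    case True
    have "cmod (poly P x) \<ge> 1" if "x \<in> X" for x
      using True that by (intro B) (auto simp: disjoint_iff)
    thus ?thesis by (intro exI[of _ 1]) auto
  next
    case False
    have "compact (X \<inter> cball 0 B)" using X by (simp add: closed_Int_compact)
    hence "\<exists>x\<in>X \<inter> cball 0 B. \<forall>y\<in>X \<inter> cball 0 B. cmod (poly P x) \<le> cmod (poly P y)"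
      using False by (intro continuous_attains_inf continuous_intros)
    then obtain x0 where x0: "x0 \<in> X \<inter> cball 0 B" "\<And>x. x \<in> X \<inter> cball 0 B \<Longrightarrow> cmod (poly P x0) \<le> cmod (poly P x)"
      by blast
    have "cmod (poly P x) \<ge> min 1 (cmod (poly P x0))" if "x \<in> X" for x
      using x0(2)[of x] B[of x] that by (cases "cmod x \<ge> B") auto
    moreover have "min 1 (cmod (poly P x0)) > 0" using x0 X by auto
    ultimately show ?thesis by blast
  qed
qed

section \<open>Regularity of the Taylor coefficients and of the Borel coefficients\<close>

lemma holomorphic2_onD:
  assumes "holomorphic2_on f X"
  shows "open X" "continuous_on X (\<lambda>(x, y). f x y)"
    and "\<And>x y. (x, y) \<in> X \<Longrightarrow> (\<lambda>x. f x y) field_differentiable at x"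
    and "\<And>x y. (x, y) \<in> X \<Longrightarrow> (\<lambda>y. f x y) field_differentiable at y"
proof -
  show "open X" using assms by (simp add: holomorphic2_on_def)
  have d: "\<exists>a b. ((\<lambda>(x, y). f x y) has_derivative (\<lambda>(h, k). a * h + b * k)) (at p)" if "p \<in> X" for p
    using assms that unfolding holomorphic2_on_def by blast
  show "continuous_on X (\<lambda>(x, y). f x y)"
    using d by (meson continuous_at_imp_continuous_on has_derivative_continuous)
  fix x y assume "(x, y) \<in> X"
  then obtain a b where ab: "((\<lambda>(x, y). f x y) has_derivative (\<lambda>(h, k). a * h + b * k)) (at (x, y))" using d by blast
  have "((\<lambda>x. (x, y)) has_derivative (\<lambda>h. (h, 0))) (at x)" by (auto intro!: derivative_eq_intros)
  from has_derivative_compose[OF this ab]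
  have "((\<lambda>x. f x y) has_field_derivative a) (at x)" by (simp add: has_field_derivative_def)
  thus "(\<lambda>x. f x y) field_differentiable at x" by (auto simp: field_differentiable_def)
  have "((\<lambda>y. (x, y)) has_derivative (\<lambda>h. (0, h))) (at y)" by (auto intro!: derivative_eq_intros)
  from has_derivative_compose[OF this ab]
  have "((\<lambda>y. f x y) has_field_derivative b) (at y)" by (simp add: has_field_derivative_def)
  thus "(\<lambda>y. f x y) field_differentiable at y" by (auto simp: field_differentiable_def)
qed

lemma holomorphic2_on_section1:
  assumes "holomorphic2_on f (U \<times> V)" "y \<in> V" shows "(\<lambda>x. f x y) holomorphic_on U"
  using holomorphic2_onD(3)[OF assms(1)] assms(2)
  by (auto simp: holomorphic_on_def intro: field_differentiable_at_within)

lemma holomorphic2_on_section2: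
  assumes "holomorphic2_on f (U \<times> V)" "x \<in> U" shows "(\<lambda>y. f x y) holomorphic_on V"
  using holomorphic2_onD(4)[OF assms(1)] assms(2)
  by (auto simp: holomorphic_on_def intro: field_differentiable_at_within)

definition taylor_coeff :: "('k \<Rightarrow> complex \<Rightarrow> complex \<Rightarrow> complex) \<Rightarrow> 'k \<Rightarrow> nat \<Rightarrow> complex \<Rightarrow> complex" where
  "taylor_coeff c k n \<epsilon> = (deriv ^^ n) (\<lambda>z. c k z \<epsilon>) 0 / fact n"

lemma taylor_coeff_bound:
  assumes h: "holomorphic2_on (c k) (ball 0 \<rho> \<times> E)" and \<rho>: "\<rho> > 0" and \<epsilon>: "\<epsilon> \<in> E"
    and C: "\<And>z. z \<in> ball 0 \<rho> \<Longrightarrow> cmod (c k z \<epsilon>) \<le> C"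
  shows "cmod (taylor_coeff c k n \<epsilon>) \<le> C * (2 / \<rho>) ^ n"
proof -
  have hz: "(\<lambda>z. c k z \<epsilon>) holomorphic_on ball 0 \<rho>" using holomorphic2_on_section1[OF h \<epsilon>] .
  have "cmod ((deriv ^^ n) (\<lambda>z. c k z \<epsilon>) 0) \<le> fact n * C / (\<rho> / 2) ^ n"
  proof (rule Cauchy_inequality)
    show "(\<lambda>z. c k z \<epsilon>) holomorphic_on ball 0 (\<rho> / 2)" by (rule holomorphic_on_subset[OF hz]) (use \<rho> in auto)
    show "continuous_on (cball 0 (\<rho> / 2)) (\<lambda>z. c k z \<epsilon>)"
      by (intro holomorphic_on_imp_continuous_on holomorphic_on_subset[OF hz]) (use \<rho> in auto)
    show "cmod (c k x \<epsilon>) \<le> C" if "cmod (0 - x) = \<rho> / 2" for x using that \<rho> by (intro C) auto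
  qed (use \<rho> in auto)
  thus ?thesis using \<rho> by (simp add: taylor_coeff_def norm_divide norm_power power_divide field_simps)
qed

text \<open>In \<epsilon> the coefficient is a Cauchy integral over one fixed circle, with an
  integrand holomorphic in \<epsilon> and bounded by a constant.\<close>

lemma taylor_coeff_holomorphic:
  assumes h: "holomorphic2_on (c k) (ball 0 \<rho> \<times> E)" and \<rho>: "\<rho> > 0" and E: "open E"
    and C: "\<And>z \<epsilon>. z \<in> ball 0 \<rho> \<Longrightarrow> \<epsilon> \<in> E \<Longrightarrow> cmod (c k z \<epsilon>) \<le> C"
  shows "taylor_coeff c k n holomorphic_on E"
proof -
  let ?g = "circlepath 0 (\<rho> / 2)"
  have gin: "?g t \<in> ball 0 \<rho>" for t using \<rho> by (simp add: circlepath norm_mult)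
  have gn: "cmod (?g t) = \<rho> / 2" for t using \<rho> by (simp add: circlepath norm_mult)
  have contg: "continuous_on X ?g" for X unfolding circlepath by (intro continuous_intros)
  define F where "F = (\<lambda>\<epsilon> t. c k (?g t) \<epsilon> / ?g t ^ Suc n * (2 * pi * \<i> * (\<rho> / 2) * exp (2 * of_real pi * \<i> * t)) / (2 * pi * \<i>))"
  have D: "dominated_family (lebesgue_on {0..1::real}) E F"
    unfolding dominated_family_def
  proof (intro conjI ballI E)
    show "(\<lambda>\<epsilon>. F \<epsilon> t) holomorphic_on E" for t
      unfolding F_def by (intro holomorphic_intros holomorphic2_on_section2[OF h gin]) (use gn[of t] \<rho> in auto)
    fix \<epsilon> assume \<epsilon>: "\<epsilon> \<in> E"
    have gne: "?g t \<noteq> 0" for t using gn[of t] \<rho> by force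
    have "continuous_on {0..1} (\<lambda>t. c k (?g t) \<epsilon>)"
      by (rule continuous_on_compose2[OF holomorphic_on_imp_continuous_on[OF holomorphic2_on_section1[OF h \<epsilon>]] contg])
         (use gin in auto)
    hence "continuous_on {0..1} (F \<epsilon>)" unfolding F_def
      by (intro continuous_intros contg) (use gne in auto)
    thus "F \<epsilon> \<in> borel_measurable (lebesgue_on {0..1})"
      by (rule continuous_imp_measurable_on_sets_lebesgue) auto
    show "\<exists>r>0. \<exists>h. integrable (lebesgue_on {0..1}) h \<and> (\<forall>y\<in>ball \<epsilon> r \<inter> E. \<forall>s\<in>space (lebesgue_on {0..1}). cmod (F y s) \<le> h s)"
    proof (intro exI[of _ 1] exI[of _ "\<lambda>_. C / (\<rho> / 2) ^ Suc n * (\<rho> / 2)"] conjI ballI)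
      show "cmod (F y s) \<le> C / (\<rho> / 2) ^ Suc n * (\<rho> / 2)" if "y \<in> ball \<epsilon> 1 \<inter> E" for y s
      proof -
        have "cmod (F y s) = cmod (c k (?g s) y) / (\<rho> / 2) ^ Suc n * (\<rho> / 2)"
          using \<rho> by (simp add: F_def norm_mult norm_divide norm_power gn[unfolded] del: power_Suc)
        also have "\<dots> \<le> C / (\<rho> / 2) ^ Suc n * (\<rho> / 2)"
          using C[OF gin] that \<rho> by (intro mult_right_mono divide_right_mono) auto
        finally show ?thesis .
      qed
    qed (auto simp: integrable_on_const)
  qed
  have "taylor_coeff c k n \<epsilon> = (LINT t|lebesgue_on {0..1}. F \<epsilon> t)" if \<epsilon>: "\<epsilon> \<in> E" for \<epsilon>
  proof -
    have hz: "(\<lambda>z. c k z \<epsilon>) holomorphic_on ball 0 \<rho>" using holomorphic2_on_section1[OF h \<epsilon>] .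
    have "((\<lambda>u. c k u \<epsilon> / (u - 0) ^ Suc n) has_contour_integral (2 * pi * \<i>) / fact n * (deriv ^^ n) (\<lambda>z. c k z \<epsilon>) 0) ?g"
      by (rule Cauchy_has_contour_integral_higher_derivative_circlepath)
        (use \<rho> in \<open>auto intro!: holomorphic_on_imp_continuous_on holomorphic_on_subset[OF hz]\<close>)
    hence "((\<lambda>t. c k (?g t) \<epsilon> / ?g t ^ Suc n * vector_derivative ?g (at t)) has_integral (2 * pi * \<i>) * taylor_coeff c k n \<epsilon>) {0..1}"
      by (simp add: has_contour_integral taylor_coeff_def)
    hence "((\<lambda>t. c k (?g t) \<epsilon> / ?g t ^ Suc n * vector_derivative ?g (at t) / (2 * pi * \<i>)) has_integral (2 * pi * \<i>) * taylor_coeff c k n \<epsilon> / (2 * pi * \<i>)) {0..1}"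
      by (rule has_integral_divide)
    hence "integral {0..1} (F \<epsilon>) = taylor_coeff c k n \<epsilon>"
      by (intro integral_unique) (simp add: F_def vector_derivative_circlepath)
    moreover have "integral {0..1} (F \<epsilon>) = (LINT t|lebesgue_on {0..1}. F \<epsilon> t)"
      using lebesgue_integral_eq_integral[OF dominated_family_integrable[OF D \<epsilon>]] by simp
    ultimately show ?thesis by simp
  qed
  moreover have "(\<lambda>\<epsilon>. LINT t|lebesgue_on {0..1}. F \<epsilon> t) holomorphic_on E"
    using dominated_family_deriv(2)[OF D] E by (auto simp: holomorphic_on_open)
  ultimately show ?thesis by (simp cong: holomorphic_cong)
qed

text \<open>On the boundary of the \<tau>-domain the data are only assumed continuous. A boundary
  slice is a limit of interior slices, locally uniformly in the second variable by compactness,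
  hence still holomorphic. This keeps the transform holomorphic in \<epsilon> along paths that touch
  the boundary.\<close>

lemma holomorphic_on_closure_param:
  fixes f :: "'a::metric_space \<Rightarrow> complex \<Rightarrow> complex"
  assumes c: "continuous_on (X \<times> E) (\<lambda>(x, y). f x y)" and U: "U \<subseteq> X" "X \<subseteq> closure U" and E: "open E"
    and h: "\<And>x. x \<in> U \<Longrightarrow> f x holomorphic_on E" and x: "x \<in> X"
  shows "f x holomorphic_on E"
proof -
  have "x \<in> closure U" using U x by blast
  then obtain u where u: "\<And>n. u n \<in> U" "u \<longlonglongrightarrow> x" unfolding closure_sequential by blast
  show ?thesis
  proof (rule holomorphic_uniform_sequence[OF E, of "\<lambda>n. f (u n)"])
    show "f (u n) holomorphic_on E" for n using h u by blast
    fix e assume e: "e \<in> E"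
    obtain d where d: "d > 0" "cball e d \<subseteq> E" using E e open_contains_cball by blast
    have "uniform_limit (cball e d) (\<lambda>n. f (u n)) (f x) sequentially"
    proof (rule uniform_limitI)
      fix \<eta> :: real assume \<eta>: "\<eta> > 0"
      have "continuous_on (X \<times> cball e d) (\<lambda>(x, y). f x y)" using c by (rule continuous_on_subset) (use d in auto)
      then obtain V where V: "x \<in> V" "open V" "\<forall>y\<in>V \<inter> X. \<forall>t\<in>cball e d. dist (f y t) (f x t) \<le> \<eta> / 2"
        using continuous_on_prod_compactE[of X "cball e d" "\<lambda>(x, y). f x y" x "\<eta> / 2"] x \<eta> by (auto simp: split_def)
      have "eventually (\<lambda>n. u n \<in> V) sequentially" using u V topological_tendstoD by blast
      thus "\<forall>\<^sub>F n in sequentially. \<forall>t\<in>cball e d. dist (f (u n) t) (f x t) < \<eta>"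
        by eventually_elim (use V u U \<eta> in force)
    qed
    thus "\<exists>d>0. cball e d \<subseteq> E \<and> uniform_limit (cball e d) (\<lambda>n. f (u n)) (f x) sequentially" using d by blast
  qed
qed

lemma borel_coeff_continuous:
  assumes P: "\<And>\<tau>. \<tau> \<in> X \<Longrightarrow> poly P \<tau> \<noteq> 0" and E: "0 \<notin> E"
    and w: "\<And>j. j < S \<Longrightarrow> continuous_on (X \<times> E) (\<lambda>(\<tau>, \<epsilon>). w j \<tau> \<epsilon>)"
    and g: "\<And>k n. k \<in> A \<Longrightarrow> continuous_on E (g k n)"
  shows "continuous_on (X \<times> E) (\<lambda>(\<tau>, \<epsilon>). borel_coeff P S A g w \<beta> \<tau> \<epsilon>)"
proof (induction \<beta> rule: less_induct)
  case (less \<beta>)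
  show ?case
  proof (cases "\<beta> < S")
    case True
    thus ?thesis using w[OF True] unfolding split_def by (simp add: borel_coeff.simps continuous_on_divide)
  next
    case False
    have 1: "continuous_on (X \<times> E) (\<lambda>p. if m < \<beta> then borel_coeff P S A g w m (fst p) (snd p) else 0)" for m
      using less[of m] by (cases "m < \<beta>") (auto simp: split_def)
    have 2: "continuous_on (X \<times> E) (\<lambda>p. g k n (snd p))" if "k \<in> A" for k n
      by (rule continuous_on_compose2[OF g[OF that]]) (auto intro!: continuous_intros)
    show ?thesis
      using False unfolding split_def
      by (subst borel_coeff.simps) (auto intro!: continuous_intros 1 2 dest: P simp: E)
  qed
qed

lemma borel_coeff_holomorphic_arg:
  assumes P: "\<And>\<tau>. \<tau> \<in> U \<Longrightarrow> poly P \<tau> \<noteq> 0" and w: "\<And>j. j < S \<Longrightarrow> (\<lambda>\<tau>. w j \<tau> \<epsilon>) holomorphic_on U"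
    and \<epsilon>: "\<epsilon> \<noteq> 0"
  shows "(\<lambda>\<tau>. borel_coeff P S A g w \<beta> \<tau> \<epsilon>) holomorphic_on U"
proof (induction \<beta> rule: less_induct)
  case (less \<beta>)
  have 1: "(\<lambda>\<tau>. if m < \<beta> then borel_coeff P S A g w m \<tau> \<epsilon> else 0) holomorphic_on U" for m
    using less[of m] by (cases "m < \<beta>") auto
  have 2: "poly P holomorphic_on U"
    using poly_holomorphic_on[OF holomorphic_on_ident] by simp
  show ?case
  proof (cases "\<beta> < S")
    case True
    thus ?thesis by (subst borel_coeff.simps) (auto intro!: holomorphic_intros w)
  next
    case False
    thus ?thesis
      by (subst borel_coeff.simps) (auto intro!: holomorphic_intros 1 2 dest: P simp: \<epsilon>)
  qed
qed

lemma borel_coeff_holomorphic_param: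
  assumes w: "\<And>j. j < S \<Longrightarrow> w j \<tau> holomorphic_on E"
    and E: "0 \<notin> E" and g: "\<And>k n. k \<in> A \<Longrightarrow> g k n holomorphic_on E"
  shows "borel_coeff P S A g w \<beta> \<tau> holomorphic_on E"
proof (induction \<beta> rule: less_induct)
  case (less \<beta>)
  have 1: "(\<lambda>\<epsilon>. if m < \<beta> then borel_coeff P S A g w m \<tau> \<epsilon> else 0) holomorphic_on E" for m
    using less[of m] by (cases "m < \<beta>") auto
  have 2: "(\<lambda>\<epsilon>. g k n \<epsilon>) holomorphic_on E" if "k \<in> A" for k n using g[OF that] .
  have 3: "(\<lambda>\<epsilon>. w j \<tau> \<epsilon>) holomorphic_on E" if "j < S" for j using w[OF that] .
  have "(\<lambda>\<epsilon>. borel_coeff P S A g w \<beta> \<tau> \<epsilon>) holomorphic_on E"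
  proof (cases "\<beta> < S")
    case True
    thus ?thesis by (subst borel_coeff.simps) (auto intro!: holomorphic_intros 3)
  next
    case False
    thus ?thesis using E
      by (subst borel_coeff.simps) (auto intro!: holomorphic_intros 1 2)
  qed
  thus ?case .
qed

text \<open>Makes dominated convergence and differentiation under the integral sign available for
  series.\<close>

lemma suminf_eq_integral:
  fixes f :: "nat \<Rightarrow> complex"
  assumes "summable (\<lambda>n. cmod (f n))"
  shows "(\<Sum>n. f n) = (LINT n|count_space UNIV. f n)"
  using assms by (subst integral_count_space_nat) (auto simp: integrable_count_space_nat_iff)

section \<open>Power series in \<open>z\<close>\<close>

text \<open>Separates the study of the series from the set of \<tau>: \<open>X\<close> will be
  \<open>HJ\<close>, or a closed sector with the disc, and \<open>Q\<close> the bound valid there.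
  Restricting to \<open>|z| \<le> R / 2\<close> gives a geometric series of ratio 1/2, hence the
  factor 2 in \<open>W_bound\<close>.\<close>

locale power_series_family =
  fixes v :: "nat \<Rightarrow> complex \<Rightarrow> complex \<Rightarrow> complex" and Q :: "complex \<Rightarrow> complex \<Rightarrow> real" and R :: real
    and X E :: "complex set"
  assumes R: "R > 0"
    and bound: "\<And>n \<tau> \<epsilon>. \<tau> \<in> X \<Longrightarrow> \<epsilon> \<in> E \<Longrightarrow> cmod (v n \<tau> \<epsilon>) \<le> Q \<tau> \<epsilon> / R ^ n"
    and Qc: "continuous_on (X \<times> E) (\<lambda>(\<tau>, \<epsilon>). Q \<tau> \<epsilon>)"
    and vc: "\<And>n. continuous_on (X \<times> E) (\<lambda>(\<tau>, \<epsilon>). v n \<tau> \<epsilon>)"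
begin

definition W :: "complex \<Rightarrow> complex \<Rightarrow> complex \<Rightarrow> complex" where
  "W \<tau> z \<epsilon> = (\<Sum>n. v n \<tau> \<epsilon> * z ^ n)"

lemma Q_nonneg: "\<tau> \<in> X \<Longrightarrow> \<epsilon> \<in> E \<Longrightarrow> Q \<tau> \<epsilon> \<ge> 0"
  using bound[of \<tau> \<epsilon> 0] norm_ge_zero[of "v 0 \<tau> \<epsilon>"] by (simp del: norm_ge_zero)

lemma term_bound:
  assumes "\<tau> \<in> X" "\<epsilon> \<in> E" "cmod z \<le> R / 2"
  shows "cmod (v n \<tau> \<epsilon> * z ^ n) \<le> Q \<tau> \<epsilon> * (1 / 2) ^ n"
proof -
  have "cmod (v n \<tau> \<epsilon> * z ^ n) \<le> (Q \<tau> \<epsilon> / R ^ n) * (R / 2) ^ n"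
    unfolding norm_mult norm_power using assms R Q_nonneg
    by (intro mult_mono bound power_mono) auto
  thus ?thesis using R by (simp add: power_divide)
qed

lemma W_summable:
  assumes "\<tau> \<in> X" "\<epsilon> \<in> E" "cmod z \<le> R / 2"
  shows "summable (\<lambda>n. cmod (v n \<tau> \<epsilon> * z ^ n))"
  by (rule summable_comparison_test[of _ "\<lambda>n. Q \<tau> \<epsilon> * (1 / 2) ^ n"])
    (use term_bound[OF assms] in \<open>auto intro!: summable_mult summable_geometric\<close>)

lemma W_bound:
  assumes "\<tau> \<in> X" "\<epsilon> \<in> E" "cmod z \<le> R / 2"
  shows "cmod (W \<tau> z \<epsilon>) \<le> 2 * Q \<tau> \<epsilon>"
proof -
  have "cmod (W \<tau> z \<epsilon>) \<le> (\<Sum>n. cmod (v n \<tau> \<epsilon> * z ^ n))"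
    unfolding W_def using W_summable[OF assms] by (rule summable_norm)
  also have "\<dots> \<le> (\<Sum>n. Q \<tau> \<epsilon> * (1 / 2) ^ n)"
    by (intro suminf_le term_bound assms W_summable summable_mult summable_geometric) auto
  also have "\<dots> = 2 * Q \<tau> \<epsilon>" by (subst suminf_mult) (auto simp: suminf_geometric summable_geometric)
  finally show ?thesis .
qed

lemma W_eq_integral:
  assumes "\<tau> \<in> X" "\<epsilon> \<in> E" "cmod z \<le> R / 2"
  shows "W \<tau> z \<epsilon> = (LINT n|count_space UNIV. v n \<tau> \<epsilon> * z ^ n)"
  unfolding W_def by (rule suminf_eq_integral[OF W_summable[OF assms]])

lemma Q_locally_bounded:
  assumes "\<tau> \<in> X" "\<epsilon> \<in> E"
  obtains V1 V2 where "open V1" "open V2" "\<tau> \<in> V1" "\<epsilon> \<in> V2"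
    "\<And>\<tau>' \<epsilon>'. \<tau>' \<in> X \<inter> V1 \<Longrightarrow> \<epsilon>' \<in> E \<inter> V2 \<Longrightarrow> Q \<tau>' \<epsilon>' \<le> Q \<tau> \<epsilon> + 1"
proof -
  have "\<forall>B. open B \<longrightarrow> (\<lambda>(\<tau>, \<epsilon>). Q \<tau> \<epsilon>) (\<tau>, \<epsilon>) \<in> B \<longrightarrow>
          (\<exists>A. open A \<and> (\<tau>, \<epsilon>) \<in> A \<and> (\<forall>y\<in>X \<times> E. y \<in> A \<longrightarrow> (\<lambda>(\<tau>, \<epsilon>). Q \<tau> \<epsilon>) y \<in> B))"
    using Qc assms unfolding continuous_on_topological by blast
  from this[rule_format, of "{..<Q \<tau> \<epsilon> + 1}"] obtain V where V: "open V" "(\<tau>, \<epsilon>) \<in> V"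
    "\<forall>y\<in>X \<times> E. y \<in> V \<longrightarrow> (\<lambda>(\<tau>, \<epsilon>). Q \<tau> \<epsilon>) y \<in> {..<Q \<tau> \<epsilon> + 1}" by auto
  obtain V1 V2 where V12: "open V1" "open V2" "(\<tau>, \<epsilon>) \<in> V1 \<times> V2" "V1 \<times> V2 \<subseteq> V"
    using open_prod_elim[OF V(1,2)] by metis
  show ?thesis by (rule that[of V1 V2]) (use V12 V(3) in \<open>auto simp: less_imp_le subset_eq\<close>)
qed

lemma W_continuous: "continuous_on (X \<times> ball 0 (R / 2) \<times> E) (\<lambda>(\<tau>, z, \<epsilon>). W \<tau> z \<epsilon>)"
proof -
  have "continuous_on (X \<times> ball 0 (R / 2) \<times> E) (\<lambda>p. LINT n|count_space UNIV. v n (fst p) (snd (snd p)) * fst (snd p) ^ n)"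
  proof (rule continuous_on_integral_dominated)
    fix n show "continuous_on (X \<times> ball 0 (R / 2) \<times> E) (\<lambda>p. v n (fst p) (snd (snd p)) * fst (snd p) ^ n)"
      by (intro continuous_intros continuous_on_compose2[OF vc[of n, unfolded split_def], of _ "\<lambda>p. (fst p, snd (snd p))", simplified]) auto
  next
    fix p assume p: "p \<in> X \<times> ball (0 :: complex) (R / 2) \<times> E"
    obtain V1 V2 where V: "open V1" "open V2" "fst p \<in> V1" "snd (snd p) \<in> V2"
      "\<And>\<tau>' \<epsilon>'. \<tau>' \<in> X \<inter> V1 \<Longrightarrow> \<epsilon>' \<in> E \<inter> V2 \<Longrightarrow> Q \<tau>' \<epsilon>' \<le> Q (fst p) (snd (snd p)) + 1"
      using Q_locally_bounded[of "fst p" "snd (snd p)"] p by (metis mem_Times_iff)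
    have "cmod (v n (fst q) (snd (snd q)) * fst (snd q) ^ n) \<le> (Q (fst p) (snd (snd p)) + 1) * (1 / 2) ^ n"
      if "q \<in> X \<times> ball 0 (R / 2) \<times> E \<inter> V1 \<times> UNIV \<times> V2" for q n
    proof -
      have "cmod (v n (fst q) (snd (snd q)) * fst (snd q) ^ n) \<le> Q (fst q) (snd (snd q)) * (1 / 2) ^ n"
        by (rule term_bound) (use that in auto)
      also have "\<dots> \<le> (Q (fst p) (snd (snd p)) + 1) * (1 / 2) ^ n"
        by (intro mult_right_mono V(5)) (use that in auto)
      finally show ?thesis .
    qed
    moreover have "open (V1 \<times> (UNIV :: complex set) \<times> V2)" using V by (intro open_Times) auto
    moreover have "p \<in> V1 \<times> UNIV \<times> V2" using V by (auto simp: mem_Times_iff)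
    moreover have "integrable (count_space UNIV) (\<lambda>n. (Q (fst p) (snd (snd p)) + 1) * (1 / 2) ^ n :: real)"
      by (auto simp: integrable_count_space_nat_iff abs_mult intro!: summable_mult summable_geometric)
    ultimately show "\<exists>V h. open V \<and> p \<in> V \<and> integrable (count_space UNIV) h \<and>
        (\<forall>q\<in>(X \<times> ball (0::complex) (R / 2) \<times> E) \<inter> V. \<forall>n\<in>space (count_space UNIV). cmod (v n (fst q) (snd (snd q)) * fst (snd q) ^ n) \<le> h n)"
      by (intro exI[of _ "V1 \<times> UNIV \<times> V2"] exI[of _ "\<lambda>n. (Q (fst p) (snd (snd p)) + 1) * (1 / 2) ^ n"]) blast
  qed auto
  thus ?thesis
    by (rule continuous_on_eq) (auto simp: W_eq_integral)
qed

lemma W_holomorphic_arg: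
  assumes U: "open U" "U \<subseteq> X" and h: "\<And>n. (\<lambda>\<tau>. v n \<tau> \<epsilon>) holomorphic_on U" and \<epsilon>: "\<epsilon> \<in> E" and z: "cmod z \<le> R / 2"
  shows "(\<lambda>\<tau>. W \<tau> z \<epsilon>) holomorphic_on U"
proof -
  have D: "dominated_family (count_space (UNIV :: nat set)) U (\<lambda>\<tau> n. v n \<tau> \<epsilon> * z ^ n)"
    unfolding dominated_family_def
  proof (intro conjI ballI U)
    show "(\<lambda>\<tau>. v n \<tau> \<epsilon> * z ^ n) holomorphic_on U" for n by (intro holomorphic_intros h)
    fix \<tau> assume \<tau>: "\<tau> \<in> U"
    obtain V1 V2 where V: "open V1" "open V2" "\<tau> \<in> V1" "\<epsilon> \<in> V2"
      "\<And>\<tau>' \<epsilon>'. \<tau>' \<in> X \<inter> V1 \<Longrightarrow> \<epsilon>' \<in> E \<inter> V2 \<Longrightarrow> Q \<tau>' \<epsilon>' \<le> Q \<tau> \<epsilon> + 1"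
      using Q_locally_bounded[of \<tau> \<epsilon>] \<tau> U \<epsilon> by (metis subsetD)
    obtain d where d: "d > 0" "ball \<tau> d \<subseteq> V1" using V open_contains_ball by blast
    have "cmod (v n y \<epsilon> * z ^ n) \<le> (Q \<tau> \<epsilon> + 1) * (1 / 2) ^ n" if "y \<in> ball \<tau> d \<inter> U" for y n
    proof -
      have "cmod (v n y \<epsilon> * z ^ n) \<le> Q y \<epsilon> * (1 / 2) ^ n" by (rule term_bound) (use that U \<epsilon> z in auto)
      also have "\<dots> \<le> (Q \<tau> \<epsilon> + 1) * (1 / 2) ^ n"
        by (intro mult_right_mono V(5)) (use that d V U \<epsilon> in auto)
      finally show ?thesis .
    qed
    moreover have "integrable (count_space UNIV) (\<lambda>n. (Q \<tau> \<epsilon> + 1) * (1 / 2) ^ n :: real)"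
      by (auto simp: integrable_count_space_nat_iff abs_mult intro!: summable_mult summable_geometric)
    ultimately show "\<exists>r>0. \<exists>h. integrable (count_space UNIV) h \<and> (\<forall>y\<in>ball \<tau> r \<inter> U. \<forall>n\<in>space (count_space UNIV). cmod (v n y \<epsilon> * z ^ n) \<le> h n)"
      using d by (intro exI[of _ d] exI[of _ "\<lambda>n. (Q \<tau> \<epsilon> + 1) * (1 / 2) ^ n"]) blast
  qed auto
  have "(\<lambda>\<tau>. LINT n|count_space UNIV. v n \<tau> \<epsilon> * z ^ n) holomorphic_on U"
    using dominated_family_deriv(2)[OF D] U by (auto simp: holomorphic_on_open)
  thus ?thesis by (rule holomorphic_transform) (use U \<epsilon> z W_eq_integral in auto)
qed

lemma W_holomorphic_param:
  assumes E: "open E" and h: "\<And>n. (\<lambda>\<epsilon>. v n \<tau> \<epsilon>) holomorphic_on E" and \<tau>: "\<tau> \<in> X" and z: "cmod z \<le> R / 2"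
  shows "(\<lambda>\<epsilon>. W \<tau> z \<epsilon>) holomorphic_on E"
proof -
  have D: "dominated_family (count_space (UNIV :: nat set)) E (\<lambda>\<epsilon> n. v n \<tau> \<epsilon> * z ^ n)"
    unfolding dominated_family_def
  proof (intro conjI ballI E)
    show "(\<lambda>\<epsilon>. v n \<tau> \<epsilon> * z ^ n) holomorphic_on E" for n by (intro holomorphic_intros h)
    fix \<epsilon> assume \<epsilon>: "\<epsilon> \<in> E"
    obtain V1 V2 where V: "open V1" "open V2" "\<tau> \<in> V1" "\<epsilon> \<in> V2"
      "\<And>\<tau>' \<epsilon>'. \<tau>' \<in> X \<inter> V1 \<Longrightarrow> \<epsilon>' \<in> E \<inter> V2 \<Longrightarrow> Q \<tau>' \<epsilon>' \<le> Q \<tau> \<epsilon> + 1"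
      using Q_locally_bounded[of \<tau> \<epsilon>] \<tau> \<epsilon> by metis
    obtain d where d: "d > 0" "ball \<epsilon> d \<subseteq> V2" using V open_contains_ball by blast
    have "cmod (v n \<tau> y * z ^ n) \<le> (Q \<tau> \<epsilon> + 1) * (1 / 2) ^ n" if "y \<in> ball \<epsilon> d \<inter> E" for y n
    proof -
      have "cmod (v n \<tau> y * z ^ n) \<le> Q \<tau> y * (1 / 2) ^ n" by (rule term_bound) (use that \<tau> z in auto)
      also have "\<dots> \<le> (Q \<tau> \<epsilon> + 1) * (1 / 2) ^ n"
        by (intro mult_right_mono V(5)) (use that d V \<tau> in auto)
      finally show ?thesis .
    qed
    moreover have "integrable (count_space UNIV) (\<lambda>n. (Q \<tau> \<epsilon> + 1) * (1 / 2) ^ n :: real)"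
      by (auto simp: integrable_count_space_nat_iff abs_mult intro!: summable_mult summable_geometric)
    ultimately show "\<exists>r>0. \<exists>h. integrable (count_space UNIV) h \<and> (\<forall>y\<in>ball \<epsilon> r \<inter> E. \<forall>n\<in>space (count_space UNIV). cmod (v n \<tau> y * z ^ n) \<le> h n)"
      using d by (intro exI[of _ d] exI[of _ "\<lambda>n. (Q \<tau> \<epsilon> + 1) * (1 / 2) ^ n"]) blast
  qed auto
  have "(\<lambda>\<epsilon>. LINT n|count_space UNIV. v n \<tau> \<epsilon> * z ^ n) holomorphic_on E"
    using dominated_family_deriv(2)[OF D] E by (auto simp: holomorphic_on_open)
  thus ?thesis by (rule holomorphic_transform) (use \<tau> z W_eq_integral in auto)
qed

end

section \<open>The equation satisfied by the sum of the series\<close>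

lemma power_series_regular:
  fixes v :: "nat \<Rightarrow> complex"
  assumes R: "R > 0" and b: "\<And>n. cmod (v n) \<le> Q / R ^ n"
  defines "f \<equiv> \<lambda>z. \<Sum>n. v n * z ^ n"
  shows "f holomorphic_on ball 0 R" and "f has_fps_expansion Abs_fps v" and "(deriv ^^ j) f 0 = fact j * v j"
proof -
  have Q: "Q \<ge> 0" using b[of 0] norm_ge_zero[of "v 0"] by (simp del: norm_ge_zero)
  have s: "(\<lambda>n. v n * z ^ n) sums f z" if "cmod z < R" for z
  proof -
    have "summable (\<lambda>n. v n * z ^ n)"
    proof (rule summable_comparison_test)
      show "summable (\<lambda>n. Q * (cmod z / R) ^ n)" using that R by (intro summable_mult summable_geometric) auto
      have "cmod (v n * z ^ n) \<le> Q * (cmod z / R) ^ n" for n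
        using mult_right_mono[OF b[of n], of "cmod z ^ n"] by (simp add: norm_mult norm_power power_divide)
      thus "\<exists>N. \<forall>n\<ge>N. cmod (v n * z ^ n) \<le> Q * (cmod z / R) ^ n" by blast
    qed
    thus ?thesis unfolding f_def by (rule summable_sums)
  qed
  show "f holomorphic_on ball 0 R" by (rule power_series_holomorphic[of 0 R v]) (use s in auto)
  show fps: "f has_fps_expansion Abs_fps v"
  proof (rule has_fps_expansionI)
    have "eventually (\<lambda>u. u \<in> ball 0 R) (nhds (0::complex))" using R by (intro eventually_nhds_in_open) auto
    thus "\<forall>\<^sub>F u in nhds 0. (\<lambda>n. fps_nth (Abs_fps v) n * u ^ n) sums f u"
      by eventually_elim (use s in auto)
  qed
  show "(deriv ^^ j) f 0 = fact j * v j" using fps_nth_fps_expansion[OF fps, of j] by simp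
qed

lemma funpow_fps_deriv_nth: "fps_nth ((fps_deriv ^^ k) F) n = fact (n + k) / fact n * fps_nth F (n + k)"
  for F :: "complex fps"
proof (induction k arbitrary: n)
  case (Suc k)
  have "of_nat (Suc n) \<noteq> (0 :: complex)" by (rule of_nat_neq_0)
  hence "of_nat (Suc n) * (fact (Suc n + k) / fact (Suc n) * fps_nth F (Suc n + k)) =
      fact (n + Suc k) / fact n * fps_nth F (n + Suc k)"
    unfolding fact_Suc[of n] by (simp del: of_nat_Suc fact_Suc)
  thus ?case by (simp add: Suc fps_deriv_nth del: of_nat_Suc fact_Suc)
qed simp

lemma has_fps_expansion_funpow_deriv:
  "f has_fps_expansion F \<Longrightarrow> (deriv ^^ k) f has_fps_expansion (fps_deriv ^^ k) F" for f :: "complex \<Rightarrow> complex"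
  by (induction k) (auto intro: has_fps_expansion_deriv)

text \<open>The recursion says exactly that both sides have the same Taylor series at 0. Both are
  holomorphic in the disc of radius \<open>R \<le> \<rho>\<close>, so the identity theorem extends
  the equality to the disc.\<close>

lemma borel_series_pde:
  fixes \<tau> \<epsilon> :: complex
  assumes fin: "finite A" and k1: "\<And>k. k \<in> A \<Longrightarrow> fst (snd k) < S"
    and c: "\<And>k. k \<in> A \<Longrightarrow> (\<lambda>z. c k z \<epsilon>) holomorphic_on ball 0 \<rho>"
    and R: "0 < R" "R \<le> \<rho>" and P: "poly P \<tau> \<noteq> 0"
    and b: "\<And>n. cmod (borel_coeff P S A (taylor_coeff c) w n \<tau> \<epsilon>) \<le> Q / R ^ n"
    and z: "z \<in> ball 0 R"
  defines "f \<equiv> \<lambda>z. \<Sum>n. borel_coeff P S A (taylor_coeff c) w n \<tau> \<epsilon> * z ^ n"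
  shows "poly P \<tau> * (deriv ^^ S) f z =
    (\<Sum>k\<in>A. c k z \<epsilon> * ((\<tau> / \<epsilon>) ^ fst k * exp (- (of_nat (snd (snd k)) * \<tau>)) * (deriv ^^ fst (snd k)) f z))"
proof -
  let ?v = "\<lambda>n. borel_coeff P S A (taylor_coeff c) w n \<tau> \<epsilon>"
  let ?F = "Abs_fps ?v"
  let ?m = "\<lambda>k. (\<tau> / \<epsilon>) ^ fst k * exp (- (of_nat (snd (snd k)) * \<tau>))"
  note ps = power_series_regular[OF R(1) b, folded f_def]
  have hd: "(deriv ^^ j) f holomorphic_on ball 0 R" for j by (intro holomorphic_higher_deriv ps(1)) auto
  have cf: "(\<lambda>z. c k z \<epsilon>) has_fps_expansion fps_expansion (\<lambda>z. c k z \<epsilon>) 0" if "k \<in> A" for k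
    by (rule has_fps_expansion_fps_expansion[OF _ _ c[OF that]]) (use R in auto)
  let ?L = "fps_const (poly P \<tau>) * (fps_deriv ^^ S) ?F"
  let ?Rh = "\<Sum>k\<in>A. fps_expansion (\<lambda>z. c k z \<epsilon>) 0 * (fps_const (?m k) * (fps_deriv ^^ fst (snd k)) ?F)"
  have L: "(\<lambda>z. poly P \<tau> * (deriv ^^ S) f z) has_fps_expansion ?L"
    by (intro has_fps_expansion_mult has_fps_expansion_const has_fps_expansion_funpow_deriv ps)
  have Rh: "(\<lambda>z. \<Sum>k\<in>A. c k z \<epsilon> * (?m k * (deriv ^^ fst (snd k)) f z)) has_fps_expansion ?Rh"
    by (intro has_fps_expansion_sum has_fps_expansion_mult has_fps_expansion_const has_fps_expansion_funpow_deriv ps cf)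
  have "?L = ?Rh"
  proof (rule fps_ext)
    fix n
    have "fps_nth ?L n = poly P \<tau> * (fact (n + S) / fact n * ?v (n + S))"
      by (simp add: funpow_fps_deriv_nth)
    also have "\<dots> = (\<Sum>k\<in>A. ?m k * (\<Sum>j\<le>n. taylor_coeff c k (n - j) \<epsilon> * (fact (j + fst (snd k)) / fact j) *
           (if j + fst (snd k) < n + S then ?v (j + fst (snd k)) else 0)))"
      using P by (subst borel_coeff.simps) simp
    also have "\<dots> = (\<Sum>k\<in>A. fps_nth (fps_expansion (\<lambda>z. c k z \<epsilon>) 0 * (fps_const (?m k) * (fps_deriv ^^ fst (snd k)) ?F)) n)"
    proof (rule sum.cong[OF refl])
      fix k assume k: "k \<in> A"
      have "fps_nth (fps_expansion (\<lambda>z. c k z \<epsilon>) 0 * (fps_const (?m k) * (fps_deriv ^^ fst (snd k)) ?F)) n =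
        fps_nth (fps_const (?m k) * ((fps_deriv ^^ fst (snd k)) ?F * fps_expansion (\<lambda>z. c k z \<epsilon>) 0)) n"
        by (simp only: mult_ac)
      also have "\<dots> = ?m k * (\<Sum>j\<le>n. fact (j + fst (snd k)) / fact j * ?v (j + fst (snd k)) * taylor_coeff c k (n - j) \<epsilon>)"
        unfolding fps_mult_left_const_nth
        by (simp add: fps_mult_nth funpow_fps_deriv_nth fps_expansion_def taylor_coeff_def atLeast0AtMost)
      also have "\<dots> = ?m k * (\<Sum>j\<le>n. taylor_coeff c k (n - j) \<epsilon> * (fact (j + fst (snd k)) / fact j) *
           (if j + fst (snd k) < n + S then ?v (j + fst (snd k)) else 0))"
      proof -
        \<comment> \<open>The guard of \<open>borel_coeff\<close> is true for every index that
          occurs.\<close>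
        have "j + fst (snd k) < n + S" if "j \<le> n" for j using k1[OF k] that by simp
        thus ?thesis by (intro arg_cong[of _ _ "\<lambda>x. ?m k * x"] sum.cong) auto
      qed
      finally show "?m k * (\<Sum>j\<le>n. taylor_coeff c k (n - j) \<epsilon> * (fact (j + fst (snd k)) / fact j) *
           (if j + fst (snd k) < n + S then ?v (j + fst (snd k)) else 0)) = 
          fps_nth (fps_expansion (\<lambda>z. c k z \<epsilon>) 0 * (fps_const (?m k) * (fps_deriv ^^ fst (snd k)) ?F)) n" by simp
    qed
    also have "\<dots> = fps_nth ?Rh n" by (simp add: fps_sum_nth)
    finally show "fps_nth ?L n = fps_nth ?Rh n" .
  qed
  hence "eventually (\<lambda>z. poly P \<tau> * (deriv ^^ S) f z = (\<Sum>k\<in>A. c k z \<epsilon> * (?m k * (deriv ^^ fst (snd k)) f z))) (nhds 0)"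
    using L Rh unfolding has_fps_expansion_def by (auto elim: eventually_elim2)
  then obtain V where V: "open V" "0 \<in> V" "\<And>z. z \<in> V \<Longrightarrow> poly P \<tau> * (deriv ^^ S) f z = (\<Sum>k\<in>A. c k z \<epsilon> * (?m k * (deriv ^^ fst (snd k)) f z))"
    unfolding eventually_nhds by blast
  show ?thesis
  proof (rule analytic_continuation_open[where s = "V \<inter> ball 0 R" and s' = "ball 0 R"
        and f = "\<lambda>z. poly P \<tau> * (deriv ^^ S) f z"
        and g = "\<lambda>z. \<Sum>k\<in>A. c k z \<epsilon> * (?m k * (deriv ^^ fst (snd k)) f z)"])
    show "(\<lambda>z. poly P \<tau> * (deriv ^^ S) f z) holomorphic_on ball 0 R" by (intro holomorphic_intros hd)
    show "(\<lambda>z. \<Sum>k\<in>A. c k z \<epsilon> * (?m k * (deriv ^^ fst (snd k)) f z)) holomorphic_on ball 0 R"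
      by (intro holomorphic_intros hd holomorphic_on_subset[OF c]) (use R in auto)
    show "V \<inter> ball 0 R \<noteq> {}" using V R by (auto intro!: exI[of _ 0])
  qed (use V z in auto)
qed

text \<open>\<open>GX\<close> lists pairs of a weight and a region: strips and sectors need
  different weights, but the radius has to be common to them. The data, and their size
  \<open>Kt\<close>, are quantified after \<open>R\<close>.\<close>

lemma radius_exists:
  fixes GX :: "((complex \<Rightarrow> real) \<times> complex set) set"
  assumes fin: "finite A" and b: "b > 1" and \<xi>: "\<xi> > 0" and \<sigma>: "\<sigma>1 > 0" and \<rho>: "\<rho> > 0"
    and A: "\<And>k0 k1 k2. (k0, k1, k2) \<in> A \<Longrightarrow> real S \<ge> real k1 + b * real k0 + b * real k2 / \<xi> \<and> S > k1"
    and ch: "\<And>k. k \<in> A \<Longrightarrow> holomorphic2_on (c k) (ball 0 \<rho> \<times> E)"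
    and cb: "\<And>k. k \<in> A \<Longrightarrow> bounded ((\<lambda>(z, \<epsilon>). c k z \<epsilon>) ` (ball 0 \<rho> \<times> E))"
    and Pm: "Pm > 0" "\<And>\<tau>. \<tau> \<in> Y \<Longrightarrow> cmod (poly P \<tau>) \<ge> Pm"
    and GX: "finite GX" "\<And>G X \<tau>. (G, X) \<in> GX \<Longrightarrow> G \<tau> \<ge> 0"
    and G: "\<And>G X k2. (G, X) \<in> GX \<Longrightarrow> \<exists>C. \<forall>\<tau>\<in>X. \<forall>y\<ge>1. cmod (exp (- (of_nat k2 * \<tau>))) * exp (- (y powr (- b) * G \<tau>)) \<le> C * y powr (b * real k2 / \<xi>)"
  shows "\<exists>R>0. R \<le> 1 \<and> R \<le> \<rho> \<and> (\<forall>G X w \<tau> \<epsilon> Kt. (G, X) \<in> GX \<longrightarrow> \<tau> \<in> X \<inter> Y \<longrightarrow> \<epsilon> \<in> E - {0} \<longrightarrow> Kt \<ge> 0 \<longrightarrow>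
     (\<forall>j<S. cmod (w j \<tau> \<epsilon>) \<le> Kt * exp (rsum b j * (\<sigma>1 * cmod \<tau> / cmod \<epsilon> + G \<tau>))) \<longrightarrow>
     (\<forall>\<beta>. cmod (borel_coeff P S A (taylor_coeff c) w \<beta> \<tau> \<epsilon>) \<le> Kt * exp (rsum b \<beta> * (\<sigma>1 * cmod \<tau> / cmod \<epsilon> + G \<tau>)) / R ^ \<beta>))"
proof -
  have "\<exists>C>0. \<forall>q\<in>GX. \<forall>k\<in>A. \<forall>\<tau>\<in>snd q. \<forall>\<epsilon>. \<epsilon> \<noteq> 0 \<longrightarrow> (\<forall>y\<ge>1. 
     cmod (\<tau> / \<epsilon>) ^ fst k * cmod (exp (- (of_nat (snd (snd k)) * \<tau>))) *
        exp (- (y powr (- b) * (\<sigma>1 * cmod \<tau> / cmod \<epsilon> + fst q \<tau>))) \<le> C * y ^ (S - fst (snd k)))"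
  proof (rule finite_uniform_bound[OF GX(1)])
    fix q assume "q \<in> GX"
    then obtain G X where q: "q = (G, X)" "(G, X) \<in> GX" by (cases q) auto
    show "\<exists>C. \<forall>k\<in>A. \<forall>\<tau>\<in>snd q. \<forall>\<epsilon>. \<epsilon> \<noteq> 0 \<longrightarrow> (\<forall>y\<ge>1. 
     cmod (\<tau> / \<epsilon>) ^ fst k * cmod (exp (- (of_nat (snd (snd k)) * \<tau>))) *
        exp (- (y powr (- b) * (\<sigma>1 * cmod \<tau> / cmod \<epsilon> + fst q \<tau>))) \<le> C * y ^ (S - fst (snd k)))"
      using weight_shift_bound[OF fin b \<xi> \<sigma> A G[OF q(2)]] q(1) by auto
  next
    fix q :: "(complex \<Rightarrow> real) \<times> complex set" and C C' :: real
    assume *: "\<forall>k\<in>A. \<forall>\<tau>\<in>snd q. \<forall>\<epsilon>. \<epsilon> \<noteq> 0 \<longrightarrow> (\<forall>y\<ge>1. 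
     cmod (\<tau> / \<epsilon>) ^ fst k * cmod (exp (- (of_nat (snd (snd k)) * \<tau>))) *
        exp (- (y powr (- b) * (\<sigma>1 * cmod \<tau> / cmod \<epsilon> + fst q \<tau>))) \<le> C * y ^ (S - fst (snd k)))" and "C \<le> C'"
    have "C * y ^ n \<le> C' * y ^ n" if "y \<ge> 1" for y :: real and n
      using that \<open>C \<le> C'\<close> by (intro mult_right_mono) auto
    thus "\<forall>k\<in>A. \<forall>\<tau>\<in>snd q. \<forall>\<epsilon>. \<epsilon> \<noteq> 0 \<longrightarrow> (\<forall>y\<ge>1. 
     cmod (\<tau> / \<epsilon>) ^ fst k * cmod (exp (- (of_nat (snd (snd k)) * \<tau>))) *
        exp (- (y powr (- b) * (\<sigma>1 * cmod \<tau> / cmod \<epsilon> + fst q \<tau>))) \<le> C' * y ^ (S - fst (snd k)))"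
      using * by (meson order_trans)
  qed
  then obtain C1 where C1: "C1 > 0" and key: "\<And>G X k \<tau> \<epsilon> y. (G, X) \<in> GX \<Longrightarrow> k \<in> A \<Longrightarrow> \<tau> \<in> X \<Longrightarrow> \<epsilon> \<noteq> 0 \<Longrightarrow> y \<ge> 1 \<Longrightarrow>
     cmod (\<tau> / \<epsilon>) ^ fst k * cmod (exp (- (of_nat (snd (snd k)) * \<tau>))) *
        exp (- (y powr (- b) * (\<sigma>1 * cmod \<tau> / cmod \<epsilon> + G \<tau>))) \<le> C1 * y ^ (S - fst (snd k))"
    by fastforce
  have "\<exists>C>0. \<forall>k\<in>A. \<forall>z\<in>ball 0 \<rho>. \<forall>\<epsilon>\<in>E. cmod (c k z \<epsilon>) \<le> C"
  proof (rule finite_uniform_bound[OF fin])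
    show "\<exists>C. \<forall>z\<in>ball 0 \<rho>. \<forall>\<epsilon>\<in>E. cmod (c k z \<epsilon>) \<le> C" if "k \<in> A" for k
      using cb[OF that] unfolding bounded_iff by fastforce
  qed (meson order_trans)
  then obtain Cg where Cg: "Cg > 0" "\<And>k z \<epsilon>. k \<in> A \<Longrightarrow> z \<in> ball 0 \<rho> \<Longrightarrow> \<epsilon> \<in> E \<Longrightarrow> cmod (c k z \<epsilon>) \<le> Cg" by blast
  define N where "N = 2 * real (card A) * Cg * C1 * (real S + 1) ^ S"
  have N: "N \<ge> 0" using Cg C1 by (simp add: N_def)
  \<comment> \<open>\<open>\<rho> / 4\<close> makes the ratio \<open>R * (2 / \<rho>)\<close> at
    most 1/2, where \<open>2 / \<rho>\<close> comes from Cauchy's inequality on the circle of radius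
    \<open>\<rho> / 2\<close>. The 1 in \<open>N + 1\<close> avoids a zero denominator when
    \<open>A\<close> is empty.\<close>
  define R where "R = min 1 (min (\<rho> / 4) (Pm / (N + 1)))"
  have R: "R > 0" "R \<le> 1" "R \<le> \<rho>" "R * (2 / \<rho>) \<le> 1 / 2" "N * R \<le> Pm"
  proof -
    show "R > 0" using Pm N \<rho> by (simp add: R_def)
    show "R \<le> 1" "R \<le> \<rho>" using \<rho> by (auto simp: R_def)
    have "R \<le> \<rho> / 4" unfolding R_def by (meson min.cobounded1 min.cobounded2 order_trans)
    thus "R * (2 / \<rho>) \<le> 1 / 2" using \<rho> by (simp add: field_simps)
    have "N * R \<le> N * (Pm / (N + 1))" using N by (intro mult_left_mono) (auto simp: R_def)
    also have "\<dots> \<le> Pm" using N Pm by (simp add: field_simps)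
    finally show "N * R \<le> Pm" .
  qed
  have "cmod (borel_coeff P S A (taylor_coeff c) w \<beta> \<tau> \<epsilon>) \<le> Kt * exp (rsum b \<beta> * (\<sigma>1 * cmod \<tau> / cmod \<epsilon> + G \<tau>)) / R ^ \<beta>"
    if q: "(G, X) \<in> GX" and \<tau>: "\<tau> \<in> X \<inter> Y" and \<epsilon>: "\<epsilon> \<in> E - {0}" and Kt: "Kt \<ge> 0"
      and w: "\<forall>j<S. cmod (w j \<tau> \<epsilon>) \<le> Kt * exp (rsum b j * (\<sigma>1 * cmod \<tau> / cmod \<epsilon> + G \<tau>))" for G X w \<tau> \<epsilon> Kt \<beta>
  proof (rule borel_coeff_bound[where Pm = Pm and Cg = Cg and ?C1.0 = C1 and B = "2 / \<rho>"])
    show "fst (snd k) < S" if "k \<in> A" for k using A[of "fst k" "fst (snd k)" "snd (snd k)"] that by auto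
    show "cmod (taylor_coeff c k n \<epsilon>) \<le> Cg * (2 / \<rho>) ^ n" if "k \<in> A" for k n
      by (rule taylor_coeff_bound[where c = c and k = k, OF ch[OF that] \<rho>]) (use Cg(2) that \<epsilon> in auto)
    show "\<sigma>1 * cmod \<tau> / cmod \<epsilon> + G \<tau> \<ge> 0" using GX(2)[OF q] \<sigma> by simp
    show "2 * real (card A) * Cg * C1 * (real S + 1) ^ S * R \<le> Pm" using R(5) by (simp add: N_def)
  qed (use fin Pm \<tau> Cg C1 Kt w key[OF q] \<epsilon> R \<rho> in auto)
  thus ?thesis using R(1-3) by (intro exI[of _ R] conjI) blast+
qed

section \<open>From weighted norms to pointwise bounds\<close>

lemma norm_H_bound:
  assumes "norm_H M \<sigma>1 \<sigma>2 \<sigma>3 X \<epsilon> v \<le> ennreal K" "\<tau> \<in> X" "\<tau> \<noteq> 0" "K \<ge> 0"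
  shows "cmod (v \<tau>) \<le> K * cmod \<tau> * exp (\<sigma>1 * cmod \<tau> / cmod \<epsilon> - \<sigma>2 * (M - 1) * exp (\<sigma>3 * cmod \<tau>))"
proof -
  have "ennreal (cmod (v \<tau>) / cmod \<tau> * exp (- (\<sigma>1 / cmod \<epsilon>) * cmod \<tau> + \<sigma>2 * (M - 1) * exp (\<sigma>3 * cmod \<tau>))) \<le> ennreal K"
    using assms(1) unfolding norm_H_def by (rule order_trans[rotated]) (rule SUP_upper, use assms in auto)
  hence "cmod (v \<tau>) / cmod \<tau> * exp (- (\<sigma>1 / cmod \<epsilon>) * cmod \<tau> + \<sigma>2 * (M - 1) * exp (\<sigma>3 * cmod \<tau>)) \<le> K"
    using assms(4) by (simp add: ennreal_le_iff)
  hence "cmod (v \<tau>) / cmod \<tau> * exp (- (\<sigma>1 / cmod \<epsilon>) * cmod \<tau> + \<sigma>2 * (M - 1) * exp (\<sigma>3 * cmod \<tau>)) *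
     exp (\<sigma>1 * cmod \<tau> / cmod \<epsilon> - \<sigma>2 * (M - 1) * exp (\<sigma>3 * cmod \<tau>)) \<le> K * exp (\<sigma>1 * cmod \<tau> / cmod \<epsilon> - \<sigma>2 * (M - 1) * exp (\<sigma>3 * cmod \<tau>))"
    by (intro mult_right_mono) auto
  hence "cmod (v \<tau>) / cmod \<tau> \<le> K * exp (\<sigma>1 * cmod \<tau> / cmod \<epsilon> - \<sigma>2 * (M - 1) * exp (\<sigma>3 * cmod \<tau>))"
    by (simp add: mult.assoc flip: exp_add)
  thus ?thesis using assms(3) by (simp add: field_simps)
qed

lemma norm_J_bound:
  assumes "norm_J \<sigma>1 \<sigma>2 \<sigma>3 X \<epsilon> v \<le> ennreal K" "\<tau> \<in> X" "\<tau> \<noteq> 0" "K \<ge> 0"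
  shows "cmod (v \<tau>) \<le> K * cmod \<tau> * exp (\<sigma>1 * cmod \<tau> / cmod \<epsilon> + \<sigma>2 * exp (\<sigma>3 * cmod \<tau>))"
proof -
  \<comment> \<open>With \<open>M = 0\<close> the factor \<open>M - 1\<close> is -1, which reverses
    the sign of the double exponential.\<close>
  have "norm_H 0 \<sigma>1 \<sigma>2 \<sigma>3 X \<epsilon> v \<le> ennreal K" using assms(1) by (simp add: norm_J_def norm_H_def)
  from norm_H_bound[OF this assms(2-4)] show ?thesis by simp
qed

lemma norm_S_bound:
  assumes "norm_S \<sigma>1 X \<epsilon> v \<le> ennreal K" "\<tau> \<in> X" "\<tau> \<noteq> 0" "K \<ge> 0"
  shows "cmod (v \<tau>) \<le> K * cmod \<tau> * exp (\<sigma>1 * cmod \<tau> / cmod \<epsilon>)"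
proof -
  have "norm_H 1 \<sigma>1 0 0 X \<epsilon> v \<le> ennreal K" using assms(1) by (simp add: norm_S_def norm_H_def)
  from norm_H_bound[OF this assms(2-4)] show ?thesis by simp
qed

section \<open>Geometry of the strips\<close>

lemma strip_bounds_chain:
  assumes sb: "strip_bounds n aH bH cJ dJ" and n: "n \<ge> 1" and k: "k \<in> {-n..n}"
  shows "cJ (-n) \<le> cJ k" "cJ k < aH k" "aH k < dJ k" "dJ k < bH k" "bH k \<le> bH n"
proof -
  have *: "cJ k < aH k \<and> aH k < dJ k \<and> dJ k < bH k" if "k \<in> {-n..n}" for k
  proof (cases "k = n")
    case False
    hence "k \<in> {-n..n-1}" using that by auto
    \<comment> \<open>For \<open>k < n\<close> the last inequality is obtained through the next
      strip: \<open>dJ k < cJ (k + 1) < bH k\<close>.\<close>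
    thus ?thesis using sb unfolding strip_bounds_def by (meson less_trans)
  qed (use sb in \<open>auto simp: strip_bounds_def\<close>)
  show "cJ k < aH k" "aH k < dJ k" "dJ k < bH k" using *[OF k] by auto
  have "m \<le> n \<longrightarrow> cJ (-n) \<le> cJ m" if "m \<ge> -n" for m
    using that
  proof (induction m rule: int_ge_induct)
    case (step i)
    show ?case
    proof
      assume i: "i + 1 \<le> n"
      hence "dJ i < cJ (i + 1)" using sb step(1) unfolding strip_bounds_def by auto
      thus "cJ (-n) \<le> cJ (i + 1)" using step *[of i] i by auto
    qed
  qed simp
  thus "cJ (-n) \<le> cJ k" using k by auto
  have "-n \<le> m \<longrightarrow> bH m \<le> bH n" if "m \<le> n" for m
    using that
  proof (induction m rule: int_le_induct)
    case (step i)
    show ?case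
    proof
      assume i: "-n \<le> i - 1"
      hence "i - 1 \<in> {-n..n-1}" using step by auto
      hence "bH (i - 1) < aH (i - 1 + 1)" using sb unfolding strip_bounds_def by blast
      thus "bH (i - 1) \<le> bH n" using step *[of i] i by auto
    qed
  qed simp
  thus "bH k \<le> bH n" using k by auto
qed

text \<open>Climbing from one \<open>H\<close> strip to the next: a height above \<open>bH m\<close>
  is above \<open>cJ (m + 1)\<close>, and the intervals \<open>[cJ, dJ]\<close> and
  \<open>[aH, bH]\<close> of index \<open>m + 1\<close> overlap, so no height is skipped.\<close>

lemma strip_cover:
  assumes sb: "strip_bounds n aH bH cJ dJ" and n: "n \<ge> 1" and \<tau>: "\<tau> \<in> strip (cJ (-n)) (bH n)"
  shows "\<exists>k\<in>{-n..n}. \<tau> \<in> strip (aH k) (bH k) \<or> \<tau> \<in> strip (cJ k) (dJ k)"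
proof -
  define y where "y = Im \<tau>"
  have y: "cJ (-n) \<le> y" "y \<le> bH n" "Re \<tau> \<le> 0" using \<tau> by (auto simp: strip_def y_def)
  note ch = strip_bounds_chain[OF sb n]
  have "m \<le> n \<longrightarrow> y \<le> bH m \<longrightarrow> (\<exists>k\<in>{-n..n}. aH k \<le> y \<and> y \<le> bH k \<or> cJ k \<le> y \<and> y \<le> dJ k)" if "m \<ge> -n" for m
    using that
  proof (induction m rule: int_ge_induct)
    case base
    show ?case
    proof (intro impI)
      assume "y \<le> bH (- n)"
      hence "aH (-n) \<le> y \<and> y \<le> bH (-n) \<or> cJ (-n) \<le> y \<and> y \<le> dJ (-n)" using y ch(3)[of "-n"] n by auto
      thus "\<exists>k\<in>{-n..n}. aH k \<le> y \<and> y \<le> bH k \<or> cJ k \<le> y \<and> y \<le> dJ k" using n by (intro bexI[of _ "-n"]) auto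
    qed
  next
    case (step m)
    show ?case
    proof (intro impI)
      assume m: "m + 1 \<le> n" "y \<le> bH (m + 1)"
      show "\<exists>k\<in>{-n..n}. aH k \<le> y \<and> y \<le> bH k \<or> cJ k \<le> y \<and> y \<le> dJ k"
      proof (cases "y \<le> bH m")
        case True
        thus ?thesis using step m by auto
      next
        case False
        have "cJ (m + 1) < bH m" using sb step(1) m unfolding strip_bounds_def by auto
        hence "aH (m+1) \<le> y \<and> y \<le> bH (m+1) \<or> cJ (m+1) \<le> y \<and> y \<le> dJ (m+1)"
          using False m ch(3)[of "m + 1"] step(1) by auto
        thus ?thesis using step(1) m by (intro bexI[of _ "m + 1"]) auto
      qed
    qed
  qed
  from this[of n] y n obtain k where "k \<in> {-n..n}" "aH k \<le> y \<and> y \<le> bH k \<or> cJ k \<le> y \<and> y \<le> dJ k" by auto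
  thus ?thesis using y by (intro bexI[of _ k]) (auto simp: strip_def y_def)
qed

lemma convex_strip: "convex (strip a b)"
proof -
  have "strip a b = {z. Im z \<ge> a} \<inter> {z. Im z \<le> b} \<inter> {z. Re z \<le> 0}" by (auto simp: strip_def)
  thus ?thesis
    by (simp add: convex_Int convex_halfspace_Im_ge convex_halfspace_Im_le convex_halfspace_Re_le)
qed

lemma strip_subset_closure_interior:
  assumes "a < b" shows "strip a b \<subseteq> closure (interior (strip a b))"
proof -
  let ?O = "{z. Im z > a} \<inter> {z. Im z < b} \<inter> {z. Re z < 0}"
  have "open ?O" by (simp add: open_Int open_halfspace_Im_gt open_halfspace_Im_lt open_halfspace_Re_lt)
  moreover have "?O \<subseteq> strip a b" by (auto simp: strip_def)
  ultimately have sub: "?O \<subseteq> interior (strip a b)" by (rule interior_maximal[rotated])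
  have "Complex (-1) ((a + b) / 2) \<in> ?O" using assms by auto
  hence "interior (strip a b) \<noteq> {}" using sub by blast
  thus ?thesis using convex_closure_interior[OF convex_strip] closure_subset by metis
qed

section \<open>The Borel transform on strips and sectors\<close>

text \<open>What can be said before the data are given. The constants \<open>\<sigma>1\<close>,
  \<open>\<sigma>2\<close>, \<open>s2\<close>, ... here are the primed ones of the theorem; in the
  final bounds the primes go to the weaker constants instead.\<close>

locale borel_problem =
  fixes \<A> :: "(nat \<times> nat \<times> nat) set"
    and c :: "nat \<times> nat \<times> nat \<Rightarrow> complex \<Rightarrow> complex \<Rightarrow> complex"
    and P :: "complex poly" and S :: nat
    and \<rho> \<epsilon>0 \<xi> b M r :: real
    and n :: int and aH bH cJ dJ :: "int \<Rightarrow> real"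
    and \<sigma>1 \<sigma>2 \<sigma>3 s2 s3 :: real
    and \<iota> :: nat and d :: "nat \<Rightarrow> real" and Sd :: "nat \<Rightarrow> complex set"
    and H J :: "int \<Rightarrow> complex set" and HJ :: "complex set"
  assumes H_def: "H = (\<lambda>k. strip (aH k) (bH k))"
    and J_def: "J = (\<lambda>k. strip (cJ k) (dJ k))"
    and HJ_def: "HJ = strip (cJ (-n)) (bH n)"
    and fin: "finite \<A>" and \<rho>: "\<rho> > 0" and \<epsilon>0: "\<epsilon>0 > 0" and S1: "S \<ge> 1"
    and ch: "\<And>k. k \<in> \<A> \<Longrightarrow> holomorphic2_on (c k) (ball 0 \<rho> \<times> ball 0 \<epsilon>0)"
    and cb: "\<And>k. k \<in> \<A> \<Longrightarrow> bounded ((\<lambda>(z, \<epsilon>). c k z \<epsilon>) ` (ball 0 \<rho> \<times> ball 0 \<epsilon>0))"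
    and P0: "P \<noteq> 0" and P1: "\<And>x. poly P x = 0 \<Longrightarrow> Re x > 0"
    and \<xi>: "\<xi> > 0" and b: "b > 1"
    and A1: "\<And>k0 k1 k2. (k0, k1, k2) \<in> \<A> \<Longrightarrow>
           real S \<ge> real k1 + b * real k0 + b * real k2 / \<xi> \<and> S > k1"
    and M: "M > zeta_sum b"
    and n: "n \<ge> 1" and sb: "strip_bounds n aH bH cJ dJ"
    and pos: "\<sigma>1 > 0" "\<sigma>2 > 0" "\<sigma>3 > 0" "s2 > 0" "s3 > 0"
    and \<xi>min: "\<xi> \<le> min \<sigma>3 s3"
    and \<iota>: "\<iota> \<ge> 2"
    and Sd: "\<And>p. p < \<iota> \<Longrightarrow> unbounded_sector (d p) (Sd p) \<and> Sd p \<subseteq> {z. Re z > 0}"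
    and r: "r > 0"
    and P2: "\<And>p x. p < \<iota> \<Longrightarrow> x \<in> closure (Sd p) \<union> cball 0 r \<Longrightarrow> poly P x \<noteq> 0"
    and rJ: "ball 0 r \<inter> {z. Re z \<le> 0} \<subseteq> J 0"
begin

abbreviation "Sc p \<equiv> closure (Sd p) \<union> cball 0 r"
abbreviation "So p \<equiv> Sd p \<union> ball 0 r"
abbreviation "E \<equiv> ball (0::complex) \<epsilon>0 - {0}"
abbreviation "\<zeta> \<equiv> zeta_sum b"

definition GH where "GH \<tau> = \<sigma>2 * exp (\<sigma>3 * cmod \<tau>)"
definition GJ where "GJ \<tau> = s2 * exp (s3 * cmod \<tau>)"

text \<open>Contains every \<tau> that occurs and no root of \<open>P\<close>; being closed, it
  carries a positive lower bound for the modulus of \<open>P\<close>.\<close>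

definition Ydom where "Ydom = {z. Re z \<le> 0} \<union> (\<Union>p<\<iota>. Sc p)"

lemma HJ_Y: "HJ \<subseteq> Ydom" and Sc_Y: "p < \<iota> \<Longrightarrow> Sc p \<subseteq> Ydom"
  by (auto simp: HJ_def strip_def Ydom_def)

lemma Sc_Re: assumes "p < \<iota>" "\<tau> \<in> Sc p" shows "Re \<tau> \<ge> - r"
proof -
  have "Sd p \<subseteq> {z. Re z \<ge> 0}" using Sd[OF assms(1)] by force
  hence "closure (Sd p) \<subseteq> {z. Re z \<ge> 0}" by (intro closure_minimal closed_halfspace_Re_ge)
  moreover have "Re \<tau> \<ge> - r" if "\<tau> \<in> cball 0 r" using that abs_Re_le_cmod[of \<tau>] by auto
  ultimately show ?thesis using assms(2) r by auto
qed

text \<open>The first two weights are strong enough on the whole plane. The third has no double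
  exponential: where \<open>Re \<tau> \<ge> - r\<close>, the factor \<open>exp(- k2 \<tau>)\<close>
  is bounded by \<open>exp(k2 r)\<close>, and nothing has to be absorbed.\<close>

definition weights :: "((complex \<Rightarrow> real) \<times> complex set) set" where
  "weights = {(GH, UNIV), (GJ, UNIV), (\<lambda>_. 0, {z. Re z \<ge> - r})}"

text \<open>The radius has to work for all data \<open>w\<close> at once, because \<open>\<delta>\<close> is chosen before the data.
  It does not depend on their size, since the coefficients are linear in \<open>w\<close>.\<close>

definition radius_ok :: "real \<Rightarrow> bool" where
  "radius_ok R \<longleftrightarrow> R > 0 \<and> R \<le> 1 \<and> R \<le> \<rho> \<and> (\<forall>G X w \<tau> \<epsilon> Kt. (G, X) \<in> weights \<longrightarrow>
     \<tau> \<in> X \<inter> Ydom \<longrightarrow> \<epsilon> \<in> E \<longrightarrow> Kt \<ge> 0 \<longrightarrow>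
     (\<forall>j<S. cmod (w j \<tau> \<epsilon>) \<le> Kt * exp (rsum b j * (\<sigma>1 * cmod \<tau> / cmod \<epsilon> + G \<tau>))) \<longrightarrow>
     (\<forall>\<beta>. cmod (borel_coeff P S \<A> (taylor_coeff c) w \<beta> \<tau> \<epsilon>) \<le> Kt * exp (rsum b \<beta> * (\<sigma>1 * cmod \<tau> / cmod \<epsilon> + G \<tau>)) / R ^ \<beta>))"

lemma Pnz: assumes "\<tau> \<in> Ydom" shows "poly P \<tau> \<noteq> 0"
proof -
  have "Re \<tau> \<le> 0 \<or> (\<exists>p<\<iota>. \<tau> \<in> Sc p)" using assms unfolding Ydom_def by blast
  thus ?thesis
  proof
    assume "Re \<tau> \<le> 0" thus ?thesis using P1[of \<tau>] by force
  qed (use P2 in blast)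
qed

lemma ex_radius: "\<exists>R. radius_ok R"
proof -
  have "closed Ydom" unfolding Ydom_def
    by (intro closed_Un closed_UN closed_halfspace_Re_le) auto
  hence "\<exists>m>0. \<forall>x\<in>Ydom. cmod (poly P x) \<ge> m"
    by (rule poly_bounded_below[OF P0]) (rule Pnz)
  then obtain Pm where Pm: "Pm > 0" "\<And>x. x \<in> Ydom \<Longrightarrow> cmod (poly P x) \<ge> Pm" by blast
  let ?GX = weights
  have 1: "G \<tau> \<ge> 0" if "(G, X) \<in> ?GX" for G X \<tau> using that pos by (auto simp: weights_def GH_def GJ_def)
  have S: "\<exists>C. \<forall>\<tau>\<in>{z. Re z \<ge> - r}. \<forall>y\<ge>1. cmod (exp (- (of_nat k2 * \<tau>))) * exp (- (y powr (- b) * 0)) \<le> C * y powr (b * real k2 / \<xi>)" for k2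
  proof (intro exI[of _ "exp (real k2 * r)"] ballI allI impI)
    fix \<tau> :: complex and y :: real assume \<tau>: "\<tau> \<in> {z. Re z \<ge> - r}" and y: "y \<ge> 1"
    have "real k2 * (- Re \<tau>) \<le> real k2 * r" using \<tau> by (intro mult_left_mono) auto
    hence "cmod (exp (- (of_nat k2 * \<tau>))) * exp (- (y powr (- b) * 0)) \<le> exp (real k2 * r) * 1" by simp
    also have "\<dots> \<le> exp (real k2 * r) * y powr (b * real k2 / \<xi>)"
      using y b \<xi> by (intro mult_left_mono ge_one_powr_ge_zero) auto
    finally show "cmod (exp (- (of_nat k2 * \<tau>))) * exp (- (y powr (- b) * 0)) \<le> exp (real k2 * r) * y powr (b * real k2 / \<xi>)" .
  qed
  have 3: "\<exists>C. \<forall>\<tau>\<in>X. \<forall>y\<ge>1. cmod (exp (- (of_nat k2 * \<tau>))) * exp (- (y powr (- b) * G \<tau>)) \<le> C * y powr (b * real k2 / \<xi>)"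
    if "(G, X) \<in> ?GX" for G X k2
  proof -
    consider "G = GH" | "G = GJ" | "G = (\<lambda>_. 0)" "X = {z. Re z \<ge> - r}" using \<open>(G, X) \<in> ?GX\<close> by (auto simp: weights_def)
    thus ?thesis
    proof cases
      case 1
      show ?thesis unfolding 1 GH_def by (rule superexp_weight_bound[OF b \<xi>]) (use \<xi>min pos in auto)
    next
      case 2
      show ?thesis unfolding 2 GJ_def by (rule superexp_weight_bound[OF b \<xi>]) (use \<xi>min pos in auto)
    qed (simp only: S)
  qed
  have "finite ?GX" by (simp add: weights_def)
  show ?thesis unfolding radius_ok_def
    by (rule radius_exists[where A = \<A> and c = c and S = S and P = P and b = b and \<xi> = \<xi> and ?\<sigma>1.0 = \<sigma>1
          and \<rho> = \<rho> and GX = weights and Y = Ydom and E = "ball 0 \<epsilon>0" and Pm = Pm])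
      (fact fin b \<xi> pos(1) \<rho> A1 ch cb Pm(1) Pm(2) \<open>finite weights\<close> 1 3)+
qed

end

locale borel_data = borel_problem +
  fixes w :: "nat \<Rightarrow> complex \<Rightarrow> complex \<Rightarrow> complex" and R :: real
  assumes adm: "admissible_data S \<epsilon>0 HJ n H J \<iota> Sd r M (\<sigma>1, \<sigma>2, \<sigma>3) (s2, s3) w"
    and Rok: "radius_ok R"
begin

definition v where "v \<beta> \<tau> \<epsilon> = borel_coeff P S \<A> (taylor_coeff c) w \<beta> \<tau> \<epsilon>"
definition W where "W \<tau> z \<epsilon> = (\<Sum>\<beta>. v \<beta> \<tau> \<epsilon> * z ^ \<beta>)"
abbreviation "D \<equiv> ball (0::complex) (R / 2)"

lemma R: "R > 0" "R \<le> 1" "R \<le> \<rho>" using Rok by (auto simp: radius_ok_def)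

lemma w_regular:
  assumes "j < S"
  shows "holomorphic2_on (w j) (interior HJ \<times> E)" "continuous_on (HJ \<times> E) (\<lambda>(\<tau>, \<epsilon>). w j \<tau> \<epsilon>)"
    "p < \<iota> \<Longrightarrow> holomorphic2_on (w j) (So p \<times> E)" "p < \<iota> \<Longrightarrow> continuous_on (Sc p \<times> E) (\<lambda>(\<tau>, \<epsilon>). w j \<tau> \<epsilon>)"
  using adm assms unfolding admissible_data_def by auto

text \<open>The norms ignore \<tau> = 0, but a finite norm bounds the quotient by |\<tau>| nearby,
  and continuity forces the value 0. Consequently the bounds extend to \<tau> = 0, and the integrand
  has a removable singularity there.\<close>

lemma w_zero: assumes "j < S" "\<epsilon> \<in> E" shows "w j 0 \<epsilon> = 0"
proof -
  have \<iota>0: "0 < \<iota>" using \<iota> by simp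
  obtain K :: real where K: "\<And>p \<epsilon>. \<epsilon> \<in> E \<Longrightarrow> p < \<iota> \<Longrightarrow> norm_S \<sigma>1 (Sc p) \<epsilon> (\<lambda>\<tau>. w j \<tau> \<epsilon>) \<le> ennreal K"
    using adm assms unfolding admissible_data_def prod.case by blast
  have "norm_S \<sigma>1 (Sc 0) \<epsilon> (\<lambda>\<tau>. w j \<tau> \<epsilon>) \<le> ennreal (max K 0)"
    using K[OF assms(2) \<iota>0] by (rule order_trans) (intro ennreal_leI, simp)
  from norm_S_bound[OF this]
  have bd: "cmod (w j \<tau> \<epsilon>) \<le> max K 0 * cmod \<tau> * exp (\<sigma>1 * cmod \<tau> / cmod \<epsilon>)" if "\<tau> \<in> ball 0 r" "\<tau> \<noteq> 0" for \<tau>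
    using that by auto
  have "(\<lambda>\<tau>. w j \<tau> \<epsilon>) holomorphic_on So 0" by (rule holomorphic2_on_section1[OF w_regular(3)[OF assms(1) \<iota>0] assms(2)])
  hence "(\<lambda>\<tau>. w j \<tau> \<epsilon>) holomorphic_on ball 0 r" by (rule holomorphic_on_subset) auto
  hence "continuous_on (ball 0 r) (\<lambda>\<tau>. w j \<tau> \<epsilon>)" by (rule holomorphic_on_imp_continuous_on)
  hence "((\<lambda>\<tau>. w j \<tau> \<epsilon>) \<longlongrightarrow> w j 0 \<epsilon>) (at 0)"
    using r continuous_on_eq_continuous_at[of "ball 0 r" "\<lambda>\<tau>. w j \<tau> \<epsilon>"] by (simp add: isCont_def)
  hence "((\<lambda>\<tau>. cmod (w j \<tau> \<epsilon>)) \<longlongrightarrow> cmod (w j 0 \<epsilon>)) (at 0)" by (rule tendsto_norm)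
  moreover have "((\<lambda>\<tau>. max K 0 * cmod \<tau> * exp (\<sigma>1 * cmod \<tau> / cmod \<epsilon>)) \<longlongrightarrow> max K 0 * cmod 0 * exp (\<sigma>1 * cmod 0 / cmod \<epsilon>)) (at 0)"
    using assms(2) by (intro tendsto_intros) auto
  moreover have "eventually (\<lambda>\<tau>. cmod (w j \<tau> \<epsilon>) \<le> max K 0 * cmod \<tau> * exp (\<sigma>1 * cmod \<tau> / cmod \<epsilon>)) (at 0)"
    unfolding eventually_at using bd r by (intro exI[of _ r]) (auto simp: dist_norm)
  ultimately have "cmod (w j 0 \<epsilon>) \<le> max K 0 * cmod 0 * exp (\<sigma>1 * cmod 0 / cmod \<epsilon>)"
    by (intro tendsto_le[of "at (0::complex)"]) auto
  thus ?thesis by simp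
qed

lemma w_bounds:
  "\<exists>K>0. \<forall>j\<in>{..<S}. \<forall>\<epsilon>\<in>E. 
     (\<forall>k\<in>{-n..n}. (\<forall>\<tau>\<in>H k. cmod (w j \<tau> \<epsilon>) \<le> K * cmod \<tau> * exp (\<sigma>1 * cmod \<tau> / cmod \<epsilon> - \<sigma>2 * (M - 1) * exp (\<sigma>3 * cmod \<tau>))) \<and>
        (\<forall>\<tau>\<in>J k. cmod (w j \<tau> \<epsilon>) \<le> K * cmod \<tau> * exp (\<sigma>1 * cmod \<tau> / cmod \<epsilon> + s2 * exp (s3 * cmod \<tau>)))) \<and>
     (\<forall>p<\<iota>. \<forall>\<tau>\<in>Sc p. cmod (w j \<tau> \<epsilon>) \<le> K * cmod \<tau> * exp (\<sigma>1 * cmod \<tau> / cmod \<epsilon>))"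
  (is "\<exists>K>0. \<forall>j\<in>_. ?Q j K")
proof (rule finite_uniform_bound)
  fix j assume "j \<in> {..<S}"
  hence j: "j < S" by simp
  then obtain K :: real where K: "\<And>\<epsilon>. \<epsilon> \<in> E \<Longrightarrow> (\<forall>k\<in>{-n..n}. norm_H M \<sigma>1 \<sigma>2 \<sigma>3 (H k) \<epsilon> (\<lambda>\<tau>. w j \<tau> \<epsilon>) \<le> ennreal K \<and>
              norm_J \<sigma>1 s2 s3 (J k) \<epsilon> (\<lambda>\<tau>. w j \<tau> \<epsilon>) \<le> ennreal K) \<and>
           (\<forall>p<\<iota>. norm_S \<sigma>1 (Sc p) \<epsilon> (\<lambda>\<tau>. w j \<tau> \<epsilon>) \<le> ennreal K)"
    using adm unfolding admissible_data_def prod.case by blast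
  have KK: "x \<le> ennreal (max K 0)" if "x \<le> ennreal K" for x
    using that by (rule order_trans) (intro ennreal_leI, simp)
  have "?Q j (max K 0)"
  proof (intro ballI conjI allI impI)
    fix \<epsilon> k \<tau> assume \<epsilon>: "\<epsilon> \<in> E" and k: "k \<in> {-n..n}"
    show "cmod (w j \<tau> \<epsilon>) \<le> max K 0 * cmod \<tau> * exp (\<sigma>1 * cmod \<tau> / cmod \<epsilon> - \<sigma>2 * (M - 1) * exp (\<sigma>3 * cmod \<tau>))" if "\<tau> \<in> H k"
    proof (cases "\<tau> = 0")
      case False
      have "norm_H M \<sigma>1 \<sigma>2 \<sigma>3 (H k) \<epsilon> (\<lambda>\<tau>. w j \<tau> \<epsilon>) \<le> ennreal K" using K[OF \<epsilon>] k by blast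
      from norm_H_bound[OF KK[OF this] that False] show ?thesis by simp
    qed (use w_zero[OF j \<epsilon>] in simp)
    show "cmod (w j \<tau> \<epsilon>) \<le> max K 0 * cmod \<tau> * exp (\<sigma>1 * cmod \<tau> / cmod \<epsilon> + s2 * exp (s3 * cmod \<tau>))" if "\<tau> \<in> J k"
    proof (cases "\<tau> = 0")
      case False
      have "norm_J \<sigma>1 s2 s3 (J k) \<epsilon> (\<lambda>\<tau>. w j \<tau> \<epsilon>) \<le> ennreal K" using K[OF \<epsilon>] k by blast
      from norm_J_bound[OF KK[OF this] that False] show ?thesis by simp
    qed (use w_zero[OF j \<epsilon>] in simp)
  next
    fix \<epsilon> p \<tau> assume \<epsilon>: "\<epsilon> \<in> E" and p: "p < \<iota>" and \<tau>: "\<tau> \<in> Sc p"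
    show "cmod (w j \<tau> \<epsilon>) \<le> max K 0 * cmod \<tau> * exp (\<sigma>1 * cmod \<tau> / cmod \<epsilon>)"
    proof (cases "\<tau> = 0")
      case False
      have "norm_S \<sigma>1 (Sc p) \<epsilon> (\<lambda>\<tau>. w j \<tau> \<epsilon>) \<le> ennreal K" using K[OF \<epsilon>] p by blast
      from norm_S_bound[OF KK[OF this] \<tau> False] show ?thesis by simp
    qed (use w_zero[OF j \<epsilon>] in simp)
  qed
  thus "\<exists>C. ?Q j C" by blast
next
  fix j C C' assume *: "?Q j C" and C: "C \<le> C'"
  have m: "C * x * exp y \<le> C' * x * exp y" if "x \<ge> 0" for x y :: real
    using C that by (intro mult_right_mono) auto
  show "?Q j C'"
    using * m[OF norm_ge_zero] by (meson order_trans)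
qed simp

definition Kw where "Kw = (SOME K. K > 0 \<and> (\<forall>j\<in>{..<S}. \<forall>\<epsilon>\<in>E. 
     (\<forall>k\<in>{-n..n}. (\<forall>\<tau>\<in>H k. cmod (w j \<tau> \<epsilon>) \<le> K * cmod \<tau> * exp (\<sigma>1 * cmod \<tau> / cmod \<epsilon> - \<sigma>2 * (M - 1) * exp (\<sigma>3 * cmod \<tau>))) \<and>
        (\<forall>\<tau>\<in>J k. cmod (w j \<tau> \<epsilon>) \<le> K * cmod \<tau> * exp (\<sigma>1 * cmod \<tau> / cmod \<epsilon> + s2 * exp (s3 * cmod \<tau>)))) \<and>
     (\<forall>p<\<iota>. \<forall>\<tau>\<in>Sc p. cmod (w j \<tau> \<epsilon>) \<le> K * cmod \<tau> * exp (\<sigma>1 * cmod \<tau> / cmod \<epsilon>))))"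

lemma Kw: "Kw > 0"
  "\<And>j \<epsilon> k \<tau>. j < S \<Longrightarrow> \<epsilon> \<in> E \<Longrightarrow> k \<in> {-n..n} \<Longrightarrow> \<tau> \<in> H k \<Longrightarrow> 
     cmod (w j \<tau> \<epsilon>) \<le> Kw * cmod \<tau> * exp (\<sigma>1 * cmod \<tau> / cmod \<epsilon> - \<sigma>2 * (M - 1) * exp (\<sigma>3 * cmod \<tau>))"
  "\<And>j \<epsilon> k \<tau>. j < S \<Longrightarrow> \<epsilon> \<in> E \<Longrightarrow> k \<in> {-n..n} \<Longrightarrow> \<tau> \<in> J k \<Longrightarrow> 
     cmod (w j \<tau> \<epsilon>) \<le> Kw * cmod \<tau> * exp (\<sigma>1 * cmod \<tau> / cmod \<epsilon> + s2 * exp (s3 * cmod \<tau>))"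
  "\<And>j \<epsilon> p \<tau>. j < S \<Longrightarrow> \<epsilon> \<in> E \<Longrightarrow> p < \<iota> \<Longrightarrow> \<tau> \<in> Sc p \<Longrightarrow> 
     cmod (w j \<tau> \<epsilon>) \<le> Kw * cmod \<tau> * exp (\<sigma>1 * cmod \<tau> / cmod \<epsilon>)"
  using someI_ex[OF w_bounds, folded Kw_def] by simp_all

text \<open>\<open>rsum b j \<ge> 1\<close> turns a bound on the data with the plain weight into the
  hypothesis of \<open>radius_ok\<close> for each index \<open>j < S\<close>; in the conclusion
  \<open>\<zeta>\<close> dominates all partial sums.\<close>

lemma v_bound:
  assumes G: "(G, X) \<in> weights"
    and \<tau>: "\<tau> \<in> X" "\<tau> \<in> Ydom" and \<epsilon>: "\<epsilon> \<in> E" and Kt: "Kt \<ge> 0"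
    and wb: "\<And>j. j < S \<Longrightarrow> cmod (w j \<tau> \<epsilon>) \<le> Kt * exp (\<sigma>1 * cmod \<tau> / cmod \<epsilon> + G \<tau>)"
  shows "cmod (v \<beta> \<tau> \<epsilon>) \<le> Kt * exp (\<zeta> * (\<sigma>1 * cmod \<tau> / cmod \<epsilon> + G \<tau>)) / R ^ \<beta>"
proof -
  have "G \<tau> \<ge> 0" using G pos by (auto simp: weights_def GH_def GJ_def)
  hence L: "\<sigma>1 * cmod \<tau> / cmod \<epsilon> + G \<tau> \<ge> 0" using pos by simp
  have "cmod (w j \<tau> \<epsilon>) \<le> Kt * exp (rsum b j * (\<sigma>1 * cmod \<tau> / cmod \<epsilon> + G \<tau>))" if "j < S" for j
  proof -
    have "1 * (\<sigma>1 * cmod \<tau> / cmod \<epsilon> + G \<tau>) \<le> rsum b j * (\<sigma>1 * cmod \<tau> / cmod \<epsilon> + G \<tau>)"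
      using rsum_ge_1 L by (intro mult_right_mono) auto
    hence "Kt * exp (\<sigma>1 * cmod \<tau> / cmod \<epsilon> + G \<tau>) \<le> Kt * exp (rsum b j * (\<sigma>1 * cmod \<tau> / cmod \<epsilon> + G \<tau>))"
      using Kt by (intro mult_left_mono) auto
    thus ?thesis using wb[OF that] by linarith
  qed
  hence "cmod (v \<beta> \<tau> \<epsilon>) \<le> Kt * exp (rsum b \<beta> * (\<sigma>1 * cmod \<tau> / cmod \<epsilon> + G \<tau>)) / R ^ \<beta>"
    using Rok G \<tau> \<epsilon> Kt unfolding radius_ok_def v_def by blast
  also have "\<dots> \<le> Kt * exp (\<zeta> * (\<sigma>1 * cmod \<tau> / cmod \<epsilon> + G \<tau>)) / R ^ \<beta>"
    using rsum_le_zeta[OF b] L Kt R by (intro divide_right_mono mult_left_mono exp_le_cancel_iff[THEN iffD2] mult_right_mono) auto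
  finally show ?thesis .
qed

definition QH where "QH \<tau> \<epsilon> = Kw * cmod \<tau> * exp (\<zeta> * (\<sigma>1 * cmod \<tau> / cmod \<epsilon>) - (M - \<zeta>) * GH \<tau>)"
definition QJ where "QJ \<tau> \<epsilon> = Kw * cmod \<tau> * exp (\<zeta> * (\<sigma>1 * cmod \<tau> / cmod \<epsilon> + GJ \<tau>))"
definition QS where "QS \<tau> \<epsilon> = Kw * cmod \<tau> * exp (\<zeta> * (\<sigma>1 * cmod \<tau> / cmod \<epsilon>))"

lemma H_sub: "k \<in> {-n..n} \<Longrightarrow> H k \<subseteq> HJ" and J_sub: "k \<in> {-n..n} \<Longrightarrow> J k \<subseteq> HJ"
  using strip_bounds_chain[OF sb n, of k] by (auto simp: H_def J_def HJ_def strip_def)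

text \<open>The data decay like the exponential of \<open>- (M - 1) * GH\<close>, but the weights
  need a positive exponent. Write it as \<open>- M * GH + GH\<close> and put
  \<open>exp(- M * GH)\<close> into \<open>Kt\<close>, which may depend on \<tau> because the
  recursion is pointwise in \<tau>. The recursion raises \<open>GH\<close> to
  \<open>\<zeta> * GH\<close>, and \<open>- (M - \<zeta>) * GH\<close> remains.\<close>

lemma v_H:
  assumes "k \<in> {-n..n}" "\<tau> \<in> H k" "\<epsilon> \<in> E" shows "cmod (v \<beta> \<tau> \<epsilon>) \<le> QH \<tau> \<epsilon> / R ^ \<beta>"
proof -
  have "cmod (v \<beta> \<tau> \<epsilon>) \<le> (Kw * cmod \<tau> * exp (- M * GH \<tau>)) * exp (\<zeta> * (\<sigma>1 * cmod \<tau> / cmod \<epsilon> + GH \<tau>)) / R ^ \<beta>"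
  proof (rule v_bound)
    show "(GH, UNIV) \<in> weights" by (simp add: weights_def)
    show "cmod (w j \<tau> \<epsilon>) \<le> (Kw * cmod \<tau> * exp (- M * GH \<tau>)) * exp (\<sigma>1 * cmod \<tau> / cmod \<epsilon> + GH \<tau>)" if "j < S" for j
    proof -
      have "exp (- M * GH \<tau>) * exp (\<sigma>1 * cmod \<tau> / cmod \<epsilon> + GH \<tau>) = exp (\<sigma>1 * cmod \<tau> / cmod \<epsilon> - \<sigma>2 * (M - 1) * exp (\<sigma>3 * cmod \<tau>))"
        unfolding exp_add[symmetric] GH_def by (simp add: algebra_simps)
      thus ?thesis using Kw(2)[OF that assms(3,1,2)] by (simp add: mult.assoc)
    qed
  qed (use assms H_sub HJ_Y Kw(1) in auto)
  also have "exp (- M * GH \<tau>) = exp (\<zeta> * (\<sigma>1 * cmod \<tau> / cmod \<epsilon>) - (M - \<zeta>) * GH \<tau>) / exp (\<zeta> * (\<sigma>1 * cmod \<tau> / cmod \<epsilon> + GH \<tau>))"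
    unfolding exp_diff[symmetric] by (simp add: algebra_simps)
  finally show ?thesis by (simp add: QH_def)
qed

text \<open>Segments from 0 and between corners cross strips of both kinds, so one bound on all of
  \<open>HJ\<close> is needed; on the \<open>H\<close> strips it gives the decay away.\<close>

lemma v_HJ:
  assumes "\<tau> \<in> HJ" "\<epsilon> \<in> E" shows "cmod (v \<beta> \<tau> \<epsilon>) \<le> QJ \<tau> \<epsilon> / R ^ \<beta>"
proof -
  obtain k where k: "k \<in> {-n..n}" "\<tau> \<in> H k \<or> \<tau> \<in> J k"
    using strip_cover[OF sb n, of \<tau>] assms by (auto simp: HJ_def H_def J_def)
  show ?thesis
  proof (cases "\<tau> \<in> H k")
    case True
    have "- (M - \<zeta>) * GH \<tau> \<le> 0" using M pos by (intro mult_nonpos_nonneg) (auto simp: GH_def)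
    moreover have "\<zeta> * GJ \<tau> \<ge> 0" using zeta_sum_ge_1[OF b] pos by (simp add: GJ_def)
    ultimately have "\<zeta> * (\<sigma>1 * cmod \<tau> / cmod \<epsilon>) - (M - \<zeta>) * GH \<tau> \<le> \<zeta> * (\<sigma>1 * cmod \<tau> / cmod \<epsilon> + GJ \<tau>)"
      by (simp add: algebra_simps)
    hence "QH \<tau> \<epsilon> / R ^ \<beta> \<le> QJ \<tau> \<epsilon> / R ^ \<beta>"
      unfolding QH_def QJ_def using Kw(1) R by (intro divide_right_mono mult_left_mono) auto
    thus ?thesis using v_H[OF k(1) True assms(2), of \<beta>] by linarith
  next
    case False
    hence kJ: "\<tau> \<in> J k" using k by blast
    have "cmod (v \<beta> \<tau> \<epsilon>) \<le> (Kw * cmod \<tau>) * exp (\<zeta> * (\<sigma>1 * cmod \<tau> / cmod \<epsilon> + GJ \<tau>)) / R ^ \<beta>"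
    proof (rule v_bound)
      show "(GJ, UNIV) \<in> weights" by (simp add: weights_def)
      show "cmod (w j \<tau> \<epsilon>) \<le> (Kw * cmod \<tau>) * exp (\<sigma>1 * cmod \<tau> / cmod \<epsilon> + GJ \<tau>)" if "j < S" for j
        using Kw(3)[OF that assms(2) k(1) kJ] by (simp add: GJ_def)
    qed (use assms HJ_Y Kw(1) in auto)
    thus ?thesis by (simp add: QJ_def)
  qed
qed

lemma v_S:
  assumes "p < \<iota>" "\<tau> \<in> Sc p" "\<epsilon> \<in> E" shows "cmod (v \<beta> \<tau> \<epsilon>) \<le> QS \<tau> \<epsilon> / R ^ \<beta>"
proof -
  have "cmod (v \<beta> \<tau> \<epsilon>) \<le> (Kw * cmod \<tau>) * exp (\<zeta> * (\<sigma>1 * cmod \<tau> / cmod \<epsilon> + (\<lambda>_. 0) \<tau>)) / R ^ \<beta>"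
  proof (rule v_bound)
    show "((\<lambda>_. 0), {z. Re z \<ge> - r}) \<in> weights" by (simp add: weights_def)
    show "cmod (w j \<tau> \<epsilon>) \<le> (Kw * cmod \<tau>) * exp (\<sigma>1 * cmod \<tau> / cmod \<epsilon> + (\<lambda>_. 0) \<tau>)" if "j < S" for j
      using Kw(4)[OF that assms(3,1,2)] by simp
  qed (use assms Sc_Re[OF assms(1,2)] Sc_Y[OF assms(1)] Kw(1) in auto)
  thus ?thesis by (simp add: QS_def)
qed

lemma tc_hol: "k \<in> \<A> \<Longrightarrow> taylor_coeff c k m holomorphic_on ball 0 \<epsilon>0"
proof -
  assume k: "k \<in> \<A>"
  then obtain C where "\<And>z \<epsilon>. z \<in> ball 0 \<rho> \<Longrightarrow> \<epsilon> \<in> ball 0 \<epsilon>0 \<Longrightarrow> cmod (c k z \<epsilon>) \<le> C"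
    using cb[OF k] unfolding bounded_iff by fastforce
  thus ?thesis by (intro taylor_coeff_holomorphic[where c = c and k = k, OF ch[OF k] \<rho>]) auto
qed

lemma tc_hol_E: assumes "k \<in> \<A>" shows "taylor_coeff c k m holomorphic_on E"
  by (rule holomorphic_on_subset[OF tc_hol[OF assms]]) auto

lemma v_cont:
  assumes "X \<subseteq> Ydom" and "\<And>j. j < S \<Longrightarrow> continuous_on (X \<times> E) (\<lambda>(\<tau>, \<epsilon>). w j \<tau> \<epsilon>)"
  shows "continuous_on (X \<times> E) (\<lambda>(\<tau>, \<epsilon>). v \<beta> \<tau> \<epsilon>)"
  unfolding v_def
  by (rule borel_coeff_continuous)
    (use assms Pnz in \<open>auto intro!: holomorphic_on_imp_continuous_on tc_hol_E\<close>)

lemma So_open: "p < \<iota> \<Longrightarrow> open (So p)"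
proof -
  assume p: "p < \<iota>"
  have "0 < S" using S1 by simp
  hence "open (So p \<times> E)" using w_regular(3)[of 0 p] p by (auto simp: holomorphic2_on_def)
  moreover have "of_real (\<epsilon>0 / 2) \<in> E" using \<epsilon>0 by simp
  ultimately have "So p = (\<lambda>\<tau>. (\<tau>, of_real (\<epsilon>0 / 2))) -` (So p \<times> E)" by auto
  also have "open \<dots>" by (rule open_vimage[OF \<open>open (So p \<times> E)\<close>]) (intro continuous_intros)
  finally show ?thesis .
qed

lemma So_Sc: "So p \<subseteq> Sc p" "Sc p \<subseteq> closure (So p)"
  using closure_subset[of "Sd p"] r by (auto simp: closure_Un)

lemma cHJ: "cJ (-n) < bH n"
  using strip_bounds_chain[OF sb n, of n] n by auto

lemma HJ_closure: "HJ \<subseteq> closure (interior HJ)"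
  unfolding HJ_def by (rule strip_subset_closure_interior[OF cHJ])

lemma w_eps_HJ: assumes "j < S" "\<tau> \<in> HJ" shows "w j \<tau> holomorphic_on E"
proof (rule holomorphic_on_closure_param[OF w_regular(2)[OF assms(1)] interior_subset HJ_closure])
  show "w j x holomorphic_on E" if "x \<in> interior HJ" for x
    using holomorphic2_on_section2[OF w_regular(1)[OF assms(1)] that] .
qed (use assms in auto)

lemma w_eps_S: assumes "j < S" "p < \<iota>" "\<tau> \<in> Sc p" shows "w j \<tau> holomorphic_on E"
proof (rule holomorphic_on_closure_param[OF w_regular(4)[OF assms(1,2)], of "So p"])
  show "w j x holomorphic_on E" if "x \<in> So p" for x
    using holomorphic2_on_section2[OF w_regular(3)[OF assms(1,2)] that] .
qed (use So_Sc assms in auto)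

lemma v_eps: assumes "\<tau> \<in> HJ \<or> (\<exists>p<\<iota>. \<tau> \<in> Sc p)" shows "v \<beta> \<tau> holomorphic_on E"
proof -
  have "w j \<tau> holomorphic_on E" if "j < S" for j
    using assms w_eps_HJ[OF that] w_eps_S[OF that] by blast
  hence "borel_coeff P S \<A> (taylor_coeff c) w \<beta> \<tau> holomorphic_on E"
    by (rule borel_coeff_holomorphic_param) (auto intro!: tc_hol_E)
  thus ?thesis by (simp add: v_def[abs_def])
qed

lemma FJ: "power_series_family v QJ R HJ E"
proof
  show "continuous_on (HJ \<times> E) (\<lambda>(\<tau>, \<epsilon>). QJ \<tau> \<epsilon>)"
    unfolding QJ_def GJ_def split_def by (intro continuous_intros) auto
  show "continuous_on (HJ \<times> E) (\<lambda>(\<tau>, \<epsilon>). v \<beta> \<tau> \<epsilon>)" for \<beta>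
    by (rule v_cont[OF HJ_Y w_regular(2)])
qed (use R v_HJ in auto)

lemma family_W: "power_series_family.W v = W"
  by (intro ext) (simp add: W_def power_series_family.W_def[OF FJ])

lemma FS: assumes "p < \<iota>" shows "power_series_family v QS R (Sc p) E"
proof
  show "continuous_on (Sc p \<times> E) (\<lambda>(\<tau>, \<epsilon>). QS \<tau> \<epsilon>)"
    unfolding QS_def split_def by (intro continuous_intros) auto
  show "continuous_on (Sc p \<times> E) (\<lambda>(\<tau>, \<epsilon>). v \<beta> \<tau> \<epsilon>)" for \<beta>
    by (rule v_cont[OF Sc_Y[OF assms] w_regular(4)[OF _ assms]])
qed (use R v_S assms in auto)

abbreviation "in_dom \<tau> \<equiv> \<tau> \<in> HJ \<or> (\<exists>p<\<iota>. \<tau> \<in> Sc p)"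

lemma in_dom_Y: "in_dom \<tau> \<Longrightarrow> \<tau> \<in> Ydom" using HJ_Y Sc_Y by blast

lemma v_in_dom: assumes "in_dom \<tau>" "\<epsilon> \<in> E" obtains Q where "\<And>\<beta>. cmod (v \<beta> \<tau> \<epsilon>) \<le> Q / R ^ \<beta>"
  using assms v_HJ v_S by blast

lemma W_z:
  assumes "in_dom \<tau>" "\<epsilon> \<in> E"
  shows "(\<lambda>z. W \<tau> z \<epsilon>) holomorphic_on D"
    and "j < S \<Longrightarrow> (deriv ^^ j) (\<lambda>z. W \<tau> z \<epsilon>) 0 = w j \<tau> \<epsilon>"
    and "z \<in> D \<Longrightarrow> poly P \<tau> * (deriv ^^ S) (\<lambda>z. W \<tau> z \<epsilon>) z =
      (\<Sum>k\<in>\<A>. c k z \<epsilon> * ((\<tau> / \<epsilon>) ^ fst k * exp (- (of_nat (snd (snd k)) * \<tau>)) * (deriv ^^ fst (snd k)) (\<lambda>z. W \<tau> z \<epsilon>) z))"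
proof -
  obtain Q where Q: "\<And>\<beta>. cmod (v \<beta> \<tau> \<epsilon>) \<le> Q / R ^ \<beta>" using v_in_dom[OF assms] by blast
  note ps = power_series_regular[OF R(1) Q, folded W_def]
  show "(\<lambda>z. W \<tau> z \<epsilon>) holomorphic_on D" by (rule holomorphic_on_subset[OF ps(1)]) (use R in auto)
  show "j < S \<Longrightarrow> (deriv ^^ j) (\<lambda>z. W \<tau> z \<epsilon>) 0 = w j \<tau> \<epsilon>"
    using ps(3)[of j] by (simp add: v_def borel_coeff.simps)
  assume z: "z \<in> D"
  show "poly P \<tau> * (deriv ^^ S) (\<lambda>z. W \<tau> z \<epsilon>) z =
      (\<Sum>k\<in>\<A>. c k z \<epsilon> * ((\<tau> / \<epsilon>) ^ fst k * exp (- (of_nat (snd (snd k)) * \<tau>)) * (deriv ^^ fst (snd k)) (\<lambda>z. W \<tau> z \<epsilon>) z))"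
    unfolding W_def v_def
  proof (rule borel_series_pde[OF fin _ _ R(1) R(3) Pnz[OF in_dom_Y[OF assms(1)]] Q[unfolded v_def]])
    show "fst (snd k) < S" if "k \<in> \<A>" for k using A1[of "fst k" "fst (snd k)" "snd (snd k)"] that by auto
    show "(\<lambda>z. c k z \<epsilon>) holomorphic_on ball 0 \<rho>" if "k \<in> \<A>" for k
      by (rule holomorphic2_on_section1[OF ch[OF that]]) (use assms in auto)
    show "z \<in> ball 0 R" using z R by auto
  qed
qed

lemma W_bound_of:
  assumes "\<And>\<beta>. cmod (v \<beta> \<tau> \<epsilon>) \<le> Q / R ^ \<beta>" "z \<in> D"
  shows "cmod (W \<tau> z \<epsilon>) \<le> 2 * Q"
proof -
  \<comment> \<open>A single point serves as domain: continuity of the majorant is then trivial, and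
    any pointwise bound \<open>Q\<close> can be used.\<close>
  have F: "power_series_family v (\<lambda>_ _. Q) R {\<tau>} {\<epsilon>}"
    by unfold_locales (use assms R in \<open>auto intro!: continuous_intros\<close>)
  show ?thesis
    using power_series_family.W_bound[OF F, of \<tau> \<epsilon> z] assms by (simp add: family_W)
qed

lemma W_eps: assumes "in_dom \<tau>" "z \<in> D" shows "(\<lambda>\<epsilon>. W \<tau> z \<epsilon>) holomorphic_on E"
proof -
  have E: "open E" by (intro open_delete) auto
  have z: "cmod z \<le> R / 2" using assms by simp
  show ?thesis
    using assms(1) power_series_family.W_holomorphic_param[OF FJ E v_eps[OF assms(1)] _ z, unfolded family_W]
      power_series_family.W_holomorphic_param[OF FS E v_eps[OF assms(1)] _ z, unfolded family_W] by blast
qed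

lemma W_cont:
  "continuous_on (HJ \<times> D \<times> E) (\<lambda>(\<tau>, z, \<epsilon>). W \<tau> z \<epsilon>)"
  "p < \<iota> \<Longrightarrow> continuous_on (Sc p \<times> D \<times> E) (\<lambda>(\<tau>, z, \<epsilon>). W \<tau> z \<epsilon>)"
  using power_series_family.W_continuous[OF FJ] power_series_family.W_continuous[OF FS] by (auto simp: family_W)

lemma W_arg:
  assumes "\<epsilon> \<in> E" "z \<in> D"
  shows "(\<lambda>\<tau>. W \<tau> z \<epsilon>) holomorphic_on interior HJ" "p < \<iota> \<Longrightarrow> (\<lambda>\<tau>. W \<tau> z \<epsilon>) holomorphic_on So p"
proof -
  have z: "cmod z \<le> R / 2" using assms by simp
  have *: "(\<lambda>\<tau>. v \<beta> \<tau> \<epsilon>) holomorphic_on X" if "X \<subseteq> Ydom" "\<And>j. j < S \<Longrightarrow> holomorphic2_on (w j) (X \<times> E)" for X \<beta>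
    unfolding v_def
    by (rule borel_coeff_holomorphic_arg) (use that Pnz assms in \<open>auto intro: holomorphic2_on_section1[OF that(2)]\<close>)
  show "(\<lambda>\<tau>. W \<tau> z \<epsilon>) holomorphic_on interior HJ"
    using power_series_family.W_holomorphic_arg[OF FJ open_interior interior_subset *[OF _ w_regular(1)] assms(1) z]
      HJ_Y interior_subset[of HJ] by (auto simp: family_W)
  show "(\<lambda>\<tau>. W \<tau> z \<epsilon>) holomorphic_on So p" if p: "p < \<iota>"
    using power_series_family.W_holomorphic_arg[OF FS[OF p] So_open[OF p] So_Sc(1) *[OF _ w_regular(3)[OF _ p]] assms(1) z]
      Sc_Y[OF p] So_Sc(1)[of p] unfolding family_W by blast
qed

lemma W_holomorphic3:
  "holomorphic3_on W (interior HJ \<times> D \<times> E)" "p < \<iota> \<Longrightarrow> holomorphic3_on W (So p \<times> D \<times> E)"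
proof -
  have E: "open E" by (intro open_delete) auto
  have gen: "holomorphic3_on W (X \<times> D \<times> E)" if X: "open X" "\<And>\<tau>. \<tau> \<in> X \<Longrightarrow> in_dom \<tau>"
    "continuous_on (X \<times> D \<times> E) (\<lambda>(\<tau>, z, \<epsilon>). W \<tau> z \<epsilon>)" "\<And>z \<epsilon>. \<epsilon> \<in> E \<Longrightarrow> z \<in> D \<Longrightarrow> (\<lambda>\<tau>. W \<tau> z \<epsilon>) holomorphic_on X" for X
  proof (rule holomorphic3_onI)
    show "open (X \<times> D \<times> E)" using X E by (intro open_Times) auto
    fix \<tau> z \<epsilon> assume "(\<tau>, z, \<epsilon>) \<in> X \<times> D \<times> E"
    hence m: "\<tau> \<in> X" "z \<in> D" "\<epsilon> \<in> E" by auto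
    show "(\<lambda>\<tau>. W \<tau> z \<epsilon>) field_differentiable at \<tau>" using X(4)[OF m(3,2)] X(1) m(1) holomorphic_on_imp_differentiable_at by blast
    show "(\<lambda>z. W \<tau> z \<epsilon>) field_differentiable at z" using W_z(1)[OF X(2)[OF m(1)] m(3)] m(2) holomorphic_on_imp_differentiable_at[OF _ open_ball] by blast
    show "(\<lambda>\<epsilon>. W \<tau> z \<epsilon>) field_differentiable at \<epsilon>" using W_eps[OF X(2)[OF m(1)] m(2)] E m(3) holomorphic_on_imp_differentiable_at by blast
  qed (rule X)
  show "holomorphic3_on W (interior HJ \<times> D \<times> E)"
    by (rule gen) (use interior_subset[of HJ] W_arg(1) in \<open>auto intro!: continuous_on_subset[OF W_cont(1)]\<close>)
  show "holomorphic3_on W (So p \<times> D \<times> E)" if p: "p < \<iota>"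
  proof (rule gen)
    show "continuous_on (So p \<times> D \<times> E) (\<lambda>(\<tau>, z, \<epsilon>). W \<tau> z \<epsilon>)"
      by (rule continuous_on_subset[OF W_cont(2)[OF p]]) (use So_Sc(1)[of p] in blast)
    show "in_dom \<tau>" if "\<tau> \<in> So p" for \<tau> using that So_Sc(1)[of p] p by blast
  qed (use So_open[OF p] W_arg(2)[OF _ _ p] in blast)+
qed

lemma W_H: "k \<in> {-n..n} \<Longrightarrow> \<tau> \<in> H k \<Longrightarrow> \<epsilon> \<in> E \<Longrightarrow> z \<in> D \<Longrightarrow> cmod (W \<tau> z \<epsilon>) \<le> 2 * QH \<tau> \<epsilon>"
  and W_HJ: "\<tau> \<in> HJ \<Longrightarrow> \<epsilon> \<in> E \<Longrightarrow> z \<in> D \<Longrightarrow> cmod (W \<tau> z \<epsilon>) \<le> 2 * QJ \<tau> \<epsilon>"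
  and W_S: "p < \<iota> \<Longrightarrow> \<tau> \<in> Sc p \<Longrightarrow> \<epsilon> \<in> E \<Longrightarrow> z \<in> D \<Longrightarrow> cmod (W \<tau> z \<epsilon>) \<le> 2 * QS \<tau> \<epsilon>"
  using v_H v_HJ v_S by (blast intro: W_bound_of)+

end

section \<open>Laplace integrals along bent paths\<close>

text \<open>Parametrises the segment by \<open>-1 \<le> s < 0\<close> and the half-line by
  \<open>s \<ge> 0\<close>, so that a Laplace integral is one integral over \<open>{-1..}\<close>.
  Direction \<open>- 1\<close> gives the paths in the strips; corner 0 gives the rays in the
  sectors, the segment being degenerate.\<close>

definition bent_path :: "complex \<Rightarrow> complex \<Rightarrow> real \<Rightarrow> complex" where
  "bent_path a e s = (if s < 0 then of_real (1 + s) * a else a + of_real s * e)"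

definition bent_speed :: "complex \<Rightarrow> complex \<Rightarrow> real \<Rightarrow> complex" where
  "bent_speed a e s = (if s < 0 then a else e)"

definition ray_path_integral :: "complex \<Rightarrow> complex \<Rightarrow> (complex \<Rightarrow> complex) \<Rightarrow> complex" where
  "ray_path_integral a e f = contour_integral (linepath 0 a) f + ray_integral a e f"

lemma bent_path_integral_eq_ray: "bent_path_integral a f = ray_path_integral a (- 1) f"
  by (simp add: bent_path_integral_def ray_path_integral_def)

lemma ray_integral_eq_ray: "ray_integral 0 e f = ray_path_integral 0 e f"
  by (simp add: ray_path_integral_def)

lemma continuous_on_bent_path: "continuous_on X (bent_path a e)"
proof -
  have "continuous_on ({..0} \<union> {0..}) (\<lambda>s. if s \<in> {..0} then of_real (1 + s) * a else a + of_real s * e)"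
    by (rule continuous_on_If) (auto intro!: continuous_intros)
  hence "continuous_on UNIV (\<lambda>s::real. if s \<in> {..0} then of_real (1 + s) * a else a + of_real s * e)"
    by (rule continuous_on_subset) auto
  moreover have "(\<lambda>s::real. if s \<in> {..0} then of_real (1 + s) * a else a + of_real s * e) = bent_path a e"
    by (auto simp: bent_path_def fun_eq_iff)
  ultimately have "continuous_on UNIV (bent_path a e)" by (simp only:)
  thus ?thesis by (rule continuous_on_subset) simp
qed

text \<open>The half-line of parameters is cut at 0, where \<open>bent_speed\<close> jumps. The
  value at this single parameter is wrong for the segment but negligible.\<close>

lemma ray_path_integral_eq:
  assumes i: "integrable (lebesgue_on {-1..}) (\<lambda>s. f (bent_path a e s) * bent_speed a e s)"
  shows "f contour_integrable_on (linepath 0 a)" "ray_integrable a e f"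
    "ray_path_integral a e f = (LINT s|lebesgue_on {-1..}. f (bent_path a e s) * bent_speed a e s)"
proof -
  let ?F = "\<lambda>s. f (bent_path a e s) * bent_speed a e s"
  have ai: "?F absolutely_integrable_on {-1..}"
    using i by (simp add: set_integrable_def integrable_restrict_space)
  have ai1: "?F absolutely_integrable_on {-1..0}" by (rule set_integrable_subset[OF ai]) auto
  have ai2: "?F absolutely_integrable_on {0..}" by (rule set_integrable_subset[OF ai]) auto
  show r: "ray_integrable a e f"
    unfolding ray_integrable_def
    by (rule set_integrable_cong[THEN iffD1, OF refl refl _ ai2]) (auto simp: bent_path_def bent_speed_def)
  have i1: "(?F has_integral integral {-1..0} ?F) {-1..0}"
    using ai1 by (simp add: absolutely_integrable_on_def integrable_integral)
  have "((\<lambda>s. f (of_real (1 + s) * a) * a) has_integral integral {-1..0} ?F) {-1..0}"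
    by (rule has_integral_spike[OF negligible_sing[of 0] _ i1]) (auto simp: bent_path_def bent_speed_def)
  from has_integral_shift_real_ivl[OF this, of "- 1"]
  have "((\<lambda>x. f (of_real x * a) * a) has_integral integral {-1..0} ?F) {0..1}" by simp
  hence ci: "(f has_contour_integral integral {-1..0} ?F) (linepath 0 a)"
    unfolding has_contour_integral_linepath by (simp add: linepath_def scaleR_conv_of_real)
  thus "f contour_integrable_on (linepath 0 a)" by (auto simp: contour_integrable_on_def)
  have "(?F has_integral integral {0..} ?F) {0..}"
    using ai2 by (simp add: absolutely_integrable_on_def integrable_integral)
  hence "(?F has_integral integral {-1..0} ?F + integral {0..} ?F) ({-1..0} \<union> {0..})"
    using negligible_sing[of "0 :: real"] by (intro has_integral_Un[OF i1]) (auto elim: negligible_subset)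
  moreover have "{-1..0} \<union> {0..} = {-1::real..}" by auto
  ultimately have "(?F has_integral integral {-1..0} ?F + integral {0..} ?F) {-1..}" by (simp only:)
  hence "integral {-1..} ?F = integral {-1..0} ?F + integral {0..} ?F" by (rule integral_unique)
  moreover have "integral {0..} ?F = ray_integral a e f"
    unfolding ray_integral_def by (rule integral_cong) (auto simp: bent_path_def bent_speed_def)
  moreover have "integral {-1..} ?F = (LINT s|lebesgue_on {-1..}. ?F s)"
    using lebesgue_integral_eq_integral[OF i] by simp
  ultimately show "ray_path_integral a e f = (LINT s|lebesgue_on {-1..}. ?F s)"
    using contour_integral_unique[OF ci] by (simp add: ray_path_integral_def)
qed

section \<open>Laplace integrals as solutions of the equation\<close>

lemma higher_deriv_cmult_open:
  assumes U: "open U" and f: "f holomorphic_on U" and z: "z \<in> U"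
  shows "(deriv ^^ n) (\<lambda>y. f y * C) z = (deriv ^^ n) f z * (C :: complex)"
  using z
proof (induction n arbitrary: z)
  case (Suc n)
  have "deriv ((deriv ^^ n) (\<lambda>y. f y * C)) z = deriv (\<lambda>z. (deriv ^^ n) f z * C) z"
    by (rule deriv_cong_ev) (use Suc U in \<open>auto simp: eventually_nhds intro!: exI[of _ U]\<close>)
  also have "\<dots> = deriv ((deriv ^^ n) f) z * C"
    using holomorphic_on_imp_differentiable_at[OF holomorphic_higher_deriv[OF f U] U Suc.prems]
    by simp
  finally show ?case by simp
qed simp

text \<open>In the variable \<open>t\<close> the Laplace kernel is an eigenfunction of
  \<open>t2d\<close> with eigenvalue \<open>\<tau> / \<epsilon>\<close>.\<close>

lemma t2d_funpow_exp:
  assumes "\<epsilon> \<noteq> 0" "t \<noteq> 0"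
  shows "(t2d ^^ i) (\<lambda>t. C * exp (- (\<tau> / (\<epsilon> * t)))) t = (\<tau> / \<epsilon>) ^ i * (C * exp (- (\<tau> / (\<epsilon> * t))))"
  using assms(2)
proof (induction i arbitrary: t)
  case (Suc i)
  have "deriv ((t2d ^^ i) (\<lambda>t. C * exp (- (\<tau> / (\<epsilon> * t))))) t =
        deriv (\<lambda>t. (\<tau> / \<epsilon>) ^ i * (C * exp (- (\<tau> / (\<epsilon> * t))))) t"
    by (rule deriv_cong_ev) (use Suc in \<open>auto simp: eventually_nhds intro!: exI[of _ "- {0}"]\<close>)
  also have "((\<lambda>t. (\<tau> / \<epsilon>) ^ i * (C * exp (- (\<tau> / (\<epsilon> * t))))) has_field_derivative
        (\<tau> / \<epsilon>) ^ i * (C * (exp (- (\<tau> / (\<epsilon> * t))) * (\<tau> / (\<epsilon> * t^2))))) (at t)"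
    using assms Suc.prems by (auto intro!: derivative_eq_intros simp: field_simps power2_eq_square)
  hence "deriv (\<lambda>t. (\<tau> / \<epsilon>) ^ i * (C * exp (- (\<tau> / (\<epsilon> * t))))) t = 
        (\<tau> / \<epsilon>) ^ i * (C * (exp (- (\<tau> / (\<epsilon> * t))) * (\<tau> / (\<epsilon> * t^2))))" by (rule DERIV_imp_deriv)
  finally have "deriv ((t2d ^^ i) (\<lambda>t. C * exp (- (\<tau> / (\<epsilon> * t))))) t = 
        (\<tau> / \<epsilon>) ^ i * (C * (exp (- (\<tau> / (\<epsilon> * t))) * (\<tau> / (\<epsilon> * t^2))))" .
  thus ?case using Suc.prems t2d_def[of "(t2d ^^ i) (\<lambda>t. C * exp (- (\<tau> / (\<epsilon> * t))))" t] by simp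
qed simp

locale laplace_path =
  fixes a e :: complex and W :: "complex \<Rightarrow> complex \<Rightarrow> complex \<Rightarrow> complex" and D B :: "complex set"
    and \<Omega> :: "(complex \<times> complex \<times> complex) set"
  assumes \<Omega>: "open \<Omega>" "\<Omega> \<subseteq> (- {0}) \<times> D \<times> B" and B0: "0 \<notin> B" and D: "open D" and B: "open B"
    and Wc: "continuous_on (bent_path a e ` {-1..} \<times> D \<times> B) (\<lambda>(\<tau>, z, \<epsilon>). W \<tau> z \<epsilon>)"
    and Wz: "\<And>s \<epsilon>. s \<ge> -1 \<Longrightarrow> \<epsilon> \<in> B \<Longrightarrow> (\<lambda>z. W (bent_path a e s) z \<epsilon>) holomorphic_on D"
    and We: "\<And>s z. s \<ge> -1 \<Longrightarrow> z \<in> D \<Longrightarrow> (\<lambda>\<epsilon>. W (bent_path a e s) z \<epsilon>) holomorphic_on B"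
    and dom: "\<And>p. p \<in> \<Omega> \<Longrightarrow> \<exists>V h. open V \<and> p \<in> V \<and> integrable (lebesgue_on {-1..}) h \<and>
        (\<forall>t z \<epsilon> s. (t, z, \<epsilon>) \<in> V \<inter> \<Omega> \<longrightarrow> s \<ge> -1 \<longrightarrow>
           cmod (laplace_kernel (\<lambda>\<tau>. W \<tau> z \<epsilon>) (\<epsilon> * t) (bent_path a e s) * bent_speed a e s) \<le> h s)"
begin

abbreviation "M \<equiv> lebesgue_on {-1::real..}"
abbreviation "p \<equiv> bent_path a e"

definition I :: "complex \<Rightarrow> complex \<Rightarrow> complex \<Rightarrow> real \<Rightarrow> complex" where
  "I t z \<epsilon> s = laplace_kernel (\<lambda>\<tau>. W \<tau> z \<epsilon>) (\<epsilon> * t) (p s) * bent_speed a e s"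

definition U :: "complex \<Rightarrow> complex \<Rightarrow> complex \<Rightarrow> complex" where
  "U t z \<epsilon> = (LINT s|M. I t z \<epsilon> s)"

lemma \<Omega>D: "(t, z, \<epsilon>) \<in> \<Omega> \<Longrightarrow> t \<noteq> 0 \<and> \<epsilon> \<noteq> 0 \<and> z \<in> D \<and> \<epsilon> \<in> B"
  using \<Omega> B0 by auto

lemma I_eq: "I t z \<epsilon> s = W (p s) z \<epsilon> * (exp (- (p s / (\<epsilon> * t))) / p s * bent_speed a e s)"
  by (simp add: I_def laplace_kernel_def)

lemma measurable_path: "p \<in> borel_measurable M" "bent_speed a e \<in> borel_measurable M"
proof -
  show "p \<in> borel_measurable M"
    by (rule continuous_imp_measurable_on_sets_lebesgue[OF continuous_on_bent_path]) auto
  have "bent_speed a e \<in> borel_measurable borel" unfolding bent_speed_def by measurable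
  hence "bent_speed a e \<in> borel_measurable lebesgue" by (intro measurable_completion) simp
  thus "bent_speed a e \<in> borel_measurable M" by (rule measurable_restrict_space1)
qed

lemma measurable_I: assumes "z \<in> D" "\<epsilon> \<in> B" shows "I t z \<epsilon> \<in> borel_measurable M"
proof -
  have "continuous_on {-1..} (\<lambda>s. (\<lambda>(\<tau>, z, \<epsilon>). W \<tau> z \<epsilon>) (p s, z, \<epsilon>))"
    by (rule continuous_on_compose2[OF Wc]) (use assms in \<open>auto intro!: continuous_intros continuous_on_bent_path\<close>)
  hence 1: "(\<lambda>s. W (p s) z \<epsilon>) \<in> borel_measurable M"
    by (intro continuous_imp_measurable_on_sets_lebesgue) auto
  have "continuous_on {-1..} (\<lambda>s. exp (- (p s / (\<epsilon> * t))))"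
    unfolding divide_inverse by (intro continuous_intros continuous_on_bent_path)
  hence 2: "(\<lambda>s. exp (- (p s / (\<epsilon> * t)))) \<in> borel_measurable M"
    by (intro continuous_imp_measurable_on_sets_lebesgue) auto
  show ?thesis unfolding I_eq[abs_def]
    by (intro borel_measurable_times borel_measurable_divide 1 2 measurable_path)
qed

lemma I_dom:
  assumes "q \<in> \<Omega>"
  obtains V h where "open V" "q \<in> V" "integrable M h" "V \<subseteq> \<Omega>"
    "\<And>t z \<epsilon> s. (t, z, \<epsilon>) \<in> V \<Longrightarrow> s \<ge> -1 \<Longrightarrow> cmod (I t z \<epsilon> s) \<le> h s"
proof -
  obtain V h where V: "open V" "q \<in> V" "integrable M h"
    "\<forall>t z \<epsilon> s. (t, z, \<epsilon>) \<in> V \<inter> \<Omega> \<longrightarrow> s \<ge> -1 \<longrightarrow> cmod (I t z \<epsilon> s) \<le> h s"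
    using dom[OF assms] unfolding I_def by blast
  show ?thesis by (rule that[of "V \<inter> \<Omega>" h]) (use V \<Omega> assms in auto)
qed

lemma I_dom3:
  assumes "(t0, z0, \<epsilon>0) \<in> \<Omega>"
  obtains r h where "r > 0" "integrable M h" "ball t0 r \<times> ball z0 r \<times> ball \<epsilon>0 r \<subseteq> \<Omega>"
    "\<And>t z \<epsilon> s. t \<in> ball t0 r \<Longrightarrow> z \<in> ball z0 r \<Longrightarrow> \<epsilon> \<in> ball \<epsilon>0 r \<Longrightarrow> s \<ge> -1 \<Longrightarrow> cmod (I t z \<epsilon> s) \<le> h s"
proof -
  obtain V h where V: "open V" "(t0, z0, \<epsilon>0) \<in> V" "integrable M h" "V \<subseteq> \<Omega>"
    "\<And>t z \<epsilon> s. (t, z, \<epsilon>) \<in> V \<Longrightarrow> s \<ge> -1 \<Longrightarrow> cmod (I t z \<epsilon> s) \<le> h s"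
    using I_dom[OF assms] by metis
  obtain A Q where AQ: "open A" "open Q" "(t0, z0, \<epsilon>0) \<in> A \<times> Q" "A \<times> Q \<subseteq> V"
    using open_prod_elim[OF V(1,2)] by metis
  obtain Y C where BC: "open Y" "open C" "(z0, \<epsilon>0) \<in> Y \<times> C" "Y \<times> C \<subseteq> Q"
    using open_prod_elim[OF AQ(2), of "(z0, \<epsilon>0)"] AQ(3) by (metis mem_Sigma_iff)
  obtain r1 r2 r3 where r: "r1 > 0" "r2 > 0" "r3 > 0" "ball t0 r1 \<subseteq> A" "ball z0 r2 \<subseteq> Y" "ball \<epsilon>0 r3 \<subseteq> C"
    using AQ BC by (metis mem_Sigma_iff open_contains_ball)
  define r where "r = min r1 (min r2 r3)"
  have sub: "(t, z, \<epsilon>) \<in> V" if "t \<in> ball t0 r" "z \<in> ball z0 r" "\<epsilon> \<in> ball \<epsilon>0 r" for t z \<epsilon>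
  proof -
    have "t \<in> A" "z \<in> Y" "\<epsilon> \<in> C" using that r by (auto simp: r_def subset_eq)
    thus ?thesis using AQ(4) BC(4) by blast
  qed
  show ?thesis
    by (rule that[of r h]) (use sub V r in \<open>auto simp: r_def\<close>)
qed

lemma holo_I_t: "s \<ge> -1 \<Longrightarrow> (\<lambda>t. I t z \<epsilon> s) holomorphic_on (- {0})"
  unfolding I_eq
  by (cases "\<epsilon> = 0"; cases "p s = 0") (auto intro!: holomorphic_intros)

lemma holo_I_z: "s \<ge> -1 \<Longrightarrow> \<epsilon> \<in> B \<Longrightarrow> (\<lambda>z. I t z \<epsilon> s) holomorphic_on D"
  unfolding I_eq by (intro holomorphic_intros Wz)

lemma holo_I_eps: "s \<ge> -1 \<Longrightarrow> z \<in> D \<Longrightarrow> t \<noteq> 0 \<Longrightarrow> (\<lambda>\<epsilon>. I t z \<epsilon> s) holomorphic_on B"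
  unfolding I_eq using B0 by (cases "p s = 0") (auto intro!: holomorphic_intros We)

lemma I_continuous: assumes "s \<ge> -1" shows "continuous_on \<Omega> (\<lambda>(t, z, \<epsilon>). I t z \<epsilon> s)"
proof -
  have "continuous_on \<Omega> (\<lambda>q. (\<lambda>(\<tau>, z, \<epsilon>). W \<tau> z \<epsilon>) (p s, fst (snd q), snd (snd q)))"
    by (rule continuous_on_compose2[OF Wc]) (use assms \<Omega> in \<open>auto intro!: continuous_intros\<close>)
  hence 1: "continuous_on \<Omega> (\<lambda>q. W (p s) (fst (snd q)) (snd (snd q)))" by (simp add: split_def)
  have ne: "snd (snd q) * fst q \<noteq> 0" if "q \<in> \<Omega>" for q using \<Omega>D[of "fst q" "fst (snd q)" "snd (snd q)"] that by simp
  have 2: "continuous_on \<Omega> (\<lambda>q. exp (- (p s / (snd (snd q) * fst q))) * (inverse (p s) * bent_speed a e s))"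
    by (intro continuous_intros) (use ne in auto)
  show ?thesis unfolding split_def I_eq using continuous_on_mult[OF 1 2] by (simp add: field_simps)
qed

lemma integrable_I: assumes "(t, z, \<epsilon>) \<in> \<Omega>" shows "integrable M (I t z \<epsilon>)"
proof -
  obtain r h where r: "r > 0" "integrable M h" "ball t r \<times> ball z r \<times> ball \<epsilon> r \<subseteq> \<Omega>"
    "\<And>t' z' \<epsilon>' s. t' \<in> ball t r \<Longrightarrow> z' \<in> ball z r \<Longrightarrow> \<epsilon>' \<in> ball \<epsilon> r \<Longrightarrow> s \<ge> -1 \<Longrightarrow> cmod (I t' z' \<epsilon>' s) \<le> h s"
    using I_dom3[OF assms] by blast
  show ?thesis
    by (rule Bochner_Integration.integrable_bound[OF r(2) measurable_I])
      (use \<Omega>D[OF assms] r in \<open>auto intro!: AE_I2 order_trans[OF r(4) abs_ge_self]\<close>)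
qed

lemma family_I_z: assumes Z: "open Z" "\<And>z. z \<in> Z \<Longrightarrow> (t, z, \<epsilon>) \<in> \<Omega>"
  shows "dominated_family M Z (\<lambda>z. I t z \<epsilon>)"
  unfolding dominated_family_def
proof (intro conjI ballI Z)
  show "(\<lambda>z. I t z \<epsilon> s) holomorphic_on Z" if "s \<in> space M" for s
  proof (cases "Z = {}")
    case False
    thus ?thesis using \<Omega>D Z(2) that by (intro holomorphic_on_subset[OF holo_I_z]) auto
  qed (simp add: holomorphic_on_def)
  fix z assume z: "z \<in> Z"
  note q = Z(2)[OF z]
  show "I t z \<epsilon> \<in> borel_measurable M" using \<Omega>D[OF q] by (intro measurable_I) auto
  obtain r h where r: "r > 0" "integrable M h" "ball t r \<times> ball z r \<times> ball \<epsilon> r \<subseteq> \<Omega>"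
    "\<And>t' z' \<epsilon>' s. t' \<in> ball t r \<Longrightarrow> z' \<in> ball z r \<Longrightarrow> \<epsilon>' \<in> ball \<epsilon> r \<Longrightarrow> s \<ge> -1 \<Longrightarrow> cmod (I t' z' \<epsilon>' s) \<le> h s"
    using I_dom3[OF q] by blast
  have "\<forall>y\<in>ball z r \<inter> Z. \<forall>s\<in>space M. cmod (I t y \<epsilon> s) \<le> h s" using r by auto
  thus "\<exists>r>0. \<exists>h. integrable M h \<and> (\<forall>y\<in>ball z r \<inter> Z. \<forall>s\<in>space M. cmod (I t y \<epsilon> s) \<le> h s)"
    using r(1,2) by blast
qed

lemma family_I_t: assumes T: "open T" "\<And>t. t \<in> T \<Longrightarrow> (t, z, \<epsilon>) \<in> \<Omega>"
  shows "dominated_family M T (\<lambda>t. I t z \<epsilon>)"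
  unfolding dominated_family_def
proof (intro conjI ballI T)
  show "(\<lambda>t. I t z \<epsilon> s) holomorphic_on T" if "s \<in> space M" for s
    using \<Omega>D T(2) that by (intro holomorphic_on_subset[OF holo_I_t]) auto
  fix t assume t: "t \<in> T"
  note q = T(2)[OF t]
  show "I t z \<epsilon> \<in> borel_measurable M" using \<Omega>D[OF q] by (intro measurable_I) auto
  obtain r h where r: "r > 0" "integrable M h" "ball t r \<times> ball z r \<times> ball \<epsilon> r \<subseteq> \<Omega>"
    "\<And>t' z' \<epsilon>' s. t' \<in> ball t r \<Longrightarrow> z' \<in> ball z r \<Longrightarrow> \<epsilon>' \<in> ball \<epsilon> r \<Longrightarrow> s \<ge> -1 \<Longrightarrow> cmod (I t' z' \<epsilon>' s) \<le> h s"
    using I_dom3[OF q] by blast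
  have "\<forall>y\<in>ball t r \<inter> T. \<forall>s\<in>space M. cmod (I y z \<epsilon> s) \<le> h s" using r by auto
  thus "\<exists>r>0. \<exists>h. integrable M h \<and> (\<forall>y\<in>ball t r \<inter> T. \<forall>s\<in>space M. cmod (I y z \<epsilon> s) \<le> h s)"
    using r(1,2) by blast
qed

lemma family_I_eps: assumes E: "open E" "\<And>\<epsilon>. \<epsilon> \<in> E \<Longrightarrow> (t, z, \<epsilon>) \<in> \<Omega>"
  shows "dominated_family M E (\<lambda>\<epsilon>. I t z \<epsilon>)"
  unfolding dominated_family_def
proof (intro conjI ballI E)
  show "(\<lambda>\<epsilon>. I t z \<epsilon> s) holomorphic_on E" if "s \<in> space M" for s
  proof (cases "E = {}")
    case False
    thus ?thesis using \<Omega>D E(2) that by (intro holomorphic_on_subset[OF holo_I_eps]) auto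
  qed (simp add: holomorphic_on_def)
  fix \<epsilon> assume \<epsilon>: "\<epsilon> \<in> E"
  note q = E(2)[OF \<epsilon>]
  show "I t z \<epsilon> \<in> borel_measurable M" using \<Omega>D[OF q] by (intro measurable_I) auto
  obtain r h where r: "r > 0" "integrable M h" "ball t r \<times> ball z r \<times> ball \<epsilon> r \<subseteq> \<Omega>"
    "\<And>t' z' \<epsilon>' s. t' \<in> ball t r \<Longrightarrow> z' \<in> ball z r \<Longrightarrow> \<epsilon>' \<in> ball \<epsilon> r \<Longrightarrow> s \<ge> -1 \<Longrightarrow> cmod (I t' z' \<epsilon>' s) \<le> h s"
    using I_dom3[OF q] by blast
  have "\<forall>y\<in>ball \<epsilon> r \<inter> E. \<forall>s\<in>space M. cmod (I t z y s) \<le> h s" using r by auto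
  thus "\<exists>r>0. \<exists>h. integrable M h \<and> (\<forall>y\<in>ball \<epsilon> r \<inter> E. \<forall>s\<in>space M. cmod (I t z y s) \<le> h s)"
    using r(1,2) by blast
qed

lemma U_holomorphic: "holomorphic3_on U \<Omega>"
proof (rule holomorphic3_onI[OF \<Omega>(1)])
  have "continuous_on \<Omega> (\<lambda>q. LINT s|M. (\<lambda>(t, z, \<epsilon>). I t z \<epsilon> s) q)"
  proof (rule continuous_on_integral_dominated)
    fix q assume q: "q \<in> \<Omega>"
    show "(\<lambda>s. (\<lambda>(t, z, \<epsilon>). I t z \<epsilon> s) q) \<in> borel_measurable M"
      using \<Omega>D[of "fst q" "fst (snd q)" "snd (snd q)"] q measurable_I by (auto simp: split_def)
    obtain V h where V: "open V" "q \<in> V" "integrable M h" "V \<subseteq> \<Omega>"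
      "\<And>t z \<epsilon> s. (t, z, \<epsilon>) \<in> V \<Longrightarrow> s \<ge> -1 \<Longrightarrow> cmod (I t z \<epsilon> s) \<le> h s"
      using I_dom[OF q] by metis
    have "\<forall>q\<in>\<Omega> \<inter> V. \<forall>s\<in>space M. cmod ((\<lambda>(t, z, \<epsilon>). I t z \<epsilon> s) q) \<le> h s" using V(5) by auto
    thus "\<exists>V h. open V \<and> q \<in> V \<and> integrable M h \<and> (\<forall>q\<in>\<Omega> \<inter> V. \<forall>s\<in>space M. cmod ((\<lambda>(t, z, \<epsilon>). I t z \<epsilon> s) q) \<le> h s)"
      using V(1-3) by blast
  qed (use I_continuous in auto)
  thus "continuous_on \<Omega> (\<lambda>(t, z, \<epsilon>). U t z \<epsilon>)" by (simp add: U_def split_def)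
  fix t z \<epsilon> assume q: "(t, z, \<epsilon>) \<in> \<Omega>"
  obtain r where r: "r > 0" "ball t r \<times> ball z r \<times> ball \<epsilon> r \<subseteq> \<Omega>"
    by (rule I_dom3[OF q])
  have m: "(t', z', \<epsilon>') \<in> \<Omega>" if "t' \<in> ball t r" "z' \<in> ball z r" "\<epsilon>' \<in> ball \<epsilon> r" for t' z' \<epsilon>'
    using r(2) that by blast
  have "dominated_family M (ball t r) (\<lambda>t. I t z \<epsilon>)" by (rule family_I_t) (use m r in auto)
  from dominated_family_deriv(2)[OF this, of t] 
  show "(\<lambda>t. U t z \<epsilon>) field_differentiable at t" unfolding U_def field_differentiable_def using r by auto
  have "dominated_family M (ball z r) (\<lambda>z. I t z \<epsilon>)" by (rule family_I_z) (use m r in auto)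
  from dominated_family_deriv(2)[OF this, of z] 
  show "(\<lambda>z. U t z \<epsilon>) field_differentiable at z" unfolding U_def field_differentiable_def using r by auto
  have "dominated_family M (ball \<epsilon> r) (\<lambda>\<epsilon>. I t z \<epsilon>)" by (rule family_I_eps) (use m r in auto)
  from dominated_family_deriv(2)[OF this, of \<epsilon>] 
  show "(\<lambda>\<epsilon>. U t z \<epsilon>) field_differentiable at \<epsilon>" unfolding U_def field_differentiable_def using r by auto
qed

lemma U_eq:
  assumes "(t, z, \<epsilon>) \<in> \<Omega>"
  shows "laplace_kernel (\<lambda>\<tau>. W \<tau> z \<epsilon>) (\<epsilon> * t) contour_integrable_on (linepath 0 a)"
    "ray_integrable a e (laplace_kernel (\<lambda>\<tau>. W \<tau> z \<epsilon>) (\<epsilon> * t))"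
    "U t z \<epsilon> = ray_path_integral a e (laplace_kernel (\<lambda>\<tau>. W \<tau> z \<epsilon>) (\<epsilon> * t))"
  using ray_path_integral_eq[of "laplace_kernel (\<lambda>\<tau>. W \<tau> z \<epsilon>) (\<epsilon> * t)" a e] integrable_I[OF assms]
  unfolding U_def I_def by auto

definition J :: "nat \<Rightarrow> complex \<Rightarrow> complex \<Rightarrow> complex \<Rightarrow> real \<Rightarrow> complex" where
  "J k t z \<epsilon> s = (deriv ^^ k) (\<lambda>y. W (p s) y \<epsilon>) z * (exp (- (p s / (\<epsilon> * t))) / p s * bent_speed a e s)"

lemma J_eq:
  assumes "s \<ge> -1" "z \<in> D" "\<epsilon> \<in> B"
  shows "(deriv ^^ k) (\<lambda>y. I t y \<epsilon> s) z = J k t z \<epsilon> s"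
  unfolding J_def I_eq by (rule higher_deriv_cmult_open[OF D Wz]) (use assms in auto)

lemma deriv_U:
  assumes Z: "open Z" "\<And>z. z \<in> Z \<Longrightarrow> (t, z, \<epsilon>) \<in> \<Omega>" and z: "z \<in> Z"
  shows "(deriv ^^ k) (\<lambda>y. U t y \<epsilon>) z = (LINT s|M. J k t z \<epsilon> s)" "J k t z \<epsilon> \<in> borel_measurable M" "integrable M (J k t z \<epsilon>)"
proof -
  have "(\<lambda>_. 1 :: complex) holomorphic_on Z" by simp
  note F = funpow_deriv_integral[where L = deriv and i = k, OF _ this family_I_z[OF Z], simplified]
  have eq: "(deriv ^^ k) (\<lambda>y. I t y \<epsilon> s) z = J k t z \<epsilon> s" if "s \<in> space M" for s
    using \<Omega>D[OF Z(2)[OF z]] that by (intro J_eq) auto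
  have "(deriv ^^ k) (\<lambda>y. U t y \<epsilon>) z = (LINT s|M. (deriv ^^ k) (\<lambda>y. I t y \<epsilon> s) z)"
    unfolding U_def using F(2)[OF z] by simp
  also have "\<dots> = (LINT s|M. J k t z \<epsilon> s)" by (rule Bochner_Integration.integral_cong) (use eq in auto)
  finally show "(deriv ^^ k) (\<lambda>y. U t y \<epsilon>) z = (LINT s|M. J k t z \<epsilon> s)" .
  have i: "integrable M (\<lambda>s. (deriv ^^ k) (\<lambda>y. I t y \<epsilon> s) z)"
    using dominated_family_integrable[OF F(1) z] .
  show "integrable M (J k t z \<epsilon>)" 
    using i by (rule Bochner_Integration.integrable_cong[THEN iffD1, OF refl, rotated]) (use eq in auto)
  thus "J k t z \<epsilon> \<in> borel_measurable M" by (rule borel_measurable_integrable)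
qed

text \<open>The locale bounds the integrand itself; Cauchy's inequality in \<open>z\<close> turns
  this into a majorant of its \<open>z\<close>-derivatives that is locally uniform in
  \<open>t\<close>, as needed before \<open>t2d\<close> is applied to them.\<close>

lemma family_J_t:
  assumes T: "open T" and TZ: "T \<times> D \<times> {\<epsilon>} \<subseteq> \<Omega>" and z: "z \<in> D"
  shows "dominated_family M T (\<lambda>t. J k t z \<epsilon>)"
  unfolding dominated_family_def
proof (intro conjI ballI T)
  have m: "(t, y, \<epsilon>) \<in> \<Omega>" if "t \<in> T" "y \<in> D" for t y using TZ that by blast
  show "(\<lambda>t. J k t z \<epsilon> s) holomorphic_on T" for s
    unfolding J_def using \<Omega>D[OF m[OF _ z]] by (cases "p s = 0") (auto intro!: holomorphic_intros)
  fix t assume t: "t \<in> T"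
  show "J k t z \<epsilon> \<in> borel_measurable M" by (rule deriv_U(2)[OF D m[OF t] z])
  note q = m[OF t z]
  obtain r h where r: "r > 0" "integrable M h" "ball t r \<times> ball z r \<times> ball \<epsilon> r \<subseteq> \<Omega>"
    "\<And>t' z' \<epsilon>' s. t' \<in> ball t r \<Longrightarrow> z' \<in> ball z r \<Longrightarrow> \<epsilon>' \<in> ball \<epsilon> r \<Longrightarrow> s \<ge> -1 \<Longrightarrow> cmod (I t' z' \<epsilon>' s) \<le> h s"
    using I_dom3[OF q] by blast
  have zr: "ball z r \<subseteq> D"
  proof
    fix y assume "y \<in> ball z r"
    hence "(t, y, \<epsilon>) \<in> \<Omega>" using r(1) by (intro subsetD[OF r(3)]) auto
    thus "y \<in> D" using \<Omega>D by blast
  qed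
  have "cmod (J k y z \<epsilon> s) \<le> fact k / (r / 2) ^ k * h s" if y: "y \<in> ball t r" and s: "s \<in> space M" for y s
  proof -
    have hol: "(\<lambda>y'. I y y' \<epsilon> s) holomorphic_on ball z r"
      using \<Omega>D[OF q] s by (intro holomorphic_on_subset[OF holo_I_z zr]) auto
    have "cmod ((deriv ^^ k) (\<lambda>y'. I y y' \<epsilon> s) z) \<le> fact k * h s / (r / 2) ^ k"
    proof (rule Cauchy_inequality)
      show "(\<lambda>y'. I y y' \<epsilon> s) holomorphic_on ball z (r / 2)"
        by (rule holomorphic_on_subset[OF hol]) (use r in auto)
      show "continuous_on (cball z (r / 2)) (\<lambda>y'. I y y' \<epsilon> s)"
        by (intro holomorphic_on_imp_continuous_on holomorphic_on_subset[OF hol]) (use r in auto)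
      show "cmod (I y x \<epsilon> s) \<le> h s" if "cmod (z - x) = r / 2" for x
        using r s y that by (intro r(4)) (auto simp: dist_norm)
    qed (use r in auto)
    also have "(deriv ^^ k) (\<lambda>y'. I y y' \<epsilon> s) z = J k y z \<epsilon> s"
      using \<Omega>D[OF q] s by (intro J_eq) auto
    finally show ?thesis by simp
  qed
  moreover have "integrable M (\<lambda>s. fact k / (r / 2) ^ k * h s)" using r by simp
  ultimately show "\<exists>r>0. \<exists>h. integrable M h \<and> (\<forall>y\<in>ball t r \<inter> T. \<forall>s\<in>space M. cmod (J k y z \<epsilon> s) \<le> h s)"
    using r(1) by blast
qed

text \<open>\<open>u\<close> only has to agree with \<open>U\<close> for this
  \<open>\<epsilon>\<close> and for \<open>t\<close> in \<open>T\<close>: the solution in a sector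
  equals the integral along a fixed ray only where that ray is admissible.\<close>

lemma t2d_deriv_U:
  assumes T: "open T" and TZ: "T \<times> D \<times> {\<epsilon>} \<subseteq> \<Omega>" and z: "z \<in> D" and t: "t \<in> T"
    and u: "\<And>t z. t \<in> T \<Longrightarrow> z \<in> D \<Longrightarrow> u t z \<epsilon> = U t z \<epsilon>"
  shows "(t2d ^^ i) (\<lambda>s. (deriv ^^ k) (\<lambda>y. u s y \<epsilon>) z) t = (LINT s|M. (p s / \<epsilon>) ^ i * J k t z \<epsilon> s)"
    "integrable M (\<lambda>s. (p s / \<epsilon>) ^ i * J k t z \<epsilon> s)"
proof -
  have m: "(t, y, \<epsilon>) \<in> \<Omega>" if "t \<in> T" "y \<in> D" for t y using TZ that by blast
  have h: "(\<lambda>t. t\<^sup>2 :: complex) holomorphic_on T" by (intro holomorphic_intros)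
  note F = funpow_deriv_integral[where L = t2d and i = i, OF t2d_def h family_J_t[OF T TZ z, of k]]
  have "(t2d ^^ i) (\<lambda>s. (deriv ^^ k) (\<lambda>y. u s y \<epsilon>) z) t = (t2d ^^ i) (\<lambda>t. LINT s|M. J k t z \<epsilon> s) t"
  proof (rule funpow_deriv_mult_cong[OF t2d_def T _ t])
    fix t assume t: "t \<in> T"
    have "(deriv ^^ k) (\<lambda>y. u t y \<epsilon>) z = (deriv ^^ k) (\<lambda>y. U t y \<epsilon>) z"
      by (rule funpow_deriv_mult_cong[where L = deriv and a = "\<lambda>_. 1" and U = D]) (use D z u t in auto)
    also have "\<dots> = (LINT s|M. J k t z \<epsilon> s)" by (rule deriv_U(1)[OF D m[OF t] z])
    finally show "(deriv ^^ k) (\<lambda>y. u t y \<epsilon>) z = (LINT s|M. J k t z \<epsilon> s)" .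
  qed
  also have "\<dots> = (LINT s|M. (t2d ^^ i) (\<lambda>t. J k t z \<epsilon> s) t)" by (rule F(2)[OF t])
  finally have 1: "(t2d ^^ i) (\<lambda>s. (deriv ^^ k) (\<lambda>y. u s y \<epsilon>) z) t = (LINT s|M. (t2d ^^ i) (\<lambda>t. J k t z \<epsilon> s) t)" .
  have 2: "(t2d ^^ i) (\<lambda>t. J k t z \<epsilon> s) t = (p s / \<epsilon>) ^ i * J k t z \<epsilon> s" for s
    using t2d_funpow_exp[of \<epsilon> t i "(deriv ^^ k) (\<lambda>y. W (p s) y \<epsilon>) z / p s * bent_speed a e s" "p s"] \<Omega>D[OF m[OF t z]]
    unfolding J_def by (simp add: mult_ac)
  show "(t2d ^^ i) (\<lambda>s. (deriv ^^ k) (\<lambda>y. u s y \<epsilon>) z) t = (LINT s|M. (p s / \<epsilon>) ^ i * J k t z \<epsilon> s)"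
    using 1 by (simp only: 2)
  show "integrable M (\<lambda>s. (p s / \<epsilon>) ^ i * J k t z \<epsilon> s)"
    using dominated_family_integrable[OF F(1) t] by (simp only: 2)
qed

text \<open>\<open>T\<close> has to contain the shifted points because derivatives in
  \<open>t\<close> are taken there. Powers of \<open>\<epsilon> * t2d\<close> become powers of the
  path point and sum up to \<open>poly P\<close>, so the equation for \<open>U\<close> is the
  integral of \<open>pde\<close> against the kernel.\<close>

lemma satisfies_eq_U:
  assumes T: "open T" and TZ: "T \<times> D \<times> {\<epsilon>} \<subseteq> \<Omega>" and z: "z \<in> D" and t: "t \<in> T"
    and u: "\<And>t z. t \<in> T \<Longrightarrow> z \<in> D \<Longrightarrow> u t z \<epsilon> = U t z \<epsilon>"
    and tk: "\<And>k. k \<in> A \<Longrightarrow> 1 + of_nat (snd (snd k)) * \<epsilon> * t \<noteq> 0 \<and> t / (1 + of_nat (snd (snd k)) * \<epsilon> * t) \<in> T"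
    and pde: "\<And>s. s \<ge> -1 \<Longrightarrow> poly P (p s) * (deriv ^^ S) (\<lambda>y. W (p s) y \<epsilon>) z =
      (\<Sum>k\<in>A. c k z \<epsilon> * ((p s / \<epsilon>) ^ fst k * exp (- (of_nat (snd (snd k)) * p s)) * (deriv ^^ fst (snd k)) (\<lambda>y. W (p s) y \<epsilon>) z))"
  shows "satisfies_eq P S A c u t z \<epsilon>"
proof -
  let ?t = "\<lambda>k. t / (1 + of_nat (snd (snd k)) * \<epsilon> * t)"
  have \<epsilon>: "\<epsilon> \<noteq> 0" "t \<noteq> 0" using \<Omega>D TZ t z by blast+
  note td = t2d_deriv_U[where T = T and u = u and z = z and \<epsilon> = \<epsilon>, OF T TZ z _ u]
  have "(\<Sum>i\<le>degree P. coeff P i * \<epsilon> ^ i * (t2d ^^ i) (\<lambda>s. (deriv ^^ S) (\<lambda>y. u s y \<epsilon>) z) t)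
     = (\<Sum>i\<le>degree P. coeff P i * \<epsilon> ^ i * (LINT s|M. (p s / \<epsilon>) ^ i * J S t z \<epsilon> s))"
    by (simp only: td(1)[OF t])
  also have "\<dots> = (\<Sum>i\<le>degree P. (LINT s|M. coeff P i * \<epsilon> ^ i * ((p s / \<epsilon>) ^ i * J S t z \<epsilon> s)))"
    using td(2)[OF t] by simp
  also have "\<dots> = (LINT s|M. (\<Sum>i\<le>degree P. coeff P i * \<epsilon> ^ i * ((p s / \<epsilon>) ^ i * J S t z \<epsilon> s)))"
    by (rule Bochner_Integration.integral_sum[symmetric]) (intro integrable_mult_right td(2)[OF t])
  also have "\<dots> = (LINT s|M. (\<Sum>k\<in>A. c k z \<epsilon> * ((p s / \<epsilon>) ^ fst k * J (fst (snd k)) (?t k) z \<epsilon> s)))"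
  proof (rule Bochner_Integration.integral_cong[OF refl])
    fix s assume "s \<in> space M"
    hence s: "s \<ge> -1" by simp
    let ?x = "exp (- (p s / (\<epsilon> * t))) / p s * bent_speed a e s"
    have Jk: "J (fst (snd k)) (?t k) z \<epsilon> s = exp (- (of_nat (snd (snd k)) * p s)) * (deriv ^^ fst (snd k)) (\<lambda>y. W (p s) y \<epsilon>) z * ?x"
      if "k \<in> A" for k
    proof -
      have "p s / (\<epsilon> * ?t k) = p s / (\<epsilon> * t) + of_nat (snd (snd k)) * p s"
        using \<epsilon> tk[OF that] by (simp add: field_simps)
      hence "- (p s / (\<epsilon> * ?t k)) = - (of_nat (snd (snd k)) * p s) + - (p s / (\<epsilon> * t))" by simp
      hence "exp (- (p s / (\<epsilon> * ?t k))) = exp (- (of_nat (snd (snd k)) * p s)) * exp (- (p s / (\<epsilon> * t)))"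
        by (simp only: exp_add)
      thus ?thesis by (simp add: J_def mult_ac)
    qed
    have "(\<Sum>i\<le>degree P. coeff P i * \<epsilon> ^ i * ((p s / \<epsilon>) ^ i * J S t z \<epsilon> s)) = poly P (p s) * J S t z \<epsilon> s"
      using \<epsilon> by (simp add: poly_altdef sum_distrib_left power_divide mult_ac)
    also have "\<dots> = (poly P (p s) * (deriv ^^ S) (\<lambda>y. W (p s) y \<epsilon>) z) * ?x" by (simp add: J_def)
    also have "\<dots> = (\<Sum>k\<in>A. c k z \<epsilon> * ((p s / \<epsilon>) ^ fst k * J (fst (snd k)) (?t k) z \<epsilon> s))"
      unfolding pde[OF s] sum_distrib_right by (intro sum.cong refl) (subst Jk, assumption, simp add: mult_ac)
    finally show "(\<Sum>i\<le>degree P. coeff P i * \<epsilon> ^ i * ((p s / \<epsilon>) ^ i * J S t z \<epsilon> s)) = 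
      (\<Sum>k\<in>A. c k z \<epsilon> * ((p s / \<epsilon>) ^ fst k * J (fst (snd k)) (?t k) z \<epsilon> s))" .
  qed
  also have "\<dots> = (\<Sum>k\<in>A. (LINT s|M. c k z \<epsilon> * ((p s / \<epsilon>) ^ fst k * J (fst (snd k)) (?t k) z \<epsilon> s)))"
    by (rule Bochner_Integration.integral_sum) (use tk in \<open>intro integrable_mult_right td(2), auto\<close>)
  also have "\<dots> = (\<Sum>k\<in>A. c k z \<epsilon> * (LINT s|M. (p s / \<epsilon>) ^ fst k * J (fst (snd k)) (?t k) z \<epsilon> s))"
    by (intro sum.cong refl integral_mult_right) (use tk td(2) in auto)
  also have "\<dots> = (\<Sum>k\<in>A. c k z \<epsilon> * (t2d ^^ fst k) (\<lambda>s. (deriv ^^ fst (snd k)) (\<lambda>y. u s y \<epsilon>) z) (?t k))"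
    by (intro sum.cong refl arg_cong2[of _ _ _ _ "(*)"] td(1)[symmetric]) (use tk in auto)
  finally show ?thesis using tk unfolding satisfies_eq_def by (auto simp: split_def)
qed

lemma initial_U:
  assumes T: "open T" and TZ: "T \<times> D \<times> {\<epsilon>} \<subseteq> \<Omega>" and z: "0 \<in> D" and t: "t \<in> T"
    and u: "\<And>z. z \<in> D \<Longrightarrow> u t z \<epsilon> = U t z \<epsilon>"
    and w: "\<And>s. s \<ge> -1 \<Longrightarrow> (deriv ^^ j) (\<lambda>y. W (p s) y \<epsilon>) 0 = w (p s)"
  shows "(deriv ^^ j) (\<lambda>z. u t z \<epsilon>) 0 = ray_path_integral a e (laplace_kernel w (\<epsilon> * t))"
proof -
  have m: "(t, y, \<epsilon>) \<in> \<Omega>" if "t \<in> T" "y \<in> D" for t y using TZ that by blast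
  note d = deriv_U[OF D m[OF t] z, of j]
  have eq: "J j t 0 \<epsilon> s = laplace_kernel w (\<epsilon> * t) (p s) * bent_speed a e s" if "s \<in> space M" for s
    using that w[of s] by (simp add: J_def laplace_kernel_def)
  have "(deriv ^^ j) (\<lambda>z. u t z \<epsilon>) 0 = (deriv ^^ j) (\<lambda>z. U t z \<epsilon>) 0"
    by (rule funpow_deriv_mult_cong[where L = deriv and a = "\<lambda>_. 1" and U = D]) (use D z u t in auto)
  also have "\<dots> = (LINT s|M. J j t 0 \<epsilon> s)" by (rule d(1))
  also have "\<dots> = (LINT s|M. laplace_kernel w (\<epsilon> * t) (p s) * bent_speed a e s)"
    by (rule Bochner_Integration.integral_cong) (use eq in auto)
  also have "\<dots> = ray_path_integral a e (laplace_kernel w (\<epsilon> * t))"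
  proof (rule ray_path_integral_eq(3)[symmetric])
    show "integrable M (\<lambda>s. laplace_kernel w (\<epsilon> * t) (p s) * bent_speed a e s)"
      using d(3) by (rule Bochner_Integration.integrable_cong[THEN iffD1, OF refl, rotated]) (use eq in auto)
  qed
  finally show ?thesis .
qed

end

section \<open>Sectors and deformation of contours\<close>

lemma cos_less_cos_iff_abs:
  assumes "\<bar>x\<bar> \<le> pi" "0 \<le> y" "y \<le> pi" shows "cos y < cos x \<longleftrightarrow> \<bar>x\<bar> < y"
proof -
  have "cos x = cos \<bar>x\<bar>" by (simp add: abs_if)
  thus ?thesis using assms cos_mono_less_eq[of y "\<bar>x\<bar>"] by simp
qed

text \<open>Replaces arguments modulo \<open>2 * pi\<close> by one inequality for a real part, from
  which openness, homogeneity and convexity can be read off.\<close>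

lemma sector_iff:
  assumes "0 < \<theta>" "\<theta> \<le> pi"
  shows "z \<in> sector d \<theta> \<longleftrightarrow> z \<noteq> 0 \<and> Re (z * cis (- d)) > cmod z * cos \<theta>"
proof (cases "z = 0")
  case False
  have Re: "Re (z * cis (- d)) = cmod z * cos (\<phi> - d)" if "is_Arg z \<phi>" for \<phi>
  proof -
    have "z = cmod z * cis \<phi>" using that by (simp add: is_Arg_def cis_conv_exp)
    hence "z * cis (- d) = cmod z * cis (\<phi> - d)" by (metis mult.assoc cis_mult uminus_add_conv_diff add.commute)
    thus ?thesis by simp
  qed
  show ?thesis
  proof
    assume "z \<in> sector d \<theta>"
    then obtain \<phi> where \<phi>: "is_Arg z \<phi>" "\<bar>\<phi> - d\<bar> < \<theta>" by (auto simp: sector_def)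
    have "cos \<theta> < cos (\<phi> - d)" using cos_less_cos_iff_abs[of "\<phi> - d" \<theta>] \<phi> assms by simp
    thus "z \<noteq> 0 \<and> Re (z * cis (- d)) > cmod z * cos \<theta>" using False Re[OF \<phi>(1)] by simp
  next
    assume a: "z \<noteq> 0 \<and> Re (z * cis (- d)) > cmod z * cos \<theta>"
    define \<psi> where "\<psi> = Arg (z * cis (- d))"
    have ne: "z * cis (- d) \<noteq> 0" using False by simp
    have "z * cis (- d) = cmod z * cis \<psi>"
      using is_Arg_Arg[OF ne] by (simp add: is_Arg_def cis_conv_exp \<psi>_def norm_mult)
    hence "z = cmod z * cis \<psi> * cis d" 
      by (metis mult.assoc cis_mult add.left_inverse cis_zero mult.right_neutral)
    hence "z = cmod z * cis (d + \<psi>)" by (simp add: mult.assoc cis_mult add.commute)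
    hence A: "is_Arg z (d + \<psi>)" by (simp add: is_Arg_def cis_conv_exp)
    have "cos \<theta> < cos \<psi>" using a Re[OF A] False by simp
    moreover have "\<bar>\<psi>\<bar> \<le> pi" using mpi_less_Arg[of "z * cis (- d)"] Arg_le_pi[of "z * cis (- d)"] by (simp add: \<psi>_def abs_if)
    ultimately have "\<bar>\<psi>\<bar> < \<theta>" using cos_less_cos_iff_abs[of \<psi> \<theta>] assms by simp
    thus "z \<in> sector d \<theta>" using A False by (auto simp: sector_def intro!: exI[of _ "d + \<psi>"])
  qed
qed (simp add: sector_def)

lemma open_sector: assumes "0 < \<theta>" "\<theta> \<le> pi" shows "open (sector d \<theta>)"
proof -
  have "sector d \<theta> = - {0} \<inter> {z. cmod z * cos \<theta> < Re (z * cis (- d))}" using sector_iff[OF assms] by auto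
  also have "open \<dots>" by (intro open_Int open_Collect_less continuous_intros)
  finally show ?thesis .
qed

lemma bounded_sectorD:
  assumes "bounded_sector d \<theta> X" shows "open X" "0 \<notin> X"
proof -
  obtain R where X: "0 < \<theta>" "\<theta> \<le> pi" "X = sector d \<theta> \<inter> ball 0 R" using assms by (auto simp: bounded_sector_def)
  show "open X" unfolding X(3) by (intro open_Int open_sector X open_ball)
  show "0 \<notin> X" unfolding X(3) by (simp add: sector_def)
qed

lemma right_sector:
  assumes "unbounded_sector d X" "X \<subseteq> {z. Re z > 0}"
  shows "open X" "convex X" "\<And>z s. z \<in> X \<Longrightarrow> s > 0 \<Longrightarrow> of_real s * z \<in> X"
proof -
  obtain \<theta> where \<theta>: "0 < \<theta>" "\<theta> \<le> pi" "X = sector d \<theta>" using assms by (auto simp: unbounded_sector_def)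
  show "open X" using open_sector \<theta> by simp
  have cis: "cis (d + x) \<in> X" if "\<bar>x\<bar> < \<theta>" for x
    unfolding \<theta>(3) sector_def using that by (auto simp: is_Arg_def cis_conv_exp intro!: exI[of _ "d + x"])
  \<comment> \<open>A wider sector would contain the opposite directions \<open>d + pi / 2\<close>
    and \<open>d - pi / 2\<close>, which are not both in the right half-plane. With
    \<open>cos \<theta> \<ge> 0\<close> the inequality of \<open>sector_iff\<close> survives convex
    combinations by the triangle inequality.\<close>
  have "\<theta> \<le> pi / 2"
  proof (rule ccontr)
    assume "\<not> \<theta> \<le> pi / 2"
    hence "cis (d + pi / 2) \<in> X" "cis (d + (- (pi / 2))) \<in> X" by (intro cis, simp)+
    hence "cos (d + pi / 2) > 0" "cos (d + - (pi / 2)) > 0" using assms(2) by auto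
    thus False unfolding cos_add by simp
  qed
  hence c0: "cos \<theta> \<ge> 0" using \<theta> by (intro cos_ge_zero) auto
  have mem: "z \<in> X \<longleftrightarrow> z \<noteq> 0 \<and> cmod z * cos \<theta> < Re (z * cis (- d))" for z
    using sector_iff[OF \<theta>(1,2)] \<theta>(3) by blast
  show "of_real s * z \<in> X" if "z \<in> X" "s > 0" for z s
  proof -
    have "Re (of_real s * z * cis (- d)) = s * Re (z * cis (- d))" by (simp add: mult.assoc)
    thus ?thesis using that unfolding mem by (simp add: norm_mult mult.assoc del: times_complex.sel)
  qed
  show "convex X"
  proof (rule convexI)
    fix x y and u v :: real assume xy: "x \<in> X" "y \<in> X" and uv: "0 \<le> u" "0 \<le> v" "u + v = 1"
    let ?z = "u *\<^sub>R x + v *\<^sub>R y"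
    have "Re x > 0" "Re y > 0" using xy assms by auto
    hence "u * Re x + v * Re y > 0" using uv by (cases "u = 0") (auto intro!: add_pos_nonneg)
    hence "Re ?z > 0" by simp
    hence nz: "?z \<noteq> 0" by (metis less_irrefl zero_complex.sel(1))
    have lx: "cmod x * cos \<theta> < Re (x * cis (- d))" and ly: "cmod y * cos \<theta> < Re (y * cis (- d))"
      using xy mem by auto
    have "cmod ?z * cos \<theta> \<le> (u * cmod x + v * cmod y) * cos \<theta>"
      using norm_triangle_ineq[of "u *\<^sub>R x" "v *\<^sub>R y"] uv c0 by (intro mult_right_mono) auto
    also have "\<dots> = u * (cmod x * cos \<theta>) + v * (cmod y * cos \<theta>)" by (simp add: algebra_simps)
    also have "\<dots> < u * Re (x * cis (- d)) + v * Re (y * cis (- d))"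
    proof (cases "u = 0")
      case True
      thus ?thesis using uv ly by simp
    next
      case False
      hence "u * (cmod x * cos \<theta>) < u * Re (x * cis (- d))" using lx uv by simp
      moreover have "v * (cmod y * cos \<theta>) \<le> v * Re (y * cis (- d))" using ly uv by (intro mult_left_mono) auto
      ultimately show ?thesis by linarith
    qed
    also have "\<dots> = Re (?z * cis (- d))" by (simp add: algebra_simps)
    finally show "?z \<in> X" using nz mem by blast
  qed
qed

lemma Re_of_real_mult: "Re (of_real s * z) = s * Re z" by simp

lemma convex_insert_0:
  assumes "convex X" "\<And>z s. z \<in> X \<Longrightarrow> s > 0 \<Longrightarrow> of_real s * z \<in> (X :: complex set)"
  shows "convex (insert 0 X)"
proof (rule convexI)
  fix x y and u v :: real assume xy: "x \<in> insert 0 X" "y \<in> insert 0 X" and uv: "0 \<le> u" "0 \<le> v" "u + v = 1"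
  have sc: "u *\<^sub>R x \<in> insert 0 X" if "x \<in> insert 0 X" "u \<ge> 0" for x u
    using that assms(2)[of x u] by (cases "u = 0") (auto simp: scaleR_conv_of_real)
  show "u *\<^sub>R x + v *\<^sub>R y \<in> insert 0 X"
  proof (cases "x = 0 \<or> y = 0")
    case True
    thus ?thesis using sc[OF xy(1) uv(1)] sc[OF xy(2) uv(2)] by auto
  next
    case False
    thus ?thesis using xy uv convexD[OF assms(1), of x y u v] by auto
  qed
qed

lemma holomorphic3_on_cong_subset:
  assumes "holomorphic3_on f X" "open Y" "Y \<subseteq> X" "\<And>x y z. (x, y, z) \<in> Y \<Longrightarrow> g x y z = f x y z"
  shows "holomorphic3_on g Y"
  unfolding holomorphic3_on_def
proof (intro conjI ballI assms(2))
  fix p assume p: "p \<in> Y"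
  hence "p \<in> X" using assms(3) by blast
  then obtain a b c where d: "((\<lambda>(x, y, z). f x y z) has_derivative (\<lambda>(h, k, l). a * h + b * k + c * l)) (at p)"
    using assms(1) unfolding holomorphic3_on_def by blast
  have "((\<lambda>(x, y, z). g x y z) has_derivative (\<lambda>(h, k, l). a * h + b * k + c * l)) (at p)"
    by (rule has_derivative_transform_within_open[OF d assms(2) p]) (use assms(4) in auto)
  thus "\<exists>a b c. ((\<lambda>(x, y, z). g x y z) has_derivative (\<lambda>(h, k, l). a * h + b * k + c * l)) (at p)" by blast
qed

lemma holomorphic3_on_local:
  assumes "\<And>p. p \<in> X \<Longrightarrow> \<exists>Y. p \<in> Y \<and> holomorphic3_on f Y" "open X"
  shows "holomorphic3_on f X"
  using assms unfolding holomorphic3_on_def by blast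

text \<open>\<open>cone s x\<close> is the convex cone of the \<open>\<tau>\<close> for which \<open>exp(- \<tau> x)\<close> decays at a rate at least \<open>s\<close>.\<close>

definition cone :: "real \<Rightarrow> complex \<Rightarrow> complex set" where
  "cone s x = {\<tau>. s * cmod \<tau> * cmod x \<le> Re (\<tau> * x)}"

lemma cone_add: "s \<ge> 0 \<Longrightarrow> \<tau> \<in> cone s x \<Longrightarrow> \<tau>' \<in> cone s x \<Longrightarrow> \<tau> + \<tau>' \<in> cone s x"
proof -
  assume a: "s \<ge> 0" "\<tau> \<in> cone s x" "\<tau>' \<in> cone s x"
  have "s * cmod (\<tau> + \<tau>') * cmod x \<le> s * (cmod \<tau> + cmod \<tau>') * cmod x"
    using a(1) norm_triangle_ineq by (intro mult_right_mono mult_left_mono) auto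
  thus ?thesis using a by (simp add: cone_def algebra_simps)
qed

lemma cone_scale: "u \<ge> 0 \<Longrightarrow> \<tau> \<in> cone s x \<Longrightarrow> of_real u * \<tau> \<in> cone s x"
proof -
  assume a: "u \<ge> 0" "\<tau> \<in> cone s x"
  have "Re (of_real u * \<tau> * x) = u * Re (\<tau> * x)" by (simp add: mult.assoc)
  moreover have "u * (s * cmod \<tau> * cmod x) \<le> u * Re (\<tau> * x)" using a by (intro mult_left_mono) (auto simp: cone_def)
  ultimately show ?thesis using a(1) by (simp add: cone_def norm_mult mult_ac)
qed

lemma cone_segment:
  assumes "s \<ge> 0" "p \<in> cone s x" "q \<in> cone s x" "\<tau> \<in> closed_segment p q" shows "\<tau> \<in> cone s x"
proof -
  obtain u where u: "0 \<le> u" "u \<le> 1" "\<tau> = (1 - u) *\<^sub>R p + u *\<^sub>R q" using assms(4) by (auto simp: in_segment)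
  have "of_real (1 - u) * p + of_real u * q \<in> cone s x"
    using u by (intro cone_add cone_scale assms) auto
  thus ?thesis using u by (simp add: scaleR_conv_of_real)
qed

text \<open>The real part of \<open>cis \<theta> / (\<epsilon> * t)\<close> is the cosine of
  \<open>\<theta> - arg t - arg \<epsilon>\<close> divided by the modulus of
  \<open>\<epsilon> * t\<close>, and this cosine exceeds
  \<open>cos (pi / 2 - \<eta>) = sin \<eta>\<close>. The result no longer mentions
  arguments.\<close>

lemma arg_cond_cone:
  assumes ac: "arg_cond \<eta> \<theta> t \<epsilon>" and \<eta>: "\<eta> > 0" and ne: "t \<noteq> 0" "\<epsilon> \<noteq> 0"
  shows "\<eta> < pi / 2" "cis \<theta> \<in> cone (sin \<eta>) (1 / (\<epsilon> * t))"
proof -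
  obtain \<alpha> \<beta> where ab: "is_Arg t \<alpha>" "is_Arg \<epsilon> \<beta>" "- pi / 2 + \<eta> < \<theta> - \<alpha> - \<beta>" "\<theta> - \<alpha> - \<beta> < pi / 2 - \<eta>"
    using ac by (auto simp: arg_cond_def)
  show e: "\<eta> < pi / 2" using ab by linarith
  have "t = cmod t * cis \<alpha>" "\<epsilon> = cmod \<epsilon> * cis \<beta>" using ab by (auto simp: is_Arg_def cis_conv_exp)
  hence "\<epsilon> * t = (cmod \<epsilon> * cis \<beta>) * (cmod t * cis \<alpha>)" by metis
  also have "\<dots> = (cmod \<epsilon> * cmod t) * cis (\<beta> + \<alpha>)" by (simp flip: cis_mult)
  finally have "cis \<theta> * (1 / (\<epsilon> * t)) = cis (\<theta> - \<alpha> - \<beta>) / (cmod \<epsilon> * cmod t)"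
    by (simp add: cis_divide[symmetric] field_simps flip: cis_mult)
  hence R: "Re (cis \<theta> * (1 / (\<epsilon> * t))) = cos (\<theta> - \<alpha> - \<beta>) / (cmod \<epsilon> * cmod t)"
    by (simp only: of_real_mult[symmetric] Re_divide_of_real) simp
  have "cos (pi / 2 - \<eta>) < cos (\<theta> - \<alpha> - \<beta>)"
    using cos_less_cos_iff_abs[of "\<theta> - \<alpha> - \<beta>" "pi / 2 - \<eta>"] ab e \<eta> by auto
  hence "sin \<eta> \<le> cos (\<theta> - \<alpha> - \<beta>)" by (simp add: cos_diff)
  hence "sin \<eta> / (cmod \<epsilon> * cmod t) \<le> cos (\<theta> - \<alpha> - \<beta>) / (cmod \<epsilon> * cmod t)" by (intro divide_right_mono) auto
  thus "cis \<theta> \<in> cone (sin \<eta>) (1 / (\<epsilon> * t))" unfolding cone_def mem_Collect_eq R by (simp add: norm_divide norm_mult)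
qed

lemma arg_cond_cone_uniform:
  assumes "\<exists>\<eta>>0. \<forall>t\<in>T. \<forall>\<epsilon>\<in>E. arg_cond \<eta> (\<theta> t \<epsilon>) t \<epsilon>" and "0 \<notin> T" "0 \<notin> E"
  shows "\<exists>s>0. \<forall>t\<in>T. \<forall>\<epsilon>\<in>E. cis (\<theta> t \<epsilon>) \<in> cone s (1 / (\<epsilon> * t))"
proof -
  obtain \<eta> where \<eta>: "\<eta> > 0" "\<And>t \<epsilon>. t \<in> T \<Longrightarrow> \<epsilon> \<in> E \<Longrightarrow> arg_cond \<eta> (\<theta> t \<epsilon>) t \<epsilon>" using assms(1) by blast
  have ne: "t \<noteq> 0" "\<epsilon> \<noteq> 0" if "t \<in> T" "\<epsilon> \<in> E" for t \<epsilon> using that assms by auto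
  show ?thesis
  proof (cases "\<eta> < pi / 2")
    case True
    have "sin \<eta> > 0" using True \<eta> by (intro sin_gt_zero) auto
    moreover have "cis (\<theta> t \<epsilon>) \<in> cone (sin \<eta>) (1 / (\<epsilon> * t))" if "t \<in> T" "\<epsilon> \<in> E" for t \<epsilon>
      using arg_cond_cone(2)[OF \<eta>(2)[OF that] \<eta>(1) ne[OF that]] .
    ultimately show ?thesis by blast
  next
    case False
    \<comment> \<open>For \<open>\<eta> \<ge> pi / 2\<close> the interval in \<open>arg_cond\<close>
      is empty, so \<open>T\<close> or \<open>E\<close> is empty and any rate will do.\<close>
    hence "False" if "t \<in> T" "\<epsilon> \<in> E" for t \<epsilon> using arg_cond_cone(1)[OF \<eta>(2)[OF that] \<eta>(1) ne[OF that]] by simp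
    thus ?thesis by (intro exI[of _ 1]) auto
  qed
qed

lemma cone_antimono: "s' \<le> s \<Longrightarrow> cone s x \<subseteq> cone s' x"
proof
  fix \<tau> assume a: "s' \<le> s" "\<tau> \<in> cone s x"
  have "s' * (cmod \<tau> * cmod x) \<le> s * (cmod \<tau> * cmod x)" using a(1) by (intro mult_right_mono) auto
  thus "\<tau> \<in> cone s' x" using a(2) by (simp add: cone_def mult.assoc)
qed

lemma finite_uniform_pos:
  assumes fin: "finite A" and ex: "\<And>k. k \<in> A \<Longrightarrow> \<exists>s>0::real. Q k s"
    and mono: "\<And>k s s'. k \<in> A \<Longrightarrow> Q k s \<Longrightarrow> 0 < s' \<Longrightarrow> s' \<le> s \<Longrightarrow> Q k s'"
  shows "\<exists>s>0. \<forall>k\<in>A. Q k s"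
proof -
  \<comment> \<open>Passing to \<open>C = 1 / s\<close> turns the smallest rate into the largest
    bound.\<close>
  have "\<exists>C>0. \<forall>k\<in>A. C > 0 \<and> Q k (1 / C)"
  proof (rule finite_uniform_bound[OF fin])
    fix k assume "k \<in> A"
    then obtain s where "s > 0" "Q k s" using ex by blast
    thus "\<exists>C. C > 0 \<and> Q k (1 / C)" by (intro exI[of _ "1 / s"]) auto
  next
    fix k and C C' :: real assume "k \<in> A" "0 < C \<and> Q k (1 / C)" "C \<le> C'"
    thus "0 < C' \<and> Q k (1 / C')" using mono[of k "1 / C" "1 / C'"] by (auto simp: field_simps)
  qed
  then obtain C where "C > 0" "\<forall>k\<in>A. C > 0 \<and> Q k (1 / C)" by blast
  thus ?thesis by (intro exI[of _ "1 / C"]) auto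
qed

section \<open>Cauchy's theorem on convex sets, tails of rays, elementary estimates\<close>

lemma contour_integral_triangle:
  assumes C: "convex C" "continuous_on C F" "F holomorphic_on interior C" and abc: "a \<in> C" "b \<in> C" "c \<in> C"
  shows "contour_integral (linepath a b) F + contour_integral (linepath b c) F = contour_integral (linepath a c) F"
proof -
  have hull: "convex hull {a, b, c} \<subseteq> C" using abc C(1) by (simp add: subset_hull)
  \<comment> \<open>The version of Cauchy's theorem with mere continuity on the boundary is used
    because 0, and possibly the corners of the paths, lie on the boundary of
    \<open>HJ\<close>.\<close>
  have "(F has_contour_integral 0) (linepath a b +++ linepath b c +++ linepath c a)"
    using C hull interior_mono[OF hull]
    by (intro Cauchy_theorem_triangle_interior) (auto intro: continuous_on_subset holomorphic_on_subset)
  from has_chain_integral_chain_integral3[OF this]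
  have "contour_integral (linepath a b) F + contour_integral (linepath b c) F + contour_integral (linepath c a) F = 0" .
  moreover have "continuous_on (closed_segment c a) F"
    using C abc by (meson closed_segment_subset continuous_on_subset)
  ultimately show ?thesis using contour_integral_reverse_linepath[of c a F] by (simp add: eq_neg_iff_add_eq_0 add.assoc)
qed

lemma ray_segment_integral:
  assumes X: "X \<ge> 0" and F: "continuous_on (closed_segment a (a + of_real X * e)) F"
  shows "((\<lambda>s. F (a + of_real s * e) * e) has_integral contour_integral (linepath a (a + of_real X * e)) F) {0..X}"
proof (cases "X = 0")
  case False
  hence X0: "X > 0" using X by simp
  have "(F has_contour_integral contour_integral (linepath a (a + of_real X * e)) F) (linepath a (a + of_real X * e))"
    using contour_integrable_continuous_linepath[OF F] by (rule has_contour_integral_integral)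
  hence "((\<lambda>x. F (linepath a (a + of_real X * e) x) * (of_real X * e)) has_integral contour_integral (linepath a (a + of_real X * e)) F) {0..1}"
    by (simp add: has_contour_integral_linepath)
  moreover have "linepath a (a + of_real X * e) x = a + of_real (x * X) * e" for x
    by (simp add: linepath_def scaleR_conv_of_real algebra_simps)
  ultimately have "((\<lambda>x. F (a + of_real (x * X) * e) * (of_real X * e)) has_integral contour_integral (linepath a (a + of_real X * e)) F) {0..1}"
    by simp
  from has_integral_affinity'[OF this[unfolded interval_cbox], of "1 / X" 0] X0
  have "((\<lambda>x. F (a + of_real x * e) * (of_real X * e)) has_integral X *\<^sub>R contour_integral (linepath a (a + of_real X * e)) F) {0..X}"
    by simp
  hence "((\<lambda>x. F (a + of_real x * e) * (of_real X * e) / of_real X) has_integral X *\<^sub>R contour_integral (linepath a (a + of_real X * e)) F / of_real X) {0..X}"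
    by (rule has_integral_divide)
  thus ?thesis using X0 by (simp add: scaleR_conv_of_real)
qed auto

text \<open>The segment to \<open>a\<close> and the initial piece of the ray are replaced by one
  straight segment to the point of parameter \<open>X\<close>; only the tail of the ray is left. Two
  paths can then be compared by joining their points of parameter \<open>X\<close>.\<close>

lemma ray_path_split:
  assumes C: "convex C" "continuous_on C F" "F holomorphic_on interior C"
    and m: "0 \<in> C" "a \<in> C" "a + of_real X * e \<in> C"
    and f: "\<And>\<tau>. \<tau> \<noteq> 0 \<Longrightarrow> f \<tau> = F \<tau>" and ri: "ray_integrable a e f" and X: "X \<ge> 0" and e: "e \<noteq> 0"
  shows "ray_path_integral a e f = contour_integral (linepath 0 (a + of_real X * e)) F + integral {X..} (\<lambda>s. f (a + of_real s * e) * e)"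
    and "(\<lambda>s. f (a + of_real s * e) * e) integrable_on {X..}"
proof -
  let ?g = "\<lambda>s. f (a + of_real s * e) * e"
  have ai: "?g absolutely_integrable_on {0..}" using ri by (simp add: ray_integrable_def)
  have "?g absolutely_integrable_on {X..}" by (rule set_integrable_subset[OF ai]) (use X in auto)
  thus iX: "?g integrable_on {X..}" by (rule set_lebesgue_integral_eq_integral(1))
  have seg: "contour_integral (linepath 0 a) f = contour_integral (linepath 0 a) F"
  proof (cases "a = 0")
    case False
    have "((\<lambda>x. f (linepath 0 a x) * (a - 0)) has_integral i) {0..1} \<longleftrightarrow> ((\<lambda>x. F (linepath 0 a x) * (a - 0)) has_integral i) {0..1}" for i
      by (rule has_integral_spike_eq[of "{0}"]) (use False f in \<open>auto simp: linepath_def\<close>)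
    hence "(f has_contour_integral i) (linepath 0 a) \<longleftrightarrow> (F has_contour_integral i) (linepath 0 a)" for i
      by (simp add: has_contour_integral_linepath)
    thus ?thesis unfolding contour_integral_def contour_integrable_on_def by simp
  qed simp
  have "continuous_on (closed_segment a (a + of_real X * e)) F"
    using C(1,2) m(2,3) by (meson closed_segment_subset continuous_on_subset)
  from ray_segment_integral[OF X this]
  have F: "((\<lambda>s. F (a + of_real s * e) * e) has_integral contour_integral (linepath a (a + of_real X * e)) F) {0..X}" .
  have "(?g has_integral contour_integral (linepath a (a + of_real X * e)) F) {0..X}"
  proof (rule has_integral_spike[OF _ _ F])
    \<comment> \<open>The ray meets 0, the only point where \<open>f\<close> and \<open>F\<close>
      may differ, for at most one parameter.\<close>
    have "s = Re (- a / e)" if "a + of_real s * e = 0" for s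
    proof -
      have "of_real s = - a / e" using that e by (simp add: field_simps eq_neg_iff_add_eq_0 add.commute)
      thus ?thesis by (metis Re_complex_of_real)
    qed
    hence "{s. a + of_real s * e = 0} \<subseteq> {Re (- a / e)}" by blast
    thus "negligible {s. a + of_real s * e = 0}" by (rule negligible_subset[OF negligible_sing])
  qed (use f in auto)
  hence "(?g has_integral contour_integral (linepath a (a + of_real X * e)) F + integral {X..} ?g) ({0..X} \<union> {X..})"
    by (rule has_integral_Un[OF _ integrable_integral[OF iX]]) (rule negligible_subset[OF negligible_sing[of X]], auto)
  moreover have "{0..X} \<union> {X..} = {0..}" using X by auto
  ultimately have "ray_integral a e f = contour_integral (linepath a (a + of_real X * e)) F + integral {X..} ?g"
    unfolding ray_integral_def by (intro integral_unique) (simp only:)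
  thus "ray_path_integral a e f = contour_integral (linepath 0 (a + of_real X * e)) F + integral {X..} ?g"
    unfolding ray_path_integral_def seg contour_integral_triangle[OF C m, symmetric] by simp
qed

lemma exp_tail_bound:
  fixes g :: "real \<Rightarrow> complex"
  assumes "g integrable_on {X..}" "\<kappa> > 0" "\<And>s. s \<ge> X \<Longrightarrow> cmod (g s) \<le> C * exp (- \<kappa> * s)"
  shows "cmod (integral {X..} g) \<le> C * exp (- \<kappa> * X) / \<kappa>"
proof -
  have i: "((\<lambda>s. C * exp (- \<kappa> * s)) has_integral C * (exp (- \<kappa> * X) / \<kappa>)) {X..}"
    by (intro has_integral_mult_right has_integral_exp_minus_to_infinity assms)
  have "cmod (integral {X..} g) \<le> integral {X..} (\<lambda>s. C * exp (- \<kappa> * s))"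
    by (rule integral_norm_bound_integral) (use assms i in auto)
  thus ?thesis using integral_unique[OF i] by (simp only: times_divide_eq_right)
qed

lemma integrable_exp_tail:
  assumes "\<kappa> > 0" shows "integrable (lebesgue_on {-1::real..}) (\<lambda>s. C * exp (- \<kappa> * s))"
proof -
  have "(\<lambda>s. exp (- \<kappa> * s)) integrable_on {-1::real..}"
    using has_integral_exp_minus_to_infinity[OF assms] by blast
  hence "(\<lambda>s. exp (- \<kappa> * s)) absolutely_integrable_on {-1::real..}"
    by (intro nonnegative_absolutely_integrable_1) auto
  hence "integrable (lebesgue_on {-1::real..}) (\<lambda>s. exp (- \<kappa> * s))"
    by (simp add: set_integrable_def integrable_restrict_space)
  thus ?thesis by simp
qed

text \<open>The quadratic term of the exponential series already beats the linear one;
  \<open>B\<close> comes from completing the square. This gives convergence of the integrals in the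
  strips whatever the sign of the real part of \<open>\<tau>/(\<epsilon> t)\<close>.\<close>

lemma linear_minus_exp_bound:
  fixes \<alpha> c \<sigma> :: real
  assumes "c > 0" "\<sigma> > 0"
  shows "\<exists>B. \<forall>y\<ge>0. \<alpha> * y - c * exp (\<sigma> * y) \<le> B - y"
proof -
  define q where "q = c * \<sigma>\<^sup>2 / 2"
  have q: "q > 0" using assms by (simp add: q_def)
  have "\<alpha> * y - c * exp (\<sigma> * y) \<le> (\<alpha> + 1)\<^sup>2 / (4 * q) - y" if y: "y \<ge> 0" for y
  proof -
    have "(\<sigma> * y)\<^sup>2 / 2 \<le> exp (\<sigma> * y)" using exp_lower_Taylor_quadratic[of "\<sigma> * y"] y assms by (smt (verit) mult_nonneg_nonneg)
    hence "c * ((\<sigma> * y)\<^sup>2 / 2) \<le> c * exp (\<sigma> * y)" using assms by (intro mult_left_mono) auto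
    hence "q * y\<^sup>2 \<le> c * exp (\<sigma> * y)" by (simp add: q_def power_mult_distrib mult_ac)
    moreover have "(\<alpha> + 1) * y - q * y\<^sup>2 \<le> (\<alpha> + 1)\<^sup>2 / (4 * q)"
    proof -
      have "0 \<le> (2 * q * y - (\<alpha> + 1))\<^sup>2" by simp
      hence "4 * q * ((\<alpha> + 1) * y - q * y\<^sup>2) \<le> (\<alpha> + 1)\<^sup>2" by (simp add: power2_eq_square algebra_simps)
      thus ?thesis using q by (simp add: field_simps)
    qed
    ultimately show ?thesis by (simp add: algebra_simps)
  qed
  thus ?thesis by blast
qed

text \<open>For fixed \<open>s\<close> and \<open>\<epsilon>\<close>, the map sending
  \<open>t\<close> to \<open>t / (1 + s * \<epsilon> * t)\<close> is inverted by the one with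
  \<open>- s\<close>. Hence the set is a union over \<open>s\<close> of preimages of
  \<open>Tr\<close> under continuous maps.\<close>

lemma open_continuation_domain:
  assumes Tr: "open Tr" and D: "open D" and E: "open E"
    and ne: "\<And>t \<epsilon> s. t \<in> Tr \<Longrightarrow> \<epsilon> \<in> E \<Longrightarrow> 0 \<le> s \<Longrightarrow> (s = 0 \<or> (\<exists>(k0, k1, k2)\<in>A. s \<le> real k2)) \<Longrightarrow> 1 + of_real s * \<epsilon> * t \<noteq> 0"
  shows "open (continuation_domain A Tr D E)"
proof -
  let ?Sset = "{s. 0 \<le> s \<and> (s = 0 \<or> (\<exists>(k0, k1, k2)\<in>A. s \<le> real k2))}"
  let ?V = "\<lambda>s. {(t', z, \<epsilon>). z \<in> D \<and> \<epsilon> \<in> E \<and> 1 - of_real s * \<epsilon> * t' \<noteq> 0 \<and> t' / (1 - of_real s * \<epsilon> * t') \<in> Tr}"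
  have inv: "1 - s * \<epsilon> * (t / (1 + s * \<epsilon> * t)) = 1 / (1 + s * \<epsilon> * t)" if "1 + s * \<epsilon> * t \<noteq> 0" for s \<epsilon> t :: complex
    using that by (simp add: field_simps)
  have inv2: "1 + s * \<epsilon> * (t / (1 - s * \<epsilon> * t)) = 1 / (1 - s * \<epsilon> * t)" if "1 - s * \<epsilon> * t \<noteq> 0" for s \<epsilon> t :: complex
    using that by (simp add: field_simps)
  have "continuation_domain A Tr D E = (\<Union>s\<in>?Sset. ?V s)"
  proof (intro equalityI subsetI)
    fix q assume "q \<in> continuation_domain A Tr D E"
    then obtain t z \<epsilon> s where q: "q = (t / (1 + of_real s * \<epsilon> * t), z, \<epsilon>)" "t \<in> Tr" "z \<in> D" "\<epsilon> \<in> E" "s \<in> ?Sset"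
      unfolding continuation_domain_def by blast
    have n: "1 + of_real s * \<epsilon> * t \<noteq> 0" using ne q by blast
    have "q \<in> ?V s" unfolding q(1) unfolding mem_Collect_eq prod.case inv[OF n] using q(2-4) n by simp
    thus "q \<in> (\<Union>s\<in>?Sset. ?V s)" using q(5) by blast
  next
    fix q assume "q \<in> (\<Union>s\<in>?Sset. ?V s)"
    then obtain s where s: "s \<in> ?Sset" "q \<in> ?V s" by blast
    then obtain t' z \<epsilon> where q: "q = (t', z, \<epsilon>)" "z \<in> D" "\<epsilon> \<in> E" "1 - of_real s * \<epsilon> * t' \<noteq> 0" "t' / (1 - of_real s * \<epsilon> * t') \<in> Tr"
      by auto
    let ?t = "t' / (1 - of_real s * \<epsilon> * t')"
    have "?t / (1 + of_real s * \<epsilon> * ?t) = t'" unfolding inv2[OF q(4)] using q(4) by simp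
    hence "q = (?t / (1 + of_real s * \<epsilon> * ?t), z, \<epsilon>)" using q(1) by simp
    thus "q \<in> continuation_domain A Tr D E" unfolding continuation_domain_def using q s by blast
  qed
  moreover have "open (?V s)" for s
  proof -
    let ?N = "UNIV \<times> D \<times> E \<inter> {q. 1 - of_real s * snd (snd q) * fst q \<noteq> (0::complex)}"
    have N: "open ?N" by (intro open_Int open_Times open_Collect_neq continuous_intros D E) auto
    have "continuous_on ?N (\<lambda>q. fst q / (1 - of_real s * snd (snd q) * fst q))"
      by (intro continuous_intros) auto
    hence "open (?N \<inter> (\<lambda>q. fst q / (1 - of_real s * snd (snd q) * fst q)) -` Tr)"
      using N Tr continuous_open_preimage by blast
    moreover have "?N \<inter> (\<lambda>q. fst q / (1 - of_real s * snd (snd q) * fst q)) -` Tr = ?V s" by auto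
    ultimately show ?thesis by simp
  qed
  ultimately show ?thesis by auto
qed

section \<open>Laplace integrals along rays in the sectors\<close>

context borel_data
begin

text \<open>\<open>kp / |\<epsilon>|\<close> is the exponential growth rate of the transform. A
  kernel that decays at rate at least \<open>ka / |\<epsilon>|\<close> therefore leaves
  \<open>exp(- |\<tau>| / |\<epsilon>|)\<close>.\<close>

definition kp where "kp = \<zeta> * \<sigma>1"
definition ka where "ka = kp + 1"

lemma kp_pos: "kp > 0" "ka > 0" using zeta_sum_ge_1[OF b] pos by (auto simp: kp_def ka_def add_pos_pos)

abbreviation "ker t z \<epsilon> \<equiv> laplace_kernel (\<lambda>\<tau>. W \<tau> z \<epsilon>) (\<epsilon> * t)"

text \<open>\<open>F\<close> removes the singularity at \<open>0\<close> of the integrand \<open>ker\<close>, where \<open>x/0 = 0\<close> gives a wrong value.\<close>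

definition F where
  "F t z \<epsilon> \<tau> = (if \<tau> = 0 then deriv (\<lambda>\<tau>. W \<tau> z \<epsilon>) 0 else W \<tau> z \<epsilon> / \<tau>) * exp (- (\<tau> / (\<epsilon> * t)))"

lemma F_ker: "\<tau> \<noteq> 0 \<Longrightarrow> ker t z \<epsilon> \<tau> = F t z \<epsilon> \<tau>"
  by (simp add: F_def laplace_kernel_def)

lemma ker_0: "ker t z \<epsilon> 0 = 0" by (simp add: laplace_kernel_def)

lemma iota0: "0 < \<iota>" using \<iota> by simp

lemma W0: assumes "\<epsilon> \<in> E" "z \<in> D" shows "W 0 z \<epsilon> = 0"
  using W_S[OF iota0 _ assms, of 0] r by (simp add: QS_def)

lemma F_hol: assumes p: "p < \<iota>" and \<epsilon>: "\<epsilon> \<in> E" and z: "z \<in> D" shows "F t z \<epsilon> holomorphic_on So p"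
proof -
  have "(\<lambda>\<tau>. if \<tau> = 0 then deriv (\<lambda>\<tau>. W \<tau> z \<epsilon>) 0 else W \<tau> z \<epsilon> / \<tau>) holomorphic_on So p"
    by (rule pole_theorem_open_0[OF W_arg(2)[OF \<epsilon> z p] So_open[OF p], of 0]) (use W0[OF \<epsilon> z] in auto)
  moreover have "(\<lambda>\<tau>. exp (- (\<tau> / (\<epsilon> * t)))) holomorphic_on So p"
    unfolding divide_inverse by (intro holomorphic_intros)
  ultimately have "(\<lambda>\<tau>. (if \<tau> = 0 then deriv (\<lambda>\<tau>. W \<tau> z \<epsilon>) 0 else W \<tau> z \<epsilon> / \<tau>) * exp (- (\<tau> / (\<epsilon> * t)))) holomorphic_on So p"
    by (rule holomorphic_on_mult)
  thus ?thesis by (simp only: F_def[abs_def])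
qed

lemma F_ball: assumes "\<epsilon> \<in> E" "z \<in> D" shows "F t z \<epsilon> holomorphic_on ball 0 r"
  by (rule holomorphic_on_subset[OF F_hol[OF iota0 assms]]) auto

text \<open>0 lies on the boundary of \<open>HJ\<close>, so the removable singularity cannot be
  treated inside \<open>HJ\<close>. Near 0 the regularity is taken from the full disc, in which
  \<open>W\<close> is holomorphic too.\<close>

lemma F_HJ: assumes \<epsilon>: "\<epsilon> \<in> E" and z: "z \<in> D"
  shows "continuous_on HJ (F t z \<epsilon>)" "F t z \<epsilon> holomorphic_on interior HJ"
proof -
  have eq: "F t z \<epsilon> \<tau> = W \<tau> z \<epsilon> / \<tau> * exp (- (\<tau> / (\<epsilon> * t)))" if "\<tau> \<noteq> 0" for \<tau> using that by (simp add: F_def)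
  show "continuous_on HJ (F t z \<epsilon>)"
  proof (rule continuous_on_local)
    fix \<tau> assume "\<tau> \<in> HJ"
    show "\<exists>V. open V \<and> \<tau> \<in> V \<and> continuous_on (HJ \<inter> V) (F t z \<epsilon>)"
    proof (cases "\<tau> = 0")
      case True
      have "continuous_on (HJ \<inter> ball 0 r) (F t z \<epsilon>)"
        by (rule continuous_on_subset[OF holomorphic_on_imp_continuous_on[OF F_ball[OF \<epsilon> z]]]) auto
      thus ?thesis using True r by (intro exI[of _ "ball 0 r"]) auto
    next
      case False
      have "continuous_on (HJ \<inter> - {0}) (\<lambda>\<tau>. (\<lambda>(\<tau>, z, \<epsilon>). W \<tau> z \<epsilon>) (\<tau>, z, \<epsilon>))"
        by (rule continuous_on_compose2[OF W_cont(1)]) (use \<epsilon> z in \<open>auto intro!: continuous_intros\<close>)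
      hence "continuous_on (HJ \<inter> - {0}) (\<lambda>\<tau>. W \<tau> z \<epsilon> / \<tau> * exp (- (\<tau> * inverse (\<epsilon> * t))))"
        by (intro continuous_intros) auto
      hence "continuous_on (HJ \<inter> - {0}) (F t z \<epsilon>)"
        by (rule continuous_on_eq) (auto simp: eq divide_inverse)
      thus ?thesis using False by (intro exI[of _ "- {0}"]) auto
    qed
  qed
  have "(\<lambda>\<tau>. W \<tau> z \<epsilon> / \<tau> * exp (- (\<tau> * inverse (\<epsilon> * t)))) holomorphic_on interior HJ - {0}"
    by (intro holomorphic_intros holomorphic_on_subset[OF W_arg(1)[OF \<epsilon> z]]) auto
  hence "F t z \<epsilon> holomorphic_on interior HJ - {0}"
    by (rule holomorphic_transform) (auto simp: eq divide_inverse)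
  moreover have "F t z \<epsilon> holomorphic_on interior HJ \<inter> ball 0 r"
    by (rule holomorphic_on_subset[OF F_ball[OF \<epsilon> z]]) auto
  ultimately have "F t z \<epsilon> holomorphic_on (interior HJ - {0}) \<union> (interior HJ \<inter> ball 0 r)"
    by (intro holomorphic_on_Un) (auto intro!: open_delete)
  moreover have "interior HJ = (interior HJ - {0}) \<union> (interior HJ \<inter> ball 0 r)" using r by auto
  ultimately show "F t z \<epsilon> holomorphic_on interior HJ" by simp
qed

lemma F_norm: "\<tau> \<noteq> 0 \<Longrightarrow> cmod (W \<tau> z \<epsilon>) \<le> 2 * (Kw * cmod \<tau> * exp B) \<Longrightarrow> 
   cmod (F t z \<epsilon> \<tau>) \<le> 2 * Kw * exp (B - Re (\<tau> / (\<epsilon> * t)))"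
proof -
  assume a: "\<tau> \<noteq> 0" "cmod (W \<tau> z \<epsilon>) \<le> 2 * (Kw * cmod \<tau> * exp B)"
  have "cmod (W \<tau> z \<epsilon>) / cmod \<tau> \<le> 2 * Kw * exp B" using a by (simp add: field_simps)
  hence "cmod (W \<tau> z \<epsilon>) / cmod \<tau> * exp (- Re (\<tau> / (\<epsilon> * t))) \<le> 2 * Kw * exp B * exp (- Re (\<tau> / (\<epsilon> * t)))"
    by (intro mult_right_mono) auto
  moreover have "cmod (F t z \<epsilon> \<tau>) = cmod (W \<tau> z \<epsilon>) / cmod \<tau> * exp (- Re (\<tau> / (\<epsilon> * t)))"
    using a by (simp add: F_def norm_mult norm_divide del: Re_divide)
  ultimately show ?thesis by (simp add: exp_diff exp_minus field_simps)
qed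

lemma F_bound_H:
  assumes "k \<in> {-n..n}" "\<tau> \<in> H k" "\<tau> \<noteq> 0" "\<epsilon> \<in> E" "z \<in> D"
  shows "cmod (F t z \<epsilon> \<tau>) \<le> 2 * Kw * exp (kp * cmod \<tau> / cmod \<epsilon> - (M - \<zeta>) * GH \<tau> - Re (\<tau> / (\<epsilon> * t)))"
proof -
  have eq: "kp * cmod \<tau> / cmod \<epsilon> = \<zeta> * (\<sigma>1 * cmod \<tau> / cmod \<epsilon>)" by (simp add: kp_def)
  show ?thesis unfolding eq using W_H[OF assms(1,2,4,5)] assms(3) by (intro F_norm) (auto simp: QH_def)
qed

lemma F_bound_HJ:
  assumes "\<tau> \<in> HJ" "\<tau> \<noteq> 0" "\<epsilon> \<in> E" "z \<in> D"
  shows "cmod (F t z \<epsilon> \<tau>) \<le> 2 * Kw * exp (kp * cmod \<tau> / cmod \<epsilon> + \<zeta> * GJ \<tau> - Re (\<tau> / (\<epsilon> * t)))"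
proof -
  have eq: "kp * cmod \<tau> / cmod \<epsilon> + \<zeta> * GJ \<tau> = \<zeta> * (\<sigma>1 * cmod \<tau> / cmod \<epsilon> + GJ \<tau>)" by (simp add: kp_def algebra_simps)
  show ?thesis unfolding eq using W_HJ[OF assms(1,3,4)] assms(2) by (intro F_norm) (auto simp: QJ_def)
qed

lemma F_bound_S:
  assumes "p < \<iota>" "\<tau> \<in> Sc p" "\<tau> \<noteq> 0" "\<epsilon> \<in> E" "z \<in> D"
  shows "cmod (F t z \<epsilon> \<tau>) \<le> 2 * Kw * exp (kp * cmod \<tau> / cmod \<epsilon> - Re (\<tau> / (\<epsilon> * t)))"
proof -
  have eq: "kp * cmod \<tau> / cmod \<epsilon> = \<zeta> * (\<sigma>1 * cmod \<tau> / cmod \<epsilon>)" by (simp add: kp_def)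
  show ?thesis unfolding eq using W_S[OF assms(1,2,4,5)] assms(3) by (intro F_norm) (auto simp: QS_def)
qed

text \<open>An admissible direction of integration. The inequality is strict so that it persists for
  nearby \<open>t\<close> and \<open>\<epsilon>\<close>, which makes \<open>OmS\<close>
  open.\<close>

definition okdir :: "complex \<Rightarrow> complex \<Rightarrow> complex \<Rightarrow> bool" where
  "okdir e t \<epsilon> \<longleftrightarrow> cmod e = 1 \<and> ka / cmod \<epsilon> < Re (e / (\<epsilon> * t))"

lemma Sd_sector: assumes "p < \<iota>"
  shows "open (Sd p)" "convex (Sd p)" "\<And>z s. z \<in> Sd p \<Longrightarrow> s > 0 \<Longrightarrow> of_real s * z \<in> Sd p"
  using right_sector[of "d p" "Sd p"] Sd[OF assms] by auto

lemma Sd_ray: assumes "p < \<iota>" "e \<in> Sd p" "s \<ge> 0" shows "of_real s * e \<in> Sc p"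
  using Sd_sector(3)[OF assms(1,2), of s] assms(3) closure_subset[of "Sd p"] r by (cases "s = 0") auto

lemma S_ker_bound:
  assumes p: "p < \<iota>" and e: "e \<in> Sd p" and ok: "okdir e t \<epsilon>" and \<epsilon>: "\<epsilon> \<in> E" and z: "z \<in> D" and s: "s \<ge> 0"
  shows "cmod (ker t z \<epsilon> (of_real s * e) * e) \<le> 2 * Kw * exp (- (1 / cmod \<epsilon>) * s)"
proof (cases "s = 0")
  case True
  thus ?thesis using Kw(1) by (simp add: ker_0)
next
  case False
  have e1: "cmod e = 1" "e \<noteq> 0" using ok by (auto simp: okdir_def)
  have "Re (of_real s * e / (\<epsilon> * t)) = s * Re (e / (\<epsilon> * t))"
    by (metis Re_of_real_mult times_divide_eq_right)
  moreover have "s * (ka / cmod \<epsilon>) \<le> s * Re (e / (\<epsilon> * t))" using s ok by (intro mult_left_mono) (auto simp: okdir_def)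
  ultimately have R: "kp * cmod (of_real s * e) / cmod \<epsilon> - Re (of_real s * e / (\<epsilon> * t)) \<le> - (1 / cmod \<epsilon>) * s"
    using s e1 by (simp add: norm_mult ka_def field_simps add_divide_distrib)
  have "cmod (ker t z \<epsilon> (of_real s * e) * e) = cmod (F t z \<epsilon> (of_real s * e))"
    using False e1 by (subst F_ker) (auto simp: norm_mult)
  also have "\<dots> \<le> 2 * Kw * exp (kp * cmod (of_real s * e) / cmod \<epsilon> - Re (of_real s * e / (\<epsilon> * t)))"
    by (rule F_bound_S[OF p Sd_ray[OF p e s] _ \<epsilon> z]) (use False e1 in auto)
  also have "\<dots> \<le> 2 * Kw * exp (- (1 / cmod \<epsilon>) * s)"
    using R Kw(1) by (intro mult_left_mono) auto
  finally show ?thesis .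
qed

text \<open>On a chord between two points of modulus \<open>N\<close> the modulus is at most
  \<open>N\<close> by convexity, while the real part, being affine, keeps the lower bound of the end
  points. So the rate \<open>N / |\<epsilon>|\<close> holds even where the chord comes closer to
  0.\<close>

lemma segment_S_bound:
  assumes N: "N > 0" and u: "cmod u1 = N" "cmod u2 = N"
    and R: "ka * N / cmod \<epsilon> \<le> Re (u1 / (\<epsilon> * t))" "ka * N / cmod \<epsilon> \<le> Re (u2 / (\<epsilon> * t))"
    and \<tau>: "\<tau> \<in> closed_segment u1 u2" and dm: "p < \<iota>" "\<tau> \<in> Sc p" and \<epsilon>: "\<epsilon> \<in> E" and z: "z \<in> D"
  shows "cmod (F t z \<epsilon> \<tau>) \<le> 2 * Kw * exp (- N / cmod \<epsilon>)"
proof -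
  obtain u where u': "0 \<le> u" "u \<le> 1" "\<tau> = (1 - u) *\<^sub>R u1 + u *\<^sub>R u2" using \<tau> by (auto simp: in_segment)
  have "cmod \<tau> \<le> (1 - u) * N + u * N" unfolding u'(3)
    using norm_triangle_ineq[of "(1 - u) *\<^sub>R u1" "u *\<^sub>R u2"] u u' by simp
  hence tN: "cmod \<tau> \<le> N" by (simp add: algebra_simps)
  have "\<tau> / (\<epsilon> * t) = of_real (1 - u) * (u1 / (\<epsilon> * t)) + of_real u * (u2 / (\<epsilon> * t))"
    unfolding u'(3) by (simp add: scaleR_conv_of_real add_divide_distrib)
  hence "Re (\<tau> / (\<epsilon> * t)) = (1 - u) * Re (u1 / (\<epsilon> * t)) + u * Re (u2 / (\<epsilon> * t))"
    by (simp only: plus_complex.sel Re_complex_of_real times_complex.sel Im_complex_of_real)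
  also have "\<dots> \<ge> (1 - u) * (ka * N / cmod \<epsilon>) + u * (ka * N / cmod \<epsilon>)"
    using R u' by (intro add_mono mult_left_mono) auto
  finally have Rt: "Re (\<tau> / (\<epsilon> * t)) \<ge> ka * N / cmod \<epsilon>"
    unfolding distrib_right[symmetric] by simp
  have "ka * N / cmod \<epsilon> > 0" using kp_pos N \<epsilon> by simp
  hence "\<tau> \<noteq> 0" using Rt by auto
  have "cmod (F t z \<epsilon> \<tau>) \<le> 2 * Kw * exp (kp * cmod \<tau> / cmod \<epsilon> - Re (\<tau> / (\<epsilon> * t)))"
    by (rule F_bound_S[OF dm \<open>\<tau> \<noteq> 0\<close> \<epsilon> z])
  also have "kp * cmod \<tau> / cmod \<epsilon> \<le> kp * N / cmod \<epsilon>"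
    using tN kp_pos by (intro divide_right_mono mult_left_mono) auto
  hence "2 * Kw * exp (kp * cmod \<tau> / cmod \<epsilon> - Re (\<tau> / (\<epsilon> * t))) \<le> 2 * Kw * exp (- N / cmod \<epsilon>)"
    using Rt Kw(1) by (intro mult_left_mono) (auto simp: ka_def add_divide_distrib algebra_simps)
  finally show ?thesis .
qed

definition OmS :: "complex \<Rightarrow> (complex \<times> complex \<times> complex) set" where
  "OmS e = {(t, z, \<epsilon>). t \<noteq> 0 \<and> z \<in> D \<and> \<epsilon> \<in> E \<and> okdir e t \<epsilon>}"

lemma open_E: "open E" by (intro open_delete) auto

lemma open_OmS: "open (OmS e)"
proof (cases "cmod e = 1")
  case True
  let ?N = "(- {0 :: complex}) \<times> D \<times> E"
  have N: "open ?N" by (intro open_Times open_E open_Compl) auto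
  have c: "continuous_on ?N (\<lambda>q. Re (e / (snd (snd q) * fst q)) - ka / cmod (snd (snd q)))"
    by (intro continuous_intros) auto
  have "open (?N \<inter> (\<lambda>q. Re (e / (snd (snd q) * fst q)) - ka / cmod (snd (snd q))) -` {0<..})"
    by (rule continuous_open_preimage[OF c N]) auto
  also have "?N \<inter> (\<lambda>q. Re (e / (snd (snd q) * fst q)) - ka / cmod (snd (snd q))) -` {0<..} = OmS e"
    using True by (auto simp: OmS_def okdir_def)
  finally show ?thesis .
next
  case False
  hence "OmS e = {}" by (auto simp: OmS_def okdir_def)
  thus ?thesis by simp
qed

lemma laplace_S:
  assumes p: "p < \<iota>" and e: "e \<in> Sd p"
  shows "laplace_path 0 e W D E (OmS e)"
proof
  have im': "bent_path 0 e s \<in> Sc p" for s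
    using Sd_ray[OF p e, of s] r by (cases "s < 0") (auto simp: bent_path_def)
  hence im: "bent_path 0 e ` {-1..} \<subseteq> Sc p" by blast
  show "continuous_on (bent_path 0 e ` {-1..} \<times> D \<times> E) (\<lambda>(\<tau>, z, \<epsilon>). W \<tau> z \<epsilon>)"
    by (rule continuous_on_subset[OF W_cont(2)[OF p]]) (use im in blast)
  show "(\<lambda>z. W (bent_path 0 e s) z \<epsilon>) holomorphic_on D" if "s \<ge> -1" "\<epsilon> \<in> E" for s \<epsilon>
    using W_z(1)[OF _ that(2)] im' p by blast
  show "(\<lambda>\<epsilon>. W (bent_path 0 e s) z \<epsilon>) holomorphic_on E" if "s \<ge> -1" "z \<in> D" for s z
    using W_eps[OF _ that(2)] im' p by blast
  fix q assume q: "q \<in> OmS e"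
  \<comment> \<open>One majorant for all parameters: \<open>|\<epsilon>| < \<epsilon>0\<close>
    weakens the decay to the fixed rate \<open>1 / \<epsilon>0\<close>. For \<open>s < 0\<close> the
    integrand vanishes, since the degenerate segment has speed 0.\<close>
  have "cmod (ker t z \<epsilon> (bent_path 0 e s) * bent_speed 0 e s) \<le> 2 * Kw * exp (- (1 / \<epsilon>0) * s)"
    if q: "(t, z, \<epsilon>) \<in> OmS e" and s: "s \<ge> -1" for t z \<epsilon> s
  proof (cases "s < 0")
    case True
    thus ?thesis using Kw(1) by (simp add: bent_speed_def)
  next
    case False
    have "cmod (ker t z \<epsilon> (of_real s * e) * e) \<le> 2 * Kw * exp (- (1 / cmod \<epsilon>) * s)"
      by (rule S_ker_bound[OF p e]) (use q False in \<open>auto simp: OmS_def\<close>)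
    also have "\<dots> \<le> 2 * Kw * exp (- (1 / \<epsilon>0) * s)"
    proof -
      have "1 / \<epsilon>0 * s \<le> 1 / cmod \<epsilon> * s" using q False \<epsilon>0 by (intro mult_right_mono) (auto simp: OmS_def field_simps)
      thus ?thesis using Kw(1) by (intro mult_left_mono) auto
    qed
    finally show ?thesis using False by (simp add: bent_path_def bent_speed_def)
  qed
  thus "\<exists>V h. open V \<and> q \<in> V \<and> integrable (lebesgue_on {-1..}) h \<and>
        (\<forall>t z \<epsilon> s. (t, z, \<epsilon>) \<in> V \<inter> OmS e \<longrightarrow> s \<ge> -1 \<longrightarrow>
           cmod (ker t z \<epsilon> (bent_path 0 e s) * bent_speed 0 e s) \<le> h s)"
    using integrable_exp_tail[of "1 / \<epsilon>0" "2 * Kw"] \<epsilon>0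
    by (intro exI[of _ UNIV] exI[of _ "\<lambda>s. 2 * Kw * exp (- (1 / \<epsilon>0) * s)"]) auto
qed (use open_OmS open_E in \<open>auto simp: OmS_def\<close>)

text \<open>Both rays are cut at distance \<open>N\<close>; the two tails and the chord joining the
  cuts are of size \<open>exp(- N / |\<epsilon>|)\<close>. The convex set \<open>C\<close> is left
  open for two uses: the sector with 0 for arbitrarily large \<open>N\<close>, and the disc of
  radius \<open>r\<close> for rays in different sectors.\<close>

lemma two_rays:
  assumes p: "p1 < \<iota>" "p2 < \<iota>" and e: "e1 \<in> Sd p1" "e2 \<in> Sd p2" and ok: "okdir e1 t \<epsilon>" "okdir e2 t \<epsilon>"
    and \<epsilon>: "\<epsilon> \<in> E" and z: "z \<in> D" and t: "t \<noteq> 0" and N: "N > 0"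
    and C: "convex C" "continuous_on C (F t z \<epsilon>)" "F t z \<epsilon> holomorphic_on interior C" "0 \<in> C" "of_real N * e1 \<in> C" "of_real N * e2 \<in> C"
    and dm: "\<And>\<tau>. \<tau> \<in> C \<Longrightarrow> \<exists>p<\<iota>. \<tau> \<in> Sc p"
  shows "cmod (ray_path_integral 0 e1 (ker t z \<epsilon>) - ray_path_integral 0 e2 (ker t z \<epsilon>)) \<le> 2 * Kw * exp (- N / cmod \<epsilon>) * (2 * N + 2 * cmod \<epsilon>)"
proof -
  have q: "(t, z, \<epsilon>) \<in> OmS e1" "(t, z, \<epsilon>) \<in> OmS e2" using ok \<epsilon> z t by (auto simp: OmS_def)
  have e0: "e1 \<noteq> 0" "e2 \<noteq> 0" "cmod e1 = 1" "cmod e2 = 1" using ok by (auto simp: okdir_def)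
  have N0: "N \<ge> 0" using N by simp
  note sp1 = ray_path_split[OF C(1-4) C(4) _ F_ker laplace_path.U_eq(2)[OF laplace_S[OF p(1) e(1)] q(1)] N0 e0(1), unfolded add_0_left, OF C(5)]
  note sp2 = ray_path_split[OF C(1-4) C(4) _ F_ker laplace_path.U_eq(2)[OF laplace_S[OF p(2) e(2)] q(2)] N0 e0(2), unfolded add_0_left, OF C(6)]
  let ?T1 = "integral {N..} (\<lambda>s. ker t z \<epsilon> (of_real s * e1) * e1)"
  let ?T2 = "integral {N..} (\<lambda>s. ker t z \<epsilon> (of_real s * e2) * e2)"
  let ?c = "contour_integral (linepath (of_real N * e1) (of_real N * e2)) (F t z \<epsilon>)"
  have m: "1 / cmod \<epsilon> > 0" using \<epsilon> by simp
  have T1: "cmod ?T1 \<le> 2 * Kw * exp (- (1 / cmod \<epsilon>) * N) / (1 / cmod \<epsilon>)"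
    by (rule exp_tail_bound[OF sp1(2) m]) (use S_ker_bound[OF p(1) e(1) ok(1) \<epsilon> z] N in auto)
  have T2: "cmod ?T2 \<le> 2 * Kw * exp (- (1 / cmod \<epsilon>) * N) / (1 / cmod \<epsilon>)"
    by (rule exp_tail_bound[OF sp2(2) m]) (use S_ker_bound[OF p(2) e(2) ok(2) \<epsilon> z] N in auto)
  have Rr: "ka * N / cmod \<epsilon> \<le> Re (of_real N * e / (\<epsilon> * t))" if "okdir e t \<epsilon>" for e
  proof -
    have "Re (of_real N * e / (\<epsilon> * t)) = N * Re (e / (\<epsilon> * t))"
      by (metis Re_of_real_mult times_divide_eq_right)
    moreover have "N * (ka / cmod \<epsilon>) \<le> N * Re (e / (\<epsilon> * t))" using N that by (intro mult_left_mono) (auto simp: okdir_def)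
    ultimately show ?thesis by (simp add: mult_ac)
  qed
  have segC: "closed_segment (of_real N * e1) (of_real N * e2) \<subseteq> C" using C by (simp add: closed_segment_subset)
  have "cmod ?c \<le> 2 * Kw * exp (- N / cmod \<epsilon>) * cmod (of_real N * e2 - of_real N * e1)"
  proof (rule contour_integral_bound_linepath)
    show "F t z \<epsilon> contour_integrable_on linepath (of_real N * e1) (of_real N * e2)"
      by (rule contour_integrable_continuous_linepath[OF continuous_on_subset[OF C(2) segC]])
    fix \<tau> assume \<tau>: "\<tau> \<in> closed_segment (of_real N * e1) (of_real N * e2)"
    then obtain p where "p < \<iota>" "\<tau> \<in> Sc p" using dm segC by blast
    thus "cmod (F t z \<epsilon> \<tau>) \<le> 2 * Kw * exp (- N / cmod \<epsilon>)"
      using segment_S_bound[OF N _ _ Rr[OF ok(1)] Rr[OF ok(2)] \<tau> _ _ \<epsilon> z] e0 N by (simp add: norm_mult)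
  qed (use Kw(1) in auto)
  also have "cmod (of_real N * e2 - of_real N * e1) \<le> 2 * N"
    using norm_triangle_ineq4[of "of_real N * e2" "of_real N * e1"] e0 N by (simp add: norm_mult)
  hence "2 * Kw * exp (- N / cmod \<epsilon>) * cmod (of_real N * e2 - of_real N * e1) \<le> 2 * Kw * exp (- N / cmod \<epsilon>) * (2 * N)"
    using Kw(1) by (intro mult_left_mono) auto
  finally have c: "cmod ?c \<le> 2 * Kw * exp (- N / cmod \<epsilon>) * (2 * N)" .
  have eq: "ray_path_integral 0 e1 (ker t z \<epsilon>) - ray_path_integral 0 e2 (ker t z \<epsilon>) = ?T1 - ?T2 - ?c"
    using sp1(1) sp2(1) contour_integral_triangle[OF C(1-6)] by (simp add: algebra_simps)
  have d: "cmod (ray_path_integral 0 e1 (ker t z \<epsilon>) - ray_path_integral 0 e2 (ker t z \<epsilon>)) \<le> cmod ?T1 + cmod ?T2 + cmod ?c"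
    unfolding eq using norm_triangle_ineq4[of "?T1 - ?T2" ?c] norm_triangle_ineq4[of ?T1 ?T2] by linarith
  define q where "q = 2 * Kw * exp (- N / cmod \<epsilon>)"
  have "2 * Kw * exp (- (1 / cmod \<epsilon>) * N) / (1 / cmod \<epsilon>) = q * cmod \<epsilon>" by (simp add: q_def)
  moreover have "q * (2 * N + 2 * cmod \<epsilon>) = q * (2 * N) + q * cmod \<epsilon> + q * cmod \<epsilon>" by (simp add: algebra_simps)
  ultimately show ?thesis using d T1 T2 c unfolding q_def[symmetric] by linarith
qed

text \<open>Within one sector the cut in \<open>two_rays\<close> may be made at any distance, and
  its bound tends to 0.\<close>

lemma ray_direction_independent:
  assumes p: "p < \<iota>" and e: "e1 \<in> Sd p" "e2 \<in> Sd p" and q: "(t, z, \<epsilon>) \<in> OmS e1" "(t, z, \<epsilon>) \<in> OmS e2"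
  shows "ray_path_integral 0 e1 (ker t z \<epsilon>) = ray_path_integral 0 e2 (ker t z \<epsilon>)"
proof -
  have a: "okdir e1 t \<epsilon>" "okdir e2 t \<epsilon>" "\<epsilon> \<in> E" "z \<in> D" "t \<noteq> 0" using q by (auto simp: OmS_def)
  let ?C = "insert 0 (Sd p)"
  let ?d = "cmod (ray_path_integral 0 e1 (ker t z \<epsilon>) - ray_path_integral 0 e2 (ker t z \<epsilon>))"
  have sub: "?C \<subseteq> So p" using r by auto
  have b: "?d \<le> 2 * Kw * exp (- N / cmod \<epsilon>) * (2 * N + 2 * cmod \<epsilon>)" if N: "N > 0" for N
  proof (rule two_rays[OF p p e a(1,2) a(3,4,5) N, where C = ?C])
    show "convex ?C" by (rule convex_insert_0[OF Sd_sector(2,3)[OF p]])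
    show "continuous_on ?C (F t z \<epsilon>)"
      by (rule continuous_on_subset[OF holomorphic_on_imp_continuous_on[OF F_hol[OF p a(3,4)]] sub])
    show "F t z \<epsilon> holomorphic_on interior ?C"
      by (rule holomorphic_on_subset[OF F_hol[OF p a(3,4)]]) (use sub interior_subset in blast)
    show "\<exists>p<\<iota>. \<tau> \<in> Sc p" if "\<tau> \<in> ?C" for \<tau> using that sub So_Sc(1)[of p] p by blast
  qed (use Sd_sector(3)[OF p] e N in auto)
  define m where "m = cmod \<epsilon>"
  have m: "m > 0" using a by (simp add: m_def)
  define c where "c = 2 * Kw * (2 * m\<^sup>2) * (2 + 2 * m)"
  have c: "c \<ge> 0" using Kw(1) m by (simp add: c_def)
  \<comment> \<open>The exponential is traded for \<open>exp(- N / m) \<le> 2 * m^2 / N^2\<close>,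
    so that \<open>?d * N\<close> stays bounded for all \<open>N \<ge> 1\<close>, which forces
    \<open>?d = 0\<close>.\<close>
  have b2: "?d * N \<le> c" if N: "N \<ge> 1" for N
  proof -
    have "(N / m)\<^sup>2 / 2 \<le> exp (N / m)" using exp_lower_Taylor_quadratic[of "N / m"] N m by (smt (verit) divide_nonneg_pos)
    hence "exp (- N / m) \<le> 2 * m\<^sup>2 / N\<^sup>2" using N m by (simp add: exp_minus field_simps power_divide)
    hence "2 * Kw * exp (- N / m) * (2 * N + 2 * m) \<le> 2 * Kw * (2 * m\<^sup>2 / N\<^sup>2) * ((2 + 2 * m) * N)"
      using Kw(1) N m by (intro mult_mono) (auto simp: algebra_simps)
    also have "\<dots> = c / N" using N by (simp add: c_def power2_eq_square)
    finally have "?d \<le> c / N" using b[of N] N by (simp add: m_def)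
    thus ?thesis using N by (simp add: field_simps)
  qed
  have "?d = 0"
  proof (rule ccontr)
    assume "?d \<noteq> 0"
    hence d: "?d > 0" by simp
    have "?d * (c / ?d + 1) \<le> c" using c d by (intro b2) simp
    thus False using d by (simp add: algebra_simps)
  qed
  thus ?thesis by simp
qed

text \<open>The given direction varies with \<open>t\<close> and \<open>\<epsilon>\<close> without
  any regularity, so integrating along it is not visibly holomorphic. An arbitrary admissible
  direction is chosen instead: by independence the value agrees with the prescribed integral, and
  also, on each \<open>OmS e\<close>, with the integral along the fixed ray
  \<open>e\<close>.\<close>

definition uS where
  "uS p t z \<epsilon> = ray_path_integral 0 (SOME e. e \<in> Sd p \<and> okdir e t \<epsilon>) (ker t z \<epsilon>)"

lemma uS_eq:
  assumes p: "p < \<iota>" and e: "e \<in> Sd p" and q: "(t, z, \<epsilon>) \<in> OmS e"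
  shows "uS p t z \<epsilon> = ray_path_integral 0 e (ker t z \<epsilon>)" "uS p t z \<epsilon> = laplace_path.U 0 e W t z \<epsilon>"
proof -
  let ?e = "SOME e. e \<in> Sd p \<and> okdir e t \<epsilon>"
  have "?e \<in> Sd p \<and> okdir ?e t \<epsilon>" by (rule someI[of _ e]) (use e q in \<open>auto simp: OmS_def\<close>)
  hence "?e \<in> Sd p" "(t, z, \<epsilon>) \<in> OmS ?e" using q by (auto simp: OmS_def)
  from ray_direction_independent[OF p this(1) e this(2) q]
  show *: "uS p t z \<epsilon> = ray_path_integral 0 e (ker t z \<epsilon>)" by (simp add: uS_def)
  show "uS p t z \<epsilon> = laplace_path.U 0 e W t z \<epsilon>"
    unfolding * laplace_path.U_eq(3)[OF laplace_S[OF p e] q] ..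
qed

end

section \<open>Laplace integrals along bent paths in the strips, and comparisons\<close>

context borel_data
begin

definition uH where "uH a t z \<epsilon> = ray_path_integral a (- 1) (ker t z \<epsilon>)"

text \<open>The counterpart of \<open>okdir\<close> for arbitrary \<tau>: not strict and
  homogeneous, hence a convex cone to which segments and half-lines between its points
  belong.\<close>

abbreviation "Cn t \<epsilon> \<equiv> cone (ka * cmod t) (1 / (\<epsilon> * t))"

lemma CnD: assumes "\<tau> \<in> Cn t \<epsilon>" "t \<noteq> 0" "\<epsilon> \<noteq> 0" shows "ka * cmod \<tau> / cmod \<epsilon> \<le> Re (\<tau> / (\<epsilon> * t))"
proof -
  have "ka * cmod t * cmod \<tau> * cmod (1 / (\<epsilon> * t)) = ka * cmod \<tau> / cmod \<epsilon>"
    using assms by (simp add: norm_divide norm_mult)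
  thus ?thesis using assms(1) unfolding cone_def by simp
qed

lemma zero_HJ: "0 \<in> HJ"
proof -
  have "0 \<in> J 0" using rJ r by auto
  thus ?thesis using J_sub[of 0] n by auto
qed

lemma convex_HJ: "convex HJ" by (simp add: HJ_def convex_strip)

lemma H_ray: "a \<in> H k \<Longrightarrow> s \<ge> 0 \<Longrightarrow> a + of_real s * (- 1) \<in> H k"
  by (simp add: H_def strip_def)

lemma HJ_scale: assumes "a \<in> HJ" "0 \<le> u" "u \<le> 1" shows "of_real u * a \<in> HJ"
  using convexD[OF convex_HJ zero_HJ assms(1), of "1 - u" u] assms by (simp add: scaleR_conv_of_real)

lemma H_ray_norm: assumes "a \<in> H k" "s \<ge> 0"
  shows "s \<le> cmod (a + of_real s * (- 1))" "cmod a \<le> cmod (a + of_real s * (- 1))" "cmod (a + of_real s * (- 1)) \<le> cmod a + s"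
proof -
  have Re: "Re a \<le> 0" using assms by (simp add: H_def strip_def)
  show "s \<le> cmod (a + of_real s * (- 1))" using abs_Re_le_cmod[of "a + of_real s * (- 1)"] Re assms(2) by simp
  have "\<bar>Re a\<bar> \<le> \<bar>Re a - s\<bar>" using Re assms(2) by simp
  hence "(Re a)\<^sup>2 \<le> (Re a - s)\<^sup>2" by (simp only: abs_le_square_iff)
  thus "cmod a \<le> cmod (a + of_real s * (- 1))" by (simp add: cmod_def)
  show "cmod (a + of_real s * (- 1)) \<le> cmod a + s" using norm_triangle_ineq[of a "of_real s * (- 1)"] assms(2) by simp
qed

definition OmH :: "(complex \<times> complex \<times> complex) set" where
  "OmH = (- {0}) \<times> D \<times> E"

text \<open>No condition links \<open>t\<close> to the path: the superexponential decay on
  \<open>H k\<close> outweighs the kernel even where it grows. The integral is thus defined for all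
  nonzero \<open>t\<close>, in particular at the shifted points of the equation.\<close>

lemma laplace_H:
  assumes k: "k \<in> {-n..n}" and a: "a \<in> H k"
  shows "laplace_path a (- 1) W D E OmH"
proof
  have aHJ: "a \<in> HJ" using H_sub[OF k] a by blast
  have im': "bent_path a (- 1) s \<in> HJ" if "s \<ge> -1" for s
  proof (cases "s < 0")
    case True
    have "of_real (1 + s) * a \<in> HJ" by (rule HJ_scale[OF aHJ]) (use that True in auto)
    thus ?thesis using True by (simp add: bent_path_def)
  next
    case False
    thus ?thesis using H_ray[OF a, of s] H_sub[OF k] by (auto simp: bent_path_def)
  qed
  hence im: "bent_path a (- 1) ` {-1..} \<subseteq> HJ" by auto
  show "open OmH" unfolding OmH_def by (intro open_Times open_E) auto
  show "continuous_on (bent_path a (- 1) ` {-1..} \<times> D \<times> E) (\<lambda>(\<tau>, z, \<epsilon>). W \<tau> z \<epsilon>)"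
    by (rule continuous_on_subset[OF W_cont(1)]) (use im in blast)
  show "(\<lambda>z. W (bent_path a (- 1) s) z \<epsilon>) holomorphic_on D" if "s \<ge> -1" "\<epsilon> \<in> E" for s \<epsilon>
    using W_z(1)[OF _ that(2)] im'[OF that(1)] by blast
  show "(\<lambda>\<epsilon>. W (bent_path a (- 1) s) z \<epsilon>) holomorphic_on E" if "s \<ge> -1" "z \<in> D" for s z
    using W_eps[OF _ that(2)] im'[OF that(1)] by blast
  fix q assume "q \<in> OmH"
  moreover obtain t0 z0 e0 where "q = (t0, z0, e0)" by (cases q)
  ultimately have q: "q = (t0, z0, e0)" "t0 \<noteq> 0" "z0 \<in> D" "e0 \<in> E" by (auto simp: OmH_def)
  \<comment> \<open>On the neighbourhood \<open>?V\<close> below, \<open>q1\<close> bounds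
    \<open>1 / |\<epsilon>|\<close> and \<open>q2\<close> bounds the reciprocal modulus of
    \<open>\<epsilon> * t\<close>.\<close>
  define q1 where "q1 = 2 / cmod e0"
  define q2 where "q2 = 4 / (cmod e0 * cmod t0)"
  obtain Bd where Bd: "\<And>y. y \<ge> 0 \<Longrightarrow> (kp * q1 + q2) * y - (M - \<zeta>) * \<sigma>2 * exp (\<sigma>3 * y) \<le> Bd - y"
    using linear_minus_exp_bound[of "(M - \<zeta>) * \<sigma>2" \<sigma>3 "kp * q1 + q2"] M pos by auto
  \<comment> \<open>\<open>C1\<close> serves the half-line, where the superexponential decay acts.
    \<open>C2\<close> serves the segment, which may cross \<open>J\<close> strips but stays in the
    disc of radius \<open>|a|\<close>, so the growth there is a constant; its last factor is the
    speed.\<close>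
  define C1 where "C1 = 2 * Kw * exp Bd"
  define C2 where "C2 = 2 * Kw * exp (kp * q1 * cmod a + \<zeta> * (s2 * exp (s3 * cmod a)) + q2 * cmod a) * cmod a"
  have C: "C1 \<ge> 0" "C2 \<ge> 0" using Kw(1) by (auto simp: C1_def C2_def)
  let ?V = "{t. cmod t > cmod t0 / 2} \<times> (UNIV :: complex set) \<times> {e. cmod e > cmod e0 / 2}"
  have "open ?V" by (intro open_Times open_Collect_less continuous_intros) auto
  moreover have "q \<in> ?V" using q by auto
  moreover have "cmod (ker t z \<epsilon> (bent_path a (- 1) s) * bent_speed a (- 1) s) \<le> (C1 + C2) * exp (- 1 * s)"
    if V: "(t, z, \<epsilon>) \<in> ?V \<inter> OmH" and s: "s \<ge> -1" for t z \<epsilon> s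
  proof -
    have te: "t \<noteq> 0" "z \<in> D" "\<epsilon> \<in> E" "cmod t > cmod t0 / 2" "cmod \<epsilon> > cmod e0 / 2" using V by (auto simp: OmH_def)
    have pq: "cmod e0 > 0" "cmod t0 > 0" using q by auto
    have i1: "1 / cmod \<epsilon> \<le> q1" using te pq by (simp add: q1_def field_simps)
    have "cmod \<epsilon> * cmod t \<ge> (cmod e0 / 2) * (cmod t0 / 2)" using te by (intro mult_mono) auto
    hence i2: "1 / (cmod \<epsilon> * cmod t) \<le> q2" using te pq unfolding q2_def
      by (simp add: divide_simps)
    have ex: "kp * cmod \<tau> / cmod \<epsilon> - Re (\<tau> / (\<epsilon> * t)) \<le> (kp * q1 + q2) * cmod \<tau>" for \<tau>
    proof -
      have "kp * cmod \<tau> / cmod \<epsilon> = kp * cmod \<tau> * (1 / cmod \<epsilon>)" by simp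
      also have "\<dots> \<le> kp * cmod \<tau> * q1" using i1 kp_pos by (intro mult_left_mono) auto
      finally have 1: "kp * cmod \<tau> / cmod \<epsilon> \<le> kp * cmod \<tau> * q1" .
      have "- Re (\<tau> / (\<epsilon> * t)) \<le> cmod (\<tau> / (\<epsilon> * t))" using abs_Re_le_cmod[of "\<tau> / (\<epsilon> * t)"] by linarith
      also have "\<dots> = cmod \<tau> * (1 / (cmod \<epsilon> * cmod t))" by (simp add: norm_divide norm_mult)
      also have "\<dots> \<le> cmod \<tau> * q2" using i2 by (intro mult_left_mono) auto
      finally show ?thesis using 1 by (simp add: algebra_simps)
    qed
    let ?p = "bent_path a (- 1) s"
    show ?thesis
    proof (cases "?p = 0")
      case True
      thus ?thesis using C by (simp add: ker_0)
    next
      case ne: False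
      show ?thesis
      proof (cases "s < 0")
        case True
        have p: "?p = of_real (1 + s) * a" using True by (simp add: bent_path_def)
        have "cmod ?p = (1 + s) * cmod a" unfolding p norm_mult norm_of_real using s by simp
        also have "\<dots> \<le> 1 * cmod a" using True by (intro mult_right_mono) auto
        finally have pa: "cmod ?p \<le> cmod a" by simp
        have "cmod (F t z \<epsilon> ?p) \<le> 2 * Kw * exp (kp * cmod ?p / cmod \<epsilon> + \<zeta> * GJ ?p - Re (?p / (\<epsilon> * t)))"
          by (rule F_bound_HJ[OF im'[OF s] ne te(3,2)])
        also have "\<dots> \<le> 2 * Kw * exp (kp * q1 * cmod a + \<zeta> * (s2 * exp (s3 * cmod a)) + q2 * cmod a)"
        proof -
          have "(kp * q1 + q2) * cmod ?p \<le> (kp * q1 + q2) * cmod a"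
            using pa kp_pos pq by (intro mult_left_mono) (auto simp: q1_def q2_def)
          moreover have "\<zeta> * GJ ?p \<le> \<zeta> * (s2 * exp (s3 * cmod a))"
            using pa pos zeta_sum_ge_1[OF b] by (auto simp: GJ_def)
          ultimately show ?thesis using ex[of ?p] Kw(1) by (intro mult_left_mono) (auto simp: algebra_simps)
        qed
        finally have "cmod (ker t z \<epsilon> ?p * bent_speed a (- 1) s) \<le> C2"
          unfolding norm_mult F_ker[OF ne] C2_def using True by (intro mult_mono) (auto simp: bent_speed_def Kw less_imp_le)
        also have "\<dots> \<le> (C1 + C2) * exp (- 1 * s)"
          using True C mult_mono[of C2 "C1 + C2" 1 "exp (- 1 * s)"] by simp
        finally show ?thesis .
      next
        case False
        have p: "?p = a + of_real s * (- 1)" using False by (simp add: bent_path_def)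
        have pH: "?p \<in> H k" unfolding p using H_ray[OF a] False by simp
        have sp: "s \<le> cmod ?p" unfolding p using H_ray_norm(1)[OF a] False by simp
        have "cmod (ker t z \<epsilon> ?p * bent_speed a (- 1) s) = cmod (F t z \<epsilon> ?p)"
          unfolding F_ker[OF ne] using False by (simp add: bent_speed_def)
        also have "\<dots> \<le> 2 * Kw * exp (kp * cmod ?p / cmod \<epsilon> - (M - \<zeta>) * GH ?p - Re (?p / (\<epsilon> * t)))"
          by (rule F_bound_H[OF k pH ne te(3,2)])
        also have "\<dots> \<le> 2 * Kw * exp (Bd - s)"
          using ex[of ?p] Bd[of "cmod ?p"] sp Kw(1) by (intro mult_left_mono) (auto simp: GH_def)
        also have "\<dots> = C1 * exp (- 1 * s)" by (simp add: C1_def exp_diff exp_minus field_simps)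
        also have "\<dots> \<le> (C1 + C2) * exp (- 1 * s)" using C by (intro mult_right_mono) auto
        finally show ?thesis .
      qed
    qed
  qed
  ultimately show "\<exists>V h. open V \<and> q \<in> V \<and> integrable (lebesgue_on {-1..}) h \<and>
        (\<forall>t z \<epsilon> s. (t, z, \<epsilon>) \<in> V \<inter> OmH \<longrightarrow> s \<ge> -1 \<longrightarrow>
           cmod (ker t z \<epsilon> (bent_path a (- 1) s) * bent_speed a (- 1) s) \<le> h s)"
    using integrable_exp_tail[of 1 "C1 + C2"]
    by (intro exI[of _ ?V] exI[of _ "\<lambda>s. (C1 + C2) * exp (- 1 * s)"]) auto
qed (use open_E in \<open>auto simp: OmH_def\<close>)

lemma uH_eq:
  assumes k: "k \<in> {-n..n}" and a: "a \<in> H k" and q: "(t, z, \<epsilon>) \<in> OmH"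
  shows "uH a t z \<epsilon> = laplace_path.U a (- 1) W t z \<epsilon>"
  unfolding uH_def laplace_path.U_eq(3)[OF laplace_H[OF k a] q] ..

lemma H_ker_bound:
  assumes k: "k \<in> {-n..n}" and \<tau>: "\<tau> \<in> H k" "\<tau> \<in> Cn t \<epsilon>" and \<epsilon>: "\<epsilon> \<in> E" and z: "z \<in> D" and t: "t \<noteq> 0"
  shows "cmod (ker t z \<epsilon> \<tau>) \<le> 2 * Kw * exp (- cmod \<tau> / cmod \<epsilon>)"
proof (cases "\<tau> = 0")
  case True
  thus ?thesis using Kw(1) by (simp add: ker_0)
next
  case False
  have "(M - \<zeta>) * GH \<tau> \<ge> 0" using M pos by (simp add: GH_def)
  moreover have "ka * cmod \<tau> / cmod \<epsilon> \<le> Re (\<tau> / (\<epsilon> * t))" using CnD[OF \<tau>(2) t] \<epsilon> by simp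
  ultimately have "kp * cmod \<tau> / cmod \<epsilon> - (M - \<zeta>) * GH \<tau> - Re (\<tau> / (\<epsilon> * t)) \<le> - cmod \<tau> / cmod \<epsilon>"
    by (simp add: ka_def add_divide_distrib algebra_simps)
  hence "2 * Kw * exp (kp * cmod \<tau> / cmod \<epsilon> - (M - \<zeta>) * GH \<tau> - Re (\<tau> / (\<epsilon> * t))) \<le> 2 * Kw * exp (- cmod \<tau> / cmod \<epsilon>)"
    using Kw(1) by (intro mult_left_mono) auto
  thus ?thesis using F_bound_H[OF k \<tau>(1) False \<epsilon> z, of t] F_ker[OF False, where t = t and z = z and \<epsilon> = \<epsilon>] by simp
qed

text \<open>Crossing \<open>J\<close> strips costs the double exponential at the largest modulus
  \<open>B\<close>, while the cone condition yields the decay at the smallest modulus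
  \<open>m\<close>. In every use \<open>B\<close> and \<open>m\<close> are the extreme moduli on a
  segment.\<close>

lemma HJ_F_bound:
  assumes \<tau>: "\<tau> \<in> HJ" "\<tau> \<noteq> 0" "\<tau> \<in> Cn t \<epsilon>" and \<epsilon>: "\<epsilon> \<in> E" and z: "z \<in> D" and t: "t \<noteq> 0"
    and B: "cmod \<tau> \<le> B" "m \<le> cmod \<tau>"
  shows "cmod (F t z \<epsilon> \<tau>) \<le> 2 * Kw * exp (\<zeta> * (s2 * exp (s3 * B)) - m / cmod \<epsilon>)"
proof -
  have "ka * cmod \<tau> / cmod \<epsilon> \<le> Re (\<tau> / (\<epsilon> * t))" using CnD[OF \<tau>(3) t] \<epsilon> by simp
  moreover have "\<zeta> * GJ \<tau> \<le> \<zeta> * (s2 * exp (s3 * B))" using B pos zeta_sum_ge_1[OF b] by (simp add: GJ_def)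
  moreover have "m / cmod \<epsilon> \<le> cmod \<tau> / cmod \<epsilon>" using B by (intro divide_right_mono) auto
  ultimately have "kp * cmod \<tau> / cmod \<epsilon> + \<zeta> * GJ \<tau> - Re (\<tau> / (\<epsilon> * t)) \<le> \<zeta> * (s2 * exp (s3 * B)) - m / cmod \<epsilon>"
    by (simp add: ka_def add_divide_distrib algebra_simps)
  hence "2 * Kw * exp (kp * cmod \<tau> / cmod \<epsilon> + \<zeta> * GJ \<tau> - Re (\<tau> / (\<epsilon> * t))) \<le> 2 * Kw * exp (\<zeta> * (s2 * exp (s3 * B)) - m / cmod \<epsilon>)"
    using Kw(1) by (intro mult_left_mono) auto
  thus ?thesis using F_bound_HJ[OF \<tau>(1,2) \<epsilon> z, of t] by linarith
qed

context
  fixes k a t z \<epsilon>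
  assumes k: "k \<in> {-n..n}" and a: "a \<in> H k" and aC: "a \<in> Cn t \<epsilon>" and m1: "- 1 \<in> Cn t \<epsilon>"
    and \<epsilon>: "\<epsilon> \<in> E" and z: "z \<in> D" and t: "t \<noteq> 0"
begin

lemma ka_t: "ka * cmod t \<ge> 0" using kp_pos by simp

lemma ray_Cn: "s \<ge> 0 \<Longrightarrow> a + of_real s * (- 1) \<in> Cn t \<epsilon>"
  by (intro cone_add cone_scale aC m1 ka_t)

lemma H_OmH: "(t, z, \<epsilon>) \<in> OmH" using \<epsilon> z t by (simp add: OmH_def)

lemma H_split:
  assumes X: "X \<ge> 0"
  shows "uH a t z \<epsilon> = contour_integral (linepath 0 (a + of_real X * (- 1))) (F t z \<epsilon>) + integral {X..} (\<lambda>s. ker t z \<epsilon> (a + of_real s * (- 1)) * (- 1))"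
    and "(\<lambda>s. ker t z \<epsilon> (a + of_real s * (- 1)) * (- 1)) integrable_on {X..}"
proof -
  have m: "a \<in> HJ" "a + of_real X * (- 1) \<in> HJ" using H_sub[OF k] a H_ray[OF a X] by auto
  have "(- 1 :: complex) \<noteq> 0" by simp
  note sp = ray_path_split[OF convex_HJ F_HJ[OF \<epsilon> z] zero_HJ m F_ker laplace_path.U_eq(2)[OF laplace_H[OF k a] H_OmH] X this]
  show "uH a t z \<epsilon> = contour_integral (linepath 0 (a + of_real X * (- 1))) (F t z \<epsilon>) + integral {X..} (\<lambda>s. ker t z \<epsilon> (a + of_real s * (- 1)) * (- 1))"
    unfolding uH_def by (rule sp(1))
  show "(\<lambda>s. ker t z \<epsilon> (a + of_real s * (- 1)) * (- 1)) integrable_on {X..}" by (rule sp(2))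
qed

lemma H_tail:
  assumes X: "X \<ge> 0"
  shows "cmod (integral {X..} (\<lambda>s. ker t z \<epsilon> (a + of_real s * (- 1)) * (- 1))) \<le> 2 * Kw * exp (- X / cmod \<epsilon>) * cmod \<epsilon>"
proof -
  have "cmod (integral {X..} (\<lambda>s. ker t z \<epsilon> (a + of_real s * (- 1)) * (- 1))) \<le> 2 * Kw * exp (- (1 / cmod \<epsilon>) * X) / (1 / cmod \<epsilon>)"
  proof (rule exp_tail_bound[OF H_split(2)[OF X]])
    fix s assume s: "s \<ge> X"
    hence s0: "s \<ge> 0" using X by simp
    have "cmod (ker t z \<epsilon> (a + of_real s * (- 1)) * (- 1)) \<le> 2 * Kw * exp (- cmod (a + of_real s * (- 1)) / cmod \<epsilon>)"
      using H_ker_bound[OF k H_ray[OF a s0] ray_Cn[OF s0] \<epsilon> z t] by (simp only: norm_mult norm_minus_cancel norm_one mult_1_right)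
    also have "\<dots> \<le> 2 * Kw * exp (- (1 / cmod \<epsilon>) * s)"
      using H_ray_norm(1)[OF a s0] \<epsilon> Kw(1) by (intro mult_left_mono exp_le_cancel_iff[THEN iffD2]) (auto simp: divide_right_mono)
    finally show "cmod (ker t z \<epsilon> (a + of_real s * (- 1)) * (- 1)) \<le> 2 * Kw * exp (- (1 / cmod \<epsilon>) * s)" .
  qed (use \<epsilon> in auto)
  thus ?thesis by simp
qed

text \<open>The point of parameter \<open>s\<close> has modulus at least both \<open>s\<close> and
  \<open>|a|\<close>, hence at least \<open>m + s / 2\<close>: one part gives the factor
  \<open>exp(- m / |\<epsilon>|)\<close>, the other makes the integral converge, with value
  \<open>2 * |\<epsilon>|\<close>.\<close>

lemma H_tail_0:
  assumes m: "m \<le> cmod a / 2"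
  shows "cmod (integral {0..} (\<lambda>s. ker t z \<epsilon> (a + of_real s * (- 1)) * (- 1))) \<le> 2 * Kw * exp (- m / cmod \<epsilon>) * (2 * cmod \<epsilon>)"
proof -
  have "cmod (integral {0..} (\<lambda>s. ker t z \<epsilon> (a + of_real s * (- 1)) * (- 1))) \<le> 2 * Kw * exp (- m / cmod \<epsilon>) * exp (- (1 / (2 * cmod \<epsilon>)) * 0) / (1 / (2 * cmod \<epsilon>))"
  proof (rule exp_tail_bound[OF H_split(2)[OF order_refl]])
    fix s :: real assume s0: "s \<ge> 0"
    have "cmod (ker t z \<epsilon> (a + of_real s * (- 1)) * (- 1)) \<le> 2 * Kw * exp (- cmod (a + of_real s * (- 1)) / cmod \<epsilon>)"
      using H_ker_bound[OF k H_ray[OF a s0] ray_Cn[OF s0] \<epsilon> z t] by (simp only: norm_mult norm_minus_cancel norm_one mult_1_right)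
    also have "\<dots> \<le> 2 * Kw * exp (- m / cmod \<epsilon> + - (1 / (2 * cmod \<epsilon>)) * s)"
    proof -
      have "m + s / 2 \<le> cmod (a + of_real s * (- 1))" using H_ray_norm(1,2)[OF a s0] m by linarith
      hence "(m + s / 2) / cmod \<epsilon> \<le> cmod (a + of_real s * (- 1)) / cmod \<epsilon>" by (rule divide_right_mono) simp
      hence "- cmod (a + of_real s * (- 1)) / cmod \<epsilon> \<le> - m / cmod \<epsilon> + - (1 / (2 * cmod \<epsilon>)) * s"
        by (simp add: add_divide_distrib)
      thus ?thesis using Kw(1) by (intro mult_left_mono exp_le_cancel_iff[THEN iffD2]) auto
    qed
    finally show "cmod (ker t z \<epsilon> (a + of_real s * (- 1)) * (- 1)) \<le> 2 * Kw * exp (- m / cmod \<epsilon>) * exp (- (1 / (2 * cmod \<epsilon>)) * s)"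
      by (simp only: exp_add mult.assoc)
  qed (use \<epsilon> in auto)
  thus ?thesis by simp
qed

lemma H_bounded: "cmod (uH a t z \<epsilon>) \<le> 2 * Kw * exp (\<zeta> * (s2 * exp (s3 * cmod a))) * cmod a + 2 * Kw * \<epsilon>0"
proof -
  have aHJ: "a \<in> HJ" using H_sub[OF k] a by blast
  have sub: "closed_segment 0 a \<subseteq> HJ" using zero_HJ aHJ convex_HJ by (simp add: closed_segment_subset)
  have i: "F t z \<epsilon> contour_integrable_on linepath 0 a"
    by (rule contour_integrable_continuous_linepath[OF continuous_on_subset[OF F_HJ(1)[OF \<epsilon> z] sub]])
  have zC: "0 \<in> Cn t \<epsilon>" by (simp add: cone_def)
  have "cmod (contour_integral (linepath 0 a) (F t z \<epsilon>)) \<le> 2 * Kw * exp (\<zeta> * (s2 * exp (s3 * cmod a))) * cmod (a - 0)"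
  proof (cases "a = 0")
    case False
    have op: "cmod (F t z \<epsilon> \<tau>) \<le> 2 * Kw * exp (\<zeta> * (s2 * exp (s3 * cmod a)))" if \<tau>: "\<tau> \<in> open_segment 0 a" for \<tau>
    proof -
      have \<tau>': "\<tau> \<in> closed_segment 0 a" "\<tau> \<noteq> 0" using \<tau> by (auto simp: open_segment_def)
      have "cmod \<tau> \<le> cmod a" using segment_bound(1)[OF \<tau>'(1)] by simp
      moreover have "\<tau> \<in> Cn t \<epsilon>" by (rule cone_segment[OF ka_t zC aC \<tau>'(1)])
      ultimately show ?thesis
        using HJ_F_bound[OF _ \<tau>'(2) _ \<epsilon> z t, of "cmod a" 0] \<tau>'(1) sub by auto
    qed
    show ?thesis
    proof (rule contour_integral_bound_linepath[OF i])
      fix \<tau> assume \<tau>: "\<tau> \<in> closed_segment 0 a"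
      \<comment> \<open>The pointwise bound excludes \<tau> = 0; continuity of \<open>F\<close>
        extends it to the closed segment.\<close>
      have cl: "closure (open_segment 0 a) = closed_segment 0 a" using False by (simp add: closure_open_segment)
      show "cmod (F t z \<epsilon> \<tau>) \<le> 2 * Kw * exp (\<zeta> * (s2 * exp (s3 * cmod a)))"
        by (rule continuous_on_closure_norm_le[where f = "F t z \<epsilon>" and s = "open_segment 0 a", unfolded cl])
          (use op \<tau> continuous_on_subset[OF F_HJ(1)[OF \<epsilon> z] sub] in blast)+
    qed (use Kw(1) in auto)
  qed simp
  moreover have "2 * Kw * exp (- 0 / cmod \<epsilon>) * cmod \<epsilon> \<le> 2 * Kw * \<epsilon>0" using \<epsilon> Kw(1) by simp
  ultimately show ?thesis
    using H_split(1)[OF order_refl] H_tail[OF order_refl] norm_triangle_ineq[of "contour_integral (linepath 0 a) (F t z \<epsilon>)" "integral {0..} (\<lambda>s. ker t z \<epsilon> (a + of_real s * (- 1)) * (- 1))"]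
    by (simp only: of_real_0 mult_zero_left add_0_right diff_zero)
qed

end

text \<open>Both half-lines are cut at the same parameter \<open>X\<close>, so the connecting
  segment is a translate of the one from \<open>a\<close> to \<open>a'\<close>: its length does not
  grow with \<open>X\<close>, and it stays in the cone because the cone is convex. \<open>X\<close>
  is left free, to be balanced against \<open>\<epsilon>\<close> later.\<close>

lemma H_diff:
  assumes k: "k \<in> {-n..n}" "k' \<in> {-n..n}" and a: "a \<in> H k" "a' \<in> H k'" and aC: "a \<in> Cn t \<epsilon>" "a' \<in> Cn t \<epsilon>" and m1: "- 1 \<in> Cn t \<epsilon>"
    and \<epsilon>: "\<epsilon> \<in> E" and z: "z \<in> D" and t: "t \<noteq> 0" and X: "X > 0" and Am: "cmod a \<le> Am" "cmod a' \<le> Am"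
  shows "cmod (uH a' t z \<epsilon> - uH a t z \<epsilon>) \<le> 2 * Kw * exp (\<zeta> * (s2 * exp (s3 * (Am + X))) - X / cmod \<epsilon>) * (2 * Am + 2 * cmod \<epsilon>)"
proof -
  have X0: "X \<ge> 0" using X by simp
  let ?b = "a + of_real X * (- 1)" and ?b' = "a' + of_real X * (- 1)"
  note s1 = H_split(1)[OF k(1) a(1) aC(1) m1 \<epsilon> z t X0] H_tail[OF k(1) a(1) aC(1) m1 \<epsilon> z t X0]
  note s2 = H_split(1)[OF k(2) a(2) aC(2) m1 \<epsilon> z t X0] H_tail[OF k(2) a(2) aC(2) m1 \<epsilon> z t X0]
  have bC: "?b \<in> Cn t \<epsilon>" "?b' \<in> Cn t \<epsilon>" using ray_Cn[OF k(1) a(1) aC(1) m1 \<epsilon> z t X0] ray_Cn[OF k(2) a(2) aC(2) m1 \<epsilon> z t X0] by auto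
  have bH: "?b \<in> HJ" "?b' \<in> HJ" using H_sub[OF k(1)] H_sub[OF k(2)] H_ray[OF a(1) X0] H_ray[OF a(2) X0] by auto
  have sub: "closed_segment ?b ?b' \<subseteq> HJ" using bH convex_HJ by (simp add: closed_segment_subset)
  let ?Q = "2 * Kw * exp (\<zeta> * (s2 * exp (s3 * (Am + X))) - X / cmod \<epsilon>)"
  have "cmod (contour_integral (linepath ?b ?b') (F t z \<epsilon>)) \<le> ?Q * cmod (?b' - ?b)"
  proof (rule contour_integral_bound_linepath)
    show "F t z \<epsilon> contour_integrable_on linepath ?b ?b'"
      by (rule contour_integrable_continuous_linepath[OF continuous_on_subset[OF F_HJ(1)[OF \<epsilon> z] sub]])
    fix \<tau> assume \<tau>: "\<tau> \<in> closed_segment ?b ?b'"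
    have ReL: "Re ?b \<le> - X" "Re ?b' \<le> - X" using a by (auto simp: H_def strip_def)
    have "\<tau> \<in> {z. Re z \<le> - X}"
      using closed_segment_subset[of ?b "{z. Re z \<le> - X}" ?b'] ReL convex_halfspace_Re_le[of "- X"] \<tau> by auto
    hence "X \<le> - Re \<tau>" by simp
    also have "\<dots> \<le> cmod \<tau>" using abs_Re_le_cmod[of \<tau>] by linarith
    finally have Xt: "X \<le> cmod \<tau>" .
    have "cmod ?b \<le> Am + X" "cmod ?b' \<le> Am + X" using H_ray_norm(3)[OF a(1) X0] H_ray_norm(3)[OF a(2) X0] Am by auto
    hence "\<tau> \<in> cball 0 (Am + X)" using closed_segment_subset[of ?b "cball 0 (Am + X)" ?b'] \<tau> by auto
    hence tA: "cmod \<tau> \<le> Am + X" by simp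
    have "ka * cmod t \<ge> 0" using kp_pos by simp
    from cone_segment[OF this bC \<tau>] have "\<tau> \<in> Cn t \<epsilon>" .
    moreover have "\<tau> \<noteq> 0" using Xt X by auto
    ultimately show "cmod (F t z \<epsilon> \<tau>) \<le> ?Q" using HJ_F_bound[OF _ _ _ \<epsilon> z t tA Xt] \<tau> sub by blast
  qed (use Kw(1) in auto)
  also have "?Q * cmod (?b' - ?b) \<le> ?Q * (2 * Am)"
    using norm_triangle_ineq4[of a' a] Am Kw(1) by (intro mult_left_mono) auto
  finally have c: "cmod (contour_integral (linepath ?b ?b') (F t z \<epsilon>)) \<le> ?Q * (2 * Am)" .
  have tri: "contour_integral (linepath 0 ?b) (F t z \<epsilon>) + contour_integral (linepath ?b ?b') (F t z \<epsilon>) = contour_integral (linepath 0 ?b') (F t z \<epsilon>)"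
    by (rule contour_integral_triangle[OF convex_HJ F_HJ[OF \<epsilon> z] zero_HJ bH])
  define T1 where "T1 = integral {X..} (\<lambda>s. ker t z \<epsilon> (a + of_real s * (- 1)) * (- 1))"
  define T2 where "T2 = integral {X..} (\<lambda>s. ker t z \<epsilon> (a' + of_real s * (- 1)) * (- 1))"
  have eq: "uH a' t z \<epsilon> - uH a t z \<epsilon> = contour_integral (linepath ?b ?b') (F t z \<epsilon>) + T2 - T1"
    unfolding s1(1) s2(1) T1_def[symmetric] T2_def[symmetric] tri[symmetric] by (simp only: algebra_simps)
  have le: "2 * Kw * exp (- X / cmod \<epsilon>) * cmod \<epsilon> \<le> ?Q * cmod \<epsilon>"
    using Kw(1) zeta_sum_ge_1[OF b] pos by (intro mult_right_mono mult_left_mono) auto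
  have "cmod (uH a' t z \<epsilon> - uH a t z \<epsilon>) \<le> cmod (contour_integral (linepath ?b ?b') (F t z \<epsilon>)) + cmod T2 + cmod T1"
    unfolding eq using norm_triangle_ineq4[of "contour_integral (linepath ?b ?b') (F t z \<epsilon>) + T2" T1]
      norm_triangle_ineq[of "contour_integral (linepath ?b ?b') (F t z \<epsilon>)" T2] by linarith
  also have "\<dots> \<le> ?Q * (2 * Am) + ?Q * cmod \<epsilon> + ?Q * cmod \<epsilon>"
    using c s1(2) s2(2) le unfolding T1_def[symmetric] T2_def[symmetric] by linarith
  also have "\<dots> = ?Q * (2 * Am + 2 * cmod \<epsilon>)" by (simp only: distrib_left mult_2)
  finally show ?thesis .
qed

text \<open>The ray is cut inside the disc, where \<open>F\<close> is holomorphic independently of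
  the sector, so that its beginning can be compared with other paths. With \<open>N = 0\<close> the
  tail alone is left, which shows boundedness.\<close>

lemma S_bounded:
  assumes p: "p < \<iota>" and e: "e \<in> Sd p" and q: "(t, z, \<epsilon>) \<in> OmS e" and N: "0 \<le> N" "N < r"
  shows "ray_path_integral 0 e (ker t z \<epsilon>) = contour_integral (linepath 0 (of_real N * e)) (F t z \<epsilon>) + integral {N..} (\<lambda>s. ker t z \<epsilon> (of_real s * e) * e)"
    and "cmod (integral {N..} (\<lambda>s. ker t z \<epsilon> (of_real s * e) * e)) \<le> 2 * Kw * exp (- N / cmod \<epsilon>) * cmod \<epsilon>"
proof -
  have h: "okdir e t \<epsilon>" "\<epsilon> \<in> E" "z \<in> D" using q by (auto simp: OmS_def)
  have e0: "e \<noteq> 0" "cmod e = 1" using h by (auto simp: okdir_def)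
  have C: "convex (ball (0::complex) r)" "0 \<in> ball (0::complex) r" "of_real N * e \<in> ball 0 r" using N e0 r by (auto simp: norm_mult)
  have C2: "continuous_on (ball 0 r) (F t z \<epsilon>)" by (rule holomorphic_on_imp_continuous_on[OF F_ball[OF h(2,3)]])
  have C3: "F t z \<epsilon> holomorphic_on interior (ball 0 r)" by (rule holomorphic_on_subset[OF F_ball[OF h(2,3)]]) auto
  note sp = ray_path_split[OF C(1) C2 C3 C(2) C(2) _ F_ker laplace_path.U_eq(2)[OF laplace_S[OF p e] q] N(1) e0(1), unfolded add_0_left, OF C(3)]
  show "ray_path_integral 0 e (ker t z \<epsilon>) = contour_integral (linepath 0 (of_real N * e)) (F t z \<epsilon>) + integral {N..} (\<lambda>s. ker t z \<epsilon> (of_real s * e) * e)"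
    by (rule sp(1))
  have "cmod (integral {N..} (\<lambda>s. ker t z \<epsilon> (of_real s * e) * e)) \<le> 2 * Kw * exp (- (1 / cmod \<epsilon>) * N) / (1 / cmod \<epsilon>)"
    by (rule exp_tail_bound[OF sp(2)]) (use S_ker_bound[OF p e h] N h in auto)
  thus "cmod (integral {N..} (\<lambda>s. ker t z \<epsilon> (of_real s * e) * e)) \<le> 2 * Kw * exp (- N / cmod \<epsilon>) * cmod \<epsilon>" by simp
qed

lemma uS_bounded:
  assumes p: "p < \<iota>" and e: "e \<in> Sd p" and q: "(t, z, \<epsilon>) \<in> OmS e"
  shows "cmod (uS p t z \<epsilon>) \<le> 2 * Kw * \<epsilon>0"
proof -
  have "\<epsilon> \<in> E" using q by (auto simp: OmS_def)
  hence "2 * Kw * cmod \<epsilon> \<le> 2 * Kw * \<epsilon>0" using Kw(1) by simp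
  thus ?thesis using S_bounded[OF p e q order_refl r] uS_eq(1)[OF p e q] by simp
qed

text \<open>The segment to \<open>a\<close> is interrupted at its point \<open>?b\<close> of modulus
  \<open>m\<close>, and the ray at its point \<open>?c\<close> of modulus \<open>m\<close>. Cauchy's
  theorem in the disc joins \<open>?b\<close> to \<open>?c\<close>, and the rest of both paths stays
  at distance at least \<open>m\<close> from 0. The double exponential enters only through the fixed
  corner \<open>a\<close>, as a factor independent of \<open>\<epsilon>\<close>.\<close>

lemma mixed_diff:
  assumes k: "k \<in> {-n..n}" and a: "a \<in> H k" and aC: "a \<in> Cn t \<epsilon>" and m1: "- 1 \<in> Cn t \<epsilon>"
    and p: "p < \<iota>" and e: "e \<in> Sd p" and q: "(t, z, \<epsilon>) \<in> OmS e" and m: "0 < m" "m < r" "m \<le> cmod a / 2"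
  shows "cmod (uH a t z \<epsilon> - uS p t z \<epsilon>) \<le> 2 * Kw * exp (- m / cmod \<epsilon>) * (2 * m + exp (\<zeta> * (s2 * exp (s3 * cmod a))) * cmod a + 3 * \<epsilon>0)"
proof -
  have h: "okdir e t \<epsilon>" "\<epsilon> \<in> E" "z \<in> D" "t \<noteq> 0" using q by (auto simp: OmS_def)
  have e0: "e \<noteq> 0" "cmod e = 1" using h by (auto simp: okdir_def)
  have m0: "0 \<le> m" using m by simp
  have a0: "cmod a > 0" using m by auto
  define u where "u = m / cmod a"
  have u: "0 < u" "u \<le> 1" using m a0 by (auto simp: u_def field_simps)
  let ?b = "of_real u * a" and ?c = "of_real m * e"
  let ?F = "F t z \<epsilon>"
  have "cmod ?b = u * cmod a" using u by (simp add: norm_mult)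
  hence nb: "cmod ?b = m" using a0 by (simp add: u_def)
  have nc: "cmod ?c = m" using m e0 by (simp add: norm_mult)
  have aHJ: "a \<in> HJ" using H_sub[OF k] a by blast
  have bHJ: "?b \<in> HJ" using HJ_scale[OF aHJ] u by simp
  have kat: "ka * cmod t \<ge> 0" using kp_pos by simp
  have bC: "?b \<in> Cn t \<epsilon>" using cone_scale[OF _ aC] u by simp
  define T1 where "T1 = integral {0..} (\<lambda>s. ker t z \<epsilon> (a + of_real s * (- 1)) * (- 1))"
  define T2 where "T2 = integral {m..} (\<lambda>s. ker t z \<epsilon> (of_real s * e) * e)"
  define q where "q = 2 * Kw * exp (- m / cmod \<epsilon>)"
  have q0: "q \<ge> 0" using Kw(1) by (simp add: q_def)
  have T1: "cmod T1 \<le> q * (2 * cmod \<epsilon>)" unfolding T1_def q_def by (rule H_tail_0[OF k a aC m1 h(2-4) m(3)])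
  have T2: "cmod T2 \<le> q * cmod \<epsilon>" unfolding T2_def q_def by (rule S_bounded(2)[OF p e assms(7) m0 m(2)])
  have uHe: "uH a t z \<epsilon> = contour_integral (linepath 0 a) ?F + T1"
    using H_split(1)[OF k a aC m1 h(2-4) order_refl] unfolding T1_def[symmetric] by simp
  have uSe: "uS p t z \<epsilon> = contour_integral (linepath 0 ?c) ?F + T2"
    unfolding uS_eq(1)[OF p e assms(7)] T2_def by (rule S_bounded(1)[OF p e assms(7) m0 m(2)])
  have tri1: "contour_integral (linepath 0 ?b) ?F + contour_integral (linepath ?b a) ?F = contour_integral (linepath 0 a) ?F"
    by (rule contour_integral_triangle[OF convex_HJ F_HJ[OF h(2,3)] zero_HJ bHJ aHJ])
  have bc: "?b \<in> ball 0 r" "?c \<in> ball 0 r" using nb nc m by auto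
  have Fb: "continuous_on (ball 0 r) ?F" by (rule holomorphic_on_imp_continuous_on[OF F_ball[OF h(2,3)]])
  have Fi: "?F holomorphic_on interior (ball 0 r)" by (rule holomorphic_on_subset[OF F_ball[OF h(2,3)]]) auto
  have tri2: "contour_integral (linepath 0 ?b) ?F + contour_integral (linepath ?b ?c) ?F = contour_integral (linepath 0 ?c) ?F"
    by (rule contour_integral_triangle[OF convex_ball Fb Fi _ bc]) (use r in auto)
  have subb: "closed_segment ?b ?c \<subseteq> ball 0 r" using bc by (simp add: closed_segment_subset)
  have "cmod (contour_integral (linepath ?b ?c) ?F) \<le> q * cmod (?c - ?b)"
  proof (rule contour_integral_bound_linepath)
    show "?F contour_integrable_on linepath ?b ?c"
      by (rule contour_integrable_continuous_linepath[OF continuous_on_subset[OF Fb subb]])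
    fix \<tau> assume \<tau>: "\<tau> \<in> closed_segment ?b ?c"
    show "cmod (?F \<tau>) \<le> q" unfolding q_def
    proof (rule segment_S_bound[OF m(1) nb nc _ _ \<tau> p _ h(2,3)])
      show "ka * m / cmod \<epsilon> \<le> Re (?b / (\<epsilon> * t))" using CnD[OF bC h(4)] h(2) nb by simp
      have "Re (?c / (\<epsilon> * t)) = m * Re (e / (\<epsilon> * t))" by (metis Re_of_real_mult times_divide_eq_right)
      moreover have "m * (ka / cmod \<epsilon>) \<le> m * Re (e / (\<epsilon> * t))" using m h(1) by (intro mult_left_mono) (auto simp: okdir_def)
      ultimately show "ka * m / cmod \<epsilon> \<le> Re (?c / (\<epsilon> * t))" by (simp add: mult_ac)
      show "\<tau> \<in> Sc p" using \<tau> subb by auto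
    qed
  qed (rule q0)
  also have "q * cmod (?c - ?b) \<le> q * (2 * m)"
    using norm_triangle_ineq4[of ?c ?b] nb nc q0 by (intro mult_left_mono) auto
  finally have c1: "cmod (contour_integral (linepath ?b ?c) ?F) \<le> q * (2 * m)" .
  have suba: "closed_segment ?b a \<subseteq> HJ" using bHJ aHJ convex_HJ by (simp add: closed_segment_subset)
  have "cmod (contour_integral (linepath ?b a) ?F) \<le> q * exp (\<zeta> * (s2 * exp (s3 * cmod a))) * cmod (a - ?b)"
  proof (rule contour_integral_bound_linepath)
    show "?F contour_integrable_on linepath ?b a"
      by (rule contour_integrable_continuous_linepath[OF continuous_on_subset[OF F_HJ(1)[OF h(2,3)] suba]])
    fix \<tau> assume \<tau>: "\<tau> \<in> closed_segment ?b a"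
    then obtain x where x: "0 \<le> x" "x \<le> 1" "\<tau> = (1 - x) *\<^sub>R ?b + x *\<^sub>R a" by (auto simp: in_segment)
    define y where "y = (1 - x) * u + x"
    have "\<tau> = of_real y * a" unfolding x(3) y_def by (simp add: scaleR_conv_of_real algebra_simps)
    moreover have "y - u = x * (1 - u)" "1 - y = (1 - x) * (1 - u)" by (simp_all add: y_def algebra_simps)
    hence "u \<le> y" "y \<le> 1" using x u by (smt (verit) mult_nonneg_nonneg)+
    moreover have "u * cmod a \<le> y * cmod a" "y * cmod a \<le> 1 * cmod a"
      using \<open>u \<le> y\<close> \<open>y \<le> 1\<close> by (intro mult_right_mono; simp)+
    ultimately have "cmod \<tau> = y * cmod a" "u * cmod a \<le> y * cmod a" "y * cmod a \<le> 1 * cmod a"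
      using u by (auto simp: norm_mult)
    hence tb: "cmod \<tau> \<le> cmod a" "m \<le> cmod \<tau>" using a0 by (auto simp: u_def)
    have "\<tau> \<in> Cn t \<epsilon>" by (rule cone_segment[OF kat bC aC \<tau>])
    moreover have "\<tau> \<noteq> 0" using tb m by auto
    ultimately have "cmod (?F \<tau>) \<le> 2 * Kw * exp (\<zeta> * (s2 * exp (s3 * cmod a)) - m / cmod \<epsilon>)"
      using HJ_F_bound[OF _ _ _ h(2-4) tb] \<tau> suba by blast
    also have "\<dots> = q * exp (\<zeta> * (s2 * exp (s3 * cmod a)))" by (simp add: q_def exp_diff exp_minus field_simps)
    finally show "cmod (?F \<tau>) \<le> q * exp (\<zeta> * (s2 * exp (s3 * cmod a)))" .
  qed (use q0 in auto)
  also have "\<dots> \<le> q * exp (\<zeta> * (s2 * exp (s3 * cmod a))) * cmod a"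
  proof (rule mult_left_mono)
    have "a - ?b = of_real (1 - u) * a" by (simp add: algebra_simps)
    hence "cmod (a - ?b) = (1 - u) * cmod a" using u by (simp add: norm_mult del: of_real_diff)
    thus "cmod (a - ?b) \<le> cmod a" using u a0 by (simp add: mult_left_le_one_le)
  qed (use q0 in auto)
  finally have c2: "cmod (contour_integral (linepath ?b a) ?F) \<le> q * exp (\<zeta> * (s2 * exp (s3 * cmod a))) * cmod a" .
  have eq: "uH a t z \<epsilon> - uS p t z \<epsilon> = (contour_integral (linepath ?b a) ?F - contour_integral (linepath ?b ?c) ?F) + (T1 - T2)"
    unfolding uHe uSe tri1[symmetric] tri2[symmetric] by (simp only: algebra_simps)
  have "cmod (uH a t z \<epsilon> - uS p t z \<epsilon>) \<le> cmod (contour_integral (linepath ?b a) ?F) + cmod (contour_integral (linepath ?b ?c) ?F) + cmod T1 + cmod T2"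
    unfolding eq using norm_triangle_ineq[of "contour_integral (linepath ?b a) ?F - contour_integral (linepath ?b ?c) ?F" "T1 - T2"]
      norm_triangle_ineq4[of "contour_integral (linepath ?b a) ?F" "contour_integral (linepath ?b ?c) ?F"] norm_triangle_ineq4[of T1 T2] by linarith
  also have "\<dots> \<le> q * exp (\<zeta> * (s2 * exp (s3 * cmod a))) * cmod a + q * (2 * m) + q * (2 * cmod \<epsilon>) + q * cmod \<epsilon>"
    using c1 c2 T1 T2 by linarith
  also have "\<dots> = q * (2 * m + exp (\<zeta> * (s2 * exp (s3 * cmod a))) * cmod a + 3 * cmod \<epsilon>)" by (simp add: algebra_simps)
  also have "\<dots> \<le> q * (2 * m + exp (\<zeta> * (s2 * exp (s3 * cmod a))) * cmod a + 3 * \<epsilon>0)"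
    using q0 h(2) by (intro mult_left_mono) auto
  finally show ?thesis by (simp only: q_def)
qed

end

section \<open>Solutions and their differences\<close>

text \<open>\<open>s0\<close> is a decay rate common to all paths, and \<open>ka * |t| < s0\<close>
  on \<open>Tr\<close> puts them into the cones \<open>Cn\<close>. \<open>Kx\<close> bounds the
  shifts \<open>k2\<close>, so that \<open>Kx * \<epsilon>1 * rT < 1\<close> keeps
  \<open>1 + s * \<epsilon> * t\<close> nonzero. The last bound on \<open>\<epsilon>1\<close> is the
  smallness required in \<open>difference_H\<close>.\<close>

locale laplace_data = borel_data +
  fixes T :: "complex set" and EH :: "int \<Rightarrow> complex set" and ES :: "nat \<Rightarrow> complex set"
    and \<gamma> :: "nat \<Rightarrow> complex \<Rightarrow> complex \<Rightarrow> real" and A :: "int \<Rightarrow> complex" and s0 rT Kx Am \<epsilon>1 :: real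
  assumes T: "open T" "0 \<notin> T"
    and EH: "\<And>k. k \<in> {-n..n} \<Longrightarrow> open (EH k) \<and> 0 \<notin> EH k"
    and ES: "\<And>p. p < \<iota> \<Longrightarrow> open (ES p) \<and> 0 \<notin> ES p"
    and cH: "\<And>k t \<epsilon>. k \<in> {-n..n} \<Longrightarrow> t \<in> T \<Longrightarrow> \<epsilon> \<in> EH k \<Longrightarrow> - 1 \<in> cone s0 (1 / (\<epsilon> * t)) \<and> A k \<in> cone s0 (1 / (\<epsilon> * t))"
    and A: "\<And>k. k \<in> {-n..n} \<Longrightarrow> A k \<in> H k \<and> A k \<noteq> 0 \<and> cmod (A k) \<le> Am"
    and cS: "\<And>p t \<epsilon>. p < \<iota> \<Longrightarrow> t \<in> T \<Longrightarrow> \<epsilon> \<in> ES p \<Longrightarrow> cis (\<gamma> p t \<epsilon>) \<in> Sd p \<and> cis (\<gamma> p t \<epsilon>) \<in> cone s0 (1 / (\<epsilon> * t))"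
    and s0: "s0 > 0" and rT: "rT = s0 / ka"
    and Kx: "Kx > 0" "\<And>k. k \<in> \<A> \<Longrightarrow> real (snd (snd k)) \<le> Kx"
    and \<epsilon>1: "0 < \<epsilon>1" "\<epsilon>1 \<le> \<epsilon>0" "Kx * \<epsilon>1 * rT < 1" "\<epsilon>1 \<le> exp (- (2 * s3 * (\<zeta> * (s2 * exp (s3 * Am))) + ln 2))"
begin

abbreviation "Tr \<equiv> T \<inter> ball 0 rT"
abbreviation "Bs \<equiv> ball (0::complex) \<epsilon>1"

lemma Tr: "open Tr" "t \<in> Tr \<Longrightarrow> t \<noteq> 0" "t \<in> Tr \<Longrightarrow> ka * cmod t < s0"
  using T kp_pos by (auto simp: rT field_simps)

lemma Bs_E: "\<epsilon> \<in> Bs \<Longrightarrow> \<epsilon> \<noteq> 0 \<Longrightarrow> \<epsilon> \<in> E" using \<epsilon>1 by auto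

lemma EH_E: "k \<in> {-n..n} \<Longrightarrow> \<epsilon> \<in> EH k \<inter> Bs \<Longrightarrow> \<epsilon> \<in> E" using EH[of k] by (intro Bs_E) auto
lemma ES_E: "p < \<iota> \<Longrightarrow> \<epsilon> \<in> ES p \<inter> Bs \<Longrightarrow> \<epsilon> \<in> E" using ES[of p] by (intro Bs_E) auto

lemma cone_Cn: "t \<in> Tr \<Longrightarrow> \<tau> \<in> cone s0 (1 / (\<epsilon> * t)) \<Longrightarrow> \<tau> \<in> Cn t \<epsilon>"
  using cone_antimono[of "ka * cmod t" s0 "1 / (\<epsilon> * t)"] Tr(3)[of t] by auto

lemma denom_ne:
  assumes "t \<in> Tr" "\<epsilon> \<in> Bs" "0 \<le> s" "s \<le> Kx" shows "1 + of_real s * \<epsilon> * t \<noteq> 0"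
proof
  assume "1 + of_real s * \<epsilon> * t = 0"
  hence "of_real s * \<epsilon> * t = - 1" by (simp add: eq_neg_iff_add_eq_0 add.commute)
  hence "cmod (of_real s * \<epsilon> * t) = 1" by simp
  hence "1 = s * cmod \<epsilon> * cmod t" using assms(3) by (simp add: norm_mult)
  also have "\<dots> \<le> Kx * \<epsilon>1 * rT" using assms \<epsilon>1 by (intro mult_mono) auto
  finally show False using \<epsilon>1(3) by simp
qed

lemma s_range: assumes "0 \<le> s" "s = 0 \<or> (\<exists>(k0, k1, k2)\<in>\<A>. s \<le> real k2)" shows "s \<le> Kx"
proof (cases "s = 0")
  case False
  then obtain k where "k \<in> \<A>" "s \<le> real (snd (snd k))" using assms(2) by fastforce
  thus ?thesis using Kx(2)[OF \<open>k \<in> \<A>\<close>] by linarith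
qed (use Kx in simp)

lemma okd:
  assumes p: "p < \<iota>" and t: "t \<in> Tr" and \<epsilon>: "\<epsilon> \<in> ES p \<inter> Bs"
  shows "okdir (cis (\<gamma> p t \<epsilon>)) t \<epsilon>"
proof -
  have ne: "t \<noteq> 0" "\<epsilon> \<noteq> 0" using Tr(2)[OF t] ES_E[OF p \<epsilon>] by auto
  have "ka / cmod \<epsilon> < s0 / (cmod \<epsilon> * cmod t)" using Tr(3)[OF t] ne by (simp add: field_simps)
  also have "\<dots> = s0 * cmod (cis (\<gamma> p t \<epsilon>)) * cmod (1 / (\<epsilon> * t))" by (simp add: norm_divide norm_mult)
  also have "\<dots> \<le> Re (cis (\<gamma> p t \<epsilon>) * (1 / (\<epsilon> * t)))" using cS[OF p, of t \<epsilon>] t \<epsilon> unfolding cone_def by blast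
  finally show ?thesis by (simp add: okdir_def)
qed

text \<open>The reciprocal of \<open>\<epsilon> * t\<close> increases by \<open>s\<close> under the
  shift, so the real part in \<open>okdir\<close> increases by
  \<open>s * Re e \<ge> 0\<close>.\<close>

lemma okdir_continuation:
  assumes ok: "okdir e t \<epsilon>" and e: "Re e \<ge> 0" and s: "s \<ge> 0" and ne: "1 + of_real s * \<epsilon> * t \<noteq> 0" "t \<noteq> 0" "\<epsilon> \<noteq> 0"
  shows "okdir e (t / (1 + of_real s * \<epsilon> * t)) \<epsilon>"
proof -
  have "e / (\<epsilon> * (t / (1 + of_real s * \<epsilon> * t))) = e / (\<epsilon> * t) + of_real s * e" using ne by (simp add: field_simps)
  moreover have "Re (of_real s * e) \<ge> 0" using e s by simp
  ultimately show ?thesis using ok by (simp add: okdir_def)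
qed

lemma open_cont: assumes "open X" "X \<subseteq> Bs" shows "open (continuation_domain \<A> Tr D X)"
proof (rule open_continuation_domain[OF Tr(1) open_ball assms(1)])
  fix t \<epsilon> and s :: real assume "t \<in> Tr" "\<epsilon> \<in> X" "0 \<le> s" "s = 0 \<or> (\<exists>(k0, k1, k2)\<in>\<A>. s \<le> real k2)"
  thus "1 + of_real s * \<epsilon> * t \<noteq> 0" using denom_ne[of t \<epsilon> s] s_range[of s] assms(2) by blast
qed

lemma cont_cases:
  assumes "q \<in> continuation_domain \<A> Tr D X" "X \<subseteq> Bs"
  obtains t z \<epsilon> s where "q = (t / (1 + of_real s * \<epsilon> * t), z, \<epsilon>)" "t \<in> Tr" "z \<in> D" "\<epsilon> \<in> X" "s \<ge> 0" "1 + of_real s * \<epsilon> * t \<noteq> 0"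
proof -
  obtain t z \<epsilon> s where q: "q = (t / (1 + of_real s * \<epsilon> * t), z, \<epsilon>)" "t \<in> Tr" "z \<in> D" "\<epsilon> \<in> X" "0 \<le> s" "s = 0 \<or> (\<exists>(k0, k1, k2)\<in>\<A>. s \<le> real k2)"
    using assms(1) unfolding continuation_domain_def by blast
  have "\<epsilon> \<in> Bs" using q assms by blast
  from that[OF q(1-5) denom_ne[OF q(2) this q(5) s_range[OF q(5,6)]]] show thesis .
qed

lemma shift_ne:
  assumes "k \<in> \<A>" "t \<in> Tr" "\<epsilon> \<in> Bs" shows "1 + of_nat (snd (snd k)) * \<epsilon> * t \<noteq> 0"
  using denom_ne[OF assms(2,3), of "real (snd (snd k))"] Kx(2)[OF assms(1)] by simp

lemma D0: "0 \<in> D" using R by simp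

lemma bent_H: assumes "k \<in> {-n..n}" "s \<ge> -1" shows "bent_path (A k) (- 1) s \<in> HJ"
proof (cases "s < 0")
  case True
  have "A k \<in> HJ" using A[OF assms(1)] H_sub[OF assms(1)] by blast
  hence "of_real (1 + s) * A k \<in> HJ" by (rule HJ_scale) (use assms True in auto)
  thus ?thesis using True by (simp add: bent_path_def)
next
  case False
  thus ?thesis using H_ray[of "A k" k s] A[OF assms(1)] H_sub[OF assms(1)] by (auto simp: bent_path_def)
qed

lemma bent_S: assumes "p < \<iota>" "e \<in> Sd p" shows "bent_path 0 e s \<in> Sc p"
  using Sd_ray[OF assms, of s] r by (cases "s < 0") (auto simp: bent_path_def)

lemma OmH_mem: "t \<noteq> 0 \<Longrightarrow> z \<in> D \<Longrightarrow> \<epsilon> \<in> E \<Longrightarrow> (t, z, \<epsilon>) \<in> OmH" by (simp add: OmH_def)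

text \<open>Since the integral is holomorphic on all of \<open>OmH\<close>, the set \<open>T\<close>
  of \<open>satisfies_eq_U\<close> can be the punctured plane, which contains all shifted
  points.\<close>

lemma solution_H:
  assumes k: "k \<in> {-n..n}"
  shows "bounded_holomorphic_solution P S \<A> c
     (\<lambda>j t \<epsilon>. bent_path_integral (A k) (laplace_kernel (\<lambda>\<tau>. w j \<tau> \<epsilon>) (\<epsilon> * t))) Tr D (EH k \<inter> Bs) (uH (A k))"
  unfolding bounded_holomorphic_solution_def
proof (intro conjI ballI allI impI)
  have a: "A k \<in> H k" using A[OF k] by simp
  note lp = laplace_H[OF k a]
  have op: "open (- {0 :: complex})" by (intro open_Compl) auto
  have cont_sub: "continuation_domain \<A> Tr D (EH k \<inter> Bs) \<subseteq> OmH"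
  proof
    fix q assume "q \<in> continuation_domain \<A> Tr D (EH k \<inter> Bs)"
    then obtain t z \<epsilon> s where q: "q = (t / (1 + of_real s * \<epsilon> * t), z, \<epsilon>)" "t \<in> Tr" "z \<in> D" "\<epsilon> \<in> EH k \<inter> Bs" "s \<ge> 0" "1 + of_real s * \<epsilon> * t \<noteq> 0"
      by (rule cont_cases) auto
    thus "q \<in> OmH" using Tr(2)[OF q(2)] EH_E[OF k q(4)] by (simp add: OmH_def)
  qed
  show "holomorphic3_on (uH (A k)) (continuation_domain \<A> Tr D (EH k \<inter> Bs))"
  proof (rule holomorphic3_on_cong_subset[OF laplace_path.U_holomorphic[OF lp] _ cont_sub])
    show "open (continuation_domain \<A> Tr D (EH k \<inter> Bs))" by (rule open_cont) (use EH[OF k] in auto)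
  qed (use uH_eq[OF k a] cont_sub in blast)
  have "cmod (uH (A k) t z \<epsilon>) \<le> 2 * Kw * exp (\<zeta> * (s2 * exp (s3 * cmod (A k)))) * cmod (A k) + 2 * Kw * \<epsilon>0"
    if "t \<in> Tr" "z \<in> D" "\<epsilon> \<in> EH k \<inter> Bs" for t z \<epsilon>
    by (rule H_bounded[OF k a _ _ EH_E[OF k that(3)] that(2) Tr(2)[OF that(1)]])
      (use cone_Cn[OF that(1)] cH[OF k, of t \<epsilon>] that in auto)
  thus "bounded ((\<lambda>(t, z, \<epsilon>). uH (A k) t z \<epsilon>) ` (Tr \<times> D \<times> (EH k \<inter> Bs)))"
    by (intro boundedI[where B = "2 * Kw * exp (\<zeta> * (s2 * exp (s3 * cmod (A k)))) * cmod (A k) + 2 * Kw * \<epsilon>0"]) auto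
  fix t \<epsilon> assume t: "t \<in> Tr" and \<epsilon>: "\<epsilon> \<in> EH k \<inter> Bs"
  have t0: "t \<in> - {0}" using Tr(2)[OF t] by simp
  have eE: "\<epsilon> \<in> E" by (rule EH_E[OF k \<epsilon>])
  have TZ: "(- {0}) \<times> D \<times> {\<epsilon>} \<subseteq> OmH" using eE by (auto simp: OmH_def)
  have u: "uH (A k) t z \<epsilon> = laplace_path.U (A k) (- 1) W t z \<epsilon>" if "t \<in> - {0}" "z \<in> D" for t z
    using uH_eq[OF k a, of t z \<epsilon>] that eE by (simp add: OmH_def)
  show "satisfies_eq P S \<A> c (uH (A k)) t z \<epsilon>" if z: "z \<in> D" for z
  proof (rule laplace_path.satisfies_eq_U[where u = "uH (A k)" and \<epsilon> = \<epsilon>, OF lp op TZ z t0 u])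
    show "1 + of_nat (snd (snd k)) * \<epsilon> * t \<noteq> 0 \<and> t / (1 + of_nat (snd (snd k)) * \<epsilon> * t) \<in> - {0}" if "k \<in> \<A>" for k
      using shift_ne[OF that t] \<epsilon> t0 by simp
    show "poly P (bent_path (A k) (- 1) s) * (deriv ^^ S) (\<lambda>y. W (bent_path (A k) (- 1) s) y \<epsilon>) z =
      (\<Sum>ka\<in>\<A>. c ka z \<epsilon> * ((bent_path (A k) (- 1) s / \<epsilon>) ^ fst ka * exp (- (of_nat (snd (snd ka)) * bent_path (A k) (- 1) s)) *
         (deriv ^^ fst (snd ka)) (\<lambda>y. W (bent_path (A k) (- 1) s) y \<epsilon>) z))" if "s \<ge> -1" for s
      by (rule W_z(3)[OF _ eE z]) (use bent_H[OF k that] in blast)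
  qed
  show "(deriv ^^ j) (\<lambda>z. uH (A k) t z \<epsilon>) 0 = bent_path_integral (A k) (laplace_kernel (\<lambda>\<tau>. w j \<tau> \<epsilon>) (\<epsilon> * t))" if j: "j < S" for j
    unfolding bent_path_integral_eq_ray
  proof (rule laplace_path.initial_U[where u = "uH (A k)" and \<epsilon> = \<epsilon> and w = "\<lambda>\<tau>. w j \<tau> \<epsilon>", OF lp op TZ D0 t0 u[OF t0]])
    show "(deriv ^^ j) (\<lambda>y. W (bent_path (A k) (- 1) s) y \<epsilon>) 0 = w j (bent_path (A k) (- 1) s) \<epsilon>" if "s \<ge> -1" for s
      by (rule W_z(2)[OF _ eE j]) (use bent_H[OF k that] in blast)
  qed
qed

lemma representation_H:
  assumes k: "k \<in> {-n..n}" and t: "t \<in> Tr" and z: "z \<in> D" and \<epsilon>: "\<epsilon> \<in> EH k \<inter> Bs"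
  shows "bent_path_integrable (A k) (laplace_kernel (\<lambda>\<tau>. W \<tau> z \<epsilon>) (\<epsilon> * t)) \<and>
    uH (A k) t z \<epsilon> = bent_path_integral (A k) (laplace_kernel (\<lambda>\<tau>. W \<tau> z \<epsilon>) (\<epsilon> * t))"
proof -
  have q: "(t, z, \<epsilon>) \<in> OmH" by (rule OmH_mem[OF Tr(2)[OF t] z EH_E[OF k \<epsilon>]])
  have a: "A k \<in> H k" using A[OF k] by simp
  show ?thesis
    using laplace_path.U_eq(1,2)[OF laplace_H[OF k a] q] by (simp add: bent_path_integrable_def bent_path_integral_eq_ray uH_def)
qed

lemma OmS_mem:
  assumes "p < \<iota>" "t \<in> Tr" "z \<in> D" "\<epsilon> \<in> ES p \<inter> Bs"
  shows "(t, z, \<epsilon>) \<in> OmS (cis (\<gamma> p t \<epsilon>))" "cis (\<gamma> p t \<epsilon>) \<in> Sd p"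
  using okd[OF assms(1,2,4)] Tr(2)[OF assms(2)] ES_E[OF assms(1,4)] cS[OF assms(1), of t \<epsilon>] assms by (auto simp: OmS_def)

lemma Sd_Re: "p < \<iota> \<Longrightarrow> e \<in> Sd p \<Longrightarrow> Re e \<ge> 0" using Sd[of p] by force

lemma solution_S:
  assumes p: "p < \<iota>"
  shows "bounded_holomorphic_solution P S \<A> c
     (\<lambda>j t \<epsilon>. ray_integral 0 (cis (\<gamma> p t \<epsilon>)) (laplace_kernel (\<lambda>\<tau>. w j \<tau> \<epsilon>) (\<epsilon> * t))) Tr D (ES p \<inter> Bs) (uS p)"
  unfolding bounded_holomorphic_solution_def
proof (intro conjI ballI allI impI)
  show "holomorphic3_on (uS p) (continuation_domain \<A> Tr D (ES p \<inter> Bs))"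
  proof (rule holomorphic3_on_local)
    show "open (continuation_domain \<A> Tr D (ES p \<inter> Bs))" by (rule open_cont) (use ES[OF p] in auto)
    fix q assume "q \<in> continuation_domain \<A> Tr D (ES p \<inter> Bs)"
    then obtain t z \<epsilon> s where q: "q = (t / (1 + of_real s * \<epsilon> * t), z, \<epsilon>)" "t \<in> Tr" "z \<in> D" "\<epsilon> \<in> ES p \<inter> Bs" "s \<ge> 0" "1 + of_real s * \<epsilon> * t \<noteq> 0"
      by (rule cont_cases) auto
    \<comment> \<open>The direction belongs to the original \<open>t\<close>, not to the continued
      point. It remains admissible at the latter, and near it \<open>uS\<close> is the integral
      along this fixed ray.\<close>
    let ?e = "cis (\<gamma> p t \<epsilon>)"
    have e: "?e \<in> Sd p" by (rule OmS_mem(2)[OF p q(2-4)])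
    have ne: "t \<noteq> 0" "\<epsilon> \<noteq> 0" "\<epsilon> \<in> E" using Tr(2)[OF q(2)] ES_E[OF p q(4)] by auto
    have "okdir ?e (t / (1 + of_real s * \<epsilon> * t)) \<epsilon>"
      by (rule okdir_continuation[OF okd[OF p q(2,4)] Sd_Re[OF p e] q(5,6) ne(1,2)])
    hence "q \<in> OmS ?e" using q ne by (simp add: OmS_def)
    moreover have "holomorphic3_on (uS p) (OmS ?e)"
      by (rule holomorphic3_on_cong_subset[OF laplace_path.U_holomorphic[OF laplace_S[OF p e]] open_OmS order_refl])
        (rule uS_eq(2)[OF p e])
    ultimately show "\<exists>Y. q \<in> Y \<and> holomorphic3_on (uS p) Y" by blast
  qed
  have "cmod (uS p t z \<epsilon>) \<le> 2 * Kw * \<epsilon>0" if "t \<in> Tr" "z \<in> D" "\<epsilon> \<in> ES p \<inter> Bs" for t z \<epsilon>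
    by (rule uS_bounded[OF p OmS_mem(2)[OF p that] OmS_mem(1)[OF p that]])
  thus "bounded ((\<lambda>(t, z, \<epsilon>). uS p t z \<epsilon>) ` (Tr \<times> D \<times> (ES p \<inter> Bs)))"
    by (intro boundedI[where B = "2 * Kw * \<epsilon>0"]) auto
  fix t \<epsilon> assume t: "t \<in> Tr" and \<epsilon>: "\<epsilon> \<in> ES p \<inter> Bs"
  define e where "e = cis (\<gamma> p t \<epsilon>)"
  have e: "e \<in> Sd p" "okdir e t \<epsilon>" unfolding e_def using OmS_mem(2)[OF p t D0 \<epsilon>] okd[OF p t \<epsilon>] by auto
  have eE: "\<epsilon> \<in> E" by (rule ES_E[OF p \<epsilon>])
  have ne: "t \<noteq> 0" "\<epsilon> \<noteq> 0" using Tr(2)[OF t] eE by auto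
  note lp = laplace_S[OF p e(1)]
  \<comment> \<open>For the direction attached to the given \<open>t\<close> and
    \<open>\<epsilon>\<close>, the open set of all \<open>t\<close> for which it is admissible. It
    contains the shifted points, so it can play the role of \<open>T\<close> in
    \<open>satisfies_eq_U\<close>.\<close>
  define X where "X = {t. (t, 0, \<epsilon>) \<in> OmS e}"
  have X: "t \<in> X \<longleftrightarrow> t \<noteq> 0 \<and> okdir e t \<epsilon>" for t using eE D0 by (auto simp: X_def OmS_def)
  have op: "open X"
  proof -
    have "X = (\<lambda>t. (t, 0, \<epsilon>)) -` OmS e" by (auto simp: X_def)
    thus ?thesis by (simp only:) (intro open_vimage[OF open_OmS] continuous_intros)
  qed
  have TZ: "X \<times> D \<times> {\<epsilon>} \<subseteq> OmS e" using eE by (auto simp: X OmS_def)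
  have tX: "t \<in> X" using X ne e by simp
  have u: "uS p t z \<epsilon> = laplace_path.U 0 e W t z \<epsilon>" if "t \<in> X" "z \<in> D" for t z
    by (rule uS_eq(2)[OF p e(1)]) (use that TZ in blast)
  show "satisfies_eq P S \<A> c (uS p) t z \<epsilon>" if z: "z \<in> D" for z
  proof (rule laplace_path.satisfies_eq_U[where u = "uS p" and \<epsilon> = \<epsilon>, OF lp op TZ z tX u])
    show "1 + of_nat (snd (snd k)) * \<epsilon> * t \<noteq> 0 \<and> t / (1 + of_nat (snd (snd k)) * \<epsilon> * t) \<in> X" if "k \<in> \<A>" for k
    proof -
      have n: "1 + of_nat (snd (snd k)) * \<epsilon> * t \<noteq> 0" using shift_ne[OF that t] \<epsilon> by simp
      thus ?thesis using okdir_continuation[OF e(2) Sd_Re[OF p e(1)], of "real (snd (snd k))"] ne by (simp add: X)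
    qed
    show "poly P (bent_path 0 e s) * (deriv ^^ S) (\<lambda>y. W (bent_path 0 e s) y \<epsilon>) z =
      (\<Sum>ka\<in>\<A>. c ka z \<epsilon> * ((bent_path 0 e s / \<epsilon>) ^ fst ka * exp (- (of_nat (snd (snd ka)) * bent_path 0 e s)) *
         (deriv ^^ fst (snd ka)) (\<lambda>y. W (bent_path 0 e s) y \<epsilon>) z))" if "s \<ge> -1" for s
      by (rule W_z(3)[OF _ eE z]) (use bent_S[OF p e(1)] p in blast)
  qed
  show "(deriv ^^ j) (\<lambda>z. uS p t z \<epsilon>) 0 = ray_integral 0 (cis (\<gamma> p t \<epsilon>)) (laplace_kernel (\<lambda>\<tau>. w j \<tau> \<epsilon>) (\<epsilon> * t))" if j: "j < S" for j
    unfolding ray_integral_eq_ray e_def[symmetric]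
  proof (rule laplace_path.initial_U[where u = "uS p" and \<epsilon> = \<epsilon> and w = "\<lambda>\<tau>. w j \<tau> \<epsilon>", OF lp op TZ D0 tX u[OF tX]])
    show "(deriv ^^ j) (\<lambda>y. W (bent_path 0 e s) y \<epsilon>) 0 = w j (bent_path 0 e s) \<epsilon>" if "s \<ge> -1" for s
      by (rule W_z(2)[OF _ eE j]) (use bent_S[OF p e(1)] p in blast)
  qed
qed

lemma representation_S:
  assumes p: "p < \<iota>" and t: "t \<in> Tr" and z: "z \<in> D" and \<epsilon>: "\<epsilon> \<in> ES p \<inter> Bs"
  shows "ray_integrable 0 (cis (\<gamma> p t \<epsilon>)) (laplace_kernel (\<lambda>\<tau>. W \<tau> z \<epsilon>) (\<epsilon> * t)) \<and>
    uS p t z \<epsilon> = ray_integral 0 (cis (\<gamma> p t \<epsilon>)) (laplace_kernel (\<lambda>\<tau>. W \<tau> z \<epsilon>) (\<epsilon> * t))"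
  using laplace_path.U_eq(2)[OF laplace_S[OF p OmS_mem(2)[OF p t z \<epsilon>]] OmS_mem(1)[OF p t z \<epsilon>]]
    uS_eq(1)[OF p OmS_mem(2)[OF p t z \<epsilon>] OmS_mem(1)[OF p t z \<epsilon>]] by (simp add: ray_integral_eq_ray)

text \<open>Smallness of \<open>\<epsilon>1\<close> gives \<open>L \<ge> 2 * s3 * B + ln 2\<close>
  for \<open>L = ln (1 / |\<epsilon>|)\<close>, that is,
  \<open>B \<le> (L - ln 2) / (2 * s3)\<close>. Half of \<open>X = L / s3\<close> thus pays for the
  double exponential; the other half remains as \<open>M2 = 1 / (2 * s3)\<close>, and the reserve
  \<open>ln 2\<close> turns \<open>L\<close> into \<open>ln (2 / |\<epsilon>|)\<close>, because
  \<open>M3 > 1\<close> is wanted.\<close>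

lemma difference_H:
  assumes k: "k \<in> {-n..n-1}"
  shows "\<exists>M1>0. \<exists>M2>0. \<exists>M3>1. \<forall>t\<in>Tr. \<forall>z\<in>D. \<forall>\<epsilon>\<in>EH k \<inter> EH (k+1) \<inter> Bs.
     cmod (uH (A (k+1)) t z \<epsilon> - uH (A k) t z \<epsilon>) \<le> M1 * exp (- (M2 / cmod \<epsilon>) * ln (M3 / cmod \<epsilon>))"
proof -
  have kk: "k \<in> {-n..n}" "k + 1 \<in> {-n..n}" using k by auto
  define B where "B = \<zeta> * (s2 * exp (s3 * Am))"
  have B: "B > 0" using zeta_sum_ge_1[OF b] pos by (simp add: B_def)
  have Am: "Am \<ge> 0" using A[OF kk(1)] norm_ge_zero order_trans by blast
  have bd: "cmod (uH (A (k+1)) t z \<epsilon> - uH (A k) t z \<epsilon>) \<le> (2 * Kw * (2 * Am + 2 * \<epsilon>0)) * exp (- ((1 / (2 * s3)) / cmod \<epsilon>) * ln (2 / cmod \<epsilon>))"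
    if t: "t \<in> Tr" and z: "z \<in> D" and \<epsilon>: "\<epsilon> \<in> EH k \<inter> EH (k+1) \<inter> Bs" for t z \<epsilon>
  proof -
    have eE: "\<epsilon> \<in> E" using EH_E[OF kk(1)] \<epsilon> by blast
    have e0: "cmod \<epsilon> > 0" "cmod \<epsilon> < \<epsilon>1" using eE \<epsilon> by auto
    define L where "L = ln (1 / cmod \<epsilon>)"
    have L: "L \<ge> 2 * s3 * B + ln 2"
    proof -
      have "cmod \<epsilon> \<le> exp (- (2 * s3 * B + ln 2))" using e0 \<epsilon>1(4) by (simp add: B_def)
      hence "ln (cmod \<epsilon>) \<le> - (2 * s3 * B + ln 2)" using e0 by (metis exp_gt_zero ln_exp ln_le_cancel_iff)
      thus ?thesis using e0 by (simp add: L_def ln_div)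
    qed
    have L0: "L > 0" using L B pos by (smt (verit) ln_gt_zero mult_pos_pos)
    \<comment> \<open>Then \<open>exp (s3 * X) = 1 / |\<epsilon>|\<close>, and the exponent in
      \<open>H_diff\<close> becomes \<open>(B - X) / |\<epsilon>|\<close>.\<close>
    define X where "X = L / s3"
    have X: "X > 0" using L0 pos by (simp add: X_def)
    have "exp (s3 * (Am + X)) = exp (s3 * Am) * (1 / cmod \<epsilon>)"
      using pos e0 by (simp add: X_def L_def distrib_left exp_add)
    hence e1: "\<zeta> * (s2 * exp (s3 * (Am + X))) = B / cmod \<epsilon>" by (simp add: B_def)
    have Cns: "A k \<in> Cn t \<epsilon>" "A (k + 1) \<in> Cn t \<epsilon>" "- 1 \<in> Cn t \<epsilon>"
      using cone_Cn[OF t] cH[OF kk(1), of t \<epsilon>] cH[OF kk(2), of t \<epsilon>] t \<epsilon> by auto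
    have "cmod (uH (A (k+1)) t z \<epsilon> - uH (A k) t z \<epsilon>) \<le> 2 * Kw * exp (\<zeta> * (s2 * exp (s3 * (Am + X))) - X / cmod \<epsilon>) * (2 * Am + 2 * cmod \<epsilon>)"
      by (rule H_diff[OF kk _ _ Cns eE z Tr(2)[OF t] X]) (use A[OF kk(1)] A[OF kk(2)] in auto)
    also have "\<dots> \<le> 2 * Kw * exp (- ((1 / (2 * s3)) / cmod \<epsilon>) * ln (2 / cmod \<epsilon>)) * (2 * Am + 2 * \<epsilon>0)"
    proof -
      have "ln (2 / cmod \<epsilon>) = ln 2 + L" using e0 by (simp add: L_def ln_div)
      moreover have "- ((1 / (2 * s3)) / e) * q = (- q / (2 * s3)) / e" for e q :: real by simp
      ultimately have "- ((1 / (2 * s3)) / cmod \<epsilon>) * ln (2 / cmod \<epsilon>) = (- (ln 2 + L) / (2 * s3)) / cmod \<epsilon>" by (simp only:)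
      moreover have "B \<le> (L - ln 2) / (2 * s3)" using L pos by (simp add: pos_le_divide_eq mult_ac)
      moreover have "X - (ln 2 + L) / (2 * s3) = (L - ln 2) / (2 * s3)" using pos by (simp add: X_def field_simps)
      ultimately have "- ((1 / (2 * s3)) / cmod \<epsilon>) * ln (2 / cmod \<epsilon>) = (- (ln 2 + L) / (2 * s3)) / cmod \<epsilon>" "B - X \<le> - (ln 2 + L) / (2 * s3)"
        unfolding minus_divide_left[symmetric] by linarith+
      moreover from this(2)
      have "(B - X) / cmod \<epsilon> \<le> (- (ln 2 + L) / (2 * s3)) / cmod \<epsilon>" by (rule divide_right_mono) simp
      ultimately have "\<zeta> * (s2 * exp (s3 * (Am + X))) - X / cmod \<epsilon> \<le> - ((1 / (2 * s3)) / cmod \<epsilon>) * ln (2 / cmod \<epsilon>)"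
        unfolding e1 by (simp add: diff_divide_distrib)
      thus ?thesis using Kw(1) Am e0 \<epsilon>1(2) by (intro mult_mono) auto
    qed
    finally show ?thesis by (simp only: mult_ac)
  qed
  moreover have "2 * Kw * (2 * Am + 2 * \<epsilon>0) > 0" using Kw(1) Am \<epsilon>0 by (intro mult_pos_pos add_nonneg_pos) auto
  moreover have "1 / (2 * s3) > 0" using pos by simp
  moreover have "(2 :: real) > 1" by simp
  ultimately show ?thesis by blast
qed

lemma difference_S:
  assumes p: "p + 1 < \<iota>"
  shows "\<exists>M1>0. \<exists>M2>0. \<forall>t\<in>Tr. \<forall>z\<in>D. \<forall>\<epsilon>\<in>ES (p+1) \<inter> ES p \<inter> Bs.
     cmod (uS (p+1) t z \<epsilon> - uS p t z \<epsilon>) \<le> M1 * exp (- M2 / cmod \<epsilon>)"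
proof -
  have pp: "p < \<iota>" using p by simp
  have N: "r / 2 > 0" using r by simp
  have bd: "cmod (uS (p+1) t z \<epsilon> - uS p t z \<epsilon>) \<le> (2 * Kw * (r + 2 * \<epsilon>0)) * exp (- (r / 2) / cmod \<epsilon>)"
    if t: "t \<in> Tr" and z: "z \<in> D" and \<epsilon>: "\<epsilon> \<in> ES (p+1) \<inter> ES p \<inter> Bs" for t z \<epsilon>
  proof -
    have e1: "\<epsilon> \<in> ES (p+1) \<inter> Bs" "\<epsilon> \<in> ES p \<inter> Bs" using \<epsilon> by auto
    have eE: "\<epsilon> \<in> E" by (rule ES_E[OF pp e1(2)])
    note q1 = OmS_mem[OF p t z e1(1)] and q2 = OmS_mem[OF pp t z e1(2)]
    have "cmod (uS (p+1) t z \<epsilon> - uS p t z \<epsilon>) \<le> 2 * Kw * exp (- (r / 2) / cmod \<epsilon>) * (2 * (r / 2) + 2 * cmod \<epsilon>)"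
      unfolding uS_eq(1)[OF p q1(2,1)] uS_eq(1)[OF pp q2(2,1)]
    \<comment> \<open>Rays in different sectors can only be joined inside the disc, where the
      transform is common to them; \<open>r / 2\<close> keeps the chord in the open disc.\<close>
    proof (rule two_rays[OF p pp q1(2) q2(2) okd[OF p t e1(1)] okd[OF pp t e1(2)] eE z Tr(2)[OF t] N, where C = "ball 0 r"])
      show "continuous_on (ball 0 r) (F t z \<epsilon>)" by (rule holomorphic_on_imp_continuous_on[OF F_ball[OF eE z]])
      show "F t z \<epsilon> holomorphic_on interior (ball 0 r)" by (rule holomorphic_on_subset[OF F_ball[OF eE z]]) auto
      show "\<exists>p<\<iota>. \<tau> \<in> Sc p" if "\<tau> \<in> ball 0 r" for \<tau> using that iota0 by auto
    qed (use r in \<open>auto simp: norm_mult\<close>)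
    also have "\<dots> \<le> 2 * Kw * exp (- (r / 2) / cmod \<epsilon>) * (r + 2 * \<epsilon>0)"
      using Kw(1) eE by (intro mult_left_mono) auto
    finally show ?thesis by (simp only: mult_ac)
  qed
  moreover have "2 * Kw * (r + 2 * \<epsilon>0) > 0" using Kw(1) r \<epsilon>0 by (intro mult_pos_pos) auto
  ultimately show ?thesis using N by blast
qed

text \<open>The estimate is given for every smaller exponent as well, so that the two ends of the
  covering can share one. \<open>m\<close> stays below \<open>r\<close> for the chord in the disc,
  and at most half of \<open>|A k|\<close> for the tail that starts at \<open>A k\<close>.\<close>

lemma difference_mixed:
  assumes k: "k \<in> {-n..n}" and p: "p < \<iota>"
  shows "\<exists>C>0. \<exists>m>0. \<forall>m'. 0 < m' \<longrightarrow> m' \<le> m \<longrightarrow> (\<forall>t\<in>Tr. \<forall>z\<in>D. \<forall>\<epsilon>\<in>EH k \<inter> ES p \<inter> Bs.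
     cmod (uH (A k) t z \<epsilon> - uS p t z \<epsilon>) \<le> C * exp (- m' / cmod \<epsilon>))"
proof -
  have a: "A k \<in> H k" "A k \<noteq> 0" using A[OF k] by auto
  define m where "m = min (r / 2) (cmod (A k) / 2)"
  have m: "0 < m" "m < r" "m \<le> cmod (A k) / 2" using r a by (auto simp: m_def)
  define C where "C = 2 * Kw * (2 * m + exp (\<zeta> * (s2 * exp (s3 * cmod (A k)))) * cmod (A k) + 3 * \<epsilon>0)"
  have "0 < 2 * m + exp (\<zeta> * (s2 * exp (s3 * cmod (A k)))) * cmod (A k) + 3 * \<epsilon>0"
    using m \<epsilon>0 by (intro add_pos_pos add_pos_nonneg) auto
  hence C: "C > 0" using Kw(1) by (simp add: C_def)
  have bd: "cmod (uH (A k) t z \<epsilon> - uS p t z \<epsilon>) \<le> C * exp (- m' / cmod \<epsilon>)"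
    if t: "t \<in> Tr" and z: "z \<in> D" and \<epsilon>: "\<epsilon> \<in> EH k \<inter> ES p \<inter> Bs" and m': "m' \<le> m" for t z \<epsilon> m'
  proof -
    have e1: "\<epsilon> \<in> EH k \<inter> Bs" "\<epsilon> \<in> ES p \<inter> Bs" using \<epsilon> by auto
    have Cns: "A k \<in> Cn t \<epsilon>" "- 1 \<in> Cn t \<epsilon>" using cone_Cn[OF t] cH[OF k, of t \<epsilon>] t \<epsilon> by auto
    have "cmod (uH (A k) t z \<epsilon> - uS p t z \<epsilon>) \<le> C * exp (- m / cmod \<epsilon>)"
      using mixed_diff[OF k a(1) Cns p OmS_mem(2)[OF p t z e1(2)] OmS_mem(1)[OF p t z e1(2)] m] unfolding C_def by (simp only: mult_ac)
    also have "\<dots> \<le> C * exp (- m' / cmod \<epsilon>)" using C m' by (intro mult_left_mono) (auto simp: divide_right_mono)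
    finally show ?thesis .
  qed
  thus ?thesis using C m(1) by blast
qed

lemma differences_mixed:
  "\<exists>M1>0. \<exists>M2>0. \<forall>t\<in>Tr. \<forall>z\<in>D.
     (\<forall>\<epsilon>\<in>EH (-n) \<inter> ES 0 \<inter> Bs. cmod (uH (A (-n)) t z \<epsilon> - uS 0 t z \<epsilon>) \<le> M1 * exp (- M2 / cmod \<epsilon>)) \<and>
     (\<forall>\<epsilon>\<in>EH n \<inter> ES (\<iota>-1) \<inter> Bs. cmod (uH (A n) t z \<epsilon> - uS (\<iota>-1) t z \<epsilon>) \<le> M1 * exp (- M2 / cmod \<epsilon>))"
proof -
  have k: "-n \<in> {-n..n}" "n \<in> {-n..n}" "\<iota> - 1 < \<iota>" using n iota0 by auto
  obtain C1 m1 where C1: "C1 > 0" "m1 > 0" and b1: "\<forall>m'. 0 < m' \<longrightarrow> m' \<le> m1 \<longrightarrow> (\<forall>t\<in>Tr. \<forall>z\<in>D. \<forall>\<epsilon>\<in>EH (-n) \<inter> ES 0 \<inter> Bs.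
     cmod (uH (A (-n)) t z \<epsilon> - uS 0 t z \<epsilon>) \<le> C1 * exp (- m' / cmod \<epsilon>))"
    using difference_mixed[OF k(1) iota0] by (elim exE conjE)
  obtain C2 m2 where C2: "C2 > 0" "m2 > 0" and b2: "\<forall>m'. 0 < m' \<longrightarrow> m' \<le> m2 \<longrightarrow> (\<forall>t\<in>Tr. \<forall>z\<in>D. \<forall>\<epsilon>\<in>EH n \<inter> ES (\<iota>-1) \<inter> Bs.
     cmod (uH (A n) t z \<epsilon> - uS (\<iota>-1) t z \<epsilon>) \<le> C2 * exp (- m' / cmod \<epsilon>))"
    using difference_mixed[OF k(2,3)] by (elim exE conjE)
  define m where "m = min m1 m2"
  have m: "m > 0" "m \<le> m1" "m \<le> m2" using C1 C2 by (auto simp: m_def)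
  have le: "C1 * exp x \<le> (C1 + C2) * exp x" "C2 * exp x \<le> (C1 + C2) * exp x" for x using C1(1) C2(1) by auto
  show ?thesis
  proof (rule exI[of _ "C1 + C2"], intro exI[of _ m] conjI ballI)
    fix t z \<epsilon> assume tz: "t \<in> Tr" "z \<in> D"
    show "cmod (uH (A (-n)) t z \<epsilon> - uS 0 t z \<epsilon>) \<le> (C1 + C2) * exp (- m / cmod \<epsilon>)" if "\<epsilon> \<in> EH (-n) \<inter> ES 0 \<inter> Bs"
      using b1[rule_format, OF m(1,2) tz that] le(1) by (rule order_trans)
    show "cmod (uH (A n) t z \<epsilon> - uS (\<iota>-1) t z \<epsilon>) \<le> (C1 + C2) * exp (- m / cmod \<epsilon>)" if "\<epsilon> \<in> EH n \<inter> ES (\<iota>-1) \<inter> Bs"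
      using b2[rule_format, OF m(1,3) tz that] le(2) by (rule order_trans)
  qed (use C1 C2 m in auto)
qed

lemma W_regular:
  "holomorphic3_on W (interior HJ \<times> D \<times> (Bs - {0}))"
  "continuous_on (HJ \<times> D \<times> (Bs - {0})) (\<lambda>(\<tau>, z, \<epsilon>). W \<tau> z \<epsilon>)"
  "p < \<iota> \<Longrightarrow> holomorphic3_on W (So p \<times> D \<times> (Bs - {0}))"
  "p < \<iota> \<Longrightarrow> continuous_on (Sc p \<times> D \<times> (Bs - {0})) (\<lambda>(\<tau>, z, \<epsilon>). W \<tau> z \<epsilon>)"
proof -
  have s: "Bs - {0} \<subseteq> E" using \<epsilon>1 by auto
  have o: "open (Bs - {0})" by (intro open_delete) auto
  have sub: "X \<times> D \<times> (Bs - {0}) \<subseteq> X \<times> D \<times> E" for X :: "complex set" using s by blast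
  show "holomorphic3_on W (interior HJ \<times> D \<times> (Bs - {0}))"
    by (rule holomorphic3_on_cong_subset[OF W_holomorphic3(1) open_Times[OF open_interior open_Times[OF open_ball o]] sub refl])
  show "continuous_on (HJ \<times> D \<times> (Bs - {0})) (\<lambda>(\<tau>, z, \<epsilon>). W \<tau> z \<epsilon>)"
    by (rule continuous_on_subset[OF W_cont(1) sub])
  show "holomorphic3_on W (So p \<times> D \<times> (Bs - {0}))" if p: "p < \<iota>"
    by (rule holomorphic3_on_cong_subset[OF W_holomorphic3(2)[OF p] open_Times[OF So_open[OF p] open_Times[OF open_ball o]] sub refl])
  show "continuous_on (Sc p \<times> D \<times> (Bs - {0})) (\<lambda>(\<tau>, z, \<epsilon>). W \<tau> z \<epsilon>)" if p: "p < \<iota>"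
    by (rule continuous_on_subset[OF W_cont(2)[OF p] sub])
qed

text \<open>Enlarging \<open>\<sigma>1\<close> and \<open>s2\<close> and shrinking
  \<open>\<sigma>2\<close> only weakens the bounds already known for \<open>W\<close>, so
  \<open>2 * Kw\<close> serves as both constants.\<close>

lemma W_bounds:
  assumes \<sigma>: "\<sigma>1' > \<sigma>1" "0 < \<sigma>2'" "\<sigma>2' < \<sigma>2" "\<sigma>3' = \<sigma>3" "s2' > s2" "s3' = s3" and k: "k \<in> {-n..n}"
  shows "\<exists>CH>0. \<exists>CJ>0. \<forall>z\<in>D. \<forall>\<epsilon>\<in>Bs - {0}.
     (\<forall>\<tau>\<in>H k. cmod (W \<tau> z \<epsilon>) \<le> CH * cmod \<tau> *
        exp (\<sigma>1' / cmod \<epsilon> * \<zeta> * cmod \<tau> - \<sigma>2' * (M - \<zeta>) * exp (\<sigma>3' * cmod \<tau>))) \<and>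
     (\<forall>\<tau>\<in>J k. cmod (W \<tau> z \<epsilon>) \<le> CJ * cmod \<tau> *
        exp (\<sigma>1' / cmod \<epsilon> * \<zeta> * cmod \<tau> + s2' * \<zeta> * exp (s3' * cmod \<tau>)))"
proof (intro exI[of _ "2 * Kw"] conjI ballI)
  have \<zeta>0: "\<zeta> \<ge> 0" using zeta_sum_ge_1[OF b] by simp
  fix z \<epsilon> \<tau> assume z: "z \<in> D" and \<epsilon>: "\<epsilon> \<in> Bs - {0}"
  have eE: "\<epsilon> \<in> E" using \<epsilon> \<epsilon>1 by auto
  have le1: "\<zeta> * (\<sigma>1 * cmod \<tau> / cmod \<epsilon>) \<le> \<sigma>1' / cmod \<epsilon> * \<zeta> * cmod \<tau>"
  proof -
    have "\<sigma>1 * (\<zeta> * cmod \<tau> / cmod \<epsilon>) \<le> \<sigma>1' * (\<zeta> * cmod \<tau> / cmod \<epsilon>)" using \<sigma>(1) \<zeta>0 by (intro mult_right_mono) auto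
    thus ?thesis by (simp add: mult_ac)
  qed
  show "cmod (W \<tau> z \<epsilon>) \<le> 2 * Kw * cmod \<tau> * exp (\<sigma>1' / cmod \<epsilon> * \<zeta> * cmod \<tau> - \<sigma>2' * (M - \<zeta>) * exp (\<sigma>3' * cmod \<tau>))" if \<tau>: "\<tau> \<in> H k"
  proof -
    have "\<sigma>2' * ((M - \<zeta>) * exp (\<sigma>3 * cmod \<tau>)) \<le> \<sigma>2 * ((M - \<zeta>) * exp (\<sigma>3 * cmod \<tau>))"
      using \<sigma> M by (intro mult_right_mono) auto
    hence "\<zeta> * (\<sigma>1 * cmod \<tau> / cmod \<epsilon>) - (M - \<zeta>) * GH \<tau> \<le> \<sigma>1' / cmod \<epsilon> * \<zeta> * cmod \<tau> - \<sigma>2' * (M - \<zeta>) * exp (\<sigma>3' * cmod \<tau>)"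
      using le1 \<sigma>(4) by (simp add: GH_def mult_ac)
    hence "2 * QH \<tau> \<epsilon> \<le> 2 * (Kw * cmod \<tau> * exp (\<sigma>1' / cmod \<epsilon> * \<zeta> * cmod \<tau> - \<sigma>2' * (M - \<zeta>) * exp (\<sigma>3' * cmod \<tau>)))"
      unfolding QH_def using Kw(1) by (intro mult_left_mono) auto
    thus ?thesis using W_H[OF k \<tau> eE z] by simp
  qed
  show "cmod (W \<tau> z \<epsilon>) \<le> 2 * Kw * cmod \<tau> * exp (\<sigma>1' / cmod \<epsilon> * \<zeta> * cmod \<tau> + s2' * \<zeta> * exp (s3' * cmod \<tau>))" if \<tau>: "\<tau> \<in> J k"
  proof -
    have "s2 * (\<zeta> * exp (s3 * cmod \<tau>)) \<le> s2' * (\<zeta> * exp (s3 * cmod \<tau>))"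
      using \<sigma> \<zeta>0 by (intro mult_right_mono) auto
    hence "\<zeta> * (\<sigma>1 * cmod \<tau> / cmod \<epsilon> + GJ \<tau>) \<le> \<sigma>1' / cmod \<epsilon> * \<zeta> * cmod \<tau> + s2' * \<zeta> * exp (s3' * cmod \<tau>)"
      using le1 \<sigma>(6) by (simp add: GJ_def distrib_left mult_ac)
    hence "2 * QJ \<tau> \<epsilon> \<le> 2 * (Kw * cmod \<tau> * exp (\<sigma>1' / cmod \<epsilon> * \<zeta> * cmod \<tau> + s2' * \<zeta> * exp (s3' * cmod \<tau>)))"
      unfolding QJ_def using Kw(1) by (intro mult_left_mono) auto
    moreover have "\<tau> \<in> HJ" using J_sub[OF k] \<tau> by blast
    ultimately show ?thesis using W_HJ[OF _ eE z, of \<tau>] by simp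
  qed
qed (use Kw(1) in auto)

lemma W_bounds_S:
  assumes \<sigma>: "\<sigma>1' > \<sigma>1" and p: "p < \<iota>"
  shows "\<exists>C>0. \<forall>\<tau>\<in>So p. \<forall>z\<in>D. \<forall>\<epsilon>\<in>Bs - {0}. cmod (W \<tau> z \<epsilon>) \<le> C * cmod \<tau> * exp (\<sigma>1' / cmod \<epsilon> * \<zeta> * cmod \<tau>)"
proof (intro exI[of _ "2 * Kw"] conjI ballI)
  have \<zeta>0: "\<zeta> \<ge> 0" using zeta_sum_ge_1[OF b] by simp
  fix z \<epsilon> \<tau> assume \<tau>: "\<tau> \<in> So p" and z: "z \<in> D" and \<epsilon>: "\<epsilon> \<in> Bs - {0}"
  have eE: "\<epsilon> \<in> E" using \<epsilon> \<epsilon>1 by auto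
  have "\<sigma>1 * (\<zeta> * cmod \<tau> / cmod \<epsilon>) \<le> \<sigma>1' * (\<zeta> * cmod \<tau> / cmod \<epsilon>)" using \<sigma>(1) \<zeta>0 by (intro mult_right_mono) auto
  hence "\<zeta> * (\<sigma>1 * cmod \<tau> / cmod \<epsilon>) \<le> \<sigma>1' / cmod \<epsilon> * \<zeta> * cmod \<tau>" by (simp add: mult_ac)
  hence "2 * QS \<tau> \<epsilon> \<le> 2 * (Kw * cmod \<tau> * exp (\<sigma>1' / cmod \<epsilon> * \<zeta> * cmod \<tau>))"
    unfolding QS_def using Kw(1) by (intro mult_left_mono) auto
  moreover have "\<tau> \<in> Sc p" using \<tau> So_Sc(1)[of p] by blast
  ultimately show "cmod (W \<tau> z \<epsilon>) \<le> 2 * Kw * cmod \<tau> * exp (\<sigma>1' / cmod \<epsilon> * \<zeta> * cmod \<tau>)" using W_S[OF p _ eE z, of \<tau>] by simp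
qed (use Kw(1) in auto)

end

section \<open>Choice of the constants and conclusion\<close>

theorem theorem1:
  fixes \<A> :: "(nat \<times> nat \<times> nat) set"
    and c :: "nat \<times> nat \<times> nat \<Rightarrow> complex \<Rightarrow> complex \<Rightarrow> complex"
    and P :: "complex poly" and S :: nat
    and \<rho> \<epsilon>0 \<xi> b M r :: real
    and n :: int and aH bH cJ dJ :: "int \<Rightarrow> real"
    and \<sigma>1' \<sigma>2' \<sigma>3' s2' s3' :: real
    and \<iota> :: nat and d :: "nat \<Rightarrow> real" and Sd :: "nat \<Rightarrow> complex set"
    and H J :: "int \<Rightarrow> complex set" and HJ :: "complex set"
  assumes "H = (\<lambda>k. strip (aH k) (bH k))"
    and "J = (\<lambda>k. strip (cJ k) (dJ k))"
    and "HJ = strip (cJ (-n)) (bH n)"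
    and "finite \<A>" and "\<rho> > 0" and "\<epsilon>0 > 0" and "S \<ge> 1"
    and "\<And>k. k \<in> \<A> \<Longrightarrow> holomorphic2_on (c k) (ball 0 \<rho> \<times> ball 0 \<epsilon>0)"
    and "\<And>k. k \<in> \<A> \<Longrightarrow> bounded ((\<lambda>(z, \<epsilon>). c k z \<epsilon>) ` (ball 0 \<rho> \<times> ball 0 \<epsilon>0))"
    and "P \<noteq> 0" and "\<And>x. poly P x = 0 \<Longrightarrow> Re x > 0"
    and "\<xi> > 0" and "b > 1"
    and "\<And>k0 k1 k2. (k0, k1, k2) \<in> \<A> \<Longrightarrow>
           real S \<ge> real k1 + b * real k0 + b * real k2 / \<xi> \<and> S > k1"
    and "M > zeta_sum b"
    and "n \<ge> 1" and "strip_bounds n aH bH cJ dJ"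
    and "\<sigma>1' > 0" and "\<sigma>2' > 0" and "\<sigma>3' > 0" and "s2' > 0" and "s3' > 0"
    and "\<xi> \<le> min \<sigma>3' s3'"
    and "\<iota> \<ge> 2"
    and "\<And>p. p < \<iota> \<Longrightarrow> unbounded_sector (d p) (Sd p) \<and> Sd p \<subseteq> {z. Re z > 0}"
    and "\<And>p. p + 1 < \<iota> \<Longrightarrow> d p < d (p+1) \<and> Sd p \<inter> Sd (p+1) = {}"
    and "r > 0"
    and "\<And>p x. p < \<iota> \<Longrightarrow> x \<in> closure (Sd p) \<union> cball 0 r \<Longrightarrow> poly P x \<noteq> 0"
    and "ball 0 r \<inter> {z. Re z \<le> 0} \<subseteq> J 0"
  shows
    "\<exists>I>0. \<exists>\<delta>>0.
      \<forall>w T EH ES \<gamma> A.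
        admissible_data S \<epsilon>0 HJ n H J \<iota> Sd r M (\<sigma>1', \<sigma>2', \<sigma>3') (s2', s3') w \<longrightarrow>
        admissible_sectors \<epsilon>0 n H \<iota> Sd T EH ES \<gamma> A \<longrightarrow>
        small_data S \<epsilon>0 n H J \<iota> Sd r M (\<sigma>1', \<sigma>2', \<sigma>3') (s2', s3') I \<delta> w \<longrightarrow>
        (\<exists>\<delta>1 rT \<epsilon>1. 0 < \<delta>1 \<and> \<delta>1 < 1 \<and> 0 < rT \<and> 0 < \<epsilon>1 \<and> \<epsilon>1 \<le> \<epsilon>0 \<and>
          (let Tr = T \<inter> ball 0 rT; D = ball 0 (\<delta> * \<delta>1); B = ball 0 \<epsilon>1 in
           \<exists>uH wHJ uS wS.
            (\<forall>k\<in>{-n..n}.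
               bounded_holomorphic_solution P S \<A> c
                 (\<lambda>j t \<epsilon>. bent_path_integral (A k) (laplace_kernel (\<lambda>\<tau>. w j \<tau> \<epsilon>) (\<epsilon> * t)))
                 Tr D (EH k \<inter> B) (uH k) \<and>
               (\<forall>t\<in>Tr. \<forall>z\<in>D. \<forall>\<epsilon>\<in>EH k \<inter> B.
                  bent_path_integrable (A k) (laplace_kernel (\<lambda>\<tau>. wHJ \<tau> z \<epsilon>) (\<epsilon> * t)) \<and>
                  uH k t z \<epsilon> = bent_path_integral (A k) (laplace_kernel (\<lambda>\<tau>. wHJ \<tau> z \<epsilon>) (\<epsilon> * t)))) \<and>
            holomorphic3_on wHJ (interior HJ \<times> D \<times> (B - {0})) \<and>
            continuous_on (HJ \<times> D \<times> (B - {0})) (\<lambda>(\<tau>, z, \<epsilon>). wHJ \<tau> z \<epsilon>) \<and>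
            (\<forall>\<sigma>1 \<sigma>2 \<sigma>3 s2 s3.
               \<sigma>1 > \<sigma>1' \<and> 0 < \<sigma>2 \<and> \<sigma>2 < \<sigma>2' \<and> \<sigma>3 = \<sigma>3' \<and> s2 > s2' \<and> s3 = s3' \<longrightarrow>
               (\<forall>k\<in>{-n..n}. \<exists>CH>0. \<exists>CJ>0. \<forall>z\<in>D. \<forall>\<epsilon>\<in>B - {0}.
                  (\<forall>\<tau>\<in>H k. cmod (wHJ \<tau> z \<epsilon>) \<le> CH * cmod \<tau> *
                     exp (\<sigma>1 / cmod \<epsilon> * zeta_sum b * cmod \<tau>
                          - \<sigma>2 * (M - zeta_sum b) * exp (\<sigma>3 * cmod \<tau>))) \<and>
                  (\<forall>\<tau>\<in>J k. cmod (wHJ \<tau> z \<epsilon>) \<le> CJ * cmod \<tau> *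
                     exp (\<sigma>1 / cmod \<epsilon> * zeta_sum b * cmod \<tau>
                          + s2 * zeta_sum b * exp (s3 * cmod \<tau>))))) \<and>
            (\<forall>k\<in>{-n..n-1}. \<exists>M1>0. \<exists>M2>0. \<exists>M3>1.
               \<forall>t\<in>Tr. \<forall>z\<in>D. \<forall>\<epsilon>\<in>EH k \<inter> EH (k+1) \<inter> B.
                 cmod (uH (k+1) t z \<epsilon> - uH k t z \<epsilon>)
                   \<le> M1 * exp (- (M2 / cmod \<epsilon>) * ln (M3 / cmod \<epsilon>))) \<and>
            (\<forall>p<\<iota>.
               bounded_holomorphic_solution P S \<A> c
                 (\<lambda>j t \<epsilon>. ray_integral 0 (cis (\<gamma> p t \<epsilon>)) (laplace_kernel (\<lambda>\<tau>. w j \<tau> \<epsilon>) (\<epsilon> * t)))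
                 Tr D (ES p \<inter> B) (uS p) \<and>
               (\<forall>t\<in>Tr. \<forall>z\<in>D. \<forall>\<epsilon>\<in>ES p \<inter> B.
                  ray_integrable 0 (cis (\<gamma> p t \<epsilon>)) (laplace_kernel (\<lambda>\<tau>. wS p \<tau> z \<epsilon>) (\<epsilon> * t)) \<and>
                  uS p t z \<epsilon> =
                    ray_integral 0 (cis (\<gamma> p t \<epsilon>)) (laplace_kernel (\<lambda>\<tau>. wS p \<tau> z \<epsilon>) (\<epsilon> * t))) \<and>
               holomorphic3_on (wS p) ((Sd p \<union> ball 0 r) \<times> D \<times> (B - {0})) \<and>
               continuous_on ((closure (Sd p) \<union> cball 0 r) \<times> D \<times> (B - {0})) (\<lambda>(\<tau>, z, \<epsilon>). wS p \<tau> z \<epsilon>) \<and>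
               (\<forall>\<sigma>1>\<sigma>1'. \<exists>C>0. \<forall>\<tau>\<in>Sd p \<union> ball 0 r. \<forall>z\<in>D. \<forall>\<epsilon>\<in>B - {0}.
                  cmod (wS p \<tau> z \<epsilon>) \<le> C * cmod \<tau> * exp (\<sigma>1 / cmod \<epsilon> * zeta_sum b * cmod \<tau>))) \<and>
            (\<forall>p. p + 1 < \<iota> \<longrightarrow> (\<exists>M1>0. \<exists>M2>0.
               \<forall>t\<in>Tr. \<forall>z\<in>D. \<forall>\<epsilon>\<in>ES (p+1) \<inter> ES p \<inter> B.
                 cmod (uS (p+1) t z \<epsilon> - uS p t z \<epsilon>) \<le> M1 * exp (- M2 / cmod \<epsilon>))) \<and>
            (\<exists>M1>0. \<exists>M2>0. \<forall>t\<in>Tr. \<forall>z\<in>D.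
               (\<forall>\<epsilon>\<in>EH (-n) \<inter> ES 0 \<inter> B.
                  cmod (uH (-n) t z \<epsilon> - uS 0 t z \<epsilon>) \<le> M1 * exp (- M2 / cmod \<epsilon>)) \<and>
               (\<forall>\<epsilon>\<in>EH n \<inter> ES (\<iota>-1) \<inter> B.
                  cmod (uH n t z \<epsilon> - uS (\<iota>-1) t z \<epsilon>) \<le> M1 * exp (- M2 / cmod \<epsilon>)))))"
proof -
  interpret BP: borel_problem \<A> c P S \<rho> \<epsilon>0 \<xi> b M r n aH bH cJ dJ \<sigma>1' \<sigma>2' \<sigma>3' s2' s3' \<iota> d Sd H J HJ
    by (rule borel_problem.intro) (fact assms)+
  obtain R where R: "BP.radius_ok R" using BP.ex_radius by blast
  show ?thesis
  \<comment> \<open>With \<open>\<delta> = 1\<close> the radius of the disc in \<open>z\<close> is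
    \<open>\<delta>1\<close> itself, which will be \<open>R / 2\<close>; \<open>R \<le> 1\<close>
    keeps it below 1.\<close>
  proof (rule exI[of _ 1], rule conjI, simp, rule exI[of _ 1], rule conjI, simp, intro allI impI)
    fix w :: "nat \<Rightarrow> complex \<Rightarrow> complex \<Rightarrow> complex" and T :: "complex set" and EH :: "int \<Rightarrow> complex set"
      and ES :: "nat \<Rightarrow> complex set" and \<gamma> :: "nat \<Rightarrow> complex \<Rightarrow> complex \<Rightarrow> real" and A :: "int \<Rightarrow> complex"
    assume adm: "admissible_data S \<epsilon>0 HJ n H J \<iota> Sd r M (\<sigma>1', \<sigma>2', \<sigma>3') (s2', s3') w"
      and sec: "admissible_sectors \<epsilon>0 n H \<iota> Sd T EH ES \<gamma> A"
    interpret BD: borel_data \<A> c P S \<rho> \<epsilon>0 \<xi> b M r n aH bH cJ dJ \<sigma>1' \<sigma>2' \<sigma>3' s2' s3' \<iota> d Sd H J HJ w R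
      by unfold_locales (fact adm R)+
    have T: "open T" "0 \<notin> T" using sec bounded_sectorD unfolding admissible_sectors_def by blast+
    have EH: "open (EH k) \<and> 0 \<notin> EH k" if "k \<in> {-n..n}" for k
      using sec that bounded_sectorD unfolding admissible_sectors_def by blast
    have ES: "open (ES p) \<and> 0 \<notin> ES p" if "p < \<iota>" for p
      using sec that bounded_sectorD unfolding admissible_sectors_def by blast
    have A: "A k \<in> H k \<and> A k \<noteq> 0" if "k \<in> {-n..n}" for k
      using sec that unfolding admissible_sectors_def by blast
    have "\<exists>s>0. \<forall>k\<in>{-n..n}. \<forall>t\<in>T. \<forall>\<epsilon>\<in>EH k. - 1 \<in> cone s (1 / (\<epsilon> * t)) \<and> A k \<in> cone s (1 / (\<epsilon> * t))"
    proof (rule finite_uniform_pos)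
      fix k assume k: "k \<in> {-n..n}"
      have "\<exists>\<eta>>0. \<forall>k\<in>{-n..n}. \<forall>t\<in>T. \<forall>\<epsilon>\<in>EH k. arg_cond \<eta> pi t \<epsilon>"
        using sec unfolding admissible_sectors_def by (elim conjE)
      hence "\<exists>\<eta>>0. \<forall>t\<in>T. \<forall>\<epsilon>\<in>EH k. arg_cond \<eta> pi t \<epsilon>"
        using k by (meson bspec)
      hence "\<exists>s>0. \<forall>t\<in>T. \<forall>\<epsilon>\<in>EH k. cis pi \<in> cone s (1 / (\<epsilon> * t))"
        by (rule arg_cond_cone_uniform[where \<theta> = "\<lambda>_ _. pi"]) (use T EH[OF k] in auto)
      then obtain s1 where s1: "s1 > 0" "\<forall>t\<in>T. \<forall>\<epsilon>\<in>EH k. cis pi \<in> cone s1 (1 / (\<epsilon> * t))"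
        by (elim exE conjE)
      have "\<forall>k\<in>{-n..n}. A k \<in> H k \<and> A k \<noteq> 0 \<and> (\<exists>\<eta>>0. \<forall>t\<in>T. \<forall>\<epsilon>\<in>EH k. arg_cond \<eta> (Arg (A k)) t \<epsilon>)"
        using sec unfolding admissible_sectors_def by (elim conjE)
      from bspec[OF this k] have "\<exists>\<eta>>0. \<forall>t\<in>T. \<forall>\<epsilon>\<in>EH k. arg_cond \<eta> (Arg (A k)) t \<epsilon>"
        by (elim conjE)
      hence "\<exists>s>0. \<forall>t\<in>T. \<forall>\<epsilon>\<in>EH k. cis (Arg (A k)) \<in> cone s (1 / (\<epsilon> * t))"
        by (rule arg_cond_cone_uniform[where \<theta> = "\<lambda>_ _. Arg (A k)"]) (use T EH[OF k] in auto)
      then obtain s2 where s2: "s2 > 0" "\<forall>t\<in>T. \<forall>\<epsilon>\<in>EH k. cis (Arg (A k)) \<in> cone s2 (1 / (\<epsilon> * t))"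
        by (elim exE conjE)
      \<comment> \<open>The hypothesis concerns only the direction of \<open>A k\<close>; cones are
        invariant under positive multiples.\<close>
      have Ak: "A k = of_real (cmod (A k)) * cis (Arg (A k))"
        using is_Arg_Arg[of "A k"] A[OF k] unfolding is_Arg_def cis_conv_exp by metis
      have "- 1 \<in> cone (min s1 s2) (1 / (\<epsilon> * t)) \<and> A k \<in> cone (min s1 s2) (1 / (\<epsilon> * t))" if "t \<in> T" "\<epsilon> \<in> EH k" for t \<epsilon>
      proof
        have "cis pi \<in> cone (min s1 s2) (1 / (\<epsilon> * t))" using cone_antimono[of "min s1 s2" s1] s1(2) that by auto
        thus "- 1 \<in> cone (min s1 s2) (1 / (\<epsilon> * t))" by simp
        have "of_real (cmod (A k)) * cis (Arg (A k)) \<in> cone s2 (1 / (\<epsilon> * t))" using s2(2) that by (intro cone_scale) auto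
        thus "A k \<in> cone (min s1 s2) (1 / (\<epsilon> * t))" using cone_antimono[of "min s1 s2" s2] Ak by auto
      qed
      moreover have "min s1 s2 > 0" using s1 s2 by simp
      ultimately show "\<exists>s>0. \<forall>t\<in>T. \<forall>\<epsilon>\<in>EH k. - 1 \<in> cone s (1 / (\<epsilon> * t)) \<and> A k \<in> cone s (1 / (\<epsilon> * t))" by blast
    next
      fix k and s s' :: real
      assume "\<forall>t\<in>T. \<forall>\<epsilon>\<in>EH k. - 1 \<in> cone s (1 / (\<epsilon> * t)) \<and> A k \<in> cone s (1 / (\<epsilon> * t))" "s' \<le> s"
      thus "\<forall>t\<in>T. \<forall>\<epsilon>\<in>EH k. - 1 \<in> cone s' (1 / (\<epsilon> * t)) \<and> A k \<in> cone s' (1 / (\<epsilon> * t))"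
        using cone_antimono[of s' s] by blast
    qed simp
    then obtain sH where sH: "sH > 0" "\<And>k t \<epsilon>. k \<in> {-n..n} \<Longrightarrow> t \<in> T \<Longrightarrow> \<epsilon> \<in> EH k \<Longrightarrow> - 1 \<in> cone sH (1 / (\<epsilon> * t)) \<and> A k \<in> cone sH (1 / (\<epsilon> * t))"
      by blast
    have "\<exists>s>0. \<forall>p\<in>{..<\<iota>}. \<forall>t\<in>T. \<forall>\<epsilon>\<in>ES p. cis (\<gamma> p t \<epsilon>) \<in> cone s (1 / (\<epsilon> * t))"
    proof (rule finite_uniform_pos)
      fix p assume "p \<in> {..<\<iota>}"
      hence p: "p < \<iota>" by simp
      have "\<forall>p<\<iota>. \<exists>\<eta>>0. \<forall>t\<in>T. \<forall>\<epsilon>\<in>ES p. cis (\<gamma> p t \<epsilon>) \<in> Sd p \<and> arg_cond \<eta> (\<gamma> p t \<epsilon>) t \<epsilon>"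
        using sec unfolding admissible_sectors_def by (elim conjE)
      hence "\<exists>\<eta>>0. \<forall>t\<in>T. \<forall>\<epsilon>\<in>ES p. arg_cond \<eta> (\<gamma> p t \<epsilon>) t \<epsilon>"
        using p by meson
      thus "\<exists>s>0. \<forall>t\<in>T. \<forall>\<epsilon>\<in>ES p. cis (\<gamma> p t \<epsilon>) \<in> cone s (1 / (\<epsilon> * t))"
        by (rule arg_cond_cone_uniform) (use T ES[OF p] in auto)
    next
      fix p and s s' :: real
      assume "\<forall>t\<in>T. \<forall>\<epsilon>\<in>ES p. cis (\<gamma> p t \<epsilon>) \<in> cone s (1 / (\<epsilon> * t))" "s' \<le> s"
      thus "\<forall>t\<in>T. \<forall>\<epsilon>\<in>ES p. cis (\<gamma> p t \<epsilon>) \<in> cone s' (1 / (\<epsilon> * t))"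
        using cone_antimono[of s' s] by blast
    qed simp
    then obtain sS where sS: "sS > 0" "\<And>p t \<epsilon>. p < \<iota> \<Longrightarrow> t \<in> T \<Longrightarrow> \<epsilon> \<in> ES p \<Longrightarrow> cis (\<gamma> p t \<epsilon>) \<in> cone sS (1 / (\<epsilon> * t))"
      by blast
    define s0 where "s0 = min sH sS"
    have s0: "s0 > 0" "s0 \<le> sH" "s0 \<le> sS" using sH sS by (auto simp: s0_def)
    have "\<exists>C>0. \<forall>k\<in>\<A>. real (snd (snd k)) \<le> C"
      by (rule finite_uniform_bound[OF BP.fin]) auto
    then obtain Kx where Kx: "Kx > 0" "\<And>k. k \<in> \<A> \<Longrightarrow> real (snd (snd k)) \<le> Kx" by blast
    have "\<exists>C>0. \<forall>k\<in>{-n..n}. cmod (A k) \<le> C"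
      by (rule finite_uniform_bound) auto
    then obtain Am where Am: "\<And>k. k \<in> {-n..n} \<Longrightarrow> cmod (A k) \<le> Am" by blast
    define rT where "rT = s0 / BD.ka"
    have rT: "rT > 0" using s0 BD.kp_pos by (simp add: rT_def)
    \<comment> \<open>The second entry makes \<open>Kx * \<epsilon>1 * rT\<close> at most 1/2, so
      that the shifts are nonsingular; the third makes half of the decay outweigh the double
      exponential in \<open>difference_H\<close>.\<close>
    define \<epsilon>1 where "\<epsilon>1 = min \<epsilon>0 (min (1 / (2 * Kx * rT)) (exp (- (2 * s3' * (zeta_sum b * (s2' * exp (s3' * Am))) + ln 2))))"
    have \<epsilon>1: "0 < \<epsilon>1" "\<epsilon>1 \<le> \<epsilon>0" "\<epsilon>1 \<le> exp (- (2 * s3' * (zeta_sum b * (s2' * exp (s3' * Am))) + ln 2))"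
      using BP.\<epsilon>0 Kx rT by (auto simp: \<epsilon>1_def)
    have "Kx * \<epsilon>1 * rT \<le> Kx * (1 / (2 * Kx * rT)) * rT"
      using Kx rT by (intro mult_right_mono mult_left_mono) (auto simp: \<epsilon>1_def)
    also have "\<dots> < 1" using Kx rT by simp
    finally have Kxe: "Kx * \<epsilon>1 * rT < 1" .
    interpret LD: laplace_data \<A> c P S \<rho> \<epsilon>0 \<xi> b M r n aH bH cJ dJ \<sigma>1' \<sigma>2' \<sigma>3' s2' s3' \<iota> d Sd H J HJ w R T EH ES \<gamma> A s0 rT Kx Am \<epsilon>1
    proof
      show "- 1 \<in> cone s0 (1 / (\<epsilon> * t)) \<and> A k \<in> cone s0 (1 / (\<epsilon> * t))" if "k \<in> {-n..n}" "t \<in> T" "\<epsilon> \<in> EH k" for k t \<epsilon>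
        using sH(2)[OF that] cone_antimono[OF s0(2)] by blast
      show "A k \<in> H k \<and> A k \<noteq> 0 \<and> cmod (A k) \<le> Am" if "k \<in> {-n..n}" for k
        using A[OF that] Am[OF that] by blast
      show "cis (\<gamma> p t \<epsilon>) \<in> Sd p \<and> cis (\<gamma> p t \<epsilon>) \<in> cone s0 (1 / (\<epsilon> * t))" if "p < \<iota>" "t \<in> T" "\<epsilon> \<in> ES p" for p t \<epsilon>
      proof
        show "cis (\<gamma> p t \<epsilon>) \<in> Sd p" using sec that unfolding admissible_sectors_def by blast
        show "cis (\<gamma> p t \<epsilon>) \<in> cone s0 (1 / (\<epsilon> * t))" using sS(2)[OF that] cone_antimono[OF s0(3)] by blast
      qed
    qed (fact T EH ES s0(1) rT_def Kx \<epsilon>1 Kxe)+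
    have reg: "0 < R / 2" "R / 2 < 1" using BD.R by auto
    show "(\<exists>\<delta>1 rT \<epsilon>1. 0 < \<delta>1 \<and> \<delta>1 < 1 \<and> 0 < rT \<and> 0 < \<epsilon>1 \<and> \<epsilon>1 \<le> \<epsilon>0 \<and>
          (let Tr = T \<inter> ball 0 rT; D = ball 0 (1 * \<delta>1); B = ball 0 \<epsilon>1 in
           \<exists>uH wHJ uS wS.
            (\<forall>k\<in>{-n..n}.
               bounded_holomorphic_solution P S \<A> c
                 (\<lambda>j t \<epsilon>. bent_path_integral (A k) (laplace_kernel (\<lambda>\<tau>. w j \<tau> \<epsilon>) (\<epsilon> * t)))
                 Tr D (EH k \<inter> B) (uH k) \<and>
               (\<forall>t\<in>Tr. \<forall>z\<in>D. \<forall>\<epsilon>\<in>EH k \<inter> B.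
                  bent_path_integrable (A k) (laplace_kernel (\<lambda>\<tau>. wHJ \<tau> z \<epsilon>) (\<epsilon> * t)) \<and>
                  uH k t z \<epsilon> = bent_path_integral (A k) (laplace_kernel (\<lambda>\<tau>. wHJ \<tau> z \<epsilon>) (\<epsilon> * t)))) \<and>
            holomorphic3_on wHJ (interior HJ \<times> D \<times> (B - {0})) \<and>
            continuous_on (HJ \<times> D \<times> (B - {0})) (\<lambda>(\<tau>, z, \<epsilon>). wHJ \<tau> z \<epsilon>) \<and>
            (\<forall>\<sigma>1 \<sigma>2 \<sigma>3 s2 s3.
               \<sigma>1 > \<sigma>1' \<and> 0 < \<sigma>2 \<and> \<sigma>2 < \<sigma>2' \<and> \<sigma>3 = \<sigma>3' \<and> s2 > s2' \<and> s3 = s3' \<longrightarrow>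
               (\<forall>k\<in>{-n..n}. \<exists>CH>0. \<exists>CJ>0. \<forall>z\<in>D. \<forall>\<epsilon>\<in>B - {0}.
                  (\<forall>\<tau>\<in>H k. cmod (wHJ \<tau> z \<epsilon>) \<le> CH * cmod \<tau> *
                     exp (\<sigma>1 / cmod \<epsilon> * zeta_sum b * cmod \<tau>
                          - \<sigma>2 * (M - zeta_sum b) * exp (\<sigma>3 * cmod \<tau>))) \<and>
                  (\<forall>\<tau>\<in>J k. cmod (wHJ \<tau> z \<epsilon>) \<le> CJ * cmod \<tau> *
                     exp (\<sigma>1 / cmod \<epsilon> * zeta_sum b * cmod \<tau>
                          + s2 * zeta_sum b * exp (s3 * cmod \<tau>))))) \<and>
            (\<forall>k\<in>{-n..n-1}. \<exists>M1>0. \<exists>M2>0. \<exists>M3>1.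
               \<forall>t\<in>Tr. \<forall>z\<in>D. \<forall>\<epsilon>\<in>EH k \<inter> EH (k+1) \<inter> B.
                 cmod (uH (k+1) t z \<epsilon> - uH k t z \<epsilon>)
                   \<le> M1 * exp (- (M2 / cmod \<epsilon>) * ln (M3 / cmod \<epsilon>))) \<and>
            (\<forall>p<\<iota>.
               bounded_holomorphic_solution P S \<A> c
                 (\<lambda>j t \<epsilon>. ray_integral 0 (cis (\<gamma> p t \<epsilon>)) (laplace_kernel (\<lambda>\<tau>. w j \<tau> \<epsilon>) (\<epsilon> * t)))
                 Tr D (ES p \<inter> B) (uS p) \<and>
               (\<forall>t\<in>Tr. \<forall>z\<in>D. \<forall>\<epsilon>\<in>ES p \<inter> B.
                  ray_integrable 0 (cis (\<gamma> p t \<epsilon>)) (laplace_kernel (\<lambda>\<tau>. wS p \<tau> z \<epsilon>) (\<epsilon> * t)) \<and>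
                  uS p t z \<epsilon> =
                    ray_integral 0 (cis (\<gamma> p t \<epsilon>)) (laplace_kernel (\<lambda>\<tau>. wS p \<tau> z \<epsilon>) (\<epsilon> * t))) \<and>
               holomorphic3_on (wS p) ((Sd p \<union> ball 0 r) \<times> D \<times> (B - {0})) \<and>
               continuous_on ((closure (Sd p) \<union> cball 0 r) \<times> D \<times> (B - {0})) (\<lambda>(\<tau>, z, \<epsilon>). wS p \<tau> z \<epsilon>) \<and>
               (\<forall>\<sigma>1>\<sigma>1'. \<exists>C>0. \<forall>\<tau>\<in>Sd p \<union> ball 0 r. \<forall>z\<in>D. \<forall>\<epsilon>\<in>B - {0}.
                  cmod (wS p \<tau> z \<epsilon>) \<le> C * cmod \<tau> * exp (\<sigma>1 / cmod \<epsilon> * zeta_sum b * cmod \<tau>))) \<and>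
            (\<forall>p. p + 1 < \<iota> \<longrightarrow> (\<exists>M1>0. \<exists>M2>0.
               \<forall>t\<in>Tr. \<forall>z\<in>D. \<forall>\<epsilon>\<in>ES (p+1) \<inter> ES p \<inter> B.
                 cmod (uS (p+1) t z \<epsilon> - uS p t z \<epsilon>) \<le> M1 * exp (- M2 / cmod \<epsilon>))) \<and>
            (\<exists>M1>0. \<exists>M2>0. \<forall>t\<in>Tr. \<forall>z\<in>D.
               (\<forall>\<epsilon>\<in>EH (-n) \<inter> ES 0 \<inter> B.
                  cmod (uH (-n) t z \<epsilon> - uS 0 t z \<epsilon>) \<le> M1 * exp (- M2 / cmod \<epsilon>)) \<and>
               (\<forall>\<epsilon>\<in>EH n \<inter> ES (\<iota>-1) \<inter> B.
                  cmod (uH n t z \<epsilon> - uS (\<iota>-1) t z \<epsilon>) \<le> M1 * exp (- M2 / cmod \<epsilon>)))))"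
    proof (rule exI[of _ "R / 2"], rule exI[of _ rT], rule exI[of _ \<epsilon>1], intro conjI, goal_cases)
      case 6
      show ?case unfolding Let_def mult_1
      proof (rule exI[of _ "\<lambda>k. BD.uH (A k)"], rule exI[of _ BD.W], rule exI[of _ BD.uS], rule exI[of _ "\<lambda>_. BD.W"], intro conjI, goal_cases)
        case 1
        show ?case using LD.solution_H LD.representation_H by blast
      next
        case 2
        show ?case by (rule LD.W_regular(1))
      next
        case 3
        show ?case by (rule LD.W_regular(2))
      next
        case 4
        show ?case using LD.W_bounds by blast
      next
        case 5
        show ?case using LD.difference_H by blast
      next
        case 6
        show ?case using LD.solution_S LD.representation_S LD.W_regular(3,4) LD.W_bounds_S by blast
      next
        case 7
        show ?case using LD.difference_S by blast
      next
        case 8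
        show ?case by (rule LD.differences_mixed)
      qed
    qed (use reg rT \<epsilon>1 in auto)
  qed
qed

end
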